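(* Let $H$ be a Hopf algebra with invertible antipode over a field $\Bbbk$, equipped with a Woronowicz differential calculus $(\Omega^\bullet,\wedge,\mathrm d)$ such that $\Omega^1$ is finitely generated as a right $H$-module and $\overline\sigma^{\mathcal W}_{\Omega^1,\Omega^1}$ is diagonalisable with $1$ among its eigenvalues. Any metric conformally equivalent to a $\sigma^{\mathcal W}$-central metric (i.e. any metric of the form $f\mathbf g$ with $\mathbf g$ a $\sigma^{\mathcal W}$-central metric and $f\in H$ invertible) has a unique Levi-Civita connection if $$\pi_\vee^{23}|_{(\Omega^1\vee\Omega^1)\otimes_H\Omega^1}\colon(\Omega^1\vee\Omega^1)\otimes_H\Omega^1\to\Omega^1\otimes_H(\Omega^1\vee\Omega^1)$$ is invertible, where $\pi_\vee^{23}=\mathrm{id}_{\Omega^1}\otimes_H\pi_\vee$ is restricted to $(\Omega^1\vee\Omega^1)\otimes_H\Omega^1\subseteq\Omega^1\otimes_H\Omega^1\otimes_H\Omega^1$.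
   Context: Hopf algebra notation: $\otimes=\otimes_\Bbbk$, $\Delta(h)=h_1\otimes h_2$, $\overline S=S^{-1}$; right/left coactions $m\mapsto m_0\otimes m_1$, $m\mapsto m_{-1}\otimes m_0$, iterated in Sweedler notation. A bicovariant bimodule is an $H$-bimodule $M$ with commuting right and left coactions $\delta_M,\lambda_M$ satisfying $\delta_M(amb)=\Delta(a)\delta_M(m)\Delta(b)$, $\lambda_M(amb)=\Delta(a)\lambda_M(m)\Delta(b)$; $M\otimes_HN$ is one with diagonal coactions. The Woronowicz braiding is $\sigma^{\mathcal W}_{M,N}\colon M\otimes_HN\to N\otimes_HM$, $m\otimes_Hn\mapsto m_{-2}n_0S(n_1)\otimes_HS(m_{-1})m_0n_2$, an isomorphism of bicovariant bimodules; its inverse is denoted $\overline\sigma^{\mathcal W}_{N,M}\colon N\otimes_HM\to M\otimes_HN$. Subscripts or superscripts $12,23$ indicate the tensor factors acted on. Calculus: a differential calculus on $H$ is a differential graded algebra $(\Omega^\bullet,\wedge,\mathrm d)$ with $\Omega^0=H$ and $\Omega^k$ spanned by $a^0\mathrm da^1\wedge\dots\wedge\mathrm da^k$; it is bicovariant if $\Omega^\bullet$ is a graded $H$-bicomodule algebra (extending $\Delta$ on $H$) with $\mathrm d$ bicolinear. It is a Woronowicz calculus if it is bicovariant and $\Omega^\bullet$ is the braided exterior algebra of $\Omega^1$, i.e. the tensor algebra of $\Omega^1$ over $H$ modulo in each degree $n$ the kernel of $A_n=\sum_{p}\mathrm{sign}(p)\Pi_p$, where $\Pi_p$ is obtained from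 a reduced decomposition of the permutation $p$ into nearest neighbour transpositions by replacing each transposition by $\overline\sigma^{\mathcal W}_{\Omega^1,\Omega^1}$ on the corresponding neighbours. In particular $\Omega^2\cong\mathrm{Im}(\mathrm{id}-\overline\sigma^{\mathcal W}_{\Omega^1,\Omega^1})$ with $\wedge=\mathrm{id}-\overline\sigma^{\mathcal W}_{\Omega^1,\Omega^1}$ on $\Omega^1\otimes_H\Omega^1$. Symmetric tensors: $\Omega^1\vee\Omega^1\subseteq\Omega^1\otimes_H\Omega^1$ is the eigenspace of $\overline\sigma^{\mathcal W}_{\Omega^1,\Omega^1}$ for eigenvalue $1$, $\Omega^1\wedge\Omega^1$ is the sum of the other eigenspaces, and $\pi_\vee\colon\Omega^1\otimes_H\Omega^1\to\Omega^1\vee\Omega^1$ is the projection along $\Omega^1\wedge\Omega^1$. $\mathfrak X=\mathrm{Hom}_H(\Omega^1,H)$ (right $H$-linear maps) is a bicovariant bimodule with $(aXb)(\omega)=aX(b\omega)$, $X_0(\omega)\otimes X_1=X(\omega_0)_0\otimes X(\omega_0)_1S(\omega_1)$, $X_{-1}\otimes X_0(\omega)=X(\omega_0)_{-1}\overline S(\omega_{-1})\otimes X(\omega_0)_0$; $\langle X,\omega\rangle=X(\omega)$. $\mathfrak X^{\vee2}=\{\mathbf g\in\mathfrak X\otimes_H\mathfrak X:\sigma^{\mathcal W}_{\mathfrak X,\mathfrak X}(\mathbf g)=\mathbf g\}$. Metrics: for $\mathbf g=\mathbf g^{a}\otimes_H\mathbf g_{a}\in\mathfrak X\otimes_H\mathfrak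 X$ (finite sum) put $\langle\mathbf g,\omega\otimes_H\eta\rangle=\langle\mathbf g^a\langle\mathbf g_a,\omega\rangle,\eta\rangle\in H$ and $\langle\mathbf g,\omega\otimes_H\eta\otimes_H\rho\rangle=\langle\mathbf g,\omega\otimes_H\eta\rangle\rho\in\Omega^1$. $\mathbf g$ is a (pseudo-Riemannian) metric if $\mathbf g\in\mathfrak X^{\vee2}$ and $\mathbf g^\sharp=\mathbf g^a\langle\mathbf g_a,\cdot\rangle\colon\Omega^1\to\mathfrak X$ is an isomorphism of right $H$-modules. A metric is $\sigma^{\mathcal W}$-central if $\sigma^{\mathcal W}_{\mathfrak X^{\vee2},\Omega^1}(\mathbf g\otimes_H\omega)=\omega\otimes_H\mathbf g$ and $\sigma^{\mathcal W}_{\Omega^1,\mathfrak X^{\vee2}}(\omega\otimes_H\mathbf g)=\mathbf g\otimes_H\omega$ for all $\omega\in\Omega^1$. If $\mathbf g$ is a metric and $f\in H$ is invertible, $f\mathbf g$ is again a metric; $\mathbf g$ and $f\mathbf g$ are called conformally equivalent. Connections: a right connection on a right $H$-module $M$ is a linear $\nabla\colon M\to M\otimes_H\Omega^1$ with $\nabla(ma)=\nabla(m)a+m\otimes_H\mathrm da$. For a right connection $\nabla$ on $\Omega^1$, the prescription $\nabla_{-1}\otimes\nabla_0(m)=\nabla(m_0)_{-1}\overline S(m_{-1})\otimes\nabla(m_0)_0$ defines an element $\nabla_{-1}\otimes\nabla_0\in H\otimes\mathrm{Hom}_\Bbbk(\Omega^1,\Omega^1\otimes_H\Omega^1)$, with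 iteration $\nabla_{-2}\otimes\nabla_{-1}\otimes\nabla_0$, and $\nabla\oplus\nabla$ is the right connection on $\Omega^1\otimes_H\Omega^1$ given by $(\nabla\oplus\nabla)(m\otimes_Hn)=\sigma^{\mathcal W}_{23}(\nabla(m_0S(m_1))\otimes_Hm_2n)+\nabla_{-2}m_0S(\nabla_{-1}m_1)\otimes_H\nabla_0(m_2n)$. Put $\nabla_\vee=(\pi_\vee\otimes_H\mathrm{id}_{\Omega^1})\circ(\nabla\oplus\nabla)|_{\Omega^1\vee\Omega^1}$. $\nabla$ is compatible with a metric $\mathbf g$ if $\langle\mathbf g,\nabla_\vee(\cdot)\rangle=\mathrm d\circ\langle\mathbf g,\cdot\rangle$ as maps $\Omega^1\vee\Omega^1\to\Omega^1$; it is torsion-free if $\wedge\circ\nabla+\mathrm d=0\colon\Omega^1\to\Omega^2$; it is a Levi-Civita connection for $\mathbf g$ if it is torsion-free and compatible with $\mathbf g$.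
   Formalization: The field is additionally assumed to have characteristic different from 2; in characteristic 2 uniqueness fails, e.g. for H = k[t,1/t] with Ω¹ = He, e = dt/t, where every ∇e = c e⊗e (c in k) is a Levi-Civita connection of the metric dual to e⊗e. *)

theory Defs
  imports
    Complex_Main
    "HOL-Library.Poly_Mapping"
    "HOL-Library.Function_Algebras"
    "HOL-Library.FuncSet"
    "HOL-Combinatorics.Permutations"
begin

section \<open>Formal linear combinations and quotients\<close>

text \<open>
  A subspace of a vector space that lives on a type is given by its carrier and the scalar
  multiplication; addition and zero are those of the type.
\<close>

record ('k::field, 'v) vect =
  car :: "'v set"
  sc :: "'k \<Rightarrow> 'v \<Rightarrow> 'v"

definition fsc :: "'k::field \<Rightarrow> ('a \<Rightarrow>\<^sub>0 'k) \<Rightarrow> ('a \<Rightarrow>\<^sub>0 'k)" where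
  "fsc c p = Poly_Mapping.map ((*) c) p"

definition bvec :: "'a \<Rightarrow> ('a \<Rightarrow>\<^sub>0 'k::field)" where
  "bvec x = Poly_Mapping.single x 1"

text \<open>
  The formal combination \<open>p\<close> of basis elements is sent to the same combination of their
  images under \<open>f\<close>.  Applied to a tensor this is Sweedler notation: for \<open>p = \<Sum>\<^sub>i x\<^sub>i \<otimes> y\<^sub>i\<close>
  the term \<open>swe p (\<lambda>(x, y). F x y)\<close> is \<open>\<Sum>\<^sub>i F x\<^sub>i y\<^sub>i\<close>.
\<close>

definition lext :: "('k \<Rightarrow> 'v \<Rightarrow> 'v) \<Rightarrow> ('a \<Rightarrow>\<^sub>0 'k::field) \<Rightarrow> ('a \<Rightarrow> 'v::ab_group_add) \<Rightarrow> 'v" where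
  "lext s p f = (\<Sum>x\<in>Poly_Mapping.keys p. s (Poly_Mapping.lookup p x) (f x))"

abbreviation swe :: "('a \<Rightarrow>\<^sub>0 'k::field) \<Rightarrow> ('a \<Rightarrow> ('b \<Rightarrow>\<^sub>0 'k)) \<Rightarrow> ('b \<Rightarrow>\<^sub>0 'k)" where
  "swe p f \<equiv> lext fsc p f"

text \<open>
  For subspaces \<open>U \<subseteq> F\<close>, the quotient \<open>F / U\<close> is realised on a linear complement of \<open>U\<close> in \<open>F\<close>,
  with \<open>nform F U\<close>, restricted to \<open>F\<close>, as quotient map (see \<open>nform_quotient\<close> below).  Its elements
  are then chosen representatives, hence again formal combinations of elements of the basis of \<open>F\<close>.
\<close>

definition nform :: "('a \<Rightarrow>\<^sub>0 'k::field) set \<Rightarrow> ('a \<Rightarrow>\<^sub>0 'k) set \<Rightarrow> ('a \<Rightarrow>\<^sub>0 'k) \<Rightarrow> ('a \<Rightarrow>\<^sub>0 'k)" where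
  "nform F U = (SOME f. Vector_Spaces.linear fsc fsc f \<and> range f \<subseteq> F \<and>
     (\<forall>p. f (f p) = f p) \<and> (\<forall>p\<in>F. f p = 0 \<longleftrightarrow> p \<in> U))"

definition free_on :: "'a set \<Rightarrow> ('a \<Rightarrow>\<^sub>0 'k::field) set" where
  "free_on G = {p. Poly_Mapping.keys p \<subseteq> G}"

definition qmap :: "'a set \<Rightarrow> ('a \<Rightarrow>\<^sub>0 'k::field) set \<Rightarrow> ('a \<Rightarrow>\<^sub>0 'k) \<Rightarrow> ('a \<Rightarrow>\<^sub>0 'k)" where
  "qmap G R = nform (free_on G) (module.span fsc R)"

definition qspace :: "'a set \<Rightarrow> ('a \<Rightarrow>\<^sub>0 'k::field) set \<Rightarrow> ('k, 'a \<Rightarrow>\<^sub>0 'k) vect" where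
  "qspace G R = \<lparr>car = qmap G R ` free_on G, sc = fsc\<rparr>"

lemma lookup_fsc [simp]: "Poly_Mapping.lookup (fsc c p) x = c * Poly_Mapping.lookup p x"
  unfolding fsc_def by transfer (auto simp: when_def)

lemma vector_space_fsc: "vector_space (fsc :: 'k::field \<Rightarrow> ('a \<Rightarrow>\<^sub>0 'k) \<Rightarrow> _)"
  by unfold_locales
    (rule poly_mapping_eqI, simp add: lookup_add distrib_left distrib_right mult.assoc)+

lemma nform_quotient:
  fixes F U :: "('a \<Rightarrow>\<^sub>0 'k::field) set"
  assumes F: "module.subspace fsc F" and U: "module.subspace fsc U" and "U \<subseteq> F"
  shows "Vector_Spaces.linear fsc fsc (nform F U) \<and> range (nform F U) \<subseteq> F \<and>
     (\<forall>p. nform F U (nform F U p) = nform F U p) \<and> (\<forall>p\<in>F. nform F U p = 0 \<longleftrightarrow> p \<in> U)"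
proof -
  interpret V: vector_space "fsc :: 'k \<Rightarrow> ('a \<Rightarrow>\<^sub>0 'k) \<Rightarrow> _" by (rule vector_space_fsc)
  interpret P: vector_space_pair "fsc :: 'k \<Rightarrow> ('a \<Rightarrow>\<^sub>0 'k) \<Rightarrow> _"
    "fsc :: 'k \<Rightarrow> ('a \<Rightarrow>\<^sub>0 'k) \<Rightarrow> _" by unfold_locales
  have ex: "\<exists>g. range g \<subseteq> W \<and> Vector_Spaces.linear fsc fsc g \<and> (\<forall>v\<in>W. g v = v)"
    if "V.subspace W" for W :: "('a \<Rightarrow>\<^sub>0 'k) set"
    using P.linear_exists_left_inverse_on[OF V.linear_id that] by simp
  obtain g where g: "range g \<subseteq> F" "Vector_Spaces.linear fsc fsc g" "\<And>v. v \<in> F \<Longrightarrow> g v = v"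
    using ex[OF F] by blast
  obtain h where h: "range h \<subseteq> U" "Vector_Spaces.linear fsc fsc h" "\<And>v. v \<in> U \<Longrightarrow> h v = v"
    using ex[OF U] by blast
  define f where "f = (\<lambda>p. g p - h (g p))"
  have lin: "Vector_Spaces.linear fsc fsc f"
    unfolding f_def
    using P.linear_compose_sub[OF g(2) Vector_Spaces.linear_compose[OF g(2) h(2)]] by simp
  have inF: "f p \<in> F" for p
    unfolding f_def using g(1) h(1) \<open>U \<subseteq> F\<close> by (intro V.subspace_diff[OF F]) auto
  have hf: "h (f p) = 0" for p
  proof -
    have "h (h (g p)) = h (g p)" using h by blast
    then show ?thesis by (simp add: f_def P.linear_diff[OF h(2)])
  qed
  have "f (f p) = f p" for p
    using g(3)[OF inF[of p]] hf[of p] by (simp add: f_def)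
  moreover have "f p = 0 \<longleftrightarrow> p \<in> U" if "p \<in> F" for p
    using g(3)[OF that] h(1,3) by (auto simp: f_def)
  ultimately have "\<exists>f. Vector_Spaces.linear fsc fsc f \<and> range f \<subseteq> F \<and>
     (\<forall>p. f (f p) = f p) \<and> (\<forall>p\<in>F. f p = 0 \<longleftrightarrow> p \<in> U)"
    using lin inF by blast
  then show ?thesis unfolding nform_def by (rule someI_ex)
qed

section \<open>Tensor products over the ground field\<close>

definition linear_on :: "('k::field, 'v::ab_group_add, 'x) vect_scheme \<Rightarrow>
    ('k, 'w::ab_group_add, 'y) vect_scheme \<Rightarrow> ('v \<Rightarrow> 'w) \<Rightarrow> bool" where
  "linear_on V W f \<longleftrightarrow> f \<in> car V \<rightarrow> car W \<and>
     (\<forall>x\<in>car V. \<forall>y\<in>car V. f (x + y) = f x + f y) \<and>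
     (\<forall>c. \<forall>x\<in>car V. f (sc V c x) = sc W c (f x))"

text \<open>\<open>Hom(V, W)\<close>; a map defined on the carrier of \<open>V\<close> is extended by zero to the whole type.\<close>

definition lmaps :: "('k::field, 'v::ab_group_add, 'x) vect_scheme \<Rightarrow>
    ('k, 'w::ab_group_add, 'y) vect_scheme \<Rightarrow> ('k, 'v \<Rightarrow> 'w) vect" where
  "lmaps V W = \<lparr>car = {f. linear_on V W f \<and> (\<forall>x. x \<notin> car V \<longrightarrow> f x = 0)},
     sc = (\<lambda>c f x. sc W c (f x))\<rparr>"

definition bilin_rel :: "('k::field, 'v::ab_group_add, 'x) vect_scheme \<Rightarrow>
    ('k, 'w::ab_group_add, 'y) vect_scheme \<Rightarrow> ('v \<times> 'w \<Rightarrow>\<^sub>0 'k) set" where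
  "bilin_rel V W =
     {bvec (x + x', y) - bvec (x, y) - bvec (x', y) | x x' y. x \<in> car V \<and> x' \<in> car V \<and> y \<in> car W} \<union>
     {bvec (x, y + y') - bvec (x, y) - bvec (x, y') | x y y'. x \<in> car V \<and> y \<in> car W \<and> y' \<in> car W} \<union>
     {bvec (sc V c x, y) - fsc c (bvec (x, y)) | c x y. x \<in> car V \<and> y \<in> car W} \<union>
     {bvec (x, sc W c y) - fsc c (bvec (x, y)) | c x y. x \<in> car V \<and> y \<in> car W}"

definition ktens :: "('k::field, 'v::ab_group_add, 'x) vect_scheme \<Rightarrow>
    ('k, 'w::ab_group_add, 'y) vect_scheme \<Rightarrow> ('k, 'v \<times> 'w \<Rightarrow>\<^sub>0 'k) vect" where
  "ktens V W = qspace (car V \<times> car W) (bilin_rel V W)"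

text \<open>The pure tensor \<open>x \<otimes> y\<close>.\<close>

definition ktp :: "('k::field, 'v::ab_group_add, 'x) vect_scheme \<Rightarrow>
    ('k, 'w::ab_group_add, 'y) vect_scheme \<Rightarrow> 'v \<Rightarrow> 'w \<Rightarrow> ('v \<times> 'w \<Rightarrow>\<^sub>0 'k)" where
  "ktp V W x y = qmap (car V \<times> car W) (bilin_rel V W) (bvec (x, y))"

section \<open>Hopf algebras and comodules\<close>

record (overloaded) ('k::field, 'h) hopf = "('k, 'h) vect" +
  comult :: "'h \<Rightarrow> ('h \<times> 'h \<Rightarrow>\<^sub>0 'k)"
  counit :: "'h \<Rightarrow> 'k"
  antipode :: "'h \<Rightarrow> 'h"

definition right_coaction :: "('k::field, 'h::ring_1) hopf \<Rightarrow>
    ('k, 'v::ab_group_add, 'x) vect_scheme \<Rightarrow> ('v \<Rightarrow> ('v \<times> 'h \<Rightarrow>\<^sub>0 'k)) \<Rightarrow> bool" where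
  "right_coaction H V \<delta> \<longleftrightarrow> linear_on V (ktens V H) \<delta> \<and>
     (\<forall>x\<in>car V.
        swe (\<delta> x) (\<lambda>(x0, h). swe (\<delta> x0) (\<lambda>(x0', h'). ktp V (ktens H H) x0' (ktp H H h' h))) =
        swe (\<delta> x) (\<lambda>(x0, h). ktp V (ktens H H) x0 (comult H h))) \<and>
     (\<forall>x\<in>car V. lext (sc V) (\<delta> x) (\<lambda>(x0, h). sc V (counit H h) x0) = x)"

definition left_coaction :: "('k::field, 'h::ring_1) hopf \<Rightarrow>
    ('k, 'v::ab_group_add, 'x) vect_scheme \<Rightarrow> ('v \<Rightarrow> ('h \<times> 'v \<Rightarrow>\<^sub>0 'k)) \<Rightarrow> bool" where
  "left_coaction H V \<gamma> \<longleftrightarrow> linear_on V (ktens H V) \<gamma> \<and>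
     (\<forall>x\<in>car V.
        swe (\<gamma> x) (\<lambda>(h, x0). swe (comult H h) (\<lambda>(h1, h2). ktp H (ktens H V) h1 (ktp H V h2 x0))) =
        swe (\<gamma> x) (\<lambda>(h, x0). ktp H (ktens H V) h (\<gamma> x0))) \<and>
     (\<forall>x\<in>car V. lext (sc V) (\<gamma> x) (\<lambda>(h, x0). sc V (counit H h) x0) = x)"

definition coactions_commute :: "('k::field, 'h::ring_1) hopf \<Rightarrow>
    ('k, 'v::ab_group_add, 'x) vect_scheme \<Rightarrow> ('v \<Rightarrow> ('h \<times> 'v \<Rightarrow>\<^sub>0 'k)) \<Rightarrow>
    ('v \<Rightarrow> ('v \<times> 'h \<Rightarrow>\<^sub>0 'k)) \<Rightarrow> bool" where
  "coactions_commute H V \<gamma> \<delta> \<longleftrightarrow>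
     (\<forall>x\<in>car V.
        swe (\<delta> x) (\<lambda>(x0, h). swe (\<gamma> x0) (\<lambda>(k, x0'). ktp H (ktens V H) k (ktp V H x0' h))) =
        swe (\<gamma> x) (\<lambda>(k, x0). ktp H (ktens V H) k (\<delta> x0)))"

locale hopf_algebra =
  fixes H :: "('k::field, 'h::ring_1) hopf"
  assumes car_UNIV: "car H = UNIV"
    and vector_space: "vector_space (sc H)"
    and scale_mult: "sc H c a * b = sc H c (a * b)" "a * sc H c b = sc H c (a * b)"
    and coassoc_counit: "right_coaction H H (comult H)" "left_coaction H H (comult H)"
    and comult_one: "comult H 1 = ktp H H 1 1"
    and comult_mult: "comult H (a * b) =
      swe (comult H a) (\<lambda>(a1, a2). swe (comult H b) (\<lambda>(b1, b2). ktp H H (a1 * b1) (a2 * b2)))"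
    and counit_linear: "counit H (a + b) = counit H a + counit H b"
      "counit H (sc H c a) = c * counit H a"
    and counit_one: "counit H 1 = 1"
    and counit_mult: "counit H (a * b) = counit H a * counit H b"
    and antipode_linear: "linear_on H H (antipode H)"
    and antipode:
      "lext (sc H) (comult H a) (\<lambda>(a1, a2). antipode H a1 * a2) = sc H (counit H a) 1"
      "lext (sc H) (comult H a) (\<lambda>(a1, a2). a1 * antipode H a2) = sc H (counit H a) 1"

abbreviation antipode_inv :: "('k::field, 'h) hopf \<Rightarrow> 'h \<Rightarrow> 'h" where
  "antipode_inv H \<equiv> inv (antipode H)"

section \<open>Bicovariant bimodules and the Woronowicz braiding\<close>

record (overloaded) ('k::field, 'm, 'h) bicov = "('k, 'm) vect" +
  lact :: "'h \<Rightarrow> 'm \<Rightarrow> 'm"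
  ract :: "'m \<Rightarrow> 'h \<Rightarrow> 'm"
  lcoact :: "'m \<Rightarrow> ('h \<times> 'm \<Rightarrow>\<^sub>0 'k)"
  rcoact :: "'m \<Rightarrow> ('m \<times> 'h \<Rightarrow>\<^sub>0 'k)"

definition bal_rel :: "('k::field, 'm::ab_group_add, 'h) bicov \<Rightarrow>
    ('k, 'n::ab_group_add, 'h) bicov \<Rightarrow> ('m \<times> 'n \<Rightarrow>\<^sub>0 'k) set" where
  "bal_rel M N = bilin_rel M N \<union>
     {bvec (ract M x a, y) - bvec (x, lact N a y) | x a y. x \<in> car M \<and> y \<in> car N}"

text \<open>The pure tensor \<open>x \<otimes>\<^sub>H y\<close>.\<close>

definition htp :: "('k::field, 'm::ab_group_add, 'h) bicov \<Rightarrow>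
    ('k, 'n::ab_group_add, 'h) bicov \<Rightarrow> 'm \<Rightarrow> 'n \<Rightarrow> ('m \<times> 'n \<Rightarrow>\<^sub>0 'k)" where
  "htp M N x y = qmap (car M \<times> car N) (bal_rel M N) (bvec (x, y))"

definition hspace :: "('k::field, 'm::ab_group_add, 'h) bicov \<Rightarrow>
    ('k, 'n::ab_group_add, 'h) bicov \<Rightarrow> ('k, 'm \<times> 'n \<Rightarrow>\<^sub>0 'k) vect" where
  "hspace M N = qspace (car M \<times> car N) (bal_rel M N)"

text \<open>\<open>M \<otimes>\<^sub>H N\<close> with the diagonal coactions.\<close>

definition tens :: "('k::field, 'h::ring_1) hopf \<Rightarrow> ('k, 'm::ab_group_add, 'h) bicov \<Rightarrow>
    ('k, 'n::ab_group_add, 'h) bicov \<Rightarrow> ('k, 'm \<times> 'n \<Rightarrow>\<^sub>0 'k, 'h) bicov" where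
  "tens H M N = \<lparr>
     car = car (hspace M N),
     sc = fsc,
     lact = (\<lambda>a t. swe t (\<lambda>(x, y). htp M N (lact M a x) y)),
     ract = (\<lambda>t a. swe t (\<lambda>(x, y). htp M N x (ract N y a))),
     lcoact = (\<lambda>t. swe t (\<lambda>(x, y). swe (lcoact M x) (\<lambda>(h, x0). swe (lcoact N y) (\<lambda>(k, y0).
       ktp H (hspace M N) (h * k) (htp M N x0 y0))))),
     rcoact = (\<lambda>t. swe t (\<lambda>(x, y). swe (rcoact M x) (\<lambda>(x0, h). swe (rcoact N y) (\<lambda>(y0, k).
       ktp (hspace M N) H (htp M N x0 y0) (h * k)))))\<rparr>"

text \<open>\<open>m \<otimes>\<^sub>H n \<mapsto> m\<^sub>-\<^sub>2 n\<^sub>0 S(n\<^sub>1) \<otimes>\<^sub>H S(m\<^sub>-\<^sub>1) m\<^sub>0 n\<^sub>2\<close>\<close>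

definition braid :: "('k::field, 'h::ring_1) hopf \<Rightarrow> ('k, 'm::ab_group_add, 'h) bicov \<Rightarrow>
    ('k, 'n::ab_group_add, 'h) bicov \<Rightarrow> ('m \<times> 'n \<Rightarrow>\<^sub>0 'k) \<Rightarrow> ('n \<times> 'm \<Rightarrow>\<^sub>0 'k)" where
  "braid H M N t = swe t (\<lambda>(m, n).
     swe (lcoact M m) (\<lambda>(h, m0). swe (comult H h) (\<lambda>(m2, m1).
     swe (rcoact N n) (\<lambda>(n0, k). swe (comult H k) (\<lambda>(n1, n2).
       htp N M (lact N m2 (ract N n0 (antipode H n1)))
               (lact M (antipode H m1) (ract M m0 n2)))))))"

text \<open>\<open>braid_inv H N M : N \<otimes>\<^sub>H M \<rightarrow> M \<otimes>\<^sub>H N\<close> is the inverse of \<open>braid H M N\<close>.\<close>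

definition braid_inv :: "('k::field, 'h::ring_1) hopf \<Rightarrow> ('k, 'n::ab_group_add, 'h) bicov \<Rightarrow>
    ('k, 'm::ab_group_add, 'h) bicov \<Rightarrow> ('n \<times> 'm \<Rightarrow>\<^sub>0 'k) \<Rightarrow> ('m \<times> 'n \<Rightarrow>\<^sub>0 'k)" where
  "braid_inv H N M = inv_into (car (tens H M N)) (braid H M N)"

section \<open>Differential calculi\<close>

text \<open>
  \<open>\<Omega>\<^sup>\<bullet>\<close> is the ring on the type \<open>'w\<close> with the wedge product as multiplication, \<open>grade C n\<close> is
  \<open>\<Omega>\<^sup>n\<close>, and \<open>embed\<close> identifies \<open>H\<close> with \<open>\<Omega>\<^sup>0\<close>.  The graded coactions are given degree by degree.
\<close>

record (overloaded) ('k::field, 'w, 'h) calc = "('k, 'w) vect" +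
  grade :: "nat \<Rightarrow> 'w set"
  embed :: "'h \<Rightarrow> 'w"
  diff :: "'w \<Rightarrow> 'w"
  lcoacts :: "nat \<Rightarrow> 'w \<Rightarrow> ('h \<times> 'w \<Rightarrow>\<^sub>0 'k)"
  rcoacts :: "nat \<Rightarrow> 'w \<Rightarrow> ('w \<times> 'h \<Rightarrow>\<^sub>0 'k)"

definition forms :: "('k::field, 'w, 'h) calc \<Rightarrow> nat \<Rightarrow> ('k, 'w) vect" where
  "forms C n = \<lparr>car = grade C n, sc = sc C\<rparr>"

locale differential_calculus =
  fixes H :: "('k::field, 'h::ring_1) hopf" and C :: "('k, 'w::ring_1, 'h) calc"
  assumes car_UNIV: "car C = UNIV"
    and vector_space: "vector_space (sc C)"
    and scale_mult: "sc C c v * w = sc C c (v * w)" "v * sc C c w = sc C c (v * w)"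
    and grade_subspace: "module.subspace (sc C) (grade C n)"
    and grade_mult: "v \<in> grade C m \<Longrightarrow> w \<in> grade C n \<Longrightarrow> v * w \<in> grade C (m + n)"
    and grade_direct_sum: "\<exists>!u. finite {n. u n \<noteq> 0} \<and> (\<forall>n. u n \<in> grade C n) \<and>
      w = (\<Sum>n | u n \<noteq> 0. u n)"
    and embed_hom: "embed C (a + b) = embed C a + embed C b"
      "embed C (a * b) = embed C a * embed C b" "embed C 1 = 1"
      "embed C (sc H c a) = sc C c (embed C a)"
    and embed_bij: "bij_betw (embed C) UNIV (grade C 0)"
    and diff_linear: "linear_on C C (diff C)"
    and diff_grade: "w \<in> grade C n \<Longrightarrow> diff C w \<in> grade C (Suc n)"
    and diff_diff: "diff C (diff C w) = 0"
    and diff_mult: "v \<in> grade C n \<Longrightarrow> diff C (v * w) = diff C v * w + (- 1) ^ n * (v * diff C w)"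
    and grade_span: "grade C n = module.span (sc C)
      {embed C a * prod_list (map (\<lambda>b. diff C (embed C b)) bs) | a bs. length bs = n}"

locale bicovariant_calculus = differential_calculus +
  assumes right_coaction: "right_coaction H (forms C n) (rcoacts C n)"
    and left_coaction: "left_coaction H (forms C n) (lcoacts C n)"
    and commute: "coactions_commute H (forms C n) (lcoacts C n) (rcoacts C n)"
    and rcoact_embed: "rcoacts C 0 (embed C a) =
      swe (comult H a) (\<lambda>(a1, a2). ktp (forms C 0) H (embed C a1) a2)"
    and lcoact_embed: "lcoacts C 0 (embed C a) =
      swe (comult H a) (\<lambda>(a1, a2). ktp H (forms C 0) a1 (embed C a2))"
    and rcoact_mult: "v \<in> grade C m \<Longrightarrow> w \<in> grade C n \<Longrightarrow> rcoacts C (m + n) (v * w) =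
      swe (rcoacts C m v) (\<lambda>(v0, h). swe (rcoacts C n w) (\<lambda>(w0, k).
        ktp (forms C (m + n)) H (v0 * w0) (h * k)))"
    and lcoact_mult: "v \<in> grade C m \<Longrightarrow> w \<in> grade C n \<Longrightarrow> lcoacts C (m + n) (v * w) =
      swe (lcoacts C m v) (\<lambda>(h, v0). swe (lcoacts C n w) (\<lambda>(k, w0).
        ktp H (forms C (m + n)) (h * k) (v0 * w0)))"
    and rcoact_diff: "w \<in> grade C n \<Longrightarrow> rcoacts C (Suc n) (diff C w) =
      swe (rcoacts C n w) (\<lambda>(w0, h). ktp (forms C (Suc n)) H (diff C w0) h)"
    and lcoact_diff: "w \<in> grade C n \<Longrightarrow> lcoacts C (Suc n) (diff C w) =
      swe (lcoacts C n w) (\<lambda>(h, w0). ktp H (forms C (Suc n)) h (diff C w0))"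

definition one_forms :: "('k::field, 'w::ring_1, 'h) calc \<Rightarrow> ('k, 'w, 'h) bicov" where
  "one_forms C = \<lparr>car = grade C 1, sc = sc C, lact = (\<lambda>a w. embed C a * w),
     ract = (\<lambda>w a. w * embed C a), lcoact = lcoacts C 1, rcoact = rcoacts C 1\<rparr>"

abbreviation two_tensors :: "('k::field, 'h::ring_1) hopf \<Rightarrow> ('k, 'w::ring_1, 'h) calc \<Rightarrow>
    ('k, 'w \<times> 'w \<Rightarrow>\<^sub>0 'k, 'h) bicov" where
  "two_tensors H C \<equiv> tens H (one_forms C) (one_forms C)"

text \<open>\<open>\<Omega>\<^sup>1 \<otimes>\<^sub>H \<Omega>\<^sup>1 \<otimes>\<^sub>H \<Omega>\<^sup>1\<close> is bracketed to the left.\<close>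

abbreviation three_tensors :: "('k::field, 'h::ring_1) hopf \<Rightarrow> ('k, 'w::ring_1, 'h) calc \<Rightarrow>
    ('k, ('w \<times> 'w \<Rightarrow>\<^sub>0 'k) \<times> 'w \<Rightarrow>\<^sub>0 'k, 'h) bicov" where
  "three_tensors H C \<equiv> tens H (two_tensors H C) (one_forms C)"

abbreviation sigma_bar :: "('k::field, 'h::ring_1) hopf \<Rightarrow> ('k, 'w::ring_1, 'h) calc \<Rightarrow>
    ('w \<times> 'w \<Rightarrow>\<^sub>0 'k) \<Rightarrow> ('w \<times> 'w \<Rightarrow>\<^sub>0 'k)" where
  "sigma_bar H C \<equiv> braid_inv H (one_forms C) (one_forms C)"

subsection \<open>The braided exterior algebra\<close>

text \<open>The \<open>n\<close>-th tensor power over \<open>H\<close> (for \<open>n \<ge> 1\<close>), as a quotient of the space on lists.\<close>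

definition power_basis :: "('k::field, 'm, 'h) bicov \<Rightarrow> nat \<Rightarrow> 'm list set" where
  "power_basis M n = {xs. length xs = n \<and> set xs \<subseteq> car M}"

definition power_rel :: "('k::field, 'm::ab_group_add, 'h) bicov \<Rightarrow> nat \<Rightarrow> ('m list \<Rightarrow>\<^sub>0 'k) set" where
  "power_rel M n =
     {bvec (us @ [x + y] @ vs) - bvec (us @ [x] @ vs) - bvec (us @ [y] @ vs) | us x y vs.
        us @ [x] @ vs \<in> power_basis M n \<and> y \<in> car M} \<union>
     {bvec (us @ [sc M c x] @ vs) - fsc c (bvec (us @ [x] @ vs)) | us c x vs.
        us @ [x] @ vs \<in> power_basis M n} \<union>
     {bvec (us @ [ract M x a, y] @ vs) - bvec (us @ [x, lact M a y] @ vs) | us x a y vs.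
        us @ [x, y] @ vs \<in> power_basis M n}"

definition power_pure :: "('k::field, 'm::ab_group_add, 'h) bicov \<Rightarrow> nat \<Rightarrow> 'm list \<Rightarrow>
    ('m list \<Rightarrow>\<^sub>0 'k)" where
  "power_pure M n xs = qmap (power_basis M n) (power_rel M n) (bvec xs)"

definition tensor_power :: "('k::field, 'm::ab_group_add, 'h) bicov \<Rightarrow> nat \<Rightarrow>
    ('k, 'm list \<Rightarrow>\<^sub>0 'k) vect" where
  "tensor_power M n = qspace (power_basis M n) (power_rel M n)"

definition sigma_bar_at :: "('k::field, 'h::ring_1) hopf \<Rightarrow> ('k, 'w::ring_1, 'h) calc \<Rightarrow> nat \<Rightarrow>
    nat \<Rightarrow> ('w list \<Rightarrow>\<^sub>0 'k) \<Rightarrow> ('w list \<Rightarrow>\<^sub>0 'k)" where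
  "sigma_bar_at H C n i t = swe t (\<lambda>xs.
     swe (sigma_bar H C (htp (one_forms C) (one_forms C) (xs ! i) (xs ! Suc i))) (\<lambda>(x, y).
       power_pure (one_forms C) n (take i xs @ [x, y] @ drop (i + 2) xs)))"

text \<open>
  The positions are \<open>{..<n}\<close>; the number \<open>i\<close> in a word stands for the transposition of \<open>i\<close> and
  \<open>i + 1\<close>.  By the braid relation the choice of the reduced word is immaterial.
\<close>

definition reduced_word :: "nat \<Rightarrow> (nat \<Rightarrow> nat) \<Rightarrow> nat list" where
  "reduced_word n p = arg_min length (\<lambda>is. (\<forall>i\<in>set is. Suc i < n) \<and>
     p = foldr (\<circ>) (map (\<lambda>i. transpose i (Suc i)) is) id)"

definition antisymmetrizer :: "('k::field, 'h::ring_1) hopf \<Rightarrow> ('k, 'w::ring_1, 'h) calc \<Rightarrow> nat \<Rightarrow>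
    ('w list \<Rightarrow>\<^sub>0 'k) \<Rightarrow> ('w list \<Rightarrow>\<^sub>0 'k)" where
  "antisymmetrizer H C n t = (\<Sum>p | p permutes {..<n}.
     fsc (of_int (sign p)) (foldr (\<circ>) (map (sigma_bar_at H C n) (reduced_word n p)) id t))"

text \<open>
  By \<open>grade_span\<close> the multiplication \<open>(\<Omega>\<^sup>1)\<^bsup>\<otimes>n\<^esup> \<rightarrow> \<Omega>\<^sup>n\<close> is onto, so that \<open>\<Omega>\<^sup>\<bullet>\<close> is the quotient of the
  tensor algebra of \<open>\<Omega>\<^sup>1\<close> by the kernels of these multiplications.  In degree 0 there is nothing
  to require.
\<close>

locale woronowicz_calculus = bicovariant_calculus +
  assumes kernel_wedge: "n \<ge> 1 \<Longrightarrow> t \<in> car (tensor_power (one_forms C) n) \<Longrightarrow>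
    lext (sc C) t prod_list = 0 \<longleftrightarrow> antisymmetrizer H C n t = 0"

subsection \<open>Symmetric tensors\<close>

definition eigenspace :: "('k::field, 'h::ring_1) hopf \<Rightarrow> ('k, 'w::ring_1, 'h) calc \<Rightarrow> 'k \<Rightarrow>
    ('w \<times> 'w \<Rightarrow>\<^sub>0 'k) set" where
  "eigenspace H C c = {t \<in> car (two_tensors H C). sigma_bar H C t = fsc c t}"

definition diagonalisable :: "('k::field, 'h::ring_1) hopf \<Rightarrow> ('k, 'w::ring_1, 'h) calc \<Rightarrow> bool" where
  "diagonalisable H C \<longleftrightarrow> car (two_tensors H C) = module.span fsc (\<Union>c. eigenspace H C c)"

definition vee :: "('k::field, 'h::ring_1) hopf \<Rightarrow> ('k, 'w::ring_1, 'h) calc \<Rightarrow>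
    ('w \<times> 'w \<Rightarrow>\<^sub>0 'k) set" where
  "vee H C = eigenspace H C 1"

definition wedge_part :: "('k::field, 'h::ring_1) hopf \<Rightarrow> ('k, 'w::ring_1, 'h) calc \<Rightarrow>
    ('w \<times> 'w \<Rightarrow>\<^sub>0 'k) set" where
  "wedge_part H C = module.span fsc (\<Union>c\<in>- {1}. eigenspace H C c)"

definition pi_vee :: "('k::field, 'h::ring_1) hopf \<Rightarrow> ('k, 'w::ring_1, 'h) calc \<Rightarrow>
    ('w \<times> 'w \<Rightarrow>\<^sub>0 'k) \<Rightarrow> ('w \<times> 'w \<Rightarrow>\<^sub>0 'k)" where
  "pi_vee H C t = (THE s. s \<in> vee H C \<and> t - s \<in> wedge_part H C)"

text \<open>\<open>x \<otimes> (y \<otimes> z) \<mapsto> (x \<otimes> y) \<otimes> z\<close>\<close>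

definition attach :: "('k::field, 'h::ring_1) hopf \<Rightarrow> ('k, 'w::ring_1, 'h) calc \<Rightarrow> 'w \<Rightarrow>
    ('w \<times> 'w \<Rightarrow>\<^sub>0 'k) \<Rightarrow> (('w \<times> 'w \<Rightarrow>\<^sub>0 'k) \<times> 'w \<Rightarrow>\<^sub>0 'k)" where
  "attach H C x t = swe t (\<lambda>(y, z).
     htp (two_tensors H C) (one_forms C) (htp (one_forms C) (one_forms C) x y) z)"

text \<open>\<open>T\<^sub>2\<^sub>3\<close> and \<open>T\<^sub>1\<^sub>2\<close> for an endomorphism \<open>T\<close> of \<open>\<Omega>\<^sup>1 \<otimes>\<^sub>H \<Omega>\<^sup>1\<close>\<close>

definition on_23 :: "('k::field, 'h::ring_1) hopf \<Rightarrow> ('k, 'w::ring_1, 'h) calc \<Rightarrow>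
    (('w \<times> 'w \<Rightarrow>\<^sub>0 'k) \<Rightarrow> ('w \<times> 'w \<Rightarrow>\<^sub>0 'k)) \<Rightarrow>
    (('w \<times> 'w \<Rightarrow>\<^sub>0 'k) \<times> 'w \<Rightarrow>\<^sub>0 'k) \<Rightarrow> (('w \<times> 'w \<Rightarrow>\<^sub>0 'k) \<times> 'w \<Rightarrow>\<^sub>0 'k)" where
  "on_23 H C T t = swe t (\<lambda>(s, z). swe s (\<lambda>(x, y).
     attach H C x (T (htp (one_forms C) (one_forms C) y z))))"

definition on_12 :: "('k::field, 'h::ring_1) hopf \<Rightarrow> ('k, 'w::ring_1, 'h) calc \<Rightarrow>
    (('w \<times> 'w \<Rightarrow>\<^sub>0 'k) \<Rightarrow> ('w \<times> 'w \<Rightarrow>\<^sub>0 'k)) \<Rightarrow>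
    (('w \<times> 'w \<Rightarrow>\<^sub>0 'k) \<times> 'w \<Rightarrow>\<^sub>0 'k) \<Rightarrow> (('w \<times> 'w \<Rightarrow>\<^sub>0 'k) \<times> 'w \<Rightarrow>\<^sub>0 'k)" where
  "on_12 H C T t = swe t (\<lambda>(s, z). htp (two_tensors H C) (one_forms C) (T s) z)"

text \<open>
  \<open>(\<Omega>\<^sup>1 \<or> \<Omega>\<^sup>1) \<otimes>\<^sub>H \<Omega>\<^sup>1\<close> and \<open>\<Omega>\<^sup>1 \<otimes>\<^sub>H (\<Omega>\<^sup>1 \<or> \<Omega>\<^sup>1)\<close> as subspaces of \<open>\<Omega>\<^sup>1 \<otimes>\<^sub>H \<Omega>\<^sup>1 \<otimes>\<^sub>H \<Omega>\<^sup>1\<close>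
\<close>

definition vee_12 :: "('k::field, 'h::ring_1) hopf \<Rightarrow> ('k, 'w::ring_1, 'h) calc \<Rightarrow>
    (('w \<times> 'w \<Rightarrow>\<^sub>0 'k) \<times> 'w \<Rightarrow>\<^sub>0 'k) set" where
  "vee_12 H C = module.span fsc
     {htp (two_tensors H C) (one_forms C) s z | s z. s \<in> vee H C \<and> z \<in> car (one_forms C)}"

definition vee_23 :: "('k::field, 'h::ring_1) hopf \<Rightarrow> ('k, 'w::ring_1, 'h) calc \<Rightarrow>
    (('w \<times> 'w \<Rightarrow>\<^sub>0 'k) \<times> 'w \<Rightarrow>\<^sub>0 'k) set" where
  "vee_23 H C = module.span fsc
     {attach H C x s | x s. x \<in> car (one_forms C) \<and> s \<in> vee H C}"

section \<open>Vector fields and metrics\<close>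

text \<open>
  Right \<open>H\<close>-linear maps \<open>\<Omega>\<^sup>1 \<rightarrow> H\<close>, extended by zero outside of \<open>\<Omega>\<^sup>1\<close>.  The coactions are determined
  by their values \<open>X\<^sub>0(\<omega>) \<otimes> X\<^sub>1\<close> and \<open>X\<^sub>-\<^sub>1 \<otimes> X\<^sub>0(\<omega>)\<close> on all one-forms.
\<close>

definition field_space :: "('k::field, 'h::ring_1) hopf \<Rightarrow> ('k, 'w::ring_1, 'h) calc \<Rightarrow>
    ('k, 'w \<Rightarrow> 'h) vect" where
  "field_space H C = \<lparr>
     car = {X. (\<forall>v\<in>grade C 1. \<forall>w\<in>grade C 1. X (v + w) = X v + X w) \<and>
       (\<forall>w\<in>grade C 1. \<forall>a. X (ract (one_forms C) w a) = X w * a) \<and>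
       (\<forall>w. w \<notin> grade C 1 \<longrightarrow> X w = 0)},
     sc = (\<lambda>c X w. sc H c (X w))\<rparr>"

definition vector_fields :: "('k::field, 'h::ring_1) hopf \<Rightarrow> ('k, 'w::ring_1, 'h) calc \<Rightarrow>
    ('k, 'w \<Rightarrow> 'h, 'h) bicov" where
  "vector_fields H C = \<lparr>
     car = car (field_space H C),
     sc = sc (field_space H C),
     lact = (\<lambda>a X w. a * X w),
     ract = (\<lambda>X b w. if w \<in> grade C 1 then X (lact (one_forms C) b w) else 0),
     lcoact = (\<lambda>X. THE t. t \<in> car (ktens H (field_space H C)) \<and>
       (\<forall>w\<in>grade C 1. swe t (\<lambda>(h, Y). ktp H H h (Y w)) =
          swe (lcoacts C 1 w) (\<lambda>(k, w0). swe (comult H (X w0)) (\<lambda>(x1, x0).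
            ktp H H (x1 * antipode_inv H k) x0)))),
     rcoact = (\<lambda>X. THE t. t \<in> car (ktens (field_space H C) H) \<and>
       (\<forall>w\<in>grade C 1. swe t (\<lambda>(Y, h). ktp H H (Y w) h) =
          swe (rcoacts C 1 w) (\<lambda>(w0, k). swe (comult H (X w0)) (\<lambda>(x0, x1).
            ktp H H x0 (x1 * antipode H k)))))\<rparr>"

abbreviation field_tensors :: "('k::field, 'h::ring_1) hopf \<Rightarrow> ('k, 'w::ring_1, 'h) calc \<Rightarrow>
    ('k, ('w \<Rightarrow> 'h) \<times> ('w \<Rightarrow> 'h) \<Rightarrow>\<^sub>0 'k, 'h) bicov" where
  "field_tensors H C \<equiv> tens H (vector_fields H C) (vector_fields H C)"

definition field_vee :: "('k::field, 'h::ring_1) hopf \<Rightarrow> ('k, 'w::ring_1, 'h) calc \<Rightarrow>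
    (('w \<Rightarrow> 'h) \<times> ('w \<Rightarrow> 'h) \<Rightarrow>\<^sub>0 'k) set" where
  "field_vee H C = {g \<in> car (field_tensors H C).
     braid H (vector_fields H C) (vector_fields H C) g = g}"

definition sharp :: "('k::field, 'h::ring_1) hopf \<Rightarrow> ('k, 'w::ring_1, 'h) calc \<Rightarrow>
    (('w \<Rightarrow> 'h) \<times> ('w \<Rightarrow> 'h) \<Rightarrow>\<^sub>0 'k) \<Rightarrow> 'w \<Rightarrow> ('w \<Rightarrow> 'h)" where
  "sharp H C g w = lext (sc (field_space H C)) g (\<lambda>(X, Y). ract (vector_fields H C) X (Y w))"

definition pair2 :: "('k::field, 'h::ring_1) hopf \<Rightarrow> ('k, 'w::ring_1, 'h) calc \<Rightarrow>
    (('w \<Rightarrow> 'h) \<times> ('w \<Rightarrow> 'h) \<Rightarrow>\<^sub>0 'k) \<Rightarrow> ('w \<times> 'w \<Rightarrow>\<^sub>0 'k) \<Rightarrow> 'h" where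
  "pair2 H C g t = lext (sc H) g (\<lambda>(X, Y). lext (sc H) t (\<lambda>(v, w).
     ract (vector_fields H C) X (Y v) w))"

definition pair3 :: "('k::field, 'h::ring_1) hopf \<Rightarrow> ('k, 'w::ring_1, 'h) calc \<Rightarrow>
    (('w \<Rightarrow> 'h) \<times> ('w \<Rightarrow> 'h) \<Rightarrow>\<^sub>0 'k) \<Rightarrow> (('w \<times> 'w \<Rightarrow>\<^sub>0 'k) \<times> 'w \<Rightarrow>\<^sub>0 'k) \<Rightarrow> 'w" where
  "pair3 H C g t = lext (sc C) t (\<lambda>(s, z). lact (one_forms C) (pair2 H C g s) z)"

definition is_metric :: "('k::field, 'h::ring_1) hopf \<Rightarrow> ('k, 'w::ring_1, 'h) calc \<Rightarrow>
    (('w \<Rightarrow> 'h) \<times> ('w \<Rightarrow> 'h) \<Rightarrow>\<^sub>0 'k) \<Rightarrow> bool" where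
  "is_metric H C g \<longleftrightarrow> g \<in> field_vee H C \<and>
     (\<forall>v\<in>grade C 1. \<forall>w\<in>grade C 1. sharp H C g (v + w) = sharp H C g v + sharp H C g w) \<and>
     (\<forall>w\<in>grade C 1. \<forall>a. sharp H C g (ract (one_forms C) w a) =
        ract (vector_fields H C) (sharp H C g w) a) \<and>
     bij_betw (sharp H C g) (grade C 1) (car (vector_fields H C))"

text \<open>
  The braidings of the sub-object of symmetric elements with \<open>\<Omega>\<^sup>1\<close> are the restrictions of
  those of the tensor square of the vector fields.
\<close>

definition sigma_central :: "('k::field, 'h::ring_1) hopf \<Rightarrow> ('k, 'w::ring_1, 'h) calc \<Rightarrow>
    (('w \<Rightarrow> 'h) \<times> ('w \<Rightarrow> 'h) \<Rightarrow>\<^sub>0 'k) \<Rightarrow> bool" where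
  "sigma_central H C g \<longleftrightarrow> (\<forall>w\<in>grade C 1.
     braid H (field_tensors H C) (one_forms C) (htp (field_tensors H C) (one_forms C) g w) =
       htp (one_forms C) (field_tensors H C) w g \<and>
     braid H (one_forms C) (field_tensors H C) (htp (one_forms C) (field_tensors H C) w g) =
       htp (field_tensors H C) (one_forms C) g w)"

section \<open>Connections\<close>

definition right_connection :: "('k::field, 'h::ring_1) hopf \<Rightarrow> ('k, 'w::ring_1, 'h) calc \<Rightarrow>
    ('w \<Rightarrow> ('w \<times> 'w \<Rightarrow>\<^sub>0 'k)) \<Rightarrow> bool" where
  "right_connection H C D \<longleftrightarrow> D \<in> car (lmaps (one_forms C) (two_tensors H C)) \<and>
     (\<forall>m\<in>grade C 1. \<forall>a. D (ract (one_forms C) m a) =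
        ract (two_tensors H C) (D m) a + htp (one_forms C) (one_forms C) m (diff C (embed C a)))"

text \<open>
  The element \<open>\<nabla>\<^sub>-\<^sub>1 \<otimes> \<nabla>\<^sub>0\<close> of \<open>H \<otimes> Hom(\<Omega>\<^sup>1, \<Omega>\<^sup>1 \<otimes>\<^sub>H \<Omega>\<^sup>1)\<close>, determined by the values \<open>\<nabla>\<^sub>-\<^sub>1 \<otimes> \<nabla>\<^sub>0(m)\<close>
\<close>

definition conn_coact :: "('k::field, 'h::ring_1) hopf \<Rightarrow> ('k, 'w::ring_1, 'h) calc \<Rightarrow>
    ('w \<Rightarrow> ('w \<times> 'w \<Rightarrow>\<^sub>0 'k)) \<Rightarrow> ('h \<times> ('w \<Rightarrow> ('w \<times> 'w \<Rightarrow>\<^sub>0 'k)) \<Rightarrow>\<^sub>0 'k)" where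
  "conn_coact H C D = (THE t. t \<in> car (ktens H (lmaps (one_forms C) (two_tensors H C))) \<and>
     (\<forall>m\<in>grade C 1. swe t (\<lambda>(h, E). ktp H (two_tensors H C) h (E m)) =
        swe (lcoact (one_forms C) m) (\<lambda>(h, m0). swe (lcoact (two_tensors H C) (D m0)) (\<lambda>(k, s).
          ktp H (two_tensors H C) (k * antipode_inv H h) s))))"

text \<open>
  \<open>m \<otimes>\<^sub>H n \<mapsto> \<sigma>\<^sub>2\<^sub>3(\<nabla>(m\<^sub>0 S(m\<^sub>1)) \<otimes>\<^sub>H m\<^sub>2 n) + \<nabla>\<^sub>-\<^sub>2 m\<^sub>0 S(\<nabla>\<^sub>-\<^sub>1 m\<^sub>1) \<otimes>\<^sub>H \<nabla>\<^sub>0(m\<^sub>2 n)\<close>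
\<close>

definition conn_sum :: "('k::field, 'h::ring_1) hopf \<Rightarrow> ('k, 'w::ring_1, 'h) calc \<Rightarrow>
    ('w \<Rightarrow> ('w \<times> 'w \<Rightarrow>\<^sub>0 'k)) \<Rightarrow> ('w \<times> 'w \<Rightarrow>\<^sub>0 'k) \<Rightarrow> (('w \<times> 'w \<Rightarrow>\<^sub>0 'k) \<times> 'w \<Rightarrow>\<^sub>0 'k)" where
  "conn_sum H C D t = (let M = one_forms C; S = antipode H in
     swe t (\<lambda>(m, n). swe (rcoact M m) (\<lambda>(m0, h). swe (comult H h) (\<lambda>(m1, m2).
       on_23 H C (braid H M M) (htp (two_tensors H C) M (D (ract M m0 (S m1))) (lact M m2 n)) +
       swe (conn_coact H C D) (\<lambda>(k, E). swe (comult H k) (\<lambda>(k2, k1).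
         attach H C (lact M k2 (ract M m0 (S (k1 * m1)))) (E (lact M m2 n))))))))"

definition conn_vee :: "('k::field, 'h::ring_1) hopf \<Rightarrow> ('k, 'w::ring_1, 'h) calc \<Rightarrow>
    ('w \<Rightarrow> ('w \<times> 'w \<Rightarrow>\<^sub>0 'k)) \<Rightarrow> ('w \<times> 'w \<Rightarrow>\<^sub>0 'k) \<Rightarrow> (('w \<times> 'w \<Rightarrow>\<^sub>0 'k) \<times> 'w \<Rightarrow>\<^sub>0 'k)" where
  "conn_vee H C D s = on_12 H C (pi_vee H C) (conn_sum H C D s)"

definition metric_compatible :: "('k::field, 'h::ring_1) hopf \<Rightarrow> ('k, 'w::ring_1, 'h) calc \<Rightarrow>
    (('w \<Rightarrow> 'h) \<times> ('w \<Rightarrow> 'h) \<Rightarrow>\<^sub>0 'k) \<Rightarrow> ('w \<Rightarrow> ('w \<times> 'w \<Rightarrow>\<^sub>0 'k)) \<Rightarrow> bool" where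
  "metric_compatible H C g D \<longleftrightarrow>
     (\<forall>s\<in>vee H C. pair3 H C g (conn_vee H C D s) = diff C (embed C (pair2 H C g s)))"

definition torsion_free :: "('k::field, 'w::ring_1, 'h::ring_1) calc \<Rightarrow>
    ('w \<Rightarrow> ('w \<times> 'w \<Rightarrow>\<^sub>0 'k)) \<Rightarrow> bool" where
  "torsion_free C D \<longleftrightarrow>
     (\<forall>m\<in>grade C 1. lext (sc C) (D m) (\<lambda>(x, y). x * y) + diff C m = 0)"

definition levi_civita :: "('k::field, 'h::ring_1) hopf \<Rightarrow> ('k, 'w::ring_1, 'h) calc \<Rightarrow>
    (('w \<Rightarrow> 'h) \<times> ('w \<Rightarrow> 'h) \<Rightarrow>\<^sub>0 'k) \<Rightarrow> ('w \<Rightarrow> ('w \<times> 'w \<Rightarrow>\<^sub>0 'k)) \<Rightarrow> bool" where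
  "levi_civita H C g D \<longleftrightarrow>
     right_connection H C D \<and> torsion_free C D \<and> metric_compatible H C g D"

end

theory Submission
  imports Defs
begin

text \<open>
  \<open>\<Omega>\<^sup>1\<close> is spanned over \<open>H\<close>, from either side, by its left coinvariant and by its right coinvariant
  elements, and \<open>\<sigma>\<close> is the flip \<open>m \<otimes> n \<mapsto> n \<otimes> m\<close> for \<open>m\<close> left and \<open>n\<close> right coinvariant.  On such
  generators centrality of \<open>g\<close> says that the values of \<open>\<gamma> = \<langle>g, \<cdot>\<rangle>\<close> on products of left (right)
  coinvariant forms commute with right (left) coinvariant forms.  It follows that \<open>\<gamma>\<close> is a bimodule
  map and that the contractions \<open>g12\<close>, \<open>g23\<close> of three-fold tensors satisfy
  \<open>g23 \<circ> \<sigma>12 \<circ> \<sigma>23 = g12\<close> and \<open>g12 \<circ> \<sigma>23 \<circ> \<sigma>12 = g23\<close>.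

  The sum of \<open>\<nabla>\<close> with itself takes \<open>m \<otimes> n\<close> (\<open>m\<close> right, \<open>n\<close> left coinvariant) to
  \<open>\<sigma>23(\<nabla>m \<otimes> n) + \<sigma>12 \<sigma>23(\<nabla>n \<otimes> m)\<close>.  Two torsion-free connections differ by a right linear
  \<open>\<Phi> : \<Omega>\<^sup>1 \<rightarrow> \<Omega>\<^sup>1 \<or> \<Omega>\<^sup>1\<close>, and by the identities for \<open>g12\<close> and \<open>g23\<close> compatibility of \<open>\<nabla> + \<Phi>\<close> with
  \<open>f g\<close> becomes \<open>2 g23(\<Phi> \<otimes> id) = f\<^sup>-\<^sup>1 d(f \<gamma>) - g12(\<nabla> \<oplus> \<nabla>)\<close> on \<open>\<Omega>\<^sup>1 \<or> \<Omega>\<^sup>1\<close>, with right linear right-hand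
  side.  Through \<open>g\<close> the maps \<open>\<Phi>\<close> correspond to \<open>(\<Omega>\<^sup>1 \<or> \<Omega>\<^sup>1) \<otimes> \<Omega>\<^sup>1\<close> and the right-hand sides to
  \<open>\<Omega>\<^sup>1 \<otimes> (\<Omega>\<^sup>1 \<or> \<Omega>\<^sup>1)\<close>, and \<open>\<Phi> \<mapsto> g23(\<Phi> \<otimes> id)\<close> turns into the invertible map of the hypothesis, because
  \<open>\<pi>\<close> is self-adjoint for the form \<open>gg\<close> induced by \<open>g\<close> on two-fold tensors.
\<close>

section \<open>Sweedler sums and linear maps on subspaces\<close>

lemma keys_fsc: "Poly_Mapping.keys (fsc c p) \<subseteq> Poly_Mapping.keys p"
  by (auto simp: in_keys_iff)

definition lin_on :: "'v::ab_group_add set \<Rightarrow> ('k::field \<Rightarrow> 'v \<Rightarrow> 'v) \<Rightarrow> ('k \<Rightarrow> 'w::ab_group_add \<Rightarrow> 'w) \<Rightarrow>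
    ('v \<Rightarrow> 'w) \<Rightarrow> bool" where
  "lin_on A s s' f \<longleftrightarrow> (\<forall>x\<in>A. \<forall>y\<in>A. f (x + y) = f x + f y) \<and> (\<forall>c. \<forall>x\<in>A. f (s c x) = s' c (f x))"

named_theorems lin

lemma lin_onI:
  assumes "\<And>x y. x \<in> A \<Longrightarrow> y \<in> A \<Longrightarrow> f (x + y) = f x + f y"
    and "\<And>c x. x \<in> A \<Longrightarrow> f (s c x) = s' c (f x)"
  shows "lin_on A s s' f"
  using assms unfolding lin_on_def by blast

lemma lin_on_add: "lin_on A s s' f \<Longrightarrow> x \<in> A \<Longrightarrow> y \<in> A \<Longrightarrow> f (x + y) = f x + f y"
  and lin_on_scale: "lin_on A s s' f \<Longrightarrow> x \<in> A \<Longrightarrow> f (s c x) = s' c (f x)"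
  unfolding lin_on_def by blast+

lemma lin_on_id [lin]: "lin_on A s s (\<lambda>x. x)"
  by (simp add: lin_on_def)

lemma lin_on_subset: "lin_on A s s' f \<Longrightarrow> B \<subseteq> A \<Longrightarrow> lin_on B s s' f"
  unfolding lin_on_def by blast

lemma lin_on_comp:
  assumes "lin_on B s' s'' g" and "lin_on A s s' f" and "\<And>x. x \<in> A \<Longrightarrow> f x \<in> B"
  shows "lin_on A s s'' (\<lambda>x. g (f x))"
  using assms unfolding lin_on_def by simp

lemma linear_on_lin_on: "linear_on V W f \<Longrightarrow> lin_on (car V) (sc V) (sc W) f"
  unfolding linear_on_def lin_on_def by blast

lemma linear_on_in: "linear_on V W f \<Longrightarrow> x \<in> car V \<Longrightarrow> f x \<in> car W"
  unfolding linear_on_def by blast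

lemma lext_cong: "(\<And>x. x \<in> Poly_Mapping.keys p \<Longrightarrow> f x = g x) \<Longrightarrow> lext s p f = lext s p g"
  unfolding lext_def by (rule sum.cong) auto

lemma lext_cong2: "(\<And>x y. (x, y) \<in> Poly_Mapping.keys p \<Longrightarrow> f x y = g x y) \<Longrightarrow>
    lext s p (case_prod f) = lext s p (case_prod g)"
  by (rule lext_cong) auto

context
  fixes s :: "'k::field \<Rightarrow> 'v::ab_group_add \<Rightarrow> 'v"
  assumes vs: "vector_space s"
begin

interpretation vector_space s by (rule vs)

lemma lext_eq_sum:
  assumes "finite A" "Poly_Mapping.keys p \<subseteq> A"
  shows "lext s p f = (\<Sum>x\<in>A. s (Poly_Mapping.lookup p x) (f x))"
  unfolding lext_def
  by (rule sum.mono_neutral_left[OF assms]) (auto simp: in_keys_iff)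

lemma lext_add: "lext s (p + q) f = lext s p f + lext s q f"
proof -
  let ?A = "Poly_Mapping.keys p \<union> Poly_Mapping.keys q"
  have "lext s (p + q) f = (\<Sum>x\<in>?A. s (Poly_Mapping.lookup (p + q) x) (f x))"
    by (rule lext_eq_sum) (auto dest: Poly_Mapping.keys_add[THEN subsetD])
  also have "\<dots> = lext s p f + lext s q f"
    by (subst (1 2) lext_eq_sum[of ?A]) (auto simp: lookup_add scale_left_distrib sum.distrib)
  finally show ?thesis .
qed

lemma lext_scale: "lext s (fsc c p) f = s c (lext s p f)"
  by (subst lext_eq_sum[OF _ keys_fsc]) (auto simp: lext_def scale_sum_right)

lemma lext_0 [simp]: "lext s 0 f = 0"
  by (simp add: lext_def)

lemma lext_uminus: "lext s (- p) f = - lext s p f"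
  using lext_add[of p "- p" f] by (simp add: eq_neg_iff_add_eq_0 add.commute)

lemma lext_diff: "lext s (p - q) f = lext s p f - lext s q f"
  using lext_add[of p "- q" f] by (simp add: lext_uminus)

lemma lext_sum: "lext s (\<Sum>i\<in>I. p i) f = (\<Sum>i\<in>I. lext s (p i) f)"
  by (induction I rule: infinite_finite_induct) (auto simp: lext_add)

lemma lext_bvec [simp]: "lext s (bvec x) f = f x"
  by (simp add: lext_def bvec_def)

lemma lext_add_fun: "lext s p (\<lambda>x. f x + g x) = lext s p f + lext s p g"
  by (simp add: lext_def scale_right_distrib sum.distrib)

lemma lext_add_fun2: "lext s p (\<lambda>(x, y). f x y + g x y) = lext s p (case_prod f) + lext s p (case_prod g)"
  by (simp add: lext_def scale_right_distrib sum.distrib case_prod_unfold)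

lemma lext_scale_fun: "lext s p (\<lambda>x. s c (f x)) = s c (lext s p f)"
  by (simp add: lext_def scale_sum_right mult.commute)

lemma lext_scale_fun2: "lext s p (\<lambda>(x, y). s c (f x y)) = s c (lext s p (case_prod f))"
  by (simp add: lext_def scale_sum_right mult.commute case_prod_unfold)

lemma lext_lext: "lext s (lext fsc p g) f = lext s p (\<lambda>x. lext s (g x) f)"
  by (subst (1 3) lext_def) (simp add: lext_sum lext_scale)

lemma lext_lext2: "lext s (lext fsc p (case_prod g)) f = lext s p (\<lambda>(x, y). lext s (g x y) f)"
  by (simp add: lext_lext case_prod_unfold)

lemma lext_swap: "lext s p (\<lambda>x. lext s q (\<lambda>y. f x y)) = lext s q (\<lambda>y. lext s p (\<lambda>x. f x y))"
  unfolding lext_def scale_sum_right by (subst sum.swap) (simp add: mult.commute)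

lemma lext_swap2: "lext s p (\<lambda>(x, y). lext s q (\<lambda>(z, w). f x y z w)) =
    lext s q (\<lambda>(z, w). lext s p (\<lambda>(x, y). f x y z w))"
  using lext_swap[of p q "\<lambda>(x, y) (z, w). f x y z w"] by (simp add: case_prod_unfold)

lemma lin_on_lext:
  assumes "\<And>i. i \<in> Poly_Mapping.keys p \<Longrightarrow> lin_on A s' s (\<lambda>x. f x i)"
  shows "lin_on A s' s (\<lambda>x. lext s p (f x))"
proof (rule lin_onI)
  fix x y assume "x \<in> A" "y \<in> A"
  then have "lext s p (f (x + y)) = lext s p (\<lambda>i. f x i + f y i)"
    by (intro lext_cong) (simp add: lin_on_add[OF assms])
  then show "lext s p (f (x + y)) = lext s p (f x) + lext s p (f y)" by (simp add: lext_add_fun)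
next
  fix c x assume "x \<in> A"
  then have "lext s p (f (s' c x)) = lext s p (\<lambda>i. s c (f x i))"
    by (intro lext_cong) (simp add: lin_on_scale[OF assms])
  then show "lext s p (f (s' c x)) = s c (lext s p (f x))" by (simp add: lext_scale_fun)
qed

lemma lin_on_lext2 [lin]:
  assumes "\<And>i j. (i, j) \<in> Poly_Mapping.keys p \<Longrightarrow> lin_on A s' s (\<lambda>x. f x i j)"
  shows "lin_on A s' s (\<lambda>x. lext s p (case_prod (f x)))"
  by (rule lin_on_lext) (use assms in auto)

lemma lin_on_lext_arg [lin]: "lin_on A s' fsc g \<Longrightarrow> lin_on A s' s (\<lambda>x. lext s (g x) f)"
  unfolding lin_on_def by (simp add: lext_add lext_scale)

lemma lin_on_sum_fun: "(\<And>i. i \<in> I \<Longrightarrow> lin_on A s' s (\<lambda>x. f x i)) \<Longrightarrow> lin_on A s' s (\<lambda>x. \<Sum>i\<in>I. f x i)"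
  unfolding lin_on_def by (simp add: sum.distrib scale_sum_right)

lemma lin_on_add_fun: "lin_on A s' s f \<Longrightarrow> lin_on A s' s g \<Longrightarrow> lin_on A s' s (\<lambda>x. f x + g x)"
  unfolding lin_on_def by (simp add: scale_right_distrib)

lemma lin_on_scale_fun: "lin_on A s' s f \<Longrightarrow> lin_on A s' s (\<lambda>x. s c (f x))"
  unfolding lin_on_def by (simp add: scale_right_distrib mult.commute)

end


lemma subspace_sum_scale:
  assumes "vector_space s" "module.subspace s A" "\<And>i. i \<in> I \<Longrightarrow> f i \<in> A"
  shows "(\<Sum>i\<in>I. s (c i) (f i)) \<in> A"
proof -
  interpret vector_space s by fact
  show ?thesis using assms(2,3) by (intro subspace_sum subspace_scale)
qed

lemma lext_in_subspace:
  assumes "vector_space s" "module.subspace s A" "\<And>x. x \<in> Poly_Mapping.keys p \<Longrightarrow> f x \<in> A"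
  shows "lext s p f \<in> A"
  unfolding lext_def by (rule subspace_sum_scale) fact+

lemma lin_on_lext_apply:
  assumes s: "vector_space s" and s': "vector_space s'" and A: "module.subspace s A"
    and L: "lin_on A s s' L" and f: "\<And>x. x \<in> Poly_Mapping.keys p \<Longrightarrow> f x \<in> A"
  shows "L (lext s p f) = lext s' p (\<lambda>x. L (f x))"
proof -
  interpret vector_space s by (rule s)
  interpret s': vector_space s' by (rule s')
  have L0: "L 0 = 0" using lin_on_scale[OF L subspace_0[OF A], of 0] by simp
  have "I \<subseteq> Poly_Mapping.keys p \<Longrightarrow>
    L (\<Sum>x\<in>I. s (Poly_Mapping.lookup p x) (f x)) = (\<Sum>x\<in>I. s' (Poly_Mapping.lookup p x) (L (f x)))"
    if "finite I" for I
    using that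
  proof induction
    case (insert x I)
    then show ?case
      by (simp add: lin_on_add[OF L] lin_on_scale[OF L] f subset_iff subspace_scale[OF A]
          subspace_sum_scale[OF s A])
  qed (simp add: L0)
  then show ?thesis by (simp add: lext_def)
qed

lemma lin_on_lext_apply2:
  assumes "vector_space s" "vector_space s'" "module.subspace s A" "lin_on A s s' L"
    and "\<And>x y. (x, y) \<in> Poly_Mapping.keys p \<Longrightarrow> f x y \<in> A"
  shows "L (lext s p (case_prod f)) = lext s' p (\<lambda>(x, y). L (f x y))"
  using lin_on_lext_apply[OF assms(1-4), of p "case_prod f"] assms(5)
  by (simp add: case_prod_unfold)

lemma lin_on_zero:
  assumes "vector_space s" "vector_space s'" "module.subspace s A" "lin_on A s s' L"
  shows "L 0 = 0"
  using lin_on_lext_apply[OF assms, of 0 undefined] by (simp add: lext_def)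

lemma lin_on_sum:
  assumes s: "vector_space s" and s': "vector_space s'" and A: "module.subspace s A"
    and L: "lin_on A s s' L" and f: "\<And>i. i \<in> I \<Longrightarrow> f i \<in> A"
  shows "L (\<Sum>i\<in>I. f i) = (\<Sum>i\<in>I. L (f i))"
proof -
  interpret vector_space s by (rule s)
  show ?thesis using f
    by (induction I rule: infinite_finite_induct)
      (auto simp: lin_on_zero[OF s s' A L] lin_on_add[OF L] subspace_sum[OF A])
qed

lemma lin_on_diff:
  assumes s: "vector_space s" and s': "vector_space s'" and A: "module.subspace s A"
    and L: "lin_on A s s' L" and "x \<in> A" "y \<in> A"
  shows "L (x - y) = L x - L y"
proof -
  interpret vector_space s by (rule s)
  have "L (x - y) + L y = L x"
    using lin_on_add[OF L, of "x - y" y] subspace_diff[OF A] assms by simp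
  then show ?thesis by (simp add: eq_diff_eq)
qed

lemmas vs_fsc [lin] = vector_space_fsc

interpretation fsc: vector_space "fsc :: 'k::field \<Rightarrow> ('a \<Rightarrow>\<^sub>0 'k) \<Rightarrow> _" by (rule vector_space_fsc)

lemma poly_mapping_eq_lext: "p = lext fsc p bvec"
proof (rule poly_mapping_eqI)
  fix x
  have *: "Poly_Mapping.lookup (\<Sum>y\<in>A. fsc (Poly_Mapping.lookup p y) (bvec y)) x =
      (\<Sum>y\<in>A. if y = x then Poly_Mapping.lookup p y else 0)" if "finite A" for A
    using that
    by induction (auto simp: lookup_add bvec_def lookup_single when_def)
  show "Poly_Mapping.lookup p x = Poly_Mapping.lookup (lext fsc p bvec) x"
    unfolding lext_def by (subst *) (auto simp: in_keys_iff)
qed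

section \<open>Quotients of free vector spaces\<close>

lemma free_on_subspace:
  fixes G :: "'a set"
  shows "fsc.subspace (free_on G :: ('a \<Rightarrow>\<^sub>0 'b::field) set)"
proof -
  have "Poly_Mapping.keys (x + y) \<subseteq> G" if "Poly_Mapping.keys x \<subseteq> G" "Poly_Mapping.keys y \<subseteq> G"
    for x y :: "'a \<Rightarrow>\<^sub>0 'b"
    using that Poly_Mapping.keys_add[of x y] by blast
  moreover have "Poly_Mapping.keys (fsc c x) \<subseteq> G" if "Poly_Mapping.keys x \<subseteq> G"
    for x :: "'a \<Rightarrow>\<^sub>0 'b" and c
    using that keys_fsc by fastforce
  ultimately show ?thesis by (simp add: free_on_def fsc.subspace_def)
qed

lemma bvec_free_on [simp]: "bvec x \<in> free_on G \<longleftrightarrow> x \<in> G"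
  by (simp add: free_on_def bvec_def)

lemma free_on_simps:
  "p \<in> free_on G \<Longrightarrow> q \<in> free_on G \<Longrightarrow> p + q \<in> free_on G"
  "p \<in> free_on G \<Longrightarrow> q \<in> free_on G \<Longrightarrow> p - q \<in> free_on G"
  "p \<in> free_on G \<Longrightarrow> fsc c p \<in> free_on G"
  using fsc.subspace_add fsc.subspace_diff fsc.subspace_scale free_on_subspace by blast+

locale free_quotient =
  fixes G :: "'a set" and R :: "('a \<Rightarrow>\<^sub>0 'k::field) set"
  assumes rel_free: "R \<subseteq> free_on G"
begin

lemma span_free: "fsc.span R \<subseteq> free_on G"
  using fsc.span_minimal[OF rel_free free_on_subspace] .

lemmas nf = nform_quotient[OF free_on_subspace fsc.subspace_span span_free, folded qmap_def]

lemma qmap_lin: "lin_on A fsc fsc (qmap G R)"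
proof -
  have "Vector_Spaces.linear fsc fsc (qmap G R)" using nf by blast
  then interpret L: Vector_Spaces.linear fsc fsc "qmap G R" .
  show ?thesis unfolding lin_on_def using L.add L.scale by blast
qed

lemma qmap_free: "qmap G R p \<in> free_on G" using nf by blast

lemma qmap_idem [simp]: "qmap G R (qmap G R p) = qmap G R p" using nf by blast

lemma qmap_0_iff: "p \<in> free_on G \<Longrightarrow> qmap G R p = 0 \<longleftrightarrow> p \<in> fsc.span R" using nf by blast

lemma qmap_add: "qmap G R (p + q) = qmap G R p + qmap G R q"
  using lin_on_add[OF qmap_lin] by blast

lemma qmap_scale: "qmap G R (fsc c p) = fsc c (qmap G R p)"
  using lin_on_scale[OF qmap_lin] by blast

lemma qmap_diff: "qmap G R (p - q) = qmap G R p - qmap G R q"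
  by (rule lin_on_diff[OF vs_fsc vs_fsc fsc.subspace_UNIV qmap_lin]) auto

lemma qmap_eqI: "p - q \<in> R \<Longrightarrow> qmap G R p = qmap G R q"
  using qmap_0_iff[of "p - q"] rel_free fsc.span_base[of "p - q" R] by (auto simp: qmap_diff)

lemma car_qspace: "car (qspace G R) = range (qmap G R)"
proof -
  have "qmap G R p \<in> qmap G R ` free_on G" for p
    by (rule rev_image_eqI[OF qmap_free[of p]]) simp
  then show ?thesis by (auto simp: qspace_def)
qed

lemma qmap_in: "qmap G R p \<in> car (qspace G R)" by (simp add: car_qspace)

lemma qmap_fix: "t \<in> car (qspace G R) \<Longrightarrow> qmap G R t = t" by (auto simp: car_qspace)

lemma qspace_subspace: "fsc.subspace (car (qspace G R))"
proof -
  have "0 = qmap G R 0" using qmap_diff[of 0 0] by simp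
  then show ?thesis unfolding car_qspace fsc.subspace_def
    by (auto simp: qmap_add[symmetric] qmap_scale[symmetric])
qed

lemma qspace_keys: "t \<in> car (qspace G R) \<Longrightarrow> x \<in> Poly_Mapping.keys t \<Longrightarrow> x \<in> G"
  using qmap_free by (fastforce simp: car_qspace free_on_def)

lemma qspace_eq_lext: "t \<in> car (qspace G R) \<Longrightarrow> t = lext fsc t (\<lambda>x. qmap G R (bvec x))"
  using lin_on_lext_apply[OF vs_fsc vs_fsc fsc.subspace_UNIV qmap_lin, of t bvec]
  by (simp add: qmap_fix flip: poly_mapping_eq_lext)

lemma lext_qmap:
  assumes s: "vector_space s" and p: "p \<in> free_on G" and R: "\<And>r. r \<in> R \<Longrightarrow> lext s r f = 0"
  shows "lext s (qmap G R p) f = lext s p f"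
proof -
  interpret s: vector_space s by (rule s)
  have "lext s r f = 0" if "r \<in> fsc.span R" for r
    using that
  proof (induction rule: fsc.span_induct)
    case base
    then show ?case
      by (auto simp: fsc.subspace_def lext_add[OF s] lext_scale[OF s] lext_0[OF s])
  qed (use R in auto)
  moreover have "p - qmap G R p \<in> fsc.span R"
    using qmap_0_iff[of "p - qmap G R p"] p qmap_free free_on_simps(2) by (auto simp: qmap_diff)
  ultimately show ?thesis by (fastforce simp: lext_diff[OF s])
qed

lemma lext_qmap_bvec:
  "vector_space s \<Longrightarrow> x \<in> G \<Longrightarrow> (\<And>r. r \<in> R \<Longrightarrow> lext s r f = 0) \<Longrightarrow> lext s (qmap G R (bvec x)) f = f x"
  by (simp add: lext_qmap lext_bvec)

end

section \<open>Tensor products\<close>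

definition subvs :: "('k::field, 'v::ab_group_add, 'x) vect_scheme \<Rightarrow> bool" where
  "subvs V \<longleftrightarrow> vector_space (sc V) \<and> module.subspace (sc V) (car V)"

lemma subvsD:
  assumes "subvs V"
  shows "vector_space (sc V)" "module.subspace (sc V) (car V)"
    "x \<in> car V \<Longrightarrow> y \<in> car V \<Longrightarrow> x + y \<in> car V" "x \<in> car V \<Longrightarrow> y \<in> car V \<Longrightarrow> x - y \<in> car V"
    "x \<in> car V \<Longrightarrow> sc V c x \<in> car V" "0 \<in> car V"
proof -
  show v: "vector_space (sc V)" "module.subspace (sc V) (car V)" using assms by (auto simp: subvs_def)
  interpret vector_space "sc V" by (rule v)
  show "x \<in> car V \<Longrightarrow> y \<in> car V \<Longrightarrow> x + y \<in> car V" "x \<in> car V \<Longrightarrow> y \<in> car V \<Longrightarrow> x - y \<in> car V"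
    "x \<in> car V \<Longrightarrow> sc V c x \<in> car V" "0 \<in> car V"
    using subspace_add subspace_diff subspace_scale subspace_0 v(2) by blast+
qed

definition bilin_on :: "'v::ab_group_add set \<Rightarrow> ('k::field \<Rightarrow> 'v \<Rightarrow> 'v) \<Rightarrow> 'w::ab_group_add set \<Rightarrow>
    ('k \<Rightarrow> 'w \<Rightarrow> 'w) \<Rightarrow> ('k \<Rightarrow> 'u::ab_group_add \<Rightarrow> 'u) \<Rightarrow> ('v \<Rightarrow> 'w \<Rightarrow> 'u) \<Rightarrow> bool" where
  "bilin_on A s B s' s'' F \<longleftrightarrow> (\<forall>y\<in>B. lin_on A s s'' (\<lambda>x. F x y)) \<and> (\<forall>x\<in>A. lin_on B s' s'' (F x))"

lemma bilin_onI:
  assumes "\<And>y. y \<in> B \<Longrightarrow> lin_on A s s'' (\<lambda>x. F x y)" "\<And>x. x \<in> A \<Longrightarrow> lin_on B s' s'' (\<lambda>y. F x y)"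
  shows "bilin_on A s B s' s'' F"
  using assms by (simp add: bilin_on_def)

lemma bilin_onD:
  assumes "bilin_on A s B s' s'' F"
  shows "y \<in> B \<Longrightarrow> lin_on A s s'' (\<lambda>x. F x y)" "x \<in> A \<Longrightarrow> lin_on B s' s'' (\<lambda>y. F x y)"
  using assms by (simp_all add: bilin_on_def)

abbreviation bilin where
  "bilin V W s F \<equiv> bilin_on (car V) (sc V) (car W) (sc W) s F"

lemma lext_bilin_rel:
  assumes s: "vector_space s" and V: "subvs V" and W: "subvs W" and F: "bilin V W s F"
    and r: "r \<in> bilin_rel V W"
  shows "lext s r (case_prod F) = 0"
proof -
  have "F (x + x') y = F x y + F x' y" "F (sc V c x) y = s c (F x y)"
    if "x \<in> car V" "x' \<in> car V" "y \<in> car W" for x x' y c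
    using bilin_onD(1)[OF F that(3)] that by (auto simp: lin_on_def)
  moreover have "F x (y + y') = F x y + F x y'" "F x (sc W c y) = s c (F x y)"
    if "x \<in> car V" "y \<in> car W" "y' \<in> car W" for x y y' c
    using bilin_onD(2)[OF F that(1)] that by (auto simp: lin_on_def)
  ultimately show ?thesis
    using r unfolding bilin_rel_def
    by (auto simp: lext_diff[OF s] lext_scale[OF s] lext_bvec[OF s])
qed

locale ktensor =
  fixes V :: "('k::field, 'v::ab_group_add, 'x) vect_scheme"
    and W :: "('k, 'w::ab_group_add, 'y) vect_scheme"
  assumes V: "subvs V" and W: "subvs W"
begin

lemma rel_free: "bilin_rel V W \<subseteq> free_on (car V \<times> car W)"
  unfolding bilin_rel_def by (auto intro!: free_on_simps simp: subvsD[OF V] subvsD[OF W])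

sublocale Q: free_quotient "car V \<times> car W" "bilin_rel V W"
  by unfold_locales (rule rel_free)

lemma lext_ktp:
  assumes "vector_space s" "x \<in> car V" "y \<in> car W" "bilin V W s F"
  shows "lext s (ktp V W x y) (case_prod F) = F x y"
  unfolding ktp_def
  using Q.lext_qmap_bvec[OF assms(1), of "(x, y)"] lext_bilin_rel[OF assms(1) V W assms(4)] assms
  by simp

lemma ktp_in: "ktp V W x y \<in> car (ktens V W)"
  unfolding ktp_def ktens_def by (rule Q.qmap_in)

lemma ktens_subvs: "subvs (ktens V W)"
  unfolding subvs_def ktens_def using Q.qspace_subspace vs_fsc by (auto simp: qspace_def)

lemma ktens_keys: "t \<in> car (ktens V W) \<Longrightarrow> (x, y) \<in> Poly_Mapping.keys t \<Longrightarrow> x \<in> car V \<and> y \<in> car W"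
  using Q.qspace_keys[of t "(x, y)"] by (simp add: ktens_def)

lemma ktens_eq_lext: "t \<in> car (ktens V W) \<Longrightarrow> t = lext fsc t (\<lambda>(x, y). ktp V W x y)"
  using Q.qspace_eq_lext[of t] by (simp add: ktens_def ktp_def case_prod_unfold)

lemma ktp_lin1: "y \<in> car W \<Longrightarrow> lin_on (car V) (sc V) fsc (\<lambda>x. ktp V W x y)"
  unfolding ktp_def
  by (intro lin_onI; subst Q.qmap_add[symmetric] Q.qmap_scale[symmetric]; intro Q.qmap_eqI)
    (auto simp: bilin_rel_def algebra_simps)

lemma ktp_lin2: "x \<in> car V \<Longrightarrow> lin_on (car W) (sc W) fsc (\<lambda>y. ktp V W x y)"
  unfolding ktp_def
  by (intro lin_onI; subst Q.qmap_add[symmetric] Q.qmap_scale[symmetric]; intro Q.qmap_eqI)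
    (auto simp: bilin_rel_def algebra_simps)

end

locale htensor =
  fixes M :: "('k::field, 'm::ab_group_add, 'h::ring_1) bicov" and N :: "('k, 'n::ab_group_add, 'h) bicov"
  assumes subvs_left: "subvs M" and subvs_right: "subvs N"
    and ract_car: "x \<in> car M \<Longrightarrow> ract M x a \<in> car M" and lact_car: "y \<in> car N \<Longrightarrow> lact N a y \<in> car N"
begin

sublocale K: ktensor M N by unfold_locales (rule subvs_left subvs_right)+

lemma bal_rel_free: "bal_rel M N \<subseteq> free_on (car M \<times> car N)"
  using K.rel_free unfolding bal_rel_def by (auto intro!: free_on_simps simp: ract_car lact_car)

sublocale Q: free_quotient "car M \<times> car N" "bal_rel M N"
  by unfold_locales (rule bal_rel_free)

lemma lext_htp:
  assumes s: "vector_space s" and "x \<in> car M" "y \<in> car N" and F: "bilin M N s F"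
    and bal: "\<And>x a y. x \<in> car M \<Longrightarrow> y \<in> car N \<Longrightarrow> F (ract M x a) y = F x (lact N a y)"
  shows "lext s (htp M N x y) (case_prod F) = F x y"
proof -
  have "lext s r (case_prod F) = 0" if "r \<in> bal_rel M N" for r
    using that lext_bilin_rel[OF s subvs_left subvs_right F] bal
    unfolding bal_rel_def by (auto simp: lext_diff[OF s] lext_bvec[OF s])
  then show ?thesis
    unfolding htp_def using Q.lext_qmap_bvec[OF s, of "(x, y)" "case_prod F"] assms(2,3) by simp
qed

lemma car_tens: "car (tens H M N) = car (qspace (car M \<times> car N) (bal_rel M N))"
  by (simp add: tens_def hspace_def)

lemma sc_tens: "sc (tens H M N) = fsc" by (simp add: tens_def)

lemma htp_in: "htp M N x y \<in> car (tens H M N)"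
  unfolding htp_def car_tens by (rule Q.qmap_in)

lemma tens_subvs: "subvs (tens H M N)"
  unfolding subvs_def car_tens sc_tens using Q.qspace_subspace vs_fsc by auto

lemma tens_keys: "t \<in> car (tens H M N) \<Longrightarrow> (x, y) \<in> Poly_Mapping.keys t \<Longrightarrow> x \<in> car M \<and> y \<in> car N"
  using Q.qspace_keys[of t "(x, y)"] by (simp add: car_tens)

lemma tens_eq_lext: "t \<in> car (tens H M N) \<Longrightarrow> t = lext fsc t (\<lambda>(x, y). htp M N x y)"
  using Q.qspace_eq_lext[of t] by (simp add: car_tens htp_def case_prod_unfold)

lemma htp_lin1: "y \<in> car N \<Longrightarrow> lin_on (car M) (sc M) fsc (\<lambda>x. htp M N x y)"
  unfolding htp_def
  by (intro lin_onI; subst Q.qmap_add[symmetric] Q.qmap_scale[symmetric]; intro Q.qmap_eqI)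
    (auto simp: bal_rel_def bilin_rel_def algebra_simps)

lemma htp_lin2: "x \<in> car M \<Longrightarrow> lin_on (car N) (sc N) fsc (\<lambda>y. htp M N x y)"
  unfolding htp_def
  by (intro lin_onI; subst Q.qmap_add[symmetric] Q.qmap_scale[symmetric]; intro Q.qmap_eqI)
    (auto simp: bal_rel_def bilin_rel_def algebra_simps)

lemma htp_bal: "x \<in> car M \<Longrightarrow> y \<in> car N \<Longrightarrow> htp M N (ract M x a) y = htp M N x (lact N a y)"
  unfolding htp_def by (rule Q.qmap_eqI) (auto simp: bal_rel_def)

lemma tens_induct [consumes 1, case_names htp add]:
  assumes t: "t \<in> car (tens H M N)"
    and P: "\<And>x y. x \<in> car M \<Longrightarrow> y \<in> car N \<Longrightarrow> P (htp M N x y)"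
    and add: "\<And>t u. t \<in> car (tens H M N) \<Longrightarrow> u \<in> car (tens H M N) \<Longrightarrow> P t \<Longrightarrow> P u \<Longrightarrow> P (t + u)"
  shows "P t"
proof -
  note T = subvsD[OF tens_subvs]
  have P0: "P 0"
    using P[OF subvsD(6)[OF subvs_left] subvsD(6)[OF subvs_right]]
      lin_on_zero[OF subvsD(1)[OF subvs_left] vs_fsc
        subvsD(2)[OF subvs_left] htp_lin1[OF subvsD(6)[OF subvs_right]]] by simp
  have "(\<Sum>z\<in>I. fsc (c z) (case z of (x, y) \<Rightarrow> htp M N x y)) \<in> {t \<in> car (tens H M N). P t}"
    if "finite I" "I \<subseteq> car M \<times> car N" for I c
    using that
  proof induction
    case empty
    then show ?case using P0 T(6) by simp
  next
    case (insert z I)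
    obtain x y where z: "z = (x, y)" by force
    with insert have xy: "x \<in> car M" "y \<in> car N" by auto
    have "fsc (c z) (htp M N x y) = htp M N (sc M (c z) x) y"
      using lin_on_scale[OF htp_lin1[OF xy(2)] xy(1)] by simp
    then have "P (fsc (c z) (htp M N x y))" "fsc (c z) (htp M N x y) \<in> car (tens H M N)"
      using P[OF subvsD(5)[OF subvs_left xy(1)] xy(2)] htp_in by auto
    then show ?case using insert T(3) add by (auto simp: z sc_tens)
  qed
  moreover have "Poly_Mapping.keys t \<subseteq> car M \<times> car N" using tens_keys[OF t] by auto
  ultimately have "P (lext fsc t (\<lambda>(x, y). htp M N x y))" by (simp add: lext_def)
  then show ?thesis by (simp flip: tens_eq_lext[OF t])
qed

end

locale hbimodule =
  fixes H :: "('k::field, 'h::ring_1) hopf" and M :: "('k, 'm::ab_group_add, 'h) bicov"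
  assumes subvs: "subvs M"
    and lact_closed: "x \<in> car M \<Longrightarrow> lact M a x \<in> car M"
    and ract_closed: "x \<in> car M \<Longrightarrow> ract M x a \<in> car M"
    and lact_bilin: "bilin_on UNIV (sc H) (car M) (sc M) (sc M) (lact M)"
    and ract_bilin: "bilin_on (car M) (sc M) UNIV (sc H) (sc M) (ract M)"
    and lact_one: "x \<in> car M \<Longrightarrow> lact M 1 x = x"
    and ract_one: "x \<in> car M \<Longrightarrow> ract M x 1 = x"
    and lact_mult: "x \<in> car M \<Longrightarrow> lact M (a * b) x = lact M a (lact M b x)"
    and ract_mult: "x \<in> car M \<Longrightarrow> ract M x (a * b) = ract M (ract M x a) b"
    and lact_ract: "x \<in> car M \<Longrightarrow> lact M a (ract M x b) = ract M (lact M a x) b"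
begin

lemmas vs = subvsD(1)[OF subvs] and subspace = subvsD(2)[OF subvs]
  and add_closed = subvsD(3)[OF subvs] and diff_closed = subvsD(4)[OF subvs]
  and scale_closed = subvsD(5)[OF subvs] and zero_closed = subvsD(6)[OF subvs]

lemma lact_lin1: "x \<in> car M \<Longrightarrow> lin_on UNIV (sc H) (sc M) (\<lambda>a. lact M a x)"
  and lact_lin2: "lin_on (car M) (sc M) (sc M) (lact M a)"
  using bilin_onD[OF lact_bilin] by auto

lemma ract_lin2: "x \<in> car M \<Longrightarrow> lin_on UNIV (sc H) (sc M) (ract M x)"
  and ract_lin1: "lin_on (car M) (sc M) (sc M) (\<lambda>x. ract M x a)"
  using bilin_onD[OF ract_bilin] by auto

end

locale hbimodule_pair = M: hbimodule H M + N: hbimodule H N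
  for H :: "('k::field, 'h::ring_1) hopf" and M :: "('k, 'm::ab_group_add, 'h) bicov"
    and N :: "('k, 'n::ab_group_add, 'h) bicov"
begin

sublocale htensor M N
  by unfold_locales (simp_all add: M.subvs N.subvs M.ract_closed N.lact_closed)

lemma lact_htp:
  assumes "x \<in> car M" "y \<in> car N"
  shows "lact (tens H M N) a (htp M N x y) = htp M N (lact M a x) y"
  using lext_htp[OF vs_fsc assms, of "\<lambda>x y. htp M N (lact M a x) y"]
    lin_on_comp[OF htp_lin1 M.lact_lin2 M.lact_closed]
  by (simp add: tens_def bilin_on_def htp_lin2 M.lact_closed M.lact_ract M.ract_closed htp_bal)

lemma ract_htp:
  assumes "x \<in> car M" "y \<in> car N"
  shows "ract (tens H M N) (htp M N x y) a = htp M N x (ract N y a)"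
  using lext_htp[OF vs_fsc assms, of "\<lambda>x y. htp M N x (ract N y a)"]
    lin_on_comp[OF htp_lin2 N.ract_lin1 N.ract_closed]
  by (simp add: tens_def bilin_on_def htp_lin1 N.ract_closed N.lact_closed htp_bal
      flip: N.lact_ract)

lemma tens_hbimodule: "hbimodule H (tens H M N)"
proof -
  note T = subvsD[OF tens_subvs[of H], unfolded sc_tens]
  have ladd: "lact (tens H M N) a (t + u) = lact (tens H M N) a t + lact (tens H M N) a u"
    and lsc: "lact (tens H M N) a (fsc c t) = fsc c (lact (tens H M N) a t)" for a t u c
    by (simp_all add: tens_def lext_add[OF vs_fsc] lext_scale[OF vs_fsc])
  have radd: "ract (tens H M N) (t + u) a = ract (tens H M N) t a + ract (tens H M N) u a"
    and rsc: "ract (tens H M N) (fsc c t) a = fsc c (ract (tens H M N) t a)" for a t u c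
    by (simp_all add: tens_def lext_add[OF vs_fsc] lext_scale[OF vs_fsc])
  have lin: "lact (tens H M N) a t \<in> car (tens H M N)" for a t
    unfolding tens_def using lext_in_subspace[OF vs_fsc T(2)] htp_in[of _ _ H]
    by (auto simp: tens_def intro!: lext_in_subspace[OF vs_fsc T(2)[unfolded tens_def, simplified]])
  have rin: "ract (tens H M N) t a \<in> car (tens H M N)" for a t
    unfolding tens_def using lext_in_subspace[OF vs_fsc T(2)] htp_in[of _ _ H]
    by (auto simp: tens_def intro!: lext_in_subspace[OF vs_fsc T(2)[unfolded tens_def, simplified]])
  have llin: "lin_on UNIV (sc H) fsc (\<lambda>a. lact (tens H M N) a t)" if "t \<in> car (tens H M N)" for t
    unfolding tens_def using tens_keys[OF that]
    by (auto intro!: lin_on_lext2[OF vs_fsc] lin_on_comp[OF htp_lin1 M.lact_lin1] M.lact_closed)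
  have rlin: "lin_on UNIV (sc H) fsc (\<lambda>a. ract (tens H M N) t a)" if "t \<in> car (tens H M N)" for t
    unfolding tens_def using tens_keys[OF that]
    by (auto intro!: lin_on_lext2[OF vs_fsc] lin_on_comp[OF htp_lin2 N.ract_lin2] N.ract_closed)
  show ?thesis
  proof
    show "subvs (tens H M N)" by (rule tens_subvs)
    show "bilin_on UNIV (sc H) (car (tens H M N)) (sc (tens H M N)) (sc (tens H M N)) (lact (tens H M N))"
      using llin ladd lsc by (auto simp: bilin_on_def sc_tens intro!: lin_onI)
    show "bilin_on (car (tens H M N)) (sc (tens H M N)) UNIV (sc H) (sc (tens H M N)) (ract (tens H M N))"
      using rlin radd rsc by (auto simp: bilin_on_def sc_tens intro!: lin_onI)
    fix t a b assume t: "t \<in> car (tens H M N)"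
    show "lact (tens H M N) 1 t = t" "ract (tens H M N) t 1 = t"
      "lact (tens H M N) (a * b) t = lact (tens H M N) a (lact (tens H M N) b t)"
      "ract (tens H M N) t (a * b) = ract (tens H M N) (ract (tens H M N) t a) b"
      "lact (tens H M N) a (ract (tens H M N) t b) = ract (tens H M N) (lact (tens H M N) a t) b"
      using t
      by (induction rule: tens_induct)
        (simp_all add: ladd radd lact_htp ract_htp M.lact_one N.ract_one M.lact_mult N.ract_mult
          M.lact_closed N.ract_closed)
  qed (rule lin rin)+
qed

end

section \<open>Sweedler calculus in a Hopf algebra\<close>

lemma lin_compU:
  "lin_on UNIV s' s'' g \<Longrightarrow> lin_on A s s' f \<Longrightarrow> lin_on A s s'' (\<lambda>x. g (f x))"
  by (rule lin_on_comp) auto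

context hopf_algebra
begin

abbreviation "sH \<equiv> sc H"
abbreviation "\<Delta> \<equiv> comult H"
abbreviation "S \<equiv> antipode H"
abbreviation "T \<equiv> antipode_inv H"
abbreviation "\<epsilon> \<equiv> counit H"
abbreviation "hlin \<equiv> lin_on UNIV (sc H)"
abbreviation "hbilin \<equiv> bilin_on UNIV (sc H) UNIV (sc H)"

interpretation vector_space "sc H" by (rule vector_space)

lemma vs_H [lin]: "vector_space (sc H)" by (rule vector_space)

lemma car_H [simp]: "x \<in> car H" by (simp add: car_UNIV)

lemma subvs_H: "subvs H"
  unfolding subvs_def using vector_space by (simp add: car_UNIV)

sublocale HH: ktensor H H by unfold_locales (rule subvs_H)+

lemma sc_ktens [simp]: "sc (ktens V W) = fsc" by (simp add: ktens_def qspace_def)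

sublocale HHH: ktensor H "ktens H H"
  by unfold_locales (rule subvs_H HH.ktens_subvs)+

lemma lin_mult1 [lin]: "lin_on A s sH f \<Longrightarrow> lin_on A s sH (\<lambda>x. f x * a)"
  and lin_mult2 [lin]: "lin_on A s sH f \<Longrightarrow> lin_on A s sH (\<lambda>x. a * f x)"
  unfolding lin_on_def by (simp_all add: algebra_simps scale_mult)

lemma lin_\<Delta> [lin]: "lin_on A s sH f \<Longrightarrow> lin_on A s fsc (\<lambda>x. \<Delta> (f x))"
  using coassoc_counit(1) lin_compU[of "sc H" fsc \<Delta>]
  by (auto simp: right_coaction_def dest!: linear_on_lin_on simp: car_UNIV)

lemma lin_S [lin]: "lin_on A s sH f \<Longrightarrow> lin_on A s sH (\<lambda>x. S (f x))"
  using antipode_linear lin_compU[of "sc H" "sc H" S]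
  by (auto dest!: linear_on_lin_on simp: car_UNIV)

lemma \<Delta>_in: "\<Delta> h \<in> car (ktens H H)"
  using coassoc_counit(1) by (auto simp: right_coaction_def intro: linear_on_in)

lemma lext_ktp_H:
  "vector_space s \<Longrightarrow> hbilin s F \<Longrightarrow> lext s (ktp H H x y) (case_prod F) = F x y"
  by (rule HH.lext_ktp) (simp_all add: car_UNIV)

lemma coassoc:
  assumes s [lin]: "vector_space s"
    and F: "\<And>b c. hlin s (\<lambda>a. F a b c)" "\<And>a c. hlin s (\<lambda>b. F a b c)" "\<And>a b. hlin s (\<lambda>c. F a b c)"
  shows "lext s (\<Delta> h) (\<lambda>(a, b). lext s (\<Delta> a) (\<lambda>(c, d). F c d b)) =
    lext s (\<Delta> h) (\<lambda>(c, a). lext s (\<Delta> a) (\<lambda>(d, b). F c d b))"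
proof -
  let ?L = "\<lambda>a u. lext s u (\<lambda>(b, c). F a b c)"
  have bil: "bilin H (ktens H H) s ?L"
    by (intro bilin_onI lin s) (auto intro: lin_on_subset[OF F(1)] lin)
  have L: "lext s (ktp H (ktens H H) a u) (case_prod ?L) = ?L a u" if "u \<in> car (ktens H H)" for a u
    by (rule HHH.lext_ktp[OF s _ that bil]) simp
  have "swe (\<Delta> h) (\<lambda>(x0, h). swe (\<Delta> x0) (\<lambda>(x0', h'). ktp H (ktens H H) x0' (ktp H H h' h))) =
        swe (\<Delta> h) (\<lambda>(x0, h). ktp H (ktens H H) x0 (\<Delta> h))"
    using coassoc_counit(1) by (auto simp: right_coaction_def)
  from arg_cong[OF this, of "\<lambda>t. lext s t (case_prod ?L)"]
  show ?thesis
    by (simp add: lext_lext2[OF s] L HH.ktp_in \<Delta>_in lext_ktp_H[OF s] bilin_onI F)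
qed

lemma counit_right: "vector_space s \<Longrightarrow> hlin s F \<Longrightarrow> lext s (\<Delta> h) (\<lambda>(a, b). s (\<epsilon> b) (F a)) = F h"
  and counit_left: "vector_space s \<Longrightarrow> hlin s F \<Longrightarrow> lext s (\<Delta> h) (\<lambda>(a, b). s (\<epsilon> a) (F b)) = F h"
proof -
  assume s: "vector_space s" and F: "hlin s F"
  have *: "lext sH (\<Delta> h) (\<lambda>(x0, h). sH (\<epsilon> h) x0) = h" "lext sH (\<Delta> h) (\<lambda>(h, x0). sH (\<epsilon> h) x0) = h"
    using coassoc_counit by (auto simp: right_coaction_def left_coaction_def)
  have L: "F (lext sH (\<Delta> h) (case_prod g)) = lext s (\<Delta> h) (\<lambda>(x, y). F (g x y))" for g
    by (rule lin_on_lext_apply2[OF vector_space s _ F]) auto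
  have F': "F (sH c x) = s c (F x)" for c x using lin_on_scale[OF F] by simp
  show "lext s (\<Delta> h) (\<lambda>(a, b). s (\<epsilon> b) (F a)) = F h" using L[of "\<lambda>x0 h. sH (\<epsilon> h) x0"] by (simp add: F' *)
  show "lext s (\<Delta> h) (\<lambda>(a, b). s (\<epsilon> a) (F b)) = F h" using L[of "\<lambda>h x0. sH (\<epsilon> h) x0"] by (simp add: F' *)
qed

lemma lext_\<Delta>_mult:
  assumes s: "vector_space s" and F: "hbilin s F"
  shows "lext s (\<Delta> (a * b)) (case_prod F) =
    lext s (\<Delta> a) (\<lambda>(a1, a2). lext s (\<Delta> b) (\<lambda>(b1, b2). F (a1 * b1) (a2 * b2)))"
  by (simp add: comult_mult lext_lext2[OF s] lext_ktp_H[OF s F])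

lemma lext_\<Delta>_one: "vector_space s \<Longrightarrow> hbilin s F \<Longrightarrow> lext s (\<Delta> 1) (case_prod F) = F 1 1"
  by (simp add: comult_one lext_ktp_H)

definition cancels :: "('h \<Rightarrow> 'h \<Rightarrow> 'h) \<Rightarrow> bool" where
  "cancels K \<longleftrightarrow> hbilin sH K \<and> (\<forall>h. lext sH (\<Delta> h) (case_prod K) = sH (\<epsilon> h) 1)"

lemma cancelsD: "cancels K \<Longrightarrow> hlin sH (\<lambda>a. K a b)" "cancels K \<Longrightarrow> hlin sH (\<lambda>b. K a b)"
  by (simp_all add: cancels_def bilin_on_def)

lemma cancel:
  assumes "cancels K" "vector_space s" "hlin s F"
  shows "lext s (\<Delta> h) (\<lambda>(a, b). F (K a b)) = s (\<epsilon> h) (F 1)"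
proof -
  have "F (lext sH (\<Delta> h) (case_prod K)) = lext s (\<Delta> h) (\<lambda>(x, y). F (K x y))"
    by (rule lin_on_lext_apply2[OF vector_space assms(2) _ assms(3)]) auto
  then show ?thesis using assms lin_on_scale[OF assms(3)] by (simp add: cancels_def)
qed

lemma cancel_right:
  assumes K: "cancels K" and s: "vector_space s" and G: "\<And>b. hlin s (\<lambda>a. G a b)" "\<And>a. hlin s (\<lambda>b. G a b)"
  shows "lext s (\<Delta> h) (\<lambda>(a, b). lext s (\<Delta> b) (\<lambda>(c, d). G a (K c d))) = G h 1"
  by (simp add: cancel[OF K s G(2)] counit_right[OF s G(1)])

lemma cancel_left:
  assumes K: "cancels K" and s: "vector_space s" and G: "\<And>b. hlin s (\<lambda>a. G a b)" "\<And>a. hlin s (\<lambda>b. G a b)"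
  shows "lext s (\<Delta> h) (\<lambda>(a, b). lext s (\<Delta> a) (\<lambda>(c, d). G (K c d) b)) = G 1 h"
  by (simp add: cancel[OF K s G(1)] counit_left[OF s G(2)])

lemma cancel_mid:
  assumes K: "cancels K" and s [lin]: "vector_space s"
    and G: "\<And>b c. hlin s (\<lambda>a. G a b c)" "\<And>a c. hlin s (\<lambda>b. G a b c)" "\<And>a b. hlin s (\<lambda>c. G a b c)"
  shows "lext s (\<Delta> h) (\<lambda>(a, b). lext s (\<Delta> a) (\<lambda>(u, v). lext s (\<Delta> b) (\<lambda>(x, y). G u (K v x) y))) =
    lext s (\<Delta> h) (\<lambda>(u, y). G u 1 y)"
proof -
  note [lin] = G[THEN lin_compU] cancelsD[OF K, THEN lin_compU]
  have "lext s (\<Delta> h) (\<lambda>(a, b). lext s (\<Delta> a) (\<lambda>(u, v). lext s (\<Delta> b) (\<lambda>(x, y). G u (K v x) y))) =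
     lext s (\<Delta> h) (\<lambda>(u, a). lext s (\<Delta> a) (\<lambda>(v, b). lext s (\<Delta> b) (\<lambda>(x, y). G u (K v x) y)))"
    by (rule coassoc) (intro lin)+
  also have "\<dots> = lext s (\<Delta> h) (\<lambda>(u, a). lext s (\<Delta> a) (\<lambda>(b, y). lext s (\<Delta> b) (\<lambda>(v, x). G u (K v x) y)))"
    by (intro lext_cong2 coassoc[symmetric]) (intro lin)+
  also have "\<dots> = lext s (\<Delta> h) (\<lambda>(u, a). G u 1 a)"
    by (intro lext_cong2 cancel_left[OF K s]) (intro lin)+
  finally show ?thesis .
qed

lemma cancels_S_left: "cancels (\<lambda>a b. S a * b)" and cancels_S_right: "cancels (\<lambda>a b. a * S b)"
  unfolding cancels_def by (intro conjI allI antipode bilin_onI lin)+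

lemma S_one [simp]: "S 1 = 1"
proof -
  have "lext sH (\<Delta> 1) (\<lambda>(a, b). S a * b) = S 1 * 1"
    by (rule lext_\<Delta>_one[OF vector_space]) (intro bilin_onI lin)
  then show ?thesis using antipode(1)[of 1] by (simp add: counit_one)
qed

lemma S_mult: "S (a * b) = S b * S a"
proof -
  have "S (a * b) = lext sH (\<Delta> a) (\<lambda>(a1, a'). lext sH (\<Delta> a') (\<lambda>(a2, a3). S (a1 * b) * (a2 * S a3)))"
    using cancel_right[OF cancels_S_right vector_space, of "\<lambda>a1 k. S (a1 * b) * k" a, symmetric]
    by (simp add: lin)
  also have "\<dots> = lext sH (\<Delta> a) (\<lambda>(a1, a'). lext sH (\<Delta> a') (\<lambda>(a2, a3).
      lext sH (\<Delta> b) (\<lambda>(b1, b'). lext sH (\<Delta> b') (\<lambda>(b2, b3). S (a1 * b1) * (a2 * (b2 * S b3) * S a3)))))"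
    by (intro lext_cong2) (subst cancel_right[OF cancels_S_right vector_space], (intro lin)+, simp)
  also have "\<dots> = lext sH (\<Delta> a) (\<lambda>(a', a3). lext sH (\<Delta> a') (\<lambda>(a1, a2).
      lext sH (\<Delta> b) (\<lambda>(b1, b'). lext sH (\<Delta> b') (\<lambda>(b2, b3). S (a1 * b1) * (a2 * (b2 * S b3) * S a3)))))"
    by (rule coassoc[symmetric]) (intro lin)+
  also have "\<dots> = lext sH (\<Delta> a) (\<lambda>(a', a3). lext sH (\<Delta> a') (\<lambda>(a1, a2).
      lext sH (\<Delta> b) (\<lambda>(b', b3). lext sH (\<Delta> b') (\<lambda>(b1, b2). S (a1 * b1) * (a2 * (b2 * S b3) * S a3)))))"
    by (intro lext_cong2 coassoc[symmetric]) (intro lin)+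
  also have "\<dots> = lext sH (\<Delta> a) (\<lambda>(a', a3). lext sH (\<Delta> b) (\<lambda>(b', b3). lext sH (\<Delta> a') (\<lambda>(a1, a2).
       lext sH (\<Delta> b') (\<lambda>(b1, b2). (S (a1 * b1) * (a2 * b2)) * (S b3 * S a3)))))"
    by (intro lext_cong2, subst lext_swap2[OF vector_space]) (simp add: mult.assoc)
  also have "\<dots> = lext sH (\<Delta> a) (\<lambda>(a', a3). lext sH (\<Delta> b) (\<lambda>(b', b3).
      lext sH (\<Delta> (a' * b')) (\<lambda>(x, y). (S x * y) * (S b3 * S a3))))"
    by (intro lext_cong2 lext_\<Delta>_mult[symmetric, OF vector_space] bilin_onI) (intro lin)+
  also have "\<dots> = lext sH (\<Delta> a) (\<lambda>(a', a3). lext sH (\<Delta> b) (\<lambda>(b', b3). sH (\<epsilon> (a' * b')) (S b3 * S a3)))"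
    by (intro lext_cong2, subst cancel[OF cancels_S_left vector_space]) (intro lin, simp)
  also have "\<dots> = lext sH (\<Delta> a) (\<lambda>(a', a3). sH (\<epsilon> a') (S b * S a3))"
    by (intro lext_cong2, subst counit_left[OF vector_space, symmetric, where h = b])
      (intro lin, simp add: counit_mult lext_scale_fun2[OF vector_space, symmetric])
  also have "\<dots> = S b * S a"
    by (rule counit_left[OF vector_space]) (intro lin)
  finally show ?thesis .
qed

lemma antipode_comult_aux:
  assumes s [lin]: "vector_space s" and G: "\<And>q. hlin s (\<lambda>p. G p q)" "\<And>p. hlin s (\<lambda>q. G p q)"
  shows "lext s (\<Delta> b) (\<lambda>(c, d). lext s (\<Delta> c) (\<lambda>(x, y). lext s (\<Delta> d) (\<lambda>(u, v). G (x * S v) (y * S u)))) =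
    s (\<epsilon> b) (G 1 1)"
proof -
  note [lin] = G[THEN lin_compU]
  have "lext s (\<Delta> b) (\<lambda>(c, d). lext s (\<Delta> c) (\<lambda>(x, y). lext s (\<Delta> d) (\<lambda>(u, v). G (x * S v) (y * S u)))) =
    lext s (\<Delta> b) (\<lambda>(x, b'). lext s (\<Delta> b') (\<lambda>(y, d). lext s (\<Delta> d) (\<lambda>(u, v). G (x * S v) (y * S u))))"
    by (rule coassoc) (intro lin)+
  also have "\<dots> = lext s (\<Delta> b) (\<lambda>(x, b'). lext s (\<Delta> b') (\<lambda>(c, v). lext s (\<Delta> c) (\<lambda>(y, u). G (x * S v) (y * S u))))"
    by (intro lext_cong2 coassoc[symmetric]) (intro lin)+
  also have "\<dots> = lext s (\<Delta> b) (\<lambda>(x, b'). G (x * S b') 1)"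
    by (intro lext_cong2, subst cancel_left[OF cancels_S_right s]) (intro lin refl)+
  also have "\<dots> = s (\<epsilon> b) (G 1 1)"
    by (rule cancel[OF cancels_S_right s]) (intro lin)+
  finally show ?thesis .
qed

lemma lext_\<Delta>_S:
  assumes s [lin]: "vector_space s" and F: "hbilin s F"
  shows "lext s (\<Delta> (S h)) (case_prod F) = lext s (\<Delta> h) (\<lambda>(a, b). F (S b) (S a))"
proof -
  have F': "\<And>y. hlin s (\<lambda>x. F x y)" "\<And>x. hlin s (\<lambda>y. F x y)"
    using F by (simp_all add: bilin_on_def)
  note [lin] = F'[THEN lin_compU]
  have "lext s (\<Delta> (S h)) (case_prod F) = lext s (\<Delta> h) (\<lambda>(a, b). s (\<epsilon> b) (lext s (\<Delta> (S a)) (case_prod F)))"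
    by (rule counit_right[symmetric]) (intro lin)+
  also have "\<dots> = lext s (\<Delta> h) (\<lambda>(a, b). lext s (\<Delta> (S a)) (\<lambda>(p, q). s (\<epsilon> b) (F (p * 1) (q * 1))))"
    by (simp add: lext_scale_fun2[OF s])
  also have "\<dots> = lext s (\<Delta> h) (\<lambda>(a, b). lext s (\<Delta> (S a)) (\<lambda>(p, q).
      lext s (\<Delta> b) (\<lambda>(c, d). lext s (\<Delta> c) (\<lambda>(x, y). lext s (\<Delta> d) (\<lambda>(u, v).
        F (p * (x * S v)) (q * (y * S u)))))))"
    by (intro lext_cong2, subst antipode_comult_aux) (intro lin refl)+
  also have "\<dots> = lext s (\<Delta> h) (\<lambda>(a, b). lext s (\<Delta> b) (\<lambda>(c, d). lext s (\<Delta> (S a)) (\<lambda>(p, q).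
      lext s (\<Delta> c) (\<lambda>(x, y). lext s (\<Delta> d) (\<lambda>(u, v). F ((p * x) * S v) ((q * y) * S u))))))"
    by (intro lext_cong2, subst lext_swap2[OF s]) (simp add: mult.assoc)
  also have "\<dots> = lext s (\<Delta> h) (\<lambda>(a, b). lext s (\<Delta> b) (\<lambda>(c, d).
      lext s (\<Delta> (S a * c)) (\<lambda>(p, q). lext s (\<Delta> d) (\<lambda>(u, v). F (p * S v) (q * S u)))))"
    by (intro lext_cong2, subst lext_\<Delta>_mult[OF s]) (intro bilin_onI lin refl)+
  also have "\<dots> = lext s (\<Delta> h) (\<lambda>(b, d). lext s (\<Delta> b) (\<lambda>(a, c).
      lext s (\<Delta> (S a * c)) (\<lambda>(p, q). lext s (\<Delta> d) (\<lambda>(u, v). F (p * S v) (q * S u)))))"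
    by (rule coassoc[symmetric]) (intro lin)+
  also have "\<dots> = lext s (\<Delta> 1) (\<lambda>(p, q). lext s (\<Delta> h) (\<lambda>(u, v). F (p * S v) (q * S u)))"
    by (rule cancel_left[OF cancels_S_left s]) (intro lin)+
  also have "\<dots> = lext s (\<Delta> h) (\<lambda>(u, v). F (1 * S v) (1 * S u))"
    by (rule lext_\<Delta>_one[OF s]) (intro bilin_onI lin)+
  finally show ?thesis by simp
qed

end

locale hopf_bij = hopf_algebra +
  assumes bij_S: "bij (antipode H)"
begin

interpretation vector_space "sc H" by (rule vector_space)

lemma S_T [simp]: "S (T x) = x" and T_S [simp]: "T (S x) = x"
  using bij_S by (simp_all add: bij_is_surj surj_f_inv_f bij_is_inj)

lemma S_eq_iff: "S x = S y \<longleftrightarrow> x = y"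
  using bij_S by (auto dest!: bij_is_inj simp: inj_eq)

lemma T_mult: "T (a * b) = T b * T a"
  by (subst S_eq_iff[symmetric]) (simp add: S_mult)

lemma T_one [simp]: "T 1 = 1"
  using T_S[of 1] by simp

lemma lin_T [lin]: "lin_on A s sH f \<Longrightarrow> lin_on A s sH (\<lambda>x. T (f x))"
proof -
  have S: "hlin sH S" using lin_S[OF lin_on_id] .
  have "hlin sH T"
    by (rule lin_onI; subst S_eq_iff[symmetric]) (simp_all add: lin_on_add[OF S] lin_on_scale[OF S])
  then show "lin_on A s sH f \<Longrightarrow> lin_on A s sH (\<lambda>x. T (f x))" by (rule lin_compU)
qed

lemma cancels_T: "cancels (\<lambda>a b. T b * a)" "cancels (\<lambda>a b. b * T a)"
proof -
  have T1: "hlin sH T" by (intro lin)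
  have "T (lext sH (\<Delta> h) (case_prod F)) = lext sH (\<Delta> h) (\<lambda>(x, y). T (F x y))" for F h
    by (rule lin_on_lext_apply2[OF vector_space vector_space _ T1]) auto
  note L = this
  have e: "T (sH c 1) = sH c 1" for c by (simp add: lin_on_scale[OF T1])
  have "lext sH (\<Delta> h) (\<lambda>(a, b). T b * a) = sH (\<epsilon> h) 1"
    "lext sH (\<Delta> h) (\<lambda>(a, b). b * T a) = sH (\<epsilon> h) 1" for h
    subgoal using L[of h "\<lambda>a b. S a * b", symmetric] by (simp only: antipode e T_mult T_S)
    subgoal using L[of h "\<lambda>a b. a * S b", symmetric] by (simp only: antipode e T_mult T_S)
    done
  then show "cancels (\<lambda>a b. T b * a)" "cancels (\<lambda>a b. b * T a)"
    unfolding cancels_def by (auto intro!: bilin_onI lin)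
qed

lemma lext_\<Delta>_T:
  assumes s [lin]: "vector_space s" and F: "hbilin s F"
  shows "lext s (\<Delta> (T h)) (case_prod F) = lext s (\<Delta> h) (\<lambda>(a, b). F (T b) (T a))"
proof -
  have F': "\<And>y. hlin s (\<lambda>x. F x y)" "\<And>x. hlin s (\<lambda>y. F x y)"
    using F by (simp_all add: bilin_on_def)
  note [lin] = F'[THEN lin_compU]
  show ?thesis
    using lext_\<Delta>_S[OF s, of "\<lambda>x y. F (T y) (T x)" "T h"]
    by (simp add: bilin_onI lin)
qed

end

section \<open>One-forms and their coinvariants\<close>

text \<open>The degree of one-forms must not be rewritten to \<open>Suc 0\<close>.\<close>

declare One_nat_def [simp del]

declare One_nat_def [symmetric, simp]

lemma ktp_cong:
  "car V = car V' \<Longrightarrow> sc V = sc V' \<Longrightarrow> car W = car W' \<Longrightarrow> sc W = sc W' \<Longrightarrow> ktp V W = ktp V' W'"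
  by (simp add: ktp_def bilin_rel_def fun_eq_iff)

lemma ktens_cong:
  "car V = car V' \<Longrightarrow> sc V = sc V' \<Longrightarrow> car W = car W' \<Longrightarrow> sc W = sc W' \<Longrightarrow> ktens V W = ktens V' W'"
  by (simp add: ktens_def bilin_rel_def)

locale hopf_calculus = hopf_bij H + calc: woronowicz_calculus H C
  for H :: "('k::field, 'h::ring_1) hopf" and C :: "('k, 'w::ring_1, 'h) calc"
begin

abbreviation "\<iota> \<equiv> embed C"
abbreviation "Om \<equiv> one_forms C"
abbreviation "sC \<equiv> sc C"
abbreviation "\<Omega> \<equiv> grade C 1"
abbreviation "\<delta> \<equiv> diff C"
abbreviation "cl \<equiv> lcoacts C 1"
abbreviation "cr \<equiv> rcoacts C 1"

interpretation vC: vector_space "sc C" by (rule calc.vector_space)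

lemma vs_C [lin]: "vector_space (sc C)" by (rule calc.vector_space)

lemma Om_simps [simp]: "car Om = \<Omega>" "sc Om = sC" "lact Om a w = \<iota> a * w" "ract Om w a = w * \<iota> a"
  "lcoact Om = cl" "rcoact Om = cr"
  by (simp_all add: one_forms_def)

lemma forms_simps [simp]: "car (forms C n) = grade C n" "sc (forms C n) = sC"
  by (simp_all add: forms_def)

lemma subvs_forms: "subvs (forms C n)"
  by (simp add: subvs_def vs_C calc.grade_subspace)

lemma subvs_Om: "subvs Om"
  by (simp add: subvs_def vs_C calc.grade_subspace)

lemmas \<Omega>_subspace = calc.grade_subspace[of 1]

lemma \<iota>_grade: "\<iota> a \<in> grade C 0"
  using calc.embed_bij by (auto simp: bij_betw_def)

lemma \<Omega>_closed [simp]: "x \<in> \<Omega> \<Longrightarrow> \<iota> a * x \<in> \<Omega>" "x \<in> \<Omega> \<Longrightarrow> x * \<iota> a \<in> \<Omega>" "\<delta> (\<iota> a) \<in> \<Omega>"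
  "x \<in> \<Omega> \<Longrightarrow> y \<in> \<Omega> \<Longrightarrow> x + y \<in> \<Omega>" "x \<in> \<Omega> \<Longrightarrow> y \<in> \<Omega> \<Longrightarrow> x - y \<in> \<Omega>" "x \<in> \<Omega> \<Longrightarrow> sC c x \<in> \<Omega>" "0 \<in> \<Omega>"
  using calc.grade_mult[OF \<iota>_grade, of x 1 a] calc.grade_mult[OF _ \<iota>_grade, of x 1 a]
    calc.diff_grade[OF \<iota>_grade, of a] subvsD[OF subvs_Om]
  by auto

lemma \<Omega>_grade0 [simp]: "x \<in> \<Omega> \<Longrightarrow> y \<in> grade C 0 \<Longrightarrow> x * y \<in> \<Omega>" "x \<in> \<Omega> \<Longrightarrow> y \<in> grade C 0 \<Longrightarrow> y * x \<in> \<Omega>"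
  using calc.grade_mult[of x 1 y 0] calc.grade_mult[of y 0 x 1] by auto

lemma \<Omega>_lext: "(\<And>x y. (x, y) \<in> Poly_Mapping.keys p \<Longrightarrow> f x y \<in> \<Omega>) \<Longrightarrow> lext sC p (case_prod f) \<in> \<Omega>"
  by (rule lext_in_subspace[OF vs_C \<Omega>_subspace]) auto

lemma lin_multC1 [lin]: "lin_on A s sC f \<Longrightarrow> lin_on A s sC (\<lambda>x. f x * a)"
  and lin_multC2 [lin]: "lin_on A s sC f \<Longrightarrow> lin_on A s sC (\<lambda>x. a * f x)"
  unfolding lin_on_def by (simp_all add: algebra_simps calc.scale_mult)

lemma lin_\<iota> [lin]: "lin_on A s sH f \<Longrightarrow> lin_on A s sC (\<lambda>x. \<iota> (f x))"
  unfolding lin_on_def by (simp add: calc.embed_hom)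

lemma lin_\<delta> [lin]: "lin_on A s sC f \<Longrightarrow> lin_on A s sC (\<lambda>x. \<delta> (f x))"
  using calc.diff_linear lin_compU[of sC sC \<delta>]
  by (auto dest!: linear_on_lin_on simp: calc.car_UNIV)

lemma Om_hbimodule: "hbimodule H Om"
  by unfold_locales
    (auto simp: subvs_Om calc.embed_hom mult.assoc intro!: bilin_onI lin)

sublocale Om: hbimodule H Om by (rule Om_hbimodule)

sublocale HO: ktensor H Om by unfold_locales (rule subvs_H subvs_Om)+
sublocale OH: ktensor Om H by unfold_locales (rule subvs_H subvs_Om)+

lemma ktp_HO_forms: "ktp H (forms C 1) = ktp H Om" and ktp_OH_forms: "ktp (forms C 1) H = ktp Om H"
  and ktens_HO_forms: "ktens H (forms C 1) = ktens H Om" and ktens_OH_forms: "ktens (forms C 1) H = ktens Om H"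
  by (auto intro!: ktp_cong ktens_cong)

lemma lin_HO1 [lin]: "lin_on A s sH f \<Longrightarrow> y \<in> \<Omega> \<Longrightarrow> lin_on A s fsc (\<lambda>x. ktp H Om (f x) y)"
  using lin_on_comp[OF HO.ktp_lin1[of y], of A s f] by (simp add: car_UNIV)

lemma lin_HO2 [lin]: "lin_on A s sC f \<Longrightarrow> (\<And>x. x \<in> A \<Longrightarrow> f x \<in> \<Omega>) \<Longrightarrow> lin_on A s fsc (\<lambda>x. ktp H Om a (f x))"
  using lin_on_comp[OF HO.ktp_lin2[of a], of A s f] by auto

lemma lin_OH1 [lin]: "lin_on A s sH f \<Longrightarrow> y \<in> \<Omega> \<Longrightarrow> lin_on A s fsc (\<lambda>x. ktp Om H y (f x))"
  using lin_on_comp[OF OH.ktp_lin2[of y], of A s f] by (simp add: car_UNIV)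

lemma lin_OH2 [lin]: "lin_on A s sC f \<Longrightarrow> (\<And>x. x \<in> A \<Longrightarrow> f x \<in> \<Omega>) \<Longrightarrow> lin_on A s fsc (\<lambda>x. ktp Om H (f x) a)"
  using lin_on_comp[OF OH.ktp_lin1[of a], of A s f] by auto

lemma lext_HO:
  "vector_space s \<Longrightarrow> y \<in> \<Omega> \<Longrightarrow> bilin_on UNIV sH \<Omega> sC s F \<Longrightarrow> lext s (ktp H Om x y) (case_prod F) = F x y"
  using HO.lext_ktp[of s x y F] by (simp add: car_UNIV)

lemma lext_OH:
  "vector_space s \<Longrightarrow> y \<in> \<Omega> \<Longrightarrow> bilin_on \<Omega> sC UNIV sH s F \<Longrightarrow> lext s (ktp Om H y x) (case_prod F) = F y x"
  using OH.lext_ktp[of s y x F] by (simp add: car_UNIV)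

lemma cl_in: "x \<in> \<Omega> \<Longrightarrow> cl x \<in> car (ktens H Om)" and cr_in: "x \<in> \<Omega> \<Longrightarrow> cr x \<in> car (ktens Om H)"
  using calc.left_coaction[of 1] calc.right_coaction[of 1]
  by (auto simp: left_coaction_def right_coaction_def ktens_HO_forms ktens_OH_forms dest: linear_on_in)

lemma cl_keys [dest!]: "(h, y) \<in> Poly_Mapping.keys (cl x) \<Longrightarrow> x \<in> \<Omega> \<Longrightarrow> y \<in> \<Omega>"
  and cr_keys [dest!]: "(y, h) \<in> Poly_Mapping.keys (cr x) \<Longrightarrow> x \<in> \<Omega> \<Longrightarrow> y \<in> \<Omega>"
  using HO.ktens_keys[OF cl_in, of x h y] OH.ktens_keys[OF cr_in, of x y h] by auto

lemma cl_lin: "lin_on \<Omega> sC fsc cl" and cr_lin: "lin_on \<Omega> sC fsc cr"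
  using calc.left_coaction[of 1] calc.right_coaction[of 1]
  by (auto simp: left_coaction_def right_coaction_def dest!: linear_on_lin_on)

lemma lin_cl [lin]: "lin_on A s sC f \<Longrightarrow> (\<And>x. x \<in> A \<Longrightarrow> f x \<in> \<Omega>) \<Longrightarrow> lin_on A s fsc (\<lambda>x. cl (f x))"
  and lin_cr [lin]: "lin_on A s sC f \<Longrightarrow> (\<And>x. x \<in> A \<Longrightarrow> f x \<in> \<Omega>) \<Longrightarrow> lin_on A s fsc (\<lambda>x. cr (f x))"
  using lin_on_comp[OF cl_lin, of A s f] lin_on_comp[OF cr_lin, of A s f] by auto

sublocale H0: ktensor H "forms C 0" by unfold_locales (rule subvs_H subvs_forms)+
sublocale O0: ktensor "forms C 0" H by unfold_locales (rule subvs_H subvs_forms)+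

lemma cl_left:
  assumes v: "v \<in> \<Omega>"
  shows "cl (\<iota> a * v) = swe (\<Delta> a) (\<lambda>(a1, a2). swe (cl v) (\<lambda>(k, w). ktp H Om (a1 * k) (\<iota> a2 * w)))"
proof -
  have "lext fsc (ktp H (forms C 0) b (\<iota> c)) (\<lambda>(h, v0). swe (cl v) (\<lambda>(k, w). ktp H Om (h * k) (v0 * w))) =
      swe (cl v) (\<lambda>(k, w). ktp H Om (b * k) (\<iota> c * w))" for b c
    by (rule H0.lext_ktp) (auto simp: \<iota>_grade v intro!: bilin_onI lin)
  then show ?thesis
    using calc.lcoact_mult[OF \<iota>_grade v, of a]
    by (simp add: calc.lcoact_embed lext_lext2[OF vs_fsc] ktp_HO_forms)
qed

lemma cl_right:
  assumes v: "v \<in> \<Omega>"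
  shows "cl (v * \<iota> a) = swe (cl v) (\<lambda>(k, w). swe (\<Delta> a) (\<lambda>(a1, a2). ktp H Om (k * a1) (w * \<iota> a2)))"
proof -
  have "lext fsc (ktp H (forms C 0) b (\<iota> c)) (\<lambda>(h, v0). ktp H Om (k * h) (w * v0)) =
      ktp H Om (k * b) (w * \<iota> c)" if "w \<in> \<Omega>" for b c k w
    by (rule H0.lext_ktp) (auto simp: \<iota>_grade that intro!: bilin_onI lin)
  then show ?thesis
    using calc.lcoact_mult[OF v \<iota>_grade, of a]
    by (auto simp: calc.lcoact_embed lext_lext2[OF vs_fsc] ktp_HO_forms v intro!: lext_cong2)
qed

lemma cr_left:
  assumes v: "v \<in> \<Omega>"
  shows "cr (\<iota> a * v) = swe (\<Delta> a) (\<lambda>(a1, a2). swe (cr v) (\<lambda>(w, k). ktp Om H (\<iota> a1 * w) (a2 * k)))"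
proof -
  have "lext fsc (ktp (forms C 0) H (\<iota> b) c) (\<lambda>(v0, h). swe (cr v) (\<lambda>(w, k). ktp Om H (v0 * w) (h * k))) =
      swe (cr v) (\<lambda>(w, k). ktp Om H (\<iota> b * w) (c * k))" for b c
    by (rule O0.lext_ktp) (auto simp: \<iota>_grade v intro!: bilin_onI lin)
  then show ?thesis
    using calc.rcoact_mult[OF \<iota>_grade v, of a]
    by (simp add: calc.rcoact_embed lext_lext2[OF vs_fsc] ktp_OH_forms)
qed

lemma cr_right:
  assumes v: "v \<in> \<Omega>"
  shows "cr (v * \<iota> a) = swe (cr v) (\<lambda>(w, k). swe (\<Delta> a) (\<lambda>(a1, a2). ktp Om H (w * \<iota> a1) (k * a2)))"
proof -
  have "lext fsc (ktp (forms C 0) H (\<iota> b) c) (\<lambda>(v0, h). ktp Om H (w * v0) (k * h)) =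
      ktp Om H (w * \<iota> b) (k * c)" if "w \<in> \<Omega>" for b c k w
    by (rule O0.lext_ktp) (auto simp: \<iota>_grade that intro!: bilin_onI lin)
  then show ?thesis
    using calc.rcoact_mult[OF v \<iota>_grade, of a]
    by (auto simp: calc.rcoact_embed lext_lext2[OF vs_fsc] ktp_OH_forms v intro!: lext_cong2)
qed

lemma cl_\<delta>: "cl (\<delta> (\<iota> b)) = swe (\<Delta> b) (\<lambda>(b1, b2). ktp H Om b1 (\<delta> (\<iota> b2)))"
proof -
  have "lext fsc (ktp H (forms C 0) b (\<iota> c)) (\<lambda>(h, w0). ktp H Om h (\<delta> w0)) = ktp H Om b (\<delta> (\<iota> c))" for b c
    by (rule H0.lext_ktp) (auto simp: \<iota>_grade calc.diff_grade[of _ 0, folded One_nat_def] intro!: bilin_onI lin)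
  then show ?thesis
    using calc.lcoact_diff[OF \<iota>_grade, of b]
    by (simp add: calc.lcoact_embed lext_lext2[OF vs_fsc] ktp_HO_forms)
qed

lemma cr_\<delta>: "cr (\<delta> (\<iota> b)) = swe (\<Delta> b) (\<lambda>(b1, b2). ktp Om H (\<delta> (\<iota> b1)) b2)"
proof -
  have "lext fsc (ktp (forms C 0) H (\<iota> b) c) (\<lambda>(w0, h). ktp Om H (\<delta> w0) h) = ktp Om H (\<delta> (\<iota> b)) c" for b c
    by (rule O0.lext_ktp) (auto simp: \<iota>_grade calc.diff_grade[of _ 0, folded One_nat_def] intro!: bilin_onI lin)
  then show ?thesis
    using calc.rcoact_diff[OF \<iota>_grade, of b]
    by (simp add: calc.rcoact_embed lext_lext2[OF vs_fsc] ktp_OH_forms)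
qed

definition "lco = {m \<in> \<Omega>. cl m = ktp H Om 1 m}"
definition "rco = {n \<in> \<Omega>. cr n = ktp Om H n 1}"

lemma lco_\<Omega> [simp]: "m \<in> lco \<Longrightarrow> m \<in> \<Omega>" and rco_\<Omega> [simp]: "m \<in> rco \<Longrightarrow> m \<in> \<Omega>"
  and cl_lco: "m \<in> lco \<Longrightarrow> cl m = ktp H Om 1 m" and cr_rco: "m \<in> rco \<Longrightarrow> cr m = ktp Om H m 1"
  unfolding lco_def rco_def by blast+

lemma lcoI:
  assumes f: "\<And>a b. f a b \<in> \<Omega>"
    and eq: "swe p (\<lambda>(a, b). cl (f a b)) = swe p (\<lambda>(a, b). ktp H Om 1 (f a b))"
  shows "lext sC p (case_prod f) \<in> lco"
proof -
  have lin1: "lin_on \<Omega> sC fsc (\<lambda>x. ktp H Om 1 x)"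
    by (intro lin)
  have 1: "cl (lext sC p (case_prod f)) = swe p (\<lambda>(a, b). cl (f a b))"
    by (rule lin_on_lext_apply2[OF vs_C vs_fsc \<Omega>_subspace cl_lin]) (rule f)
  have 2: "ktp H Om 1 (lext sC p (case_prod f)) = swe p (\<lambda>(a, b). ktp H Om 1 (f a b))"
    by (rule lin_on_lext_apply2[OF vs_C vs_fsc \<Omega>_subspace lin1]) (rule f)
  show ?thesis
    unfolding lco_def by (rule CollectI, rule conjI, rule \<Omega>_lext, rule f) (simp only: 1 2 eq)
qed

lemma rcoI:
  assumes f: "\<And>a b. f a b \<in> \<Omega>"
    and eq: "swe p (\<lambda>(a, b). cr (f a b)) = swe p (\<lambda>(a, b). ktp Om H (f a b) 1)"
  shows "lext sC p (case_prod f) \<in> rco"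
proof -
  have lin1: "lin_on \<Omega> sC fsc (\<lambda>x. ktp Om H x 1)"
    by (intro lin)
  have 1: "cr (lext sC p (case_prod f)) = swe p (\<lambda>(a, b). cr (f a b))"
    by (rule lin_on_lext_apply2[OF vs_C vs_fsc \<Omega>_subspace cr_lin]) (rule f)
  have 2: "ktp Om H (lext sC p (case_prod f)) 1 = swe p (\<lambda>(a, b). ktp Om H (f a b) 1)"
    by (rule lin_on_lext_apply2[OF vs_C vs_fsc \<Omega>_subspace lin1]) (rule f)
  show ?thesis
    unfolding rco_def by (rule CollectI, rule conjI, rule \<Omega>_lext, rule f) (simp only: 1 2 eq)
qed

lemma cl_lco_left:
  assumes m: "m \<in> lco"
  shows "cl (\<iota> a * m) = swe (\<Delta> a) (\<lambda>(a1, a2). ktp H Om a1 (\<iota> a2 * m))"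
proof -
  have "lext fsc (ktp H Om 1 m) (\<lambda>(k, w). ktp H Om (b * k) (\<iota> c * w)) = ktp H Om (b * 1) (\<iota> c * m)" for b c
    by (rule lext_HO) (auto simp: m intro!: bilin_onI lin)
  then show ?thesis by (simp add: cl_left cl_lco m)
qed

lemma cl_lco_right:
  assumes m: "m \<in> lco"
  shows "cl (m * \<iota> a) = swe (\<Delta> a) (\<lambda>(a1, a2). ktp H Om a1 (m * \<iota> a2))"
proof -
  have "lext fsc (ktp H Om 1 m) (\<lambda>(k, w). swe (\<Delta> a) (\<lambda>(a1, a2). ktp H Om (k * a1) (w * \<iota> a2))) =
      swe (\<Delta> a) (\<lambda>(a1, a2). ktp H Om (1 * a1) (m * \<iota> a2))"
    by (rule lext_HO) (auto simp: m intro!: bilin_onI lin)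
  then show ?thesis by (simp add: cl_right cl_lco m)
qed

lemma cr_rco_left:
  assumes m: "m \<in> rco"
  shows "cr (\<iota> a * m) = swe (\<Delta> a) (\<lambda>(a1, a2). ktp Om H (\<iota> a1 * m) a2)"
proof -
  have "lext fsc (ktp Om H m 1) (\<lambda>(w, k). ktp Om H (\<iota> b * w) (c * k)) = ktp Om H (\<iota> b * m) (c * 1)" for b c
    by (rule lext_OH) (auto simp: m intro!: bilin_onI lin)
  then show ?thesis by (simp add: cr_left cr_rco m)
qed

lemma cr_rco_right:
  assumes m: "m \<in> rco"
  shows "cr (m * \<iota> a) = swe (\<Delta> a) (\<lambda>(a1, a2). ktp Om H (m * \<iota> a1) a2)"
proof -
  have "lext fsc (ktp Om H m 1) (\<lambda>(w, k). swe (\<Delta> a) (\<lambda>(a1, a2). ktp Om H (w * \<iota> a1) (k * a2))) =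
      swe (\<Delta> a) (\<lambda>(a1, a2). ktp Om H (m * \<iota> a1) (1 * a2))"
    by (rule lext_OH) (auto simp: m intro!: bilin_onI lin)
  then show ?thesis by (simp add: cr_right cr_rco m)
qed

lemma lco_\<delta>: "lext sC (\<Delta> b) (\<lambda>(b1, b2). \<iota> (S b1) * \<delta> (\<iota> b2)) \<in> lco"
proof (rule lcoI)
  have "swe (\<Delta> b) (\<lambda>(b1, b2). cl (\<iota> (S b1) * \<delta> (\<iota> b2))) = swe (\<Delta> b) (\<lambda>(b1, b2).
     swe (\<Delta> (S b1)) (\<lambda>(p, q). swe (\<Delta> b2) (\<lambda>(x, y). ktp H Om (p * x) (\<iota> q * \<delta> (\<iota> y)))))"
    by (auto simp: cl_left cl_\<delta> lext_lext2[OF vs_fsc] intro!: lext_cong2 lext_HO bilin_onI lin)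
  also have "\<dots> = swe (\<Delta> b) (\<lambda>(b1, b2).
     swe (\<Delta> b1) (\<lambda>(u, v). swe (\<Delta> b2) (\<lambda>(x, y). ktp H Om (S v * x) (\<iota> (S u) * \<delta> (\<iota> y)))))"
    by (auto intro!: lext_cong2 lext_\<Delta>_S bilin_onI lin)
  also have "\<dots> = swe (\<Delta> b) (\<lambda>(b1, b2). ktp H Om 1 (\<iota> (S b1) * \<delta> (\<iota> b2)))"
    by (rule cancel_mid[OF cancels_S_left]) (auto intro!: lin)
  finally show "swe (\<Delta> b) (\<lambda>(b1, b2). cl (\<iota> (S b1) * \<delta> (\<iota> b2))) =
    swe (\<Delta> b) (\<lambda>(b1, b2). ktp H Om 1 (\<iota> (S b1) * \<delta> (\<iota> b2)))" .
qed simp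

lemma lco_ad:
  assumes m: "m \<in> lco"
  shows "lext sC (\<Delta> a) (\<lambda>(a1, a2). \<iota> a2 * m * \<iota> (T a1)) \<in> lco"
proof (rule lcoI)
  have "swe (\<Delta> a) (\<lambda>(a1, a2). cl (\<iota> a2 * m * \<iota> (T a1))) = swe (\<Delta> a) (\<lambda>(a1, a2).
     swe (\<Delta> a2) (\<lambda>(x, y). swe (\<Delta> (T a1)) (\<lambda>(p, q). ktp H Om (x * p) (\<iota> y * m * \<iota> q))))"
    by (auto simp: cl_right cl_lco_left m lext_lext2[OF vs_fsc] intro!: lext_cong2 lext_HO bilin_onI lin)
  also have "\<dots> = swe (\<Delta> a) (\<lambda>(a1, a2).
     swe (\<Delta> (T a1)) (\<lambda>(p, q). swe (\<Delta> a2) (\<lambda>(x, y). ktp H Om (x * p) (\<iota> y * m * \<iota> q))))"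
    by (intro lext_cong2 lext_swap2 vs_fsc)
  also have "\<dots> = swe (\<Delta> a) (\<lambda>(a1, a2).
     swe (\<Delta> a1) (\<lambda>(u, v). swe (\<Delta> a2) (\<lambda>(x, y). ktp H Om (x * T v) (\<iota> y * m * \<iota> (T u)))))"
    using m by (auto intro!: lext_cong2 lext_\<Delta>_T bilin_onI lin)
  also have "\<dots> = swe (\<Delta> a) (\<lambda>(a1, a2). ktp H Om 1 (\<iota> a2 * m * \<iota> (T a1)))"
    using m by (intro cancel_mid[OF cancels_T(2)]) (auto intro!: lin)
  finally show "swe (\<Delta> a) (\<lambda>(a1, a2). cl (\<iota> a2 * m * \<iota> (T a1))) =
    swe (\<Delta> a) (\<lambda>(a1, a2). ktp H Om 1 (\<iota> a2 * m * \<iota> (T a1)))" .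
qed (use m in simp)

lemma rco_\<delta>: "lext sC (\<Delta> b) (\<lambda>(b1, b2). \<delta> (\<iota> b1) * \<iota> (S b2)) \<in> rco"
proof (rule rcoI)
  have "swe (\<Delta> b) (\<lambda>(b1, b2). cr (\<delta> (\<iota> b1) * \<iota> (S b2))) = swe (\<Delta> b) (\<lambda>(b1, b2).
     swe (\<Delta> b1) (\<lambda>(u, v). swe (\<Delta> (S b2)) (\<lambda>(p, q). ktp Om H (\<delta> (\<iota> u) * \<iota> p) (v * q))))"
    by (auto simp: cr_right cr_\<delta> lext_lext2[OF vs_fsc] intro!: lext_cong2 lext_OH bilin_onI lin)
  also have "\<dots> = swe (\<Delta> b) (\<lambda>(b1, b2).
     swe (\<Delta> b1) (\<lambda>(u, v). swe (\<Delta> b2) (\<lambda>(x, y). ktp Om H (\<delta> (\<iota> u) * \<iota> (S y)) (v * S x))))"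
    by (auto intro!: lext_cong2 lext_\<Delta>_S bilin_onI lin)
  also have "\<dots> = swe (\<Delta> b) (\<lambda>(b1, b2). ktp Om H (\<delta> (\<iota> b1) * \<iota> (S b2)) 1)"
    by (rule cancel_mid[OF cancels_S_right]) (auto intro!: lin)
  finally show "swe (\<Delta> b) (\<lambda>(b1, b2). cr (\<delta> (\<iota> b1) * \<iota> (S b2))) =
    swe (\<Delta> b) (\<lambda>(b1, b2). ktp Om H (\<delta> (\<iota> b1) * \<iota> (S b2)) 1)" .
qed simp

lemma rco_ad:
  assumes n: "n \<in> rco"
  shows "lext sC (\<Delta> a) (\<lambda>(a1, a2). \<iota> a1 * n * \<iota> (S a2)) \<in> rco"
proof (rule rcoI)
  have "swe (\<Delta> a) (\<lambda>(a1, a2). cr (\<iota> a1 * n * \<iota> (S a2))) = swe (\<Delta> a) (\<lambda>(b1, b2).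
     swe (\<Delta> b1) (\<lambda>(u, v). swe (\<Delta> (S b2)) (\<lambda>(p, q). ktp Om H (\<iota> u * n * \<iota> p) (v * q))))"
    by (auto simp: cr_right cr_rco_left n lext_lext2[OF vs_fsc] intro!: lext_cong2 lext_OH bilin_onI lin)
  also have "\<dots> = swe (\<Delta> a) (\<lambda>(b1, b2).
     swe (\<Delta> b1) (\<lambda>(u, v). swe (\<Delta> b2) (\<lambda>(x, y). ktp Om H (\<iota> u * n * \<iota> (S y)) (v * S x))))"
    using n by (auto intro!: lext_cong2 lext_\<Delta>_S bilin_onI lin)
  also have "\<dots> = swe (\<Delta> a) (\<lambda>(b1, b2). ktp Om H (\<iota> b1 * n * \<iota> (S b2)) 1)"
    using n by (intro cancel_mid[OF cancels_S_right]) (auto intro!: lin)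
  finally show "swe (\<Delta> a) (\<lambda>(a1, a2). cr (\<iota> a1 * n * \<iota> (S a2))) =
    swe (\<Delta> a) (\<lambda>(a1, a2). ktp Om H (\<iota> a1 * n * \<iota> (S a2)) 1)" .
qed (use n in simp)

lemma rco_ad':
  assumes n: "n \<in> rco"
  shows "lext sC (\<Delta> a) (\<lambda>(a1, a2). \<iota> (T a2) * n * \<iota> a1) \<in> rco"
proof (rule rcoI)
  have "swe (\<Delta> a) (\<lambda>(a1, a2). cr (\<iota> (T a2) * n * \<iota> a1)) = swe (\<Delta> a) (\<lambda>(b1, b2).
     swe (\<Delta> (T b2)) (\<lambda>(p, q). swe (\<Delta> b1) (\<lambda>(u, v). ktp Om H (\<iota> p * n * \<iota> u) (q * v))))"
    by (auto simp: cr_right cr_rco_left n lext_lext2[OF vs_fsc] intro!: lext_cong2 lext_OH bilin_onI lin)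
  also have "\<dots> = swe (\<Delta> a) (\<lambda>(b1, b2).
     swe (\<Delta> b1) (\<lambda>(u, v). swe (\<Delta> (T b2)) (\<lambda>(p, q). ktp Om H (\<iota> p * n * \<iota> u) (q * v))))"
    by (intro lext_cong2 lext_swap2 vs_fsc)
  also have "\<dots> = swe (\<Delta> a) (\<lambda>(b1, b2).
     swe (\<Delta> b1) (\<lambda>(u, v). swe (\<Delta> b2) (\<lambda>(x, y). ktp Om H (\<iota> (T y) * n * \<iota> u) (T x * v))))"
    using n by (auto intro!: lext_cong2 lext_\<Delta>_T bilin_onI lin)
  also have "\<dots> = swe (\<Delta> a) (\<lambda>(b1, b2). ktp Om H (\<iota> (T b2) * n * \<iota> b1) 1)"
    using n by (intro cancel_mid[OF cancels_T(1)]) (auto intro!: lin)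
  finally show "swe (\<Delta> a) (\<lambda>(a1, a2). cr (\<iota> (T a2) * n * \<iota> a1)) =
    swe (\<Delta> a) (\<lambda>(a1, a2). ktp Om H (\<iota> (T a2) * n * \<iota> a1) 1)" .
qed (use n in simp)

lemma one_form_decomp:
  "\<delta> (\<iota> b) = lext sC (\<Delta> b) (\<lambda>(b1, b'). \<iota> b1 * lext sC (\<Delta> b') (\<lambda>(b2, b3). \<iota> (S b2) * \<delta> (\<iota> b3)))"
  "\<delta> (\<iota> b) = lext sC (\<Delta> b) (\<lambda>(b', b3). lext sC (\<Delta> b') (\<lambda>(b1, b2). \<delta> (\<iota> b1) * \<iota> (S b2)) * \<iota> b3)"
  "\<iota> a * m = lext sC (\<Delta> a) (\<lambda>(a1, a'). lext sC (\<Delta> a') (\<lambda>(a2, a3). \<iota> a3 * m * \<iota> (T a2)) * \<iota> a1)"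
  "\<iota> a * m = lext sC (\<Delta> a) (\<lambda>(a', a3). lext sC (\<Delta> a') (\<lambda>(a1, a2). \<iota> a1 * m * \<iota> (S a2)) * \<iota> a3)"
  "m * \<iota> a = lext sC (\<Delta> a) (\<lambda>(a', a3). \<iota> a3 * lext sC (\<Delta> a') (\<lambda>(a1, a2). \<iota> (T a2) * m * \<iota> a1))"
proof -
  have L: "x * lext sC p (case_prod f) = lext sC p (\<lambda>(u, v). x * f u v)" for x p f
    by (rule lin_on_lext_apply2[OF vs_C vs_C, of UNIV "\<lambda>y. x * y"]) (auto intro!: lin)
  have R: "lext sC p (case_prod f) * x = lext sC p (\<lambda>(u, v). f u v * x)" for x p f
    by (rule lin_on_lext_apply2[OF vs_C vs_C, of UNIV "\<lambda>y. y * x"]) (auto intro!: lin)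
  have "lext sC (\<Delta> b) (\<lambda>(b1, b'). lext sC (\<Delta> b') (\<lambda>(b2, b3). \<iota> b1 * (\<iota> (S b2) * \<delta> (\<iota> b3)))) =
     lext sC (\<Delta> b) (\<lambda>(b', b3). lext sC (\<Delta> b') (\<lambda>(b1, b2). \<iota> b1 * (\<iota> (S b2) * \<delta> (\<iota> b3))))"
    by (rule coassoc[symmetric]) (intro lin)+
  also have "\<dots> = \<delta> (\<iota> b)"
    using cancel_left[OF cancels_S_right vs_C, of "\<lambda>x y. \<iota> x * \<delta> (\<iota> y)" b]
    by (simp add: lin calc.embed_hom mult.assoc)
  finally show "\<delta> (\<iota> b) = lext sC (\<Delta> b) (\<lambda>(b1, b'). \<iota> b1 * lext sC (\<Delta> b') (\<lambda>(b2, b3). \<iota> (S b2) * \<delta> (\<iota> b3)))"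
    by (simp add: L)
  have "lext sC (\<Delta> b) (\<lambda>(b', b3). lext sC (\<Delta> b') (\<lambda>(b1, b2). \<delta> (\<iota> b1) * \<iota> (S b2) * \<iota> b3)) =
     lext sC (\<Delta> b) (\<lambda>(b1, b'). lext sC (\<Delta> b') (\<lambda>(b2, b3). \<delta> (\<iota> b1) * \<iota> (S b2) * \<iota> b3))"
    by (rule coassoc) (intro lin)+
  also have "\<dots> = \<delta> (\<iota> b)"
    using cancel_right[OF cancels_S_left vs_C, of "\<lambda>x y. \<delta> (\<iota> x) * \<iota> y" b]
    by (simp add: lin calc.embed_hom mult.assoc)
  finally show "\<delta> (\<iota> b) = lext sC (\<Delta> b) (\<lambda>(b', b3). lext sC (\<Delta> b') (\<lambda>(b1, b2). \<delta> (\<iota> b1) * \<iota> (S b2)) * \<iota> b3)"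
    by (simp add: R)
  have "lext sC (\<Delta> a) (\<lambda>(a1, a'). lext sC (\<Delta> a') (\<lambda>(a2, a3). \<iota> a3 * m * \<iota> (T a2) * \<iota> a1)) =
     lext sC (\<Delta> a) (\<lambda>(a', a3). lext sC (\<Delta> a') (\<lambda>(a1, a2). \<iota> a3 * m * \<iota> (T a2) * \<iota> a1))"
    by (rule coassoc[symmetric]) (intro lin)+
  also have "\<dots> = \<iota> a * m"
    using cancel_left[OF cancels_T(1) vs_C, of "\<lambda>x y. \<iota> y * m * \<iota> x" a]
    by (simp add: lin calc.embed_hom mult.assoc)
  finally show "\<iota> a * m = lext sC (\<Delta> a) (\<lambda>(a1, a'). lext sC (\<Delta> a') (\<lambda>(a2, a3). \<iota> a3 * m * \<iota> (T a2)) * \<iota> a1)"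
    by (simp add: R)
  have "lext sC (\<Delta> a) (\<lambda>(a', a3). lext sC (\<Delta> a') (\<lambda>(a1, a2). \<iota> a1 * m * \<iota> (S a2) * \<iota> a3)) =
     lext sC (\<Delta> a) (\<lambda>(a1, a'). lext sC (\<Delta> a') (\<lambda>(a2, a3). \<iota> a1 * m * \<iota> (S a2) * \<iota> a3))"
    by (rule coassoc) (intro lin)+
  also have "\<dots> = \<iota> a * m"
    using cancel_right[OF cancels_S_left vs_C, of "\<lambda>x y. \<iota> x * m * \<iota> y" a]
    by (simp add: lin calc.embed_hom mult.assoc)
  finally show "\<iota> a * m = lext sC (\<Delta> a) (\<lambda>(a', a3). lext sC (\<Delta> a') (\<lambda>(a1, a2). \<iota> a1 * m * \<iota> (S a2)) * \<iota> a3)"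
    by (simp add: R)
  have "lext sC (\<Delta> a) (\<lambda>(a', a3). lext sC (\<Delta> a') (\<lambda>(a1, a2). \<iota> a3 * (\<iota> (T a2) * m * \<iota> a1))) =
     lext sC (\<Delta> a) (\<lambda>(a1, a'). lext sC (\<Delta> a') (\<lambda>(a2, a3). \<iota> a3 * (\<iota> (T a2) * m * \<iota> a1)))"
    by (rule coassoc) (intro lin)+
  also have "\<dots> = m * \<iota> a"
    using cancel_right[OF cancels_T(2) vs_C, of "\<lambda>x y. \<iota> y * m * \<iota> x" a]
    by (simp add: lin calc.embed_hom mult.assoc)
  finally show "m * \<iota> a = lext sC (\<Delta> a) (\<lambda>(a', a3). \<iota> a3 * lext sC (\<Delta> a') (\<lambda>(a1, a2). \<iota> (T a2) * m * \<iota> a1))"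
    by (simp add: L)
qed

definition "gen_HL = {\<iota> a * m | a m. m \<in> lco}"
definition "gen_LH = {m * \<iota> a | a m. m \<in> lco}"
definition "gen_HR = {\<iota> a * m | a m. m \<in> rco}"
definition "gen_RH = {m * \<iota> a | a m. m \<in> rco}"

lemma gen_intros:
  "m \<in> lco \<Longrightarrow> \<iota> a * m \<in> gen_HL" "m \<in> lco \<Longrightarrow> m * \<iota> a \<in> gen_LH"
  "m \<in> rco \<Longrightarrow> \<iota> a * m \<in> gen_HR" "m \<in> rco \<Longrightarrow> m * \<iota> a \<in> gen_RH"
  unfolding gen_HL_def gen_LH_def gen_HR_def gen_RH_def by blast+

lemma lext_span: "(\<And>x y. f x y \<in> vC.span X) \<Longrightarrow> lext sC p (case_prod f) \<in> vC.span X"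
  by (rule lext_in_subspace[OF vs_C vC.subspace_span]) auto

lemma \<Omega>_span: "\<Omega> = vC.span {\<iota> a * \<delta> (\<iota> b) | a b. True}"
proof -
  have "{\<iota> a * prod_list (map (\<lambda>b. \<delta> (\<iota> b)) bs) | a bs. length bs = 1} = {\<iota> a * \<delta> (\<iota> b) | a b. True}"
    (is "?A = ?B")
  proof (intro equalityI subsetI)
    fix x assume "x \<in> ?A"
    then obtain a bs where x: "x = \<iota> a * prod_list (map (\<lambda>b. \<delta> (\<iota> b)) bs)" and "length bs = 1" by blast
    then obtain b where "bs = [b]" using length_Suc_conv[of bs 0, folded One_nat_def] by auto
    with x show "x \<in> ?B" by auto
  next
    fix x assume "x \<in> ?B"
    then obtain a b where "x = \<iota> a * prod_list (map (\<lambda>b. \<delta> (\<iota> b)) [b])" "length [b] = 1" by auto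
    then show "x \<in> ?A" by blast
  qed
  then show ?thesis using calc.grade_span[of 1] by simp
qed

lemma span_subset: "Y \<subseteq> vC.span X \<Longrightarrow> vC.span Y \<subseteq> vC.span X"
  by (rule vC.span_minimal[OF _ vC.subspace_span])

lemma \<Omega>_HL: "\<Omega> \<subseteq> vC.span gen_HL"
  unfolding \<Omega>_span
proof (rule span_subset, safe)
  fix a b
  have "\<iota> a * \<delta> (\<iota> b) = lext sC (\<Delta> b) (\<lambda>(b1, b'). \<iota> (a * b1) * lext sC (\<Delta> b') (\<lambda>(b2, b3). \<iota> (S b2) * \<delta> (\<iota> b3)))"
    by (subst one_form_decomp(1), subst lin_on_lext_apply2[OF vs_C vs_C, of UNIV "\<lambda>y. \<iota> a * y"])
      (auto intro!: lin simp: calc.embed_hom mult.assoc)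
  also have "\<dots> \<in> vC.span gen_HL"
    by (intro lext_span vC.span_base gen_intros lco_\<delta>)
  finally show "\<iota> a * \<delta> (\<iota> b) \<in> vC.span gen_HL" .
qed

lemma \<Omega>_LH: "\<Omega> \<subseteq> vC.span gen_LH"
proof (rule order_trans[OF \<Omega>_HL span_subset], rule subsetI)
  fix x assume "x \<in> gen_HL"
  then obtain a m where "x = \<iota> a * m" "m \<in> lco" unfolding gen_HL_def by blast
  then show "x \<in> vC.span gen_LH"
    by (simp only: one_form_decomp(3)[of a m]) (intro lext_span vC.span_base gen_intros lco_ad)
qed

lemma gen_HR_RH: "gen_HR \<subseteq> vC.span gen_RH"
proof
  fix x assume "x \<in> gen_HR"
  then obtain a m where "x = \<iota> a * m" "m \<in> rco" unfolding gen_HR_def by blast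
  then show "x \<in> vC.span gen_RH"
    by (simp only: one_form_decomp(4)[of a m]) (intro lext_span vC.span_base gen_intros rco_ad)
qed

lemma \<Omega>_RH: "\<Omega> \<subseteq> vC.span gen_RH"
  unfolding \<Omega>_span
proof (rule span_subset, safe)
  fix a b
  have "\<iota> a * \<delta> (\<iota> b) = lext sC (\<Delta> b) (\<lambda>(b', b3). (\<iota> a * lext sC (\<Delta> b') (\<lambda>(b1, b2). \<delta> (\<iota> b1) * \<iota> (S b2))) * \<iota> b3)"
    by (subst one_form_decomp(2), subst lin_on_lext_apply2[OF vs_C vs_C, of UNIV "\<lambda>y. \<iota> a * y"])
      (auto intro!: lin simp: mult.assoc)
  also have "\<dots> \<in> vC.span gen_RH"
  proof (rule lext_span)
    fix b' b3
    have "x * \<iota> b3 \<in> vC.span gen_RH" if "x \<in> vC.span gen_RH" for x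
      using that
    proof (induction rule: vC.span_induct_alt)
      case (step c x y)
      have "x * \<iota> b3 \<in> gen_RH"
      proof -
        obtain a m where "x = m * \<iota> a" "m \<in> rco" using step(1) unfolding gen_RH_def by blast
        then show ?thesis using gen_intros(4)[of m "a * b3"] by (simp only: calc.embed_hom mult.assoc)
      qed
      then have "sC c (x * \<iota> b3) + y * \<iota> b3 \<in> vC.span gen_RH"
        by (intro vC.span_add vC.span_scale vC.span_base step(2))
      then show ?case by (simp add: distrib_right calc.scale_mult)
    qed (simp add: vC.span_zero)
    moreover have "\<iota> a * lext sC (\<Delta> b') (\<lambda>(b1, b2). \<delta> (\<iota> b1) * \<iota> (S b2)) \<in> vC.span gen_RH"
      by (rule subsetD[OF gen_HR_RH]) (intro gen_intros rco_\<delta>)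
    ultimately show "(\<iota> a * lext sC (\<Delta> b') (\<lambda>(b1, b2). \<delta> (\<iota> b1) * \<iota> (S b2))) * \<iota> b3 \<in> vC.span gen_RH" .
  qed
  finally show "\<iota> a * \<delta> (\<iota> b) \<in> vC.span gen_RH" .
qed

lemma \<Omega>_HR: "\<Omega> \<subseteq> vC.span gen_HR"
proof (rule order_trans[OF \<Omega>_RH span_subset], rule subsetI)
  fix x assume "x \<in> gen_RH"
  then obtain a m where "x = m * \<iota> a" "m \<in> rco" unfolding gen_RH_def by blast
  then show "x \<in> vC.span gen_HR"
    by (simp only: one_form_decomp(5)[of m a]) (intro lext_span vC.span_base gen_intros rco_ad')
qed

lemma lco_0 [simp]: "0 \<in> lco" and rco_0 [simp]: "0 \<in> rco"
  using lcoI[of "\<lambda>_ _. 0" 0] rcoI[of "\<lambda>_ _. 0" 0] by (simp_all add: lext_def)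

lemma span_induct_gen:
  assumes w: "w \<in> vC.span X" and X: "\<And>c x. x \<in> X \<Longrightarrow> sC c x \<in> X" "0 \<in> X" "X \<subseteq> \<Omega>"
    and P: "\<And>x. x \<in> X \<Longrightarrow> P x" and add: "\<And>x y. x \<in> \<Omega> \<Longrightarrow> y \<in> \<Omega> \<Longrightarrow> P x \<Longrightarrow> P y \<Longrightarrow> P (x + y)"
  shows "P w"
proof -
  have "w \<in> \<Omega> \<and> P w"
    using w by (induction rule: vC.span_induct_alt) (use X P add in auto)
  then show ?thesis ..
qed

lemma \<Omega>_cases:
  assumes w: "w \<in> \<Omega>" and add: "\<And>x y. x \<in> \<Omega> \<Longrightarrow> y \<in> \<Omega> \<Longrightarrow> P x \<Longrightarrow> P y \<Longrightarrow> P (x + y)"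
  shows \<Omega>_induct_HL [consumes 1, case_names add gen]: "(\<And>a m. m \<in> lco \<Longrightarrow> P (\<iota> a * m)) \<Longrightarrow> P w"
    and \<Omega>_induct_LH [consumes 1, case_names add gen]: "(\<And>a m. m \<in> lco \<Longrightarrow> P (m * \<iota> a)) \<Longrightarrow> P w"
    and \<Omega>_induct_HR [consumes 1, case_names add gen]: "(\<And>a m. m \<in> rco \<Longrightarrow> P (\<iota> a * m)) \<Longrightarrow> P w"
    and \<Omega>_induct_RH [consumes 1, case_names add gen]: "(\<And>a m. m \<in> rco \<Longrightarrow> P (m * \<iota> a)) \<Longrightarrow> P w"
proof -
  have sl: "sC c (\<iota> a * m) = \<iota> (sH c a) * m" "sC c (m * \<iota> a) = m * \<iota> (sH c a)" for a c m
    by (simp_all add: calc.embed_hom calc.scale_mult)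
  have HL: "x \<in> gen_HL \<Longrightarrow> sC c x \<in> gen_HL" "0 \<in> gen_HL" "gen_HL \<subseteq> \<Omega>" for x c
  proof -
    show "sC c x \<in> gen_HL" if "x \<in> gen_HL"
      using that unfolding gen_HL_def mem_Collect_eq by (metis sl(1))
    show "0 \<in> gen_HL" unfolding gen_HL_def mem_Collect_eq
      by (rule exI[of _ 0], rule exI[of _ 0]) simp
  qed (auto simp: gen_HL_def)
  have LH: "x \<in> gen_LH \<Longrightarrow> sC c x \<in> gen_LH" "0 \<in> gen_LH" "gen_LH \<subseteq> \<Omega>" for x c
  proof -
    show "sC c x \<in> gen_LH" if "x \<in> gen_LH"
      using that unfolding gen_LH_def mem_Collect_eq by (metis sl(2))
    show "0 \<in> gen_LH" unfolding gen_LH_def mem_Collect_eq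
      by (rule exI[of _ 0], rule exI[of _ 0]) simp
  qed (auto simp: gen_LH_def)
  have HR: "x \<in> gen_HR \<Longrightarrow> sC c x \<in> gen_HR" "0 \<in> gen_HR" "gen_HR \<subseteq> \<Omega>" for x c
  proof -
    show "sC c x \<in> gen_HR" if "x \<in> gen_HR"
      using that unfolding gen_HR_def mem_Collect_eq by (metis sl(1))
    show "0 \<in> gen_HR" unfolding gen_HR_def mem_Collect_eq
      by (rule exI[of _ 0], rule exI[of _ 0]) simp
  qed (auto simp: gen_HR_def)
  have RH: "x \<in> gen_RH \<Longrightarrow> sC c x \<in> gen_RH" "0 \<in> gen_RH" "gen_RH \<subseteq> \<Omega>" for x c
  proof -
    show "sC c x \<in> gen_RH" if "x \<in> gen_RH"
      using that unfolding gen_RH_def mem_Collect_eq by (metis sl(2))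
    show "0 \<in> gen_RH" unfolding gen_RH_def mem_Collect_eq
      by (rule exI[of _ 0], rule exI[of _ 0]) simp
  qed (auto simp: gen_RH_def)
  show "P w" if P: "\<And>a m. m \<in> lco \<Longrightarrow> P (\<iota> a * m)"
  proof (rule span_induct_gen[OF subsetD[OF \<Omega>_HL w] HL, of P])
    show "P x" if "x \<in> gen_HL" for x using that P unfolding gen_HL_def by blast
  qed (auto intro: add)
  show "P w" if P: "\<And>a m. m \<in> lco \<Longrightarrow> P (m * \<iota> a)"
  proof (rule span_induct_gen[OF subsetD[OF \<Omega>_LH w] LH, of P])
    show "P x" if "x \<in> gen_LH" for x using that P unfolding gen_LH_def by blast
  qed (auto intro: add)
  show "P w" if P: "\<And>a m. m \<in> rco \<Longrightarrow> P (\<iota> a * m)"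
  proof (rule span_induct_gen[OF subsetD[OF \<Omega>_HR w] HR, of P])
    show "P x" if "x \<in> gen_HR" for x using that P unfolding gen_HR_def by blast
  qed (auto intro: add)
  show "P w" if P: "\<And>a m. m \<in> rco \<Longrightarrow> P (m * \<iota> a)"
  proof (rule span_induct_gen[OF subsetD[OF \<Omega>_RH w] RH, of P])
    show "P x" if "x \<in> gen_RH" for x using that P unfolding gen_RH_def by blast
  qed (auto intro: add)
qed

end

section \<open>The Woronowicz braiding on one-forms\<close>

context hopf_calculus
begin

abbreviation "W2 \<equiv> tens H Om Om"
abbreviation "W3 \<equiv> tens H W2 Om"
abbreviation tensor2 (infixl "\<otimes>" 70) where "x \<otimes> y \<equiv> htp Om Om x y"
abbreviation tensor3 (infixl "\<odot>" 70) where "t \<odot> z \<equiv> htp W2 Om t z"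
abbreviation "attch \<equiv> attach H C"
abbreviation "\<sigma> \<equiv> braid H Om Om"

sublocale OO: hbimodule_pair H Om Om ..
sublocale W2: hbimodule H W2 by (rule OO.tens_hbimodule)
sublocale WO: hbimodule_pair H W2 Om ..
sublocale W3: hbimodule H W3 by (rule WO.tens_hbimodule)

lemma sc_W [simp]: "sc (tens H M N) = fsc" by (simp add: tens_def)

lemmas W2_closed [simp] = OO.htp_in[where H=H] W2.lact_closed W2.ract_closed W2.add_closed W2.diff_closed
  W2.zero_closed W2.scale_closed[unfolded sc_W]
lemmas W3_closed [simp] = WO.htp_in[where H=H] W3.lact_closed W3.ract_closed W3.add_closed W3.diff_closed
  W3.zero_closed W3.scale_closed[unfolded sc_W]

lemma W2_lext: "(\<And>x y. (x, y) \<in> Poly_Mapping.keys p \<Longrightarrow> f x y \<in> car W2) \<Longrightarrow> swe p (case_prod f) \<in> car W2"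
  by (rule lext_in_subspace[OF vs_fsc W2.subspace[unfolded sc_W]]) auto

lemma W3_lext: "(\<And>x y. (x, y) \<in> Poly_Mapping.keys p \<Longrightarrow> f x y \<in> car W3) \<Longrightarrow> swe p (case_prod f) \<in> car W3"
  by (rule lext_in_subspace[OF vs_fsc W3.subspace[unfolded sc_W]]) auto

lemma lin_OO1 [lin]: "lin_on A s sC f \<Longrightarrow> (\<And>x. x \<in> A \<Longrightarrow> f x \<in> \<Omega>) \<Longrightarrow> y \<in> \<Omega> \<Longrightarrow> lin_on A s fsc (\<lambda>x. f x \<otimes> y)"
  using lin_on_comp[OF OO.htp_lin1[of y], of A s f] by auto

lemma lin_OO2 [lin]: "lin_on A s sC f \<Longrightarrow> (\<And>x. x \<in> A \<Longrightarrow> f x \<in> \<Omega>) \<Longrightarrow> y \<in> \<Omega> \<Longrightarrow> lin_on A s fsc (\<lambda>x. y \<otimes> f x)"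
  using lin_on_comp[OF OO.htp_lin2[of y], of A s f] by auto

lemma lin_WO1 [lin]: "lin_on A s fsc f \<Longrightarrow> (\<And>x. x \<in> A \<Longrightarrow> f x \<in> car W2) \<Longrightarrow> y \<in> \<Omega> \<Longrightarrow> lin_on A s fsc (\<lambda>x. f x \<odot> y)"
  using lin_on_comp[OF WO.htp_lin1[of y], of A s f] by auto

lemma lin_WO2 [lin]: "lin_on A s sC f \<Longrightarrow> (\<And>x. x \<in> A \<Longrightarrow> f x \<in> \<Omega>) \<Longrightarrow> t \<in> car W2 \<Longrightarrow> lin_on A s fsc (\<lambda>x. t \<odot> f x)"
  using lin_on_comp[OF WO.htp_lin2[of t], of A s f] by auto

lemma htp_add [simp]:
  "x \<in> \<Omega> \<Longrightarrow> x' \<in> \<Omega> \<Longrightarrow> y \<in> \<Omega> \<Longrightarrow> (x + x') \<otimes> y = x \<otimes> y + x' \<otimes> y"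
  "x \<in> \<Omega> \<Longrightarrow> x' \<in> \<Omega> \<Longrightarrow> y \<in> \<Omega> \<Longrightarrow> y \<otimes> (x + x') = y \<otimes> x + y \<otimes> x'"
  "t \<in> car W2 \<Longrightarrow> t' \<in> car W2 \<Longrightarrow> y \<in> \<Omega> \<Longrightarrow> (t + t') \<odot> y = t \<odot> y + t' \<odot> y"
  "x \<in> \<Omega> \<Longrightarrow> x' \<in> \<Omega> \<Longrightarrow> t \<in> car W2 \<Longrightarrow> t \<odot> (x + x') = t \<odot> x + t \<odot> x'"
  using lin_on_add[OF OO.htp_lin1[of y]] lin_on_add[OF OO.htp_lin2[of y]]
    lin_on_add[OF WO.htp_lin1[of y]] lin_on_add[OF WO.htp_lin2[of t]] by auto

lemma htp_act [simp]:
  "x \<in> \<Omega> \<Longrightarrow> y \<in> \<Omega> \<Longrightarrow> lact W2 a (x \<otimes> y) = (\<iota> a * x) \<otimes> y"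
  "x \<in> \<Omega> \<Longrightarrow> y \<in> \<Omega> \<Longrightarrow> ract W2 (x \<otimes> y) a = x \<otimes> (y * \<iota> a)"
  "t \<in> car W2 \<Longrightarrow> y \<in> \<Omega> \<Longrightarrow> lact W3 a (t \<odot> y) = lact W2 a t \<odot> y"
  "t \<in> car W2 \<Longrightarrow> y \<in> \<Omega> \<Longrightarrow> ract W3 (t \<odot> y) a = t \<odot> (y * \<iota> a)"
  using OO.lact_htp[of x y a] OO.ract_htp[of x y a] WO.lact_htp[of t y a] WO.ract_htp[of t y a] by auto

lemma htp_bal:
  "x \<in> \<Omega> \<Longrightarrow> y \<in> \<Omega> \<Longrightarrow> (x * \<iota> a) \<otimes> y = x \<otimes> (\<iota> a * y)"
  "t \<in> car W2 \<Longrightarrow> y \<in> \<Omega> \<Longrightarrow> ract W2 t a \<odot> y = t \<odot> (\<iota> a * y)"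
  using OO.htp_bal[of x y a] WO.htp_bal[of t y a] by auto

lemma act_add [simp]:
  "lact (tens H M N) a (t + u) = lact (tens H M N) a t + lact (tens H M N) a u"
  "ract (tens H M N) (t + u) a = ract (tens H M N) t a + ract (tens H M N) u a"
  by (simp_all add: tens_def lext_add[OF vs_fsc])

lemma lin_act [lin]:
  "lin_on A s fsc f \<Longrightarrow> lin_on A s fsc (\<lambda>x. lact (tens H M N) a (f x))"
  "lin_on A s fsc f \<Longrightarrow> lin_on A s fsc (\<lambda>x. ract (tens H M N) (f x) a)"
  by (simp_all add: tens_def lin_on_lext_arg[OF vs_fsc])

lemma lin_act2 [lin]:
  "lin_on A s sH f \<Longrightarrow> t \<in> car W2 \<Longrightarrow> lin_on A s fsc (\<lambda>x. lact W2 (f x) t)"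
  "lin_on A s sH f \<Longrightarrow> t \<in> car W2 \<Longrightarrow> lin_on A s fsc (\<lambda>x. ract W2 t (f x))"
  "lin_on A s sH f \<Longrightarrow> u \<in> car W3 \<Longrightarrow> lin_on A s fsc (\<lambda>x. lact W3 (f x) u)"
  "lin_on A s sH f \<Longrightarrow> u \<in> car W3 \<Longrightarrow> lin_on A s fsc (\<lambda>x. ract W3 u (f x))"
  using lin_compU[OF W2.lact_lin1] lin_compU[OF W2.ract_lin2] lin_compU[OF W3.lact_lin1] lin_compU[OF W3.ract_lin2]
  by auto

lemma lext_OO:
  assumes "vector_space s" "x \<in> \<Omega>" "y \<in> \<Omega>" "bilin_on \<Omega> sC \<Omega> sC s F"
    and "\<And>x a y. x \<in> \<Omega> \<Longrightarrow> y \<in> \<Omega> \<Longrightarrow> F (x * \<iota> a) y = F x (\<iota> a * y)"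
  shows "lext s (x \<otimes> y) (case_prod F) = F x y"
  using assms OO.lext_htp[of s x y F] by simp

lemma lext_WO:
  assumes "vector_space s" "t \<in> car W2" "y \<in> \<Omega>" "bilin_on (car W2) fsc \<Omega> sC s F"
    and "\<And>t a y. t \<in> car W2 \<Longrightarrow> y \<in> \<Omega> \<Longrightarrow> F (ract W2 t a) y = F t (\<iota> a * y)"
  shows "lext s (t \<odot> y) (case_prod F) = F t y"
  using assms WO.lext_htp[of s t y F] by simp

lemma W2_keys [dest!]: "(x, y) \<in> Poly_Mapping.keys t \<Longrightarrow> t \<in> car W2 \<Longrightarrow> x \<in> \<Omega> \<and> y \<in> \<Omega>"
  using OO.tens_keys[of t H x y] by simp

lemma W3_keys [dest!]: "(x, y) \<in> Poly_Mapping.keys t \<Longrightarrow> t \<in> car W3 \<Longrightarrow> x \<in> car W2 \<and> y \<in> \<Omega>"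
  using WO.tens_keys[of t H x y] by simp

lemma cl_comult_left:
  assumes s [lin]: "vector_space s" and F: "bilin_on UNIV sH \<Omega> sC s F" and m: "m \<in> lco"
  shows "lext s (cl (\<iota> a * m)) (\<lambda>(h, x). lext s (\<Delta> h) (\<lambda>(h1, h2). F h1 (\<iota> (S h2) * x))) = F a m"
    and "lext s (cl (m * \<iota> c)) (\<lambda>(h, x). lext s (\<Delta> h) (\<lambda>(h1, h2). F h1 (\<iota> (S h2) * x))) =
      lext s (\<Delta> c) (\<lambda>(c1, c2). lext s (\<Delta> c1) (\<lambda>(p, q). F p (\<iota> (S q) * (m * \<iota> c2))))"
proof -
  have F1 [lin]: "lin_on A s' sH f \<Longrightarrow> y \<in> \<Omega> \<Longrightarrow> lin_on A s' s (\<lambda>x. F (f x) y)" for A s' f y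
    using lin_compU[OF bilin_onD(1)[OF F]] by blast
  have F2 [lin]: "lin_on A s' sC f \<Longrightarrow> (\<And>x. x \<in> A \<Longrightarrow> f x \<in> \<Omega>) \<Longrightarrow> lin_on A s' s (\<lambda>x. F a (f x))" for A s' f a
    using lin_on_comp[OF bilin_onD(2)[OF F]] by blast
  have L: "lext s (ktp H Om h x) (\<lambda>(h, x). lext s (\<Delta> h) (\<lambda>(h1, h2). F h1 (\<iota> (S h2) * x))) =
    lext s (\<Delta> h) (\<lambda>(h1, h2). F h1 (\<iota> (S h2) * x))" if "x \<in> \<Omega>" for h x
    by (rule lext_HO[OF s that]) (auto intro!: bilin_onI lin)
  show "lext s (cl (m * \<iota> c)) (\<lambda>(h, x). lext s (\<Delta> h) (\<lambda>(h1, h2). F h1 (\<iota> (S h2) * x))) =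
      lext s (\<Delta> c) (\<lambda>(c1, c2). lext s (\<Delta> c1) (\<lambda>(p, q). F p (\<iota> (S q) * (m * \<iota> c2))))"
    by (simp add: cl_lco_right m lext_lext2[OF s] L)
  have "lext s (cl (\<iota> a * m)) (\<lambda>(h, x). lext s (\<Delta> h) (\<lambda>(h1, h2). F h1 (\<iota> (S h2) * x))) =
      lext s (\<Delta> a) (\<lambda>(a1, a2). lext s (\<Delta> a1) (\<lambda>(p, q). F p (\<iota> (S q) * (\<iota> a2 * m))))"
    by (simp add: cl_lco_left m lext_lext2[OF s] L)
  also have "\<dots> = lext s (\<Delta> a) (\<lambda>(p, a'). lext s (\<Delta> a') (\<lambda>(q, a2). F p (\<iota> (S q) * (\<iota> a2 * m))))"
    using m by (intro coassoc) (auto intro!: lin)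
  also have "\<dots> = lext s (\<Delta> a) (\<lambda>(p, a'). lext s (\<Delta> a') (\<lambda>(q, a2). F p (\<iota> (S q * a2) * m)))"
    by (simp add: calc.embed_hom mult.assoc)
  also have "\<dots> = F a (\<iota> 1 * m)"
    using m by (intro cancel_right[OF cancels_S_left s]) (auto intro!: lin)
  finally show "lext s (cl (\<iota> a * m)) (\<lambda>(h, x). lext s (\<Delta> h) (\<lambda>(h1, h2). F h1 (\<iota> (S h2) * x))) = F a m"
    by (simp add: calc.embed_hom)
qed

lemma cr_comult_right:
  assumes s [lin]: "vector_space s" and F: "bilin_on \<Omega> sC UNIV sH s F" and n: "n \<in> rco"
  shows "lext s (cr (n * \<iota> a)) (\<lambda>(x, k). lext s (\<Delta> k) (\<lambda>(k1, k2). F (x * \<iota> (S k1)) k2)) = F n a"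
    and "lext s (cr (\<iota> c * n)) (\<lambda>(x, k). lext s (\<Delta> k) (\<lambda>(k1, k2). F (x * \<iota> (S k1)) k2)) =
      lext s (\<Delta> c) (\<lambda>(c1, c2). lext s (\<Delta> c2) (\<lambda>(p, q). F (\<iota> c1 * n * \<iota> (S p)) q))"
proof -
  have F1 [lin]: "lin_on A s' sH f \<Longrightarrow> y \<in> \<Omega> \<Longrightarrow> lin_on A s' s (\<lambda>x. F y (f x))" for A s' f y
    using lin_compU[OF bilin_onD(2)[OF F]] by blast
  have F2 [lin]: "lin_on A s' sC f \<Longrightarrow> (\<And>x. x \<in> A \<Longrightarrow> f x \<in> \<Omega>) \<Longrightarrow> lin_on A s' s (\<lambda>x. F (f x) a)" for A s' f a
    using lin_on_comp[OF bilin_onD(1)[OF F]] by blast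
  have L: "lext s (ktp Om H x k) (\<lambda>(x, k). lext s (\<Delta> k) (\<lambda>(k1, k2). F (x * \<iota> (S k1)) k2)) =
    lext s (\<Delta> k) (\<lambda>(k1, k2). F (x * \<iota> (S k1)) k2)" if "x \<in> \<Omega>" for k x
    by (rule lext_OH[OF s that]) (auto intro!: bilin_onI lin)
  show "lext s (cr (\<iota> c * n)) (\<lambda>(x, k). lext s (\<Delta> k) (\<lambda>(k1, k2). F (x * \<iota> (S k1)) k2)) =
      lext s (\<Delta> c) (\<lambda>(c1, c2). lext s (\<Delta> c2) (\<lambda>(p, q). F (\<iota> c1 * n * \<iota> (S p)) q))"
    by (simp add: cr_rco_left n lext_lext2[OF s] L)
  have "lext s (cr (n * \<iota> a)) (\<lambda>(x, k). lext s (\<Delta> k) (\<lambda>(k1, k2). F (x * \<iota> (S k1)) k2)) =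
      lext s (\<Delta> a) (\<lambda>(a1, a2). lext s (\<Delta> a2) (\<lambda>(p, q). F (n * \<iota> a1 * \<iota> (S p)) q))"
    by (simp add: cr_rco_right n lext_lext2[OF s] L)
  also have "\<dots> = lext s (\<Delta> a) (\<lambda>(a', q). lext s (\<Delta> a') (\<lambda>(a1, p). F (n * \<iota> a1 * \<iota> (S p)) q))"
    using n by (intro coassoc[symmetric]) (auto intro!: lin)
  also have "\<dots> = lext s (\<Delta> a) (\<lambda>(a', q). lext s (\<Delta> a') (\<lambda>(a1, p). F (n * \<iota> (a1 * S p)) q))"
    by (simp add: calc.embed_hom mult.assoc)
  also have "\<dots> = F (n * \<iota> 1) a"
    using n by (intro cancel_left[OF cancels_S_right s]) (auto intro!: lin)
  finally show "lext s (cr (n * \<iota> a)) (\<lambda>(x, k). lext s (\<Delta> k) (\<lambda>(k1, k2). F (x * \<iota> (S k1)) k2)) = F n a"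
    by (simp add: calc.embed_hom)
qed

definition brd :: "'w \<Rightarrow> 'w \<Rightarrow> ('w \<times> 'w \<Rightarrow>\<^sub>0 'k)" where
  "brd m n = swe (cl m) (\<lambda>(h, x). swe (\<Delta> h) (\<lambda>(h1, h2). swe (cr n) (\<lambda>(y, k). swe (\<Delta> k) (\<lambda>(k1, k2).
     (\<iota> h1 * (y * \<iota> (S k1))) \<otimes> (\<iota> (S h2) * x * \<iota> k2)))))"

lemma braid_eq_brd: "\<sigma> t = swe t (\<lambda>(m, n). brd m n)"
  by (simp add: braid_def brd_def mult.assoc)

lemma brd_bilin: "bilin_on \<Omega> sC \<Omega> sC fsc brd"
  unfolding brd_def by (auto intro!: bilin_onI lin)

lemma brd_in [simp]: "m \<in> \<Omega> \<Longrightarrow> n \<in> \<Omega> \<Longrightarrow> brd m n \<in> car W2"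
  unfolding brd_def by (auto intro!: W2_lext)

lemma brd_add [simp]:
  "x \<in> \<Omega> \<Longrightarrow> x' \<in> \<Omega> \<Longrightarrow> y \<in> \<Omega> \<Longrightarrow> brd (x + x') y = brd x y + brd x' y"
  "x \<in> \<Omega> \<Longrightarrow> x' \<in> \<Omega> \<Longrightarrow> y \<in> \<Omega> \<Longrightarrow> brd y (x + x') = brd y x + brd y x'"
  using lin_on_add[OF bilin_onD(1)[OF brd_bilin]] lin_on_add[OF bilin_onD(2)[OF brd_bilin]] by auto

lemma brd_left:
  assumes m: "m \<in> lco" and n: "n \<in> \<Omega>"
  shows "brd (\<iota> a * m) n = swe (cr n) (\<lambda>(y, k). swe (\<Delta> k) (\<lambda>(k1, k2). (\<iota> a * (y * \<iota> (S k1))) \<otimes> (m * \<iota> k2)))"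
  unfolding brd_def
  by (rule cl_comult_left(1)[OF vs_fsc _ m, where F = "\<lambda>a x. swe (cr n) (\<lambda>(y, k). swe (\<Delta> k) (\<lambda>(k1, k2). (\<iota> a * (y * \<iota> (S k1))) \<otimes> (x * \<iota> k2)))"])
    (use n in \<open>auto intro!: bilin_onI lin\<close>)

lemma brd_eq: "m \<in> lco \<Longrightarrow> n \<in> rco \<Longrightarrow> brd (\<iota> a * m) (n * \<iota> b) = (\<iota> a * n) \<otimes> (m * \<iota> b)"
  by (subst brd_left) (auto intro!: cr_comult_right(1)[where F = "\<lambda>x k. (\<iota> a * x) \<otimes> (m * \<iota> k)"] bilin_onI lin)

lemma brd_right:
  assumes n: "n \<in> rco" and x: "x \<in> \<Omega>"
  shows "brd x n = swe (cl x) (\<lambda>(h, x). swe (\<Delta> h) (\<lambda>(h1, h2). (\<iota> h1 * n) \<otimes> (\<iota> (S h2) * x)))"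
proof -
  have *: "swe (cr n) (\<lambda>(y, k). swe (\<Delta> k) (\<lambda>(k1, k2). (\<iota> a * (y * \<iota> (S k1))) \<otimes> (z * \<iota> k2))) = (\<iota> a * n) \<otimes> z"
    if z: "z \<in> \<Omega>" for a z
    using cr_comult_right(1)[OF vs_fsc _ n, where F = "\<lambda>x k. (\<iota> a * x) \<otimes> (z * \<iota> k)" and a = 1] z
    by (simp add: calc.embed_hom bilin_onI lin)
  show ?thesis unfolding brd_def
    by (intro lext_cong2 *) (use x in auto)
qed

lemma brd_lact: "x \<in> \<Omega> \<Longrightarrow> y \<in> \<Omega> \<Longrightarrow> brd (\<iota> a * x) y = lact W2 a (brd x y)"
proof (induction x rule: \<Omega>_induct_HL)
  case (gen b m)
  from gen(2,1) show ?case
  proof (induction y rule: \<Omega>_induct_RH)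
    case (gen c n)
    have "\<iota> a * (\<iota> b * m) = \<iota> (a * b) * m" by (simp add: calc.embed_hom mult.assoc)
    then show ?case using gen by (simp add: brd_eq del: mult.assoc) (simp add: calc.embed_hom mult.assoc)
  qed simp_all
qed (simp_all add: distrib_left)

lemma brd_ract: "x \<in> \<Omega> \<Longrightarrow> y \<in> \<Omega> \<Longrightarrow> brd x (y * \<iota> a) = ract W2 (brd x y) a"
proof (induction x rule: \<Omega>_induct_HL)
  case (gen b m)
  from gen(2,1) show ?case
  proof (induction y rule: \<Omega>_induct_RH)
    case (gen c n)
    have "n * \<iota> c * \<iota> a = n * \<iota> (c * a)" by (simp add: calc.embed_hom mult.assoc)
    then show ?case using gen by (simp add: brd_eq) (simp add: calc.embed_hom mult.assoc)
  qed (simp_all add: distrib_right)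
qed simp_all

lemma brd_bal_co:
  assumes m: "m \<in> lco" and n: "n \<in> rco"
  shows "brd (m * \<iota> c) n = brd m (\<iota> c * n)"
proof -
  have "brd (m * \<iota> c) n = swe (\<Delta> c) (\<lambda>(c', c3). swe (\<Delta> c') (\<lambda>(c1, c2). (\<iota> c1 * n) \<otimes> (\<iota> (S c2) * (m * \<iota> c3))))"
    using m n by (subst brd_right) (auto intro!: cl_comult_left(2)[where F = "\<lambda>h x. (\<iota> h * n) \<otimes> x"] bilin_onI lin)
  also have "\<dots> = swe (\<Delta> c) (\<lambda>(c1, c'). swe (\<Delta> c') (\<lambda>(c2, c3). (\<iota> c1 * n) \<otimes> (\<iota> (S c2) * (m * \<iota> c3))))"
    using m n by (intro coassoc) (auto intro!: lin)
  also have "\<dots> = swe (\<Delta> c) (\<lambda>(c1, c'). swe (\<Delta> c') (\<lambda>(c2, c3). (\<iota> c1 * n * \<iota> (S c2)) \<otimes> (m * \<iota> c3)))"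
    using m n by (intro lext_cong2) (simp add: htp_bal)
  also have "\<dots> = swe (cr (\<iota> c * n)) (\<lambda>(x, k). swe (\<Delta> k) (\<lambda>(k1, k2). (x * \<iota> (S k1)) \<otimes> (m * \<iota> k2)))"
    using m n by (intro cr_comult_right(2)[symmetric, where F = "\<lambda>x k. x \<otimes> (m * \<iota> k)"]) (auto intro!: bilin_onI lin)
  also have "\<dots> = brd m (\<iota> c * n)"
    using brd_left[OF m, of "\<iota> c * n" 1] n by (simp add: calc.embed_hom)
  finally show ?thesis .
qed

lemma brd_bal: "x \<in> \<Omega> \<Longrightarrow> y \<in> \<Omega> \<Longrightarrow> brd (x * \<iota> c) y = brd x (\<iota> c * y)"
proof (induction x rule: \<Omega>_induct_HL)
  case (gen b m)
  from gen(2,1) show ?case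
  proof (induction y rule: \<Omega>_induct_RH)
    case (gen a n)
    then have "brd (\<iota> b * (m * \<iota> c)) (n * \<iota> a) = brd (\<iota> b * m) (\<iota> c * n * \<iota> a)"
      by (simp add: brd_lact brd_ract brd_bal_co)
    then show ?case by (simp add: mult.assoc)
  qed (simp_all add: distrib_left)
qed (simp_all add: distrib_right)

lemma \<sigma>_htp [simp]: "x \<in> \<Omega> \<Longrightarrow> y \<in> \<Omega> \<Longrightarrow> \<sigma> (x \<otimes> y) = brd x y"
  unfolding braid_eq_brd by (rule lext_OO[OF vs_fsc _ _ brd_bilin brd_bal])

lemma \<sigma>_lin [lin]: "lin_on A s fsc f \<Longrightarrow> lin_on A s fsc (\<lambda>x. \<sigma> (f x))"
  unfolding braid_eq_brd by (intro lin)

lemma \<sigma>_add [simp]: "\<sigma> (t + u) = \<sigma> t + \<sigma> u" and \<sigma>_scale [simp]: "\<sigma> (fsc c t) = fsc c (\<sigma> t)"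
  and \<sigma>_diff [simp]: "\<sigma> (t - u) = \<sigma> t - \<sigma> u" and \<sigma>_0 [simp]: "\<sigma> 0 = 0"
  by (simp_all add: braid_eq_brd lext_add[OF vs_fsc] lext_scale[OF vs_fsc] lext_diff[OF vs_fsc] lext_0[OF vs_fsc])

lemma \<sigma>_in [simp]: "t \<in> car W2 \<Longrightarrow> \<sigma> t \<in> car W2"
  unfolding braid_eq_brd by (auto intro!: W2_lext)

lemma \<sigma>_lact: "t \<in> car W2 \<Longrightarrow> \<sigma> (lact W2 a t) = lact W2 a (\<sigma> t)"
  by (induction rule: OO.tens_induct) (simp_all add: brd_lact)

lemma \<sigma>_ract: "t \<in> car W2 \<Longrightarrow> \<sigma> (ract W2 t a) = ract W2 (\<sigma> t) a"
  by (induction rule: OO.tens_induct) (simp_all add: brd_ract)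

lemma \<sigma>_flip: "m \<in> lco \<Longrightarrow> n \<in> rco \<Longrightarrow> \<sigma> (m \<otimes> n) = n \<otimes> m"
  using brd_eq[of m n 1 1] by (simp add: calc.embed_hom)

lemma W2_induct [consumes 1, case_names htp add]:
  "t \<in> car W2 \<Longrightarrow> (\<And>x y. x \<in> \<Omega> \<Longrightarrow> y \<in> \<Omega> \<Longrightarrow> P (x \<otimes> y)) \<Longrightarrow>
    (\<And>t u. t \<in> car W2 \<Longrightarrow> u \<in> car W2 \<Longrightarrow> P t \<Longrightarrow> P u \<Longrightarrow> P (t + u)) \<Longrightarrow> P t"
  using OO.tens_induct[of t H P] by simp

lemma W3_induct [consumes 1, case_names htp add]:
  assumes u: "u \<in> car W3" and P: "\<And>x y z. x \<in> \<Omega> \<Longrightarrow> y \<in> \<Omega> \<Longrightarrow> z \<in> \<Omega> \<Longrightarrow> P (x \<otimes> y \<odot> z)"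
    and add: "\<And>t u. t \<in> car W3 \<Longrightarrow> u \<in> car W3 \<Longrightarrow> P t \<Longrightarrow> P u \<Longrightarrow> P (t + u)"
  shows "P u"
  using u
proof (induction rule: WO.tens_induct)
  case (htp t z)
  then show ?case by (induction t rule: W2_induct) (auto intro: P add)
qed (rule add)

lemma W2_gen:
  assumes t: "t \<in> car W2" and add: "\<And>t u. t \<in> car W2 \<Longrightarrow> u \<in> car W2 \<Longrightarrow> P t \<Longrightarrow> P u \<Longrightarrow> P (t + u)"
  shows W2_induct_HLRH [consumes 1, case_names add gen]: "(\<And>a b m n. m \<in> lco \<Longrightarrow> n \<in> rco \<Longrightarrow> P ((\<iota> a * m) \<otimes> (n * \<iota> b))) \<Longrightarrow> P t"
    and W2_induct_HRL [consumes 1, case_names add gen]: "(\<And>a m n. m \<in> lco \<Longrightarrow> n \<in> rco \<Longrightarrow> P ((\<iota> a * n) \<otimes> m)) \<Longrightarrow> P t"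
    and W2_induct_HLL [consumes 1, case_names add gen]: "(\<And>a m n. m \<in> lco \<Longrightarrow> n \<in> lco \<Longrightarrow> P ((\<iota> a * m) \<otimes> n)) \<Longrightarrow> P t"
    and W2_induct_LLH [consumes 1, case_names add gen]: "(\<And>a m n. m \<in> lco \<Longrightarrow> n \<in> lco \<Longrightarrow> P (m \<otimes> (n * \<iota> a))) \<Longrightarrow> P t"
    and W2_induct_RRH [consumes 1, case_names add gen]: "(\<And>a m n. m \<in> rco \<Longrightarrow> n \<in> rco \<Longrightarrow> P (m \<otimes> (n * \<iota> a))) \<Longrightarrow> P t"
    and W2_induct_RLH [consumes 1, case_names add gen]: "(\<And>a m n. m \<in> rco \<Longrightarrow> n \<in> lco \<Longrightarrow> P (m \<otimes> (n * \<iota> a))) \<Longrightarrow> P t"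
proof -
  have r: "P t" if "\<And>x y. x \<in> \<Omega> \<Longrightarrow> y \<in> \<Omega> \<Longrightarrow> P (x \<otimes> y)"
    using t by (induction rule: W2_induct) (auto intro: that add)
  show "P t" if P: "\<And>a b m n. m \<in> lco \<Longrightarrow> n \<in> rco \<Longrightarrow> P ((\<iota> a * m) \<otimes> (n * \<iota> b))"
  proof (rule r)
    fix x y assume "x \<in> \<Omega>" and y: "y \<in> \<Omega>"
    then show "P (x \<otimes> y)"
    proof (induction x rule: \<Omega>_induct_HL)
      case (gen a m)
      show ?case using y by (induction y rule: \<Omega>_induct_RH) (use gen in \<open>auto intro: P add\<close>)
    qed (use y in \<open>auto intro: add\<close>)
  qed
  show "P t" if P: "\<And>a m n. m \<in> lco \<Longrightarrow> n \<in> rco \<Longrightarrow> P ((\<iota> a * n) \<otimes> m)"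
  proof (rule r)
    fix x y assume x: "x \<in> \<Omega>" and "y \<in> \<Omega>"
    from \<open>y \<in> \<Omega>\<close> show "P (x \<otimes> y)"
    proof (induction y rule: \<Omega>_induct_HL)
      case (gen c m)
      have "P (z \<otimes> m)" if "z \<in> \<Omega>" for z
        using that by (induction z rule: \<Omega>_induct_HR) (use gen in \<open>auto intro: P add\<close>)
      from this[of "x * \<iota> c"] show ?case using x gen by (simp add: htp_bal)
    qed (use x in \<open>auto intro: add\<close>)
  qed
  show "P t" if P: "\<And>a m n. m \<in> lco \<Longrightarrow> n \<in> lco \<Longrightarrow> P ((\<iota> a * m) \<otimes> n)"
  proof (rule r)
    fix x y assume x: "x \<in> \<Omega>" and "y \<in> \<Omega>"
    from \<open>y \<in> \<Omega>\<close> show "P (x \<otimes> y)"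
    proof (induction y rule: \<Omega>_induct_HL)
      case (gen c m)
      have "P (z \<otimes> m)" if "z \<in> \<Omega>" for z
        using that by (induction z rule: \<Omega>_induct_HL) (use gen in \<open>auto intro: P add\<close>)
      from this[of "x * \<iota> c"] show ?case using x gen by (simp add: htp_bal)
    qed (use x in \<open>auto intro: add\<close>)
  qed
  show "P t" if P: "\<And>a m n. m \<in> lco \<Longrightarrow> n \<in> lco \<Longrightarrow> P (m \<otimes> (n * \<iota> a))"
  proof (rule r)
    fix x y assume "x \<in> \<Omega>" and y: "y \<in> \<Omega>"
    from \<open>x \<in> \<Omega>\<close> show "P (x \<otimes> y)"
    proof (induction x rule: \<Omega>_induct_LH)
      case (gen c m)
      have "P (m \<otimes> z)" if "z \<in> \<Omega>" for z
        using that by (induction z rule: \<Omega>_induct_LH) (use gen in \<open>auto intro: P add\<close>)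
      from this[of "\<iota> c * y"] show ?case using y gen by (simp add: htp_bal)
    qed (use y in \<open>auto intro: add\<close>)
  qed
  show "P t" if P: "\<And>a m n. m \<in> rco \<Longrightarrow> n \<in> rco \<Longrightarrow> P (m \<otimes> (n * \<iota> a))"
  proof (rule r)
    fix x y assume "x \<in> \<Omega>" and y: "y \<in> \<Omega>"
    from \<open>x \<in> \<Omega>\<close> show "P (x \<otimes> y)"
    proof (induction x rule: \<Omega>_induct_RH)
      case (gen c m)
      have "P (m \<otimes> z)" if "z \<in> \<Omega>" for z
        using that by (induction z rule: \<Omega>_induct_RH) (use gen in \<open>auto intro: P add\<close>)
      from this[of "\<iota> c * y"] show ?case using y gen by (simp add: htp_bal)
    qed (use y in \<open>auto intro: add\<close>)
  qed
  show "P t" if P: "\<And>a m n. m \<in> rco \<Longrightarrow> n \<in> lco \<Longrightarrow> P (m \<otimes> (n * \<iota> a))"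
  proof (rule r)
    fix x y assume "x \<in> \<Omega>" and y: "y \<in> \<Omega>"
    from \<open>x \<in> \<Omega>\<close> show "P (x \<otimes> y)"
    proof (induction x rule: \<Omega>_induct_RH)
      case (gen c m)
      have "P (m \<otimes> z)" if "z \<in> \<Omega>" for z
        using that by (induction z rule: \<Omega>_induct_LH) (use gen in \<open>auto intro: P add\<close>)
      from this[of "\<iota> c * y"] show ?case using y gen by (simp add: htp_bal)
    qed (use y in \<open>auto intro: add\<close>)
  qed
qed

lemma \<sigma>_surj: "t \<in> car W2 \<Longrightarrow> \<exists>u\<in>car W2. \<sigma> u = t"
proof (induction t rule: W2_induct_HRL)
  case (add t u)
  then obtain t' u' where "t' \<in> car W2" "\<sigma> t' = t" "u' \<in> car W2" "\<sigma> u' = u" by blast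
  then show ?case by (intro bexI[of _ "t' + u'"]) simp_all
next
  case (gen a m n)
  then show ?case
    using \<sigma>_lact[of "m \<otimes> n" a] \<sigma>_flip[of m n] by (intro bexI[of _ "(\<iota> a * m) \<otimes> n"]) simp_all
qed

section \<open>Three-fold tensors\<close>

lemma attch_lin [lin]: "lin_on A s fsc f \<Longrightarrow> lin_on A s fsc (\<lambda>x. attch w (f x))"
  unfolding attach_def by (intro lin)

lemma attch_lin1 [lin]:
  "lin_on A s sC f \<Longrightarrow> (\<And>x. x \<in> A \<Longrightarrow> f x \<in> \<Omega>) \<Longrightarrow> t \<in> car W2 \<Longrightarrow> lin_on A s fsc (\<lambda>x. attch (f x) t)"
  unfolding attach_def by (auto intro!: lin)

lemma attch_htp [simp]: "x \<in> \<Omega> \<Longrightarrow> y \<in> \<Omega> \<Longrightarrow> z \<in> \<Omega> \<Longrightarrow> attch x (y \<otimes> z) = x \<otimes> y \<odot> z"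
  unfolding attach_def by (rule lext_OO) (auto intro!: bilin_onI lin simp flip: htp_bal)

lemma attch_add [simp]: "attch x (t + u) = attch x t + attch x u"
  by (simp add: attach_def lext_add[OF vs_fsc])

lemma attch_in [simp]: "x \<in> \<Omega> \<Longrightarrow> t \<in> car W2 \<Longrightarrow> attch x t \<in> car W3"
  unfolding attach_def by (auto intro!: W3_lext)

lemma attch_addl [simp]: "x \<in> \<Omega> \<Longrightarrow> x' \<in> \<Omega> \<Longrightarrow> t \<in> car W2 \<Longrightarrow> attch (x + x') t = attch x t + attch x' t"
  using lin_on_add[OF attch_lin1[OF lin_on_id, of \<Omega> t], of x x'] by simp

lemma attch_act:
  assumes x: "x \<in> \<Omega>" and t: "t \<in> car W2"
  shows "attch (x * \<iota> a) t = attch x (lact W2 a t)"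
    and "attch (\<iota> a * x) t = lact W3 a (attch x t)"
    and "attch x (ract W2 t a) = ract W3 (attch x t) a"
proof -
  have "attch (x * \<iota> a) t = attch x (lact W2 a t) \<and> attch (\<iota> a * x) t = lact W3 a (attch x t) \<and>
    attch x (ract W2 t a) = ract W3 (attch x t) a"
    using t by (induction t rule: W2_induct) (simp_all add: x htp_bal)
  then show "attch (x * \<iota> a) t = attch x (lact W2 a t)"
    "attch (\<iota> a * x) t = lact W3 a (attch x t)" "attch x (ract W2 t a) = ract W3 (attch x t) a"
    by auto
qed

definition bimap :: "(('w \<times> 'w \<Rightarrow>\<^sub>0 'k) \<Rightarrow> ('w \<times> 'w \<Rightarrow>\<^sub>0 'k)) \<Rightarrow> bool" where
  "bimap U \<longleftrightarrow> (\<forall>t\<in>car W2. U t \<in> car W2) \<and> lin_on (car W2) fsc fsc U \<and>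
    (\<forall>t\<in>car W2. \<forall>a. U (lact W2 a t) = lact W2 a (U t) \<and> U (ract W2 t a) = ract W2 (U t) a)"

lemma bimapD:
  assumes "bimap U"
  shows "t \<in> car W2 \<Longrightarrow> U t \<in> car W2" "lin_on (car W2) fsc fsc U"
    "t \<in> car W2 \<Longrightarrow> U (lact W2 a t) = lact W2 a (U t)" "t \<in> car W2 \<Longrightarrow> U (ract W2 t a) = ract W2 (U t) a"
    "lin_on A s fsc f \<Longrightarrow> (\<And>x. x \<in> A \<Longrightarrow> f x \<in> car W2) \<Longrightarrow> lin_on A s fsc (\<lambda>x. U (f x))"
    "t \<in> car W2 \<Longrightarrow> u \<in> car W2 \<Longrightarrow> U (t + u) = U t + U u"
  using assms lin_on_comp[of "car W2" fsc fsc U A s f] unfolding bimap_def lin_on_def by blast+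

lemma bimap_\<sigma>: "bimap \<sigma>"
  unfolding bimap_def by (auto simp: \<sigma>_lact \<sigma>_ract intro!: lin)

lemma on_23_lin [lin]: "lin_on A s fsc f \<Longrightarrow> lin_on A s fsc (\<lambda>x. on_23 H C U (f x))"
  and on_12_lin [lin]: "lin_on A s fsc f \<Longrightarrow> lin_on A s fsc (\<lambda>x. on_12 H C U (f x))"
  unfolding on_23_def on_12_def by (intro lin, assumption)+

lemma on_add [simp]: "on_23 H C U (t + u) = on_23 H C U t + on_23 H C U u"
  "on_12 H C U (t + u) = on_12 H C U t + on_12 H C U u"
  by (simp_all add: on_23_def on_12_def lext_add[OF vs_fsc])

lemma on_12_htp [simp]:
  assumes U: "bimap U" and t: "t \<in> car W2" "z \<in> \<Omega>"
  shows "on_12 H C U (t \<odot> z) = U t \<odot> z"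
  unfolding on_12_def
  by (rule lext_WO[OF vs_fsc t]) (auto intro!: bilin_onI lin bimapD[OF U] simp: bimapD[OF U] htp_bal)

lemma on_23_htp:
  assumes U: "bimap U" and xyz: "x \<in> \<Omega>" "y \<in> \<Omega>" "z \<in> \<Omega>"
  shows "on_23 H C U (x \<otimes> y \<odot> z) = attch x (U (y \<otimes> z))"
proof -
  have f: "swe (x \<otimes> y) (\<lambda>(x, y). attch x (U (y \<otimes> z))) = attch x (U (y \<otimes> z))"
    if "x \<in> \<Omega>" "y \<in> \<Omega>" "z \<in> \<Omega>" for x y z
    by (rule lext_OO[OF vs_fsc that(1,2)])
      (use that in \<open>auto intro!: bilin_onI lin bimapD[OF U] simp: bimapD[OF U] attch_act simp flip: bimapD(3)[OF U]\<close>)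
  have g: "swe (ract W2 t a) (\<lambda>(x, y). attch x (U (y \<otimes> z))) = swe t (\<lambda>(x, y). attch x (U (y \<otimes> (\<iota> a * z))))"
    if "t \<in> car W2" "z \<in> \<Omega>" for t a z
    using that by (induction t rule: W2_induct) (simp_all add: f lext_add[OF vs_fsc] htp_bal)
  have "on_23 H C U (x \<otimes> y \<odot> z) = swe (x \<otimes> y) (\<lambda>(x, y). attch x (U (y \<otimes> z)))"
    unfolding on_23_def
    by (rule lext_WO[OF vs_fsc]) (use xyz in \<open>auto intro!: bilin_onI lin bimapD[OF U] simp: g\<close>)
  then show ?thesis using f xyz by simp
qed

lemma on_23_attch:
  assumes U: "bimap U" and x: "x \<in> \<Omega>" and t: "t \<in> car W2"
  shows "on_23 H C U (attch x t) = attch x (U t)"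
  using t by (induction t rule: W2_induct) (simp_all add: on_23_htp bimapD[OF U] U x)

lemma on_in:
  assumes U: "bimap U" and t: "t \<in> car W3"
  shows "on_12 H C U t \<in> car W3" "on_23 H C U t \<in> car W3"
proof -
  have "on_12 H C U t \<in> car W3 \<and> on_23 H C U t \<in> car W3"
    using t by (induction t rule: W3_induct) (simp_all add: on_23_htp U bimapD[OF U])
  then show "on_12 H C U t \<in> car W3" "on_23 H C U t \<in> car W3" by auto
qed

lemma on_act:
  assumes U: "bimap U" and t: "t \<in> car W3"
  shows "on_12 H C U (lact W3 a t) = lact W3 a (on_12 H C U t)"
    and "on_12 H C U (ract W3 t a) = ract W3 (on_12 H C U t) a"
    and "on_23 H C U (lact W3 a t) = lact W3 a (on_23 H C U t)"
    and "on_23 H C U (ract W3 t a) = ract W3 (on_23 H C U t) a"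
proof -
  have U1: "U (x \<otimes> (y * \<iota> a)) = ract W2 (U (x \<otimes> y)) a" "U ((\<iota> a * x) \<otimes> y) = lact W2 a (U (x \<otimes> y))"
    if "x \<in> \<Omega>" "y \<in> \<Omega>" for x y
    using bimapD(3,4)[OF U, of "x \<otimes> y"] that by simp_all
  have "on_12 H C U (lact W3 a t) = lact W3 a (on_12 H C U t) \<and>
    on_12 H C U (ract W3 t a) = ract W3 (on_12 H C U t) a \<and>
    on_23 H C U (lact W3 a t) = lact W3 a (on_23 H C U t) \<and>
    on_23 H C U (ract W3 t a) = ract W3 (on_23 H C U t) a"
    using t by (induction t rule: W3_induct) (simp_all add: on_23_htp U bimapD(1)[OF U] attch_act U1)
  then show "on_12 H C U (lact W3 a t) = lact W3 a (on_12 H C U t)"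
    "on_12 H C U (ract W3 t a) = ract W3 (on_12 H C U t) a"
    "on_23 H C U (lact W3 a t) = lact W3 a (on_23 H C U t)"
    "on_23 H C U (ract W3 t a) = ract W3 (on_23 H C U t) a"
    by auto
qed

abbreviation "\<sigma>12 \<equiv> on_12 H C \<sigma>"
abbreviation "\<sigma>23 \<equiv> on_23 H C \<sigma>"

lemmas \<sigma>_ops [simp] = on_in[OF bimap_\<sigma>] on_act[OF bimap_\<sigma>] on_12_htp[OF bimap_\<sigma>] on_23_htp[OF bimap_\<sigma>]

lemma \<sigma>12_\<sigma>23_flip:
  assumes "p \<in> lco" "q \<in> lco" "n \<in> rco"
  shows "\<sigma>12 (\<sigma>23 (p \<otimes> q \<odot> n)) = n \<otimes> p \<odot> q"
  using \<sigma>_flip[of q n] \<sigma>_flip[of p n] assms by simp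

lemma \<sigma>23_\<sigma>12_flip:
  assumes "p \<in> lco" "q \<in> rco" "r \<in> rco"
  shows "\<sigma>23 (\<sigma>12 (p \<otimes> q \<odot> r)) = q \<otimes> r \<odot> p"
  using \<sigma>_flip[of p q] \<sigma>_flip[of p r] assms by simp

lemma W3_gen:
  assumes u: "u \<in> car W3" and add: "\<And>t u. t \<in> car W3 \<Longrightarrow> u \<in> car W3 \<Longrightarrow> P t \<Longrightarrow> P u \<Longrightarrow> P (t + u)"
  shows W3_induct_LLR [consumes 1, case_names add gen]: "(\<And>a b p q n. p \<in> lco \<Longrightarrow> q \<in> lco \<Longrightarrow> n \<in> rco \<Longrightarrow>
      P (lact W3 a (ract W3 (p \<otimes> q \<odot> n) b))) \<Longrightarrow> P u"
    and W3_induct_LRR [consumes 1, case_names add gen]: "(\<And>a b p q n. p \<in> lco \<Longrightarrow> q \<in> rco \<Longrightarrow> n \<in> rco \<Longrightarrow>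
      P (lact W3 a (ract W3 (p \<otimes> q \<odot> n) b))) \<Longrightarrow> P u"
proof -
  show "P u" if P: "\<And>a b p q n. p \<in> lco \<Longrightarrow> q \<in> lco \<Longrightarrow> n \<in> rco \<Longrightarrow> P (lact W3 a (ract W3 (p \<otimes> q \<odot> n) b))"
    using u
  proof (induction rule: WO.tens_induct)
    case (htp t z)
    from \<open>t \<in> car W2\<close> show ?case
    proof (induction t rule: W2_induct_HLL)
      case (gen a p q)
      from htp(2) have "z \<in> \<Omega>" by simp
      then show ?case
        by (induction z rule: \<Omega>_induct_RH) (use gen P[of p q _ a] add in auto)
    qed (use htp(2) add in auto)
  qed (rule add)
  show "P u" if P: "\<And>a b p q n. p \<in> lco \<Longrightarrow> q \<in> rco \<Longrightarrow> n \<in> rco \<Longrightarrow> P (lact W3 a (ract W3 (p \<otimes> q \<odot> n) b))"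
    using u
  proof (induction rule: WO.tens_induct)
    case (htp t z)
    from \<open>t \<in> car W2\<close> show ?case
    proof (induction t rule: W2_induct_HLRH)
      case (gen a c p q)
      have "P ((\<iota> a * p) \<otimes> q \<odot> y)" if "y \<in> \<Omega>" for y
        using that by (induction y rule: \<Omega>_induct_RH) (use gen P[of p q _ a] add in auto)
      from this[of "\<iota> c * z"] show ?case using gen htp(2) htp_bal(2)[of "(\<iota> a * p) \<otimes> q" z c] by simp
    qed (use htp(2) add in auto)
  qed (rule add)
qed

end

section \<open>Symmetric and antisymmetric tensors\<close>

context hopf_calculus
begin

abbreviation "\<tau> \<equiv> sigma_bar H C"
abbreviation "V \<equiv> vee H C"
abbreviation "Wd \<equiv> wedge_part H C"
abbreviation "\<pi> \<equiv> pi_vee H C"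

text \<open>
  As \<open>\<tau>\<close> is the inverse only of a possibly non-injective \<open>\<sigma>\<close> so far, the eigenspaces of \<open>\<tau>\<close> are separated by
  products of maps \<open>1 - c \<sigma>\<close>.
\<close>

definition stp :: "'k \<Rightarrow> ('w \<times> 'w \<Rightarrow>\<^sub>0 'k) \<Rightarrow> ('w \<times> 'w \<Rightarrow>\<^sub>0 'k)" where
  "stp c t = t - fsc c (\<sigma> t)"

lemma stp_add: "stp c (t + u) = stp c t + stp c u"
  by (simp add: stp_def fsc.scale_right_distrib)

lemma stp_scale: "stp c (fsc b t) = fsc b (stp c t)"
  by (simp add: stp_def fsc.scale_right_diff_distrib mult.commute)

lemma stp_commute: "stp c (stp b t) = stp b (stp c t)"
  by (simp add: stp_def fsc.scale_right_diff_distrib mult.commute algebra_simps)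

lemma foldr_stp_add: "foldr stp cs (t + u) = foldr stp cs t + foldr stp cs u"
  by (induction cs) (simp_all add: stp_add)

lemma foldr_stp_scale: "foldr stp cs (fsc b t) = fsc b (foldr stp cs t)"
  by (induction cs) (simp_all add: stp_scale)

lemma foldr_stp_commute: "foldr stp cs (stp c t) = stp c (foldr stp cs t)"
  by (induction cs) (simp_all add: stp_commute)

lemma stp_0 [simp]: "stp c 0 = 0" and foldr_stp_0 [simp]: "foldr stp cs 0 = 0"
proof -
  show "stp c 0 = 0" for c by (simp add: stp_def)
  then show "foldr stp cs 0 = 0" by (induction cs) simp_all
qed

lemma foldr_stp_kernel: "\<sigma> t = 0 \<Longrightarrow> foldr stp cs t = t"
  by (induction cs) (simp_all add: stp_def)

lemma foldr_stp_fix: "\<sigma> t = t \<Longrightarrow> foldr stp cs t = fsc (prod_list (map (\<lambda>c. 1 - c) cs)) t"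
  by (induction cs) (simp_all add: stp_def fsc.scale_left_diff_distrib algebra_simps)

lemma \<sigma>_\<tau>: "t \<in> car W2 \<Longrightarrow> \<sigma> (\<tau> t) = t" and \<tau>_in [simp]: "t \<in> car W2 \<Longrightarrow> \<tau> t \<in> car W2"
  using \<sigma>_surj[of t] f_inv_into_f[of t \<sigma> "car W2"] inv_into_into[of t \<sigma> "car W2"]
  by (auto simp: braid_inv_def)

lemma eigenspaceD:
  assumes "t \<in> eigenspace H C c"
  shows "t \<in> car W2" "t = fsc c (\<sigma> t)"
proof -
  show t: "t \<in> car W2" using assms by (simp add: eigenspace_def)
  have "\<sigma> (\<tau> t) = \<sigma> (fsc c t)" using assms by (simp add: eigenspace_def)
  then show "t = fsc c (\<sigma> t)" using \<sigma>_\<tau>[OF t] by simp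
qed

lemma span_eigenspace_annihilated:
  assumes "t \<in> fsc.span (\<Union>c\<in>A. eigenspace H C c)"
  shows "\<exists>cs. set cs \<subseteq> A \<and> foldr stp cs t = 0"
  using assms
proof (induction rule: fsc.span_induct_alt)
  case base
  show ?case by (rule exI[of _ "[]"]) simp
next
  case (step b x y)
  then obtain c ds where c: "c \<in> A" "x \<in> eigenspace H C c" and ds: "set ds \<subseteq> A" "foldr stp ds y = 0" by blast
  have "stp c x = 0" using eigenspaceD(2)[OF c(2)] by (simp add: stp_def)
  then have "foldr stp (c # ds) (fsc b x + y) = 0"
    by (simp add: foldr_stp_add foldr_stp_scale stp_add stp_scale ds flip: foldr_stp_commute)
  then show ?case using c ds by (intro exI[of _ "c # ds"]) simp
qed

end

locale hopf_calculus_diag = hopf_calculus H C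
  for H :: "('k::field, 'h::ring_1) hopf" and C :: "('k, 'w::ring_1, 'h) calc" +
  assumes diag: "diagonalisable H C"
begin

lemma \<sigma>_inj: "t \<in> car W2 \<Longrightarrow> \<sigma> t = 0 \<Longrightarrow> t = 0"
  using span_eigenspace_annihilated[of t UNIV] diag foldr_stp_kernel
  by (auto simp: diagonalisable_def)

lemma \<sigma>_eq_iff: "t \<in> car W2 \<Longrightarrow> u \<in> car W2 \<Longrightarrow> \<sigma> t = \<sigma> u \<longleftrightarrow> t = u"
  using \<sigma>_inj[of "t - u"] by auto

lemma \<tau>_\<sigma> [simp]: "t \<in> car W2 \<Longrightarrow> \<tau> (\<sigma> t) = t"
  using \<sigma>_\<tau>[of "\<sigma> t"] \<sigma>_eq_iff[of "\<tau> (\<sigma> t)" t] by simp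

lemma bimap_\<tau>: "bimap \<tau>"
  unfolding bimap_def lin_on_def
  by (auto simp: \<sigma>_\<tau> \<sigma>_lact \<sigma>_ract simp flip: \<sigma>_eq_iff)

lemma vee_iff: "t \<in> V \<longleftrightarrow> t \<in> car W2 \<and> \<sigma> t = t"
proof
  assume "t \<in> V"
  then show "t \<in> car W2 \<and> \<sigma> t = t" using eigenspaceD[of t 1] by (auto simp: vee_def)
next
  assume t: "t \<in> car W2 \<and> \<sigma> t = t"
  then have "\<tau> t = t" using \<tau>_\<sigma>[of t] by simp
  with t show "t \<in> V" by (simp add: vee_def eigenspace_def)
qed

lemma V_W2 [simp]: "t \<in> V \<Longrightarrow> t \<in> car W2" and \<sigma>_V: "t \<in> V \<Longrightarrow> \<sigma> t = t"
  using vee_iff by blast+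

lemma V_closed [simp]: "t \<in> V \<Longrightarrow> u \<in> V \<Longrightarrow> t + u \<in> V" "t \<in> V \<Longrightarrow> u \<in> V \<Longrightarrow> t - u \<in> V"
  "t \<in> V \<Longrightarrow> fsc c t \<in> V" "0 \<in> V" "t \<in> V \<Longrightarrow> lact W2 a t \<in> V" "t \<in> V \<Longrightarrow> ract W2 t a \<in> V"
  by (auto simp: vee_iff \<sigma>_lact \<sigma>_ract)

lemma wedge_induct [consumes 1, case_names zero add]:
  assumes "t \<in> Wd" and "P 0"
    and "\<And>c x y b. x \<in> car W2 \<Longrightarrow> x = fsc c (\<sigma> x) \<Longrightarrow> c \<noteq> 1 \<Longrightarrow> y \<in> Wd \<Longrightarrow> P y \<Longrightarrow> P (fsc b x + y)"
  shows "P t"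
proof -
  have "t \<in> Wd \<and> P t"
    using assms(1) unfolding wedge_part_def
  proof (induction rule: fsc.span_induct_alt)
    case base
    then show ?case using assms(2) by (simp add: fsc.span_zero)
  next
    case (step b x y)
    then obtain c where c: "c \<noteq> 1" "x \<in> eigenspace H C c" by blast
    have "x \<in> fsc.span (\<Union>c\<in>-{1}. eigenspace H C c)"
      using c by (intro fsc.span_base) auto
    then have "fsc b x + y \<in> fsc.span (\<Union>c\<in>-{1}. eigenspace H C c)"
      using step by (intro fsc.span_add fsc.span_scale) auto
    then show ?case
      using assms(3)[OF eigenspaceD[OF c(2)] c(1), of y b] step by (auto simp: wedge_part_def)
  qed
  then show ?thesis ..
qed

lemma wedge_baseI: "x \<in> car W2 \<Longrightarrow> x = fsc c (\<sigma> x) \<Longrightarrow> c \<noteq> 1 \<Longrightarrow> x \<in> Wd"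
proof -
  assume x: "x \<in> car W2" "x = fsc c (\<sigma> x)" "c \<noteq> 1"
  have "\<tau> x = fsc c x"
    using \<tau>_\<sigma>[of "fsc c x"] x by simp
  then have "x \<in> eigenspace H C c" using x by (simp add: eigenspace_def)
  then show "x \<in> Wd" unfolding wedge_part_def using x(3) by (intro fsc.span_base) auto
qed

lemma Wd_subspace: "fsc.subspace Wd"
  unfolding wedge_part_def by (rule fsc.subspace_span)

lemmas Wd_closed [simp] = fsc.subspace_0[OF Wd_subspace] fsc.subspace_add[OF Wd_subspace]
  fsc.subspace_diff[OF Wd_subspace] fsc.subspace_scale[OF Wd_subspace]

lemma Wd_W2 [simp]: "t \<in> Wd \<Longrightarrow> t \<in> car W2"
  by (induction rule: wedge_induct) simp_all

lemma Wd_act [simp]: "t \<in> Wd \<Longrightarrow> lact W2 a t \<in> Wd" "t \<in> Wd \<Longrightarrow> ract W2 t a \<in> Wd"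
proof -
  have l: "lact W2 a (fsc b x) = fsc b (lact W2 a x)" "ract W2 (fsc b x) a = fsc b (ract W2 x a)" for a b x
    by (simp_all add: tens_def lext_scale[OF vs_fsc])
  have z: "lact W2 a 0 = 0" "ract W2 0 a = 0"
    by (simp_all add: tens_def lext_0[OF vs_fsc])
  have b: "lact W2 a x \<in> Wd" "ract W2 x a \<in> Wd" if "x \<in> car W2" "x = fsc c (\<sigma> x)" "c \<noteq> 1" for x c
  proof -
    have "lact W2 a x = fsc c (\<sigma> (lact W2 a x))" "ract W2 x a = fsc c (\<sigma> (ract W2 x a))"
      using that(1) by (simp_all add: \<sigma>_lact \<sigma>_ract flip: l that(2))
    then show "lact W2 a x \<in> Wd" "ract W2 x a \<in> Wd"
      using that by (auto intro: wedge_baseI)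
  qed
  show "t \<in> Wd \<Longrightarrow> lact W2 a t \<in> Wd"
    by (induction rule: wedge_induct) (simp_all add: l z b)
  show "t \<in> Wd \<Longrightarrow> ract W2 t a \<in> Wd"
    by (induction rule: wedge_induct) (simp_all add: l z b)
qed

lemma V_Wd_disjoint: "t \<in> V \<Longrightarrow> t \<in> Wd \<Longrightarrow> t = 0"
proof -
  assume t: "t \<in> V" "t \<in> Wd"
  obtain cs where cs: "set cs \<subseteq> -{1}" "foldr stp cs t = 0"
    using span_eigenspace_annihilated t(2) unfolding wedge_part_def by blast
  have "prod_list (map (\<lambda>c. 1 - c) cs) \<noteq> 0"
    using cs(1) by (induction cs) auto
  then show "t = 0" using foldr_stp_fix[OF \<sigma>_V[OF t(1)], of cs] cs(2) by simp
qed

lemma W2_decomp: "t \<in> car W2 \<Longrightarrow> \<exists>s\<in>V. t - s \<in> Wd"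
proof -
  assume "t \<in> car W2"
  then have "t \<in> fsc.span (\<Union>c. eigenspace H C c)" using diag by (simp add: diagonalisable_def)
  then show ?thesis
  proof (induction rule: fsc.span_induct_alt)
    case base
    then show ?case by (intro bexI[of _ 0]) simp_all
  next
    case (step b x y)
    then obtain c s where x: "x \<in> eigenspace H C c" and s: "s \<in> V" "y - s \<in> Wd" by blast
    show ?case
    proof (cases "c = 1")
      case True
      then have "x \<in> V" using x by (simp add: vee_def)
      then show ?thesis using s by (intro bexI[of _ "fsc b x + s"]) simp_all
    next
      case False
      then have "x \<in> Wd" using wedge_baseI[OF eigenspaceD[OF x]] by simp
      then have "fsc b x + (y - s) \<in> Wd" using s by simp
      then show ?thesis using s by (intro bexI[of _ s]) (simp_all add: algebra_simps)
    qed
  qed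
qed

lemma \<pi>_eqI: "s \<in> V \<Longrightarrow> t - s \<in> Wd \<Longrightarrow> \<pi> t = s"
  unfolding pi_vee_def
proof (rule the_equality)
  fix s' assume s: "s \<in> V" "t - s \<in> Wd" and s': "s' \<in> V \<and> t - s' \<in> Wd"
  have "(t - s) - (t - s') \<in> Wd" using s s' Wd_closed(3) by blast
  then show "s' = s" using V_Wd_disjoint[of "s' - s"] s s' by simp
qed simp

lemma \<pi>_props: "t \<in> car W2 \<Longrightarrow> \<pi> t \<in> V" "t \<in> car W2 \<Longrightarrow> t - \<pi> t \<in> Wd"
  using W2_decomp[of t] \<pi>_eqI by auto

lemma \<pi>_V [simp]: "s \<in> V \<Longrightarrow> \<pi> s = s" and \<pi>_Wd [simp]: "s \<in> Wd \<Longrightarrow> \<pi> s = 0"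
  by (simp_all add: \<pi>_eqI)

lemma bimap_\<pi>: "bimap \<pi>"
  unfolding bimap_def lin_on_def
proof (intro conjI ballI allI)
  fix t a assume t: "t \<in> car W2"
  have l: "lact W2 a (t - u) = lact W2 a t - lact W2 a u" "ract W2 (t - u) a = ract W2 t a - ract W2 u a" for u
    by (simp_all add: tens_def lext_diff[OF vs_fsc])
  show "\<pi> t \<in> car W2" using \<pi>_props t by simp
  show "\<pi> (lact W2 a t) = lact W2 a (\<pi> t)" "\<pi> (ract W2 t a) = ract W2 (\<pi> t) a"
    using \<pi>_props[OF t] by (auto intro!: \<pi>_eqI simp flip: l)
next
  fix t u assume t: "t \<in> car W2" "u \<in> car W2"
  have "t + u - (\<pi> t + \<pi> u) = (t - \<pi> t) + (u - \<pi> u)" by simp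
  then have "t + u - (\<pi> t + \<pi> u) \<in> Wd"
    using Wd_closed(2)[OF \<pi>_props(2)[OF t(1)] \<pi>_props(2)[OF t(2)]] by metis
  then show "\<pi> (t + u) = \<pi> t + \<pi> u"
    using \<pi>_props(1)[OF t(1)] \<pi>_props(1)[OF t(2)] by (intro \<pi>_eqI) simp_all
next
  fix c t assume t: "t \<in> car W2"
  show "\<pi> (fsc c t) = fsc c (\<pi> t)"
    using \<pi>_props[OF t] by (intro \<pi>_eqI) (simp_all flip: fsc.scale_right_diff_distrib)
qed

lemma \<sigma>_invariant_wedge:
  assumes s: "vector_space s" and F: "lin_on (car W2) fsc s F" "\<And>t. t \<in> car W2 \<Longrightarrow> F (\<sigma> t) = F t"
    and t: "t \<in> Wd"
  shows "F t = 0"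
  using t
proof (induction rule: wedge_induct)
  case zero
  show ?case using lin_on_zero[OF vs_fsc s W2.subspace[unfolded sc_W] F(1)] .
next
  case (add c x y b)
  interpret vector_space s by (rule s)
  have "F x = F (fsc c (\<sigma> x))" using add(2) by simp
  also have "\<dots> = s c (F x)" using add(1) by (simp add: lin_on_scale[OF F(1)] F(2))
  finally have "s (1 - c) (F x) = 0" by (simp add: scale_left_diff_distrib)
  then have "F x = 0" using add(3) by simp
  then show ?case using add by (simp add: lin_on_add[OF F(1)] lin_on_scale[OF F(1)])
qed

lemma \<sigma>_invariant_\<pi>:
  assumes s: "vector_space s" and F: "lin_on (car W2) fsc s F" "\<And>t. t \<in> car W2 \<Longrightarrow> F (\<sigma> t) = F t"
    and t: "t \<in> car W2"
  shows "F (\<pi> t) = F t"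
  using \<sigma>_invariant_wedge[OF s F \<pi>_props(2)[OF t]] lin_on_diff[OF vs_fsc s W2.subspace[unfolded sc_W] F(1) t] \<pi>_props[OF t]
  by simp

subsection \<open>The kernel of the wedge product in degree two\<close>

definition wedge :: "('w \<times> 'w \<Rightarrow>\<^sub>0 'k) \<Rightarrow> 'w" where
  "wedge t = lext sC t (\<lambda>(x, y). x * y)"

lemma wedge_htp [simp]: "x \<in> \<Omega> \<Longrightarrow> y \<in> \<Omega> \<Longrightarrow> wedge (x \<otimes> y) = x * y"
  unfolding wedge_def by (rule lext_OO) (auto intro!: bilin_onI lin simp: mult.assoc)

lemma wedge_add [simp]: "wedge (t + u) = wedge t + wedge u" and wedge_diff [simp]: "wedge (t - u) = wedge t - wedge u"
  and wedge_0 [simp]: "wedge 0 = 0" and wedge_scale [simp]: "wedge (fsc c t) = sC c (wedge t)"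
  by (simp_all add: wedge_def lext_add[OF vs_C] lext_diff[OF vs_C] lext_0[OF vs_C] lext_scale[OF vs_C])

lemma wedge_ract: "t \<in> car W2 \<Longrightarrow> wedge (ract W2 t a) = wedge t * \<iota> a"
  by (induction rule: W2_induct) (simp_all add: mult.assoc distrib_right)

lemma length_2: "length xs = 2 \<longleftrightarrow> (\<exists>x y. xs = [x, y])"
  unfolding numeral_2_eq_2 length_Suc_conv length_0_conv by blast

lemma power_basis_2: "xs \<in> power_basis Om 2 \<longleftrightarrow> (\<exists>x\<in>\<Omega>. \<exists>y\<in>\<Omega>. xs = [x, y])"
  by (auto simp: power_basis_def length_2)

sublocale TP: free_quotient "power_basis Om 2" "power_rel Om 2"
proof
  show "power_rel Om 2 \<subseteq> free_on (power_basis Om 2)"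
    unfolding power_rel_def
    by (auto intro!: free_on_simps simp: power_basis_2
        append_eq_Cons_conv Cons_eq_append_conv)
qed

abbreviation "pw x y \<equiv> power_pure Om 2 [x, y]"

lemma lext_pw:
  assumes s: "vector_space s" and xy: "x \<in> \<Omega>" "y \<in> \<Omega>"
    and G: "\<And>x y. x \<in> \<Omega> \<Longrightarrow> y \<in> \<Omega> \<Longrightarrow> G [x, y] = F x y"
    and F: "bilin_on \<Omega> sC \<Omega> sC s F" "\<And>x a y. x \<in> \<Omega> \<Longrightarrow> y \<in> \<Omega> \<Longrightarrow> F (x * \<iota> a) y = F x (\<iota> a * y)"
  shows "lext s (pw x y) G = F x y"
proof -
  note F1 = bilin_onD(1)[OF F(1)] and F2 = bilin_onD(2)[OF F(1)]
  have "lext s r G = 0" if "r \<in> power_rel Om 2" for r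
    using that unfolding power_rel_def
    by (elim UnE CollectE exE conjE)
      (auto simp: lext_diff[OF s] lext_bvec[OF s] lext_scale[OF s] G F(2)
        lin_on_add[OF F1] lin_on_add[OF F2] lin_on_scale[OF F1] lin_on_scale[OF F2] power_basis_2
        append_eq_Cons_conv Cons_eq_append_conv)
  then show ?thesis
    unfolding power_pure_def using TP.lext_qmap_bvec[OF s, of "[x, y]" G] xy by (simp add: G power_basis_2)
qed

lemma pw_bilin: "bilin_on \<Omega> sC \<Omega> sC fsc pw"
proof (intro bilin_onI lin_onI)
  fix x y z assume *: "x \<in> \<Omega>" "y \<in> \<Omega>" "z \<in> \<Omega>"
  have "bvec ([] @ [x + y] @ [z]) - bvec ([] @ [x] @ [z]) - bvec ([] @ [y] @ [z]) \<in> power_rel Om 2"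
    unfolding power_rel_def by (rule UnI1, rule UnI1, rule CollectI, (rule exI)+, rule conjI, rule refl) (use * in \<open>auto simp: power_basis_2\<close>)
  then show "pw (x + y) z = pw x z + pw y z"
    unfolding power_pure_def TP.qmap_add[symmetric] by (intro TP.qmap_eqI) (simp add: diff_diff_eq)
  have "bvec ([z] @ [x + y] @ []) - bvec ([z] @ [x] @ []) - bvec ([z] @ [y] @ []) \<in> power_rel Om 2"
    unfolding power_rel_def by (rule UnI1, rule UnI1, rule CollectI, (rule exI)+, rule conjI, rule refl) (use * in \<open>auto simp: power_basis_2\<close>)
  then show "pw z (x + y) = pw z x + pw z y"
    unfolding power_pure_def TP.qmap_add[symmetric] by (intro TP.qmap_eqI) (simp add: diff_diff_eq)
next
  fix x z c assume *: "x \<in> \<Omega>" "z \<in> \<Omega>"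
  have "bvec ([] @ [sc Om c x] @ [z]) - fsc c (bvec ([] @ [x] @ [z])) \<in> power_rel Om 2"
    unfolding power_rel_def by (rule UnI1, rule UnI2, rule CollectI, (rule exI)+, rule conjI, rule refl) (use * in \<open>auto simp: power_basis_2\<close>)
  then show "pw (sC c x) z = fsc c (pw x z)"
    unfolding power_pure_def TP.qmap_scale[symmetric] by (intro TP.qmap_eqI) simp
  have "bvec ([z] @ [sc Om c x] @ []) - fsc c (bvec ([z] @ [x] @ [])) \<in> power_rel Om 2"
    unfolding power_rel_def by (rule UnI1, rule UnI2, rule CollectI, (rule exI)+, rule conjI, rule refl) (use * in \<open>auto simp: power_basis_2\<close>)
  then show "pw z (sC c x) = fsc c (pw z x)"
    unfolding power_pure_def TP.qmap_scale[symmetric] by (intro TP.qmap_eqI) simp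
qed

lemma pw_bal: "x \<in> \<Omega> \<Longrightarrow> y \<in> \<Omega> \<Longrightarrow> pw (x * \<iota> a) y = pw x (\<iota> a * y)"
proof -
  assume *: "x \<in> \<Omega>" "y \<in> \<Omega>"
  have "bvec ([] @ [ract Om x a, y] @ []) - bvec ([] @ [x, lact Om a y] @ []) \<in> power_rel Om 2"
    unfolding power_rel_def by (rule UnI2, rule CollectI, (rule exI)+, rule conjI, rule refl) (use * in \<open>auto simp: power_basis_2\<close>)
  then show ?thesis
    unfolding power_pure_def by (intro TP.qmap_eqI) simp
qed

definition to_power :: "('w \<times> 'w \<Rightarrow>\<^sub>0 'k) \<Rightarrow> ('w list \<Rightarrow>\<^sub>0 'k)" where
  "to_power t = swe t (\<lambda>(x, y). pw x y)"

lemma to_power_htp [simp]: "x \<in> \<Omega> \<Longrightarrow> y \<in> \<Omega> \<Longrightarrow> to_power (x \<otimes> y) = pw x y"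
  unfolding to_power_def by (rule lext_OO[OF vs_fsc _ _ pw_bilin pw_bal])

lemma to_power_add [simp]: "to_power (t + u) = to_power t + to_power u"
  and to_power_diff: "to_power (t - u) = to_power t - to_power u"
  by (simp_all add: to_power_def lext_add[OF vs_fsc] lext_diff[OF vs_fsc])

lemma to_power_in: "to_power t \<in> car (tensor_power Om 2)"
  unfolding to_power_def tensor_power_def power_pure_def
  by (rule lext_in_subspace[OF vs_fsc TP.qspace_subspace]) (auto intro: TP.qmap_in)

lemma to_power_inj: "t \<in> car W2 \<Longrightarrow> to_power t = 0 \<Longrightarrow> t = 0"
proof -
  have "swe (to_power t) (\<lambda>xs. (xs ! 0) \<otimes> (xs ! 1)) = t" if "t \<in> car W2"
    using that
  proof (induction rule: W2_induct)
    case (htp x y)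
    have "swe (pw x y) (\<lambda>xs. (xs ! 0) \<otimes> (xs ! 1)) = x \<otimes> y"
      by (rule lext_pw[OF vs_fsc htp]) (auto intro!: bilin_onI lin simp: htp_bal)
    then show ?case using htp by simp
  qed (simp add: lext_add[OF vs_fsc])
  then show "t \<in> car W2 \<Longrightarrow> to_power t = 0 \<Longrightarrow> t = 0" by (metis lext_0[OF vs_fsc])
qed

lemma wedge_to_power: "t \<in> car W2 \<Longrightarrow> lext sC (to_power t) prod_list = wedge t"
proof (induction rule: W2_induct)
  case (htp x y)
  have "lext sC (pw x y) prod_list = x * y"
    by (rule lext_pw[OF vs_C htp]) (auto intro!: bilin_onI lin simp: mult.assoc)
  then show ?case using htp by simp
qed (simp add: lext_add[OF vs_C])

lemma sigma_bar_at_to_power: "t \<in> car W2 \<Longrightarrow> sigma_bar_at H C 2 0 (to_power t) = to_power (\<tau> t)"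
proof (induction rule: W2_induct)
  case (htp x y)
  have "sigma_bar_at H C 2 0 (pw x y) = to_power (\<tau> (x \<otimes> y))"
    unfolding sigma_bar_at_def
  proof (rule lext_pw[OF vs_fsc htp, where F = "\<lambda>x y. to_power (\<tau> (x \<otimes> y))"])
    show "bilin_on \<Omega> sC \<Omega> sC fsc (\<lambda>x y. to_power (\<tau> (x \<otimes> y)))"
      unfolding to_power_def by (auto intro!: bilin_onI lin bimapD(5)[OF bimap_\<tau>])
  qed (simp_all add: to_power_def htp_bal)
  then show ?case using htp by simp
next
  case (add t u)
  then show ?case by (simp add: bimapD(6)[OF bimap_\<tau>]) (simp add: sigma_bar_at_def lext_add[OF vs_fsc])
qed

lemma reduced_word_2:
  "reduced_word 2 id = []" "reduced_word 2 (Transposition.transpose 0 1) = [0]"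
proof -
  define P where "P = (\<lambda>p is. (\<forall>i\<in>set is. Suc i < 2) \<and>
     p = foldr (\<circ>) (map (\<lambda>i. Transposition.transpose i (Suc i)) is) id)"
  have r: "reduced_word 2 p = arg_min length (P p)" for p by (simp add: reduced_word_def P_def)
  have "length (arg_min length (P id)) \<le> length ([] :: nat list)"
    by (rule arg_min_nat_le) (simp add: P_def)
  then show "reduced_word 2 id = []" by (simp add: r)
  have P0: "P (Transposition.transpose 0 1) [0]" by (simp add: P_def)
  define A where "A = arg_min length (P (Transposition.transpose 0 1))"
  have "length A \<le> length [0 :: nat]"
    unfolding A_def by (rule arg_min_nat_le) (rule P0)
  moreover have PA: "P (Transposition.transpose 0 1) A"
    unfolding A_def by (rule arg_min_natI) (rule P0)
  moreover have "\<not> P (Transposition.transpose 0 1) []"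
    by (auto simp: P_def fun_eq_iff intro!: exI[of _ 0])
  ultimately obtain i where A: "A = [i]"
    by (cases A) auto
  then have "Suc i < 2" using PA by (simp add: P_def)
  then have "i = 0" by linarith
  with A show "reduced_word 2 (Transposition.transpose 0 1) = [0]" by (simp add: r A_def)
qed

lemma antisymmetrizer_2: "antisymmetrizer H C 2 t = t - sigma_bar_at H C 2 0 t"
proof -
  have "{..<2} = {0, 1 :: nat}" by auto
  then have perms: "{p. p permutes {..<2 :: nat}} = {id, Transposition.transpose 0 1}"
    by (auto simp: permutes_doubleton_iff)
  have ne: "id \<noteq> Transposition.transpose 0 (1 :: nat)"
    by (auto simp: fun_eq_iff intro!: exI[of _ 0])
  have m: "fsc (- 1) u = - u" for u :: "'w list \<Rightarrow>\<^sub>0 'k"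
    by (simp add: fsc.scale_minus_left)
  show ?thesis
    unfolding antisymmetrizer_def perms using ne
    by (simp add: reduced_word_2 sign_swap_id m sign_id)
qed

lemma wedge_eq_0_iff: "t \<in> car W2 \<Longrightarrow> wedge t = 0 \<longleftrightarrow> t \<in> V"
proof -
  assume t: "t \<in> car W2"
  have "wedge t = 0 \<longleftrightarrow> antisymmetrizer H C 2 (to_power t) = 0"
    using calc.kernel_wedge[of 2, OF _ to_power_in, of t] by (simp add: wedge_to_power[OF t])
  also have "\<dots> \<longleftrightarrow> to_power (t - \<tau> t) = 0"
    using t by (simp add: antisymmetrizer_2 sigma_bar_at_to_power to_power_diff)
  also have "\<dots> \<longleftrightarrow> t = \<tau> t"
    using to_power_inj[of "t - \<tau> t"] t by (auto simp: to_power_diff)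
  also have "\<dots> \<longleftrightarrow> t \<in> V"
    unfolding vee_iff using t \<sigma>_\<tau>[OF t] \<tau>_\<sigma>[OF t] by metis
  finally show ?thesis .
qed

lemma wedge_surj: "u \<in> grade C 2 \<Longrightarrow> \<exists>t\<in>car W2. wedge t = u"
proof -
  interpret vC: vector_space sC by (rule vs_C)
  assume "u \<in> grade C 2"
  then have "u \<in> vC.span {\<iota> a * prod_list (map (\<lambda>b. \<delta> (\<iota> b)) bs) | a bs. length bs = 2}"
    using calc.grade_span[of 2] by simp
  then show ?thesis
  proof (induction rule: vC.span_induct_alt)
    case base
    then show ?case by (intro bexI[of _ 0]) simp_all
  next
    case (step c x y)
    then obtain t a bs where t: "t \<in> car W2" "wedge t = y"
      and x: "x = \<iota> a * prod_list (map (\<lambda>b. \<delta> (\<iota> b)) bs)" "length bs = 2" by blast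
    then obtain b b' where "bs = [b, b']"
      by (auto simp: length_2)
    then have "wedge (fsc c ((\<iota> a * \<delta> (\<iota> b)) \<otimes> \<delta> (\<iota> b')) + t) = sC c x + y"
      using t x by (simp add: mult.assoc)
    then show ?case using t by (intro bexI[of _ "fsc c ((\<iota> a * \<delta> (\<iota> b)) \<otimes> \<delta> (\<iota> b')) + t"]) simp_all
  qed
qed

end

section \<open>Maps into tensor products\<close>

lemma ktens_separation:
  assumes V: "subvs V" and W: "subvs W" and t: "t \<in> car (ktens V W)"
    and 0: "\<And>\<phi>. lin_on UNIV (sc V) (*) \<phi> \<Longrightarrow> lext (sc W) t (\<lambda>(x, y). sc W (\<phi> x) y) = 0"
  shows "t = 0"
proof -
  interpret K: ktensor V W by unfold_locales fact+
  interpret vV: vector_space "sc V" using V by (simp add: subvs_def)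
  interpret vW: vector_space "sc W" using W by (simp add: subvs_def)
  obtain B where B: "B \<subseteq> car V" "vV.independent B" "car V \<subseteq> vV.span B"
    by (rule vV.basis_exists[of "car V"]) (rule that)
  define \<phi> where "\<phi> = (\<lambda>b x. vV.representation (vV.extend_basis B) x b)"
  have ext: "B \<subseteq> vV.extend_basis B" "vV.independent (vV.extend_basis B)" "vV.span (vV.extend_basis B) = UNIV"
    using vV.extend_basis_superset[OF B(2)] vV.independent_extend_basis[OF B(2)] vV.span_extend_basis[OF B(2)] by auto
  have \<phi>: "lin_on UNIV (sc V) (*) (\<phi> b)" for b
    unfolding \<phi>_def lin_on_def
    by (simp add: vV.representation_add[OF ext(2)] vV.representation_scale[OF ext(2)] ext(3))
  define A where "A = (\<Union>(x, y)\<in>Poly_Mapping.keys t. {b. \<phi> b x \<noteq> 0})"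
  have finA: "finite A"
    unfolding A_def \<phi>_def by (auto intro: vV.finite_representation)
  have x: "x = (\<Sum>b\<in>A \<inter> B. sc V (\<phi> b x) b)" if "(x, y) \<in> Poly_Mapping.keys t" for x y
  proof -
    have "x \<in> vV.span B" using K.ktens_keys[OF t that] B(3) by blast
    then have rep: "vV.representation (vV.extend_basis B) x = vV.representation B x"
      using vV.representation_extend[OF ext(2) _ ext(1)] by simp
    have "x = (\<Sum>b | vV.representation B x b \<noteq> 0. sc V (vV.representation B x b) b)"
      using vV.sum_nonzero_representation_eq[OF B(2) \<open>x \<in> vV.span B\<close>] by simp
    also have "\<dots> = (\<Sum>b\<in>A \<inter> B. sc V (\<phi> b x) b)"
      using that vV.representation_ne_zero[of B x] finA
      by (intro sum.mono_neutral_cong_left) (auto simp: A_def \<phi>_def rep)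
    finally show ?thesis .
  qed
  have "t = lext fsc t (\<lambda>(x, y). ktp V W x y)" by (rule K.ktens_eq_lext[OF t])
  also have "\<dots> = lext fsc t (\<lambda>(x, y). \<Sum>b\<in>A \<inter> B. fsc (\<phi> b x) (ktp V W b y))"
  proof (rule lext_cong2)
    fix x y assume xy: "(x, y) \<in> Poly_Mapping.keys t"
    then have y: "y \<in> car W" using K.ktens_keys[OF t] by blast
    have Bc: "b \<in> car V" if "b \<in> B" for b using that B(1) by blast
    have "ktp V W x y = ktp V W (\<Sum>b\<in>A \<inter> B. sc V (\<phi> b x) b) y" using x[OF xy] by simp
    also have "\<dots> = (\<Sum>b\<in>A \<inter> B. ktp V W (sc V (\<phi> b x) b) y)"
      by (rule lin_on_sum[OF subvsD(1)[OF V] vs_fsc subvsD(2)[OF V] K.ktp_lin1[OF y]]) (simp add: Bc subvsD(5)[OF V])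
    also have "\<dots> = (\<Sum>b\<in>A \<inter> B. fsc (\<phi> b x) (ktp V W b y))"
      by (intro sum.cong refl lin_on_scale[OF K.ktp_lin1[OF y]]) (simp add: Bc)
    finally show "ktp V W x y = (\<Sum>b\<in>A \<inter> B. fsc (\<phi> b x) (ktp V W b y))" .
  qed
  also have "\<dots> = (\<Sum>b\<in>A \<inter> B. lext fsc t (\<lambda>(x, y). fsc (\<phi> b x) (ktp V W b y)))"
    unfolding lext_def case_prod_unfold fsc.scale_sum_right by (rule sum.swap)
  also have "\<dots> = (\<Sum>b\<in>A \<inter> B. ktp V W b (lext (sc W) t (\<lambda>(x, y). sc W (\<phi> b x) y)))"
  proof (rule sum.cong)
    fix b assume "b \<in> A \<inter> B"
    then have b: "b \<in> car V" using B(1) by blast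
    have "ktp V W b (lext (sc W) t (\<lambda>(x, y). sc W (\<phi> b x) y)) = lext fsc t (\<lambda>(x, y). ktp V W b (sc W (\<phi> b x) y))"
      by (rule lin_on_lext_apply2[OF subvsD(1)[OF W] vs_fsc subvsD(2)[OF W] K.ktp_lin2[OF b]])
        (auto dest!: K.ktens_keys[OF t] simp: subvsD(5)[OF W])
    also have "\<dots> = lext fsc t (\<lambda>(x, y). fsc (\<phi> b x) (ktp V W b y))"
      by (intro lext_cong2 lin_on_scale[OF K.ktp_lin2[OF b]]) (auto dest!: K.ktens_keys[OF t])
    finally show "lext fsc t (\<lambda>(x, y). fsc (\<phi> b x) (ktp V W b y)) = ktp V W b (lext (sc W) t (\<lambda>(x, y). sc W (\<phi> b x) y))" ..
  qed simp
  also have "\<dots> = (\<Sum>b\<in>A \<inter> B. ktp V W b 0)" by (simp add: 0[OF \<phi>])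
  also have "\<dots> = 0"
    using lin_on_zero[OF subvsD(1)[OF W] vs_fsc subvsD(2)[OF W] K.ktp_lin2] B(1) by (intro sum.neutral) blast
  finally show ?thesis .
qed

lemma lext_ktens_flip:
  assumes V: "subvs V" and W: "subvs W" and t: "t \<in> car (ktens V W)"
    and s: "vector_space s" and F: "bilin_on (car W) (sc W) (car V) (sc V) s F"
  shows "lext s (lext fsc t (\<lambda>(x, y). ktp W V y x)) (case_prod F) = lext s t (\<lambda>(x, y). F y x)"
proof -
  interpret K: ktensor V W by unfold_locales fact+
  interpret L: ktensor W V by unfold_locales fact+
  show ?thesis
    unfolding lext_lext2[OF s]
    by (rule lext_cong2, drule K.ktens_keys[OF t], rule L.lext_ktp[OF s _ _ F]) auto
qed

lemma ktens_flip:
  assumes V: "subvs V" and W: "subvs W" and t: "t \<in> car (ktens V W)"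
  shows "lext fsc (lext fsc t (\<lambda>(x, y). ktp W V y x)) (\<lambda>(y, x). ktp V W x y) = t"
    and "lext fsc t (\<lambda>(x, y). ktp W V y x) \<in> car (ktens W V)"
proof -
  interpret K: ktensor V W by unfold_locales fact+
  interpret L: ktensor W V by unfold_locales fact+
  show "lext fsc (lext fsc t (\<lambda>(x, y). ktp W V y x)) (\<lambda>(y, x). ktp V W x y) = t"
    using lext_ktens_flip[OF V W t vs_fsc, of "\<lambda>y x. ktp V W x y"]
    by (simp add: bilin_onI K.ktp_lin1 K.ktp_lin2 flip: K.ktens_eq_lext[OF t])
  show "lext fsc t (\<lambda>(x, y). ktp W V y x) \<in> car (ktens W V)"
    by (rule lext_in_subspace[OF vs_fsc]) (use subvsD(2)[OF L.ktens_subvs] L.ktp_in in \<open>auto simp: ktens_def qspace_def\<close>)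
qed

section \<open>Vector fields\<close>

context hopf_calculus
begin

interpretation vH: vector_space "sc H" by (rule vector_space)

abbreviation "VF \<equiv> vector_fields H C"
abbreviation "FS \<equiv> field_space H C"
abbreviation "FT \<equiv> tens H VF VF"

lemma FS_simps [simp]: "car VF = car FS" "sc VF = sc FS" "lact VF a X = (\<lambda>w. a * X w)"
  "w \<in> \<Omega> \<Longrightarrow> ract VF X b w = X (\<iota> b * w)" "w \<notin> \<Omega> \<Longrightarrow> ract VF X b w = 0" "sc FS c X w = sH c (X w)"
  by (simp_all add: vector_fields_def field_space_def)

lemma FS_iff: "X \<in> car FS \<longleftrightarrow> (\<forall>v\<in>\<Omega>. \<forall>w\<in>\<Omega>. X (v + w) = X v + X w) \<and>
    (\<forall>w\<in>\<Omega>. \<forall>a. X (w * \<iota> a) = X w * a) \<and> (\<forall>w. w \<notin> \<Omega> \<longrightarrow> X w = 0)"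
  by (simp add: field_space_def)

lemma FS_D [simp]:
  "X \<in> car FS \<Longrightarrow> v \<in> \<Omega> \<Longrightarrow> w \<in> \<Omega> \<Longrightarrow> X (v + w) = X v + X w"
  "X \<in> car FS \<Longrightarrow> w \<in> \<Omega> \<Longrightarrow> X (w * \<iota> a) = X w * a"
  "X \<in> car FS \<Longrightarrow> w \<notin> \<Omega> \<Longrightarrow> X w = 0"
  by (simp_all add: FS_iff)

lemma scC_eq: "sC c w = w * \<iota> (sH c 1)"
  by (simp add: calc.embed_hom calc.scale_mult)

lemma FS_lin: "X \<in> car FS \<Longrightarrow> lin_on \<Omega> sC sH X"
  by (rule lin_onI) (simp_all add: scC_eq scale_mult)

lemma lin_FS [lin]: "lin_on A s sC f \<Longrightarrow> X \<in> car FS \<Longrightarrow> (\<And>x. x \<in> A \<Longrightarrow> f x \<in> \<Omega>) \<Longrightarrow> lin_on A s sH (\<lambda>x. X (f x))"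
  using lin_on_comp[OF FS_lin, of X A s f] by blast

lemma lin_FS_eval: "lin_on A s (sc FS) f \<Longrightarrow> lin_on A s sH (\<lambda>x. f x w)"
  by (simp add: lin_on_def)

lemma subvs_FS: "subvs FS"
proof -
  have v: "vector_space (sc FS)"
    by unfold_locales (simp_all add: fun_eq_iff vH.scale_right_distrib vH.scale_left_distrib)
  interpret F: vector_space "sc FS" by (rule v)
  have "F.subspace (car FS)"
    unfolding F.subspace_def
  proof (intro conjI allI ballI)
    show "0 \<in> car FS" unfolding FS_iff by (simp add: zero_fun_def)
    show "X + Y \<in> car FS" if "X \<in> car FS" "Y \<in> car FS" for X Y
      unfolding FS_iff by (simp add: that algebra_simps plus_fun_def)
    show "sc FS c X \<in> car FS" if "X \<in> car FS" for c X
      unfolding FS_iff by (simp add: that vH.scale_right_distrib scale_mult)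
  qed
  with v show ?thesis by (simp add: subvs_def)
qed

lemma FS_act [simp]: "X \<in> car FS \<Longrightarrow> (\<lambda>w. a * X w) \<in> car FS" "X \<in> car FS \<Longrightarrow> ract VF X b \<in> car FS"
proof -
  assume X: "X \<in> car FS"
  show "(\<lambda>w. a * X w) \<in> car FS" unfolding FS_iff by (simp add: X algebra_simps)
  have "ract VF X b (v + w) = ract VF X b v + ract VF X b w" if "v \<in> \<Omega>" "w \<in> \<Omega>" for v w
    using X that by (simp add: distrib_left)
  moreover have "ract VF X b (w * \<iota> a) = ract VF X b w * a" if "w \<in> \<Omega>" for w a
    using X that by (simp flip: mult.assoc)
  ultimately show "ract VF X b \<in> car FS" unfolding FS_iff by simp
qed

lemma ract_VF: "ract VF X b = (\<lambda>w. if w \<in> \<Omega> then X (\<iota> b * w) else 0)"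
  by auto

lemma VF_hbimodule: "hbimodule H VF"
proof
  show "subvs VF" using subvs_FS by (simp add: subvs_def)
  show "bilin_on UNIV sH (car VF) (sc VF) (sc VF) (lact VF)"
    by (auto intro!: bilin_onI lin_onI simp: fun_eq_iff algebra_simps scale_mult)
  show "bilin_on (car VF) (sc VF) UNIV sH (sc VF) (ract VF)"
    using lin_on_add[OF FS_lin] lin_on_scale[OF FS_lin]
    by (auto intro!: bilin_onI lin_onI simp: ract_VF fun_eq_iff algebra_simps calc.embed_hom calc.scale_mult vH.scale_zero_right)
  show "ract VF X 1 = X" if "X \<in> car VF" for X
    using that by (auto simp: ract_VF calc.embed_hom fun_eq_iff)
  show "ract VF X (a * b) = ract VF (ract VF X a) b" for X a b
    by (auto simp: ract_VF calc.embed_hom fun_eq_iff mult.assoc)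
  show "ract VF X a \<in> car VF" if "X \<in> car VF" for X a using that by simp
qed (auto simp: ract_VF fun_eq_iff mult.assoc)

sublocale VF: hbimodule H VF by (rule VF_hbimodule)
sublocale VV: hbimodule_pair H VF VF ..
sublocale FT: hbimodule H FT by (rule VV.tens_hbimodule)
sublocale FO: hbimodule_pair H FT Om ..
sublocale OF: hbimodule_pair H Om FT ..
sublocale HF: ktensor H FS by unfold_locales (rule subvs_H subvs_FS)+
sublocale FH: ktensor FS H by unfold_locales (rule subvs_H subvs_FS)+
sublocale HFT: ktensor H FT by unfold_locales (rule subvs_H FT.subvs)+
sublocale FTH: ktensor FT H by unfold_locales (rule subvs_H FT.subvs)+

abbreviation vtensor (infixl "\<otimes>\<^sub>V" 70) where "X \<otimes>\<^sub>V Y \<equiv> htp VF VF X Y"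
abbreviation "pair \<equiv> pair2 H C"

lemmas FT_closed [simp] = VV.htp_in[where H=H] FT.lact_closed FT.ract_closed

definition pair_field :: "('w \<Rightarrow> 'h) \<Rightarrow> ('w \<Rightarrow> 'h) \<Rightarrow> ('w \<times> 'w \<Rightarrow>\<^sub>0 'k) \<Rightarrow> 'h" where
  "pair_field X Y t = lext sH t (\<lambda>(v, w). X (\<iota> (Y v) * w))"

lemma pair_eq: "t \<in> car W2 \<Longrightarrow> pair G t = lext sH G (\<lambda>(X, Y). pair_field X Y t)"
  unfolding pair2_def pair_field_def by (intro lext_cong2) auto

lemma pair_field_htp [simp]:
  "X \<in> car FS \<Longrightarrow> Y \<in> car FS \<Longrightarrow> x \<in> \<Omega> \<Longrightarrow> y \<in> \<Omega> \<Longrightarrow> pair_field X Y (x \<otimes> y) = X (\<iota> (Y x) * y)"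
  unfolding pair_field_def
  by (rule lext_OO) (auto intro!: bilin_onI lin simp: calc.embed_hom mult.assoc)

lemma pair_field_add [simp]: "pair_field X Y (t + u) = pair_field X Y t + pair_field X Y u"
  by (simp add: pair_field_def lext_add[OF vs_H])

lemma pair_lin [lin]: "lin_on A s fsc f \<Longrightarrow> lin_on A s sH (\<lambda>x. pair G (f x))"
  and pair_lin1 [lin]: "lin_on A s fsc f' \<Longrightarrow> lin_on A s sH (\<lambda>x. pair (f' x) t)"
  unfolding pair2_def by (intro lin, assumption)+

lemma pair_add [simp]: "pair G (t + u) = pair G t + pair G u" "pair (F + G) t = pair F t + pair G t"
  using lin_on_add[OF pair_lin[OF lin_on_id], of _ UNIV] lin_on_add[OF pair_lin1[OF lin_on_id], of _ UNIV] by auto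

lemma pair_diff [simp]: "pair G (t - u) = pair G t - pair G u"
  by (rule lin_on_diff[OF vs_fsc vs_H fsc.subspace_UNIV pair_lin[OF lin_on_id]]) simp_all

lemma pair_htp:
  assumes X: "X \<in> car FS" and Y: "Y \<in> car FS" and t: "t \<in> car W2"
  shows "pair (X \<otimes>\<^sub>V Y) t = pair_field X Y t"
  unfolding pair_eq[OF t]
proof (rule VV.lext_htp[OF vs_H])
  have 1: "lin_on (car FS) (sc FS) sH (\<lambda>X. pair_field X Y t)" for Y
    unfolding pair_field_def by (intro lin_on_lext2[OF vs_H] lin_FS_eval[OF lin_on_id])
  have 2: "lin_on (car FS) (sc FS) sH (\<lambda>Y. X (\<iota> (Y v) * w))" if "X \<in> car FS" "w \<in> \<Omega>" for X v w
    by (rule lin_FS[OF _ that(1)]) (use that in \<open>auto intro!: lin_multC1 lin_\<iota> lin_FS_eval[OF lin_on_id]\<close>)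
  show "bilin VF VF sH (\<lambda>X Y. pair_field X Y t)"
    using 1 by (auto intro!: bilin_onI) (unfold pair_field_def, intro lin_on_lext2[OF vs_H] 2, use t in auto)
  show "pair_field (ract VF X a) Y t = pair_field X (lact VF a Y) t" if "X \<in> car VF" "Y \<in> car VF" for X Y a
    unfolding pair_field_def using t by (intro lext_cong2) (auto simp: calc.embed_hom mult.assoc)
qed (use X Y in simp_all)

lemma FT_induct [consumes 1, case_names htp add]:
  "G \<in> car FT \<Longrightarrow> (\<And>X Y. X \<in> car FS \<Longrightarrow> Y \<in> car FS \<Longrightarrow> P (X \<otimes>\<^sub>V Y)) \<Longrightarrow>
    (\<And>t u. t \<in> car FT \<Longrightarrow> u \<in> car FT \<Longrightarrow> P t \<Longrightarrow> P u \<Longrightarrow> P (t + u)) \<Longrightarrow> P G"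
  using VV.tens_induct[of G H P] by simp

lemma FT_htp_act [simp]:
  "X \<in> car FS \<Longrightarrow> Y \<in> car FS \<Longrightarrow> lact FT a (X \<otimes>\<^sub>V Y) = (\<lambda>w. a * X w) \<otimes>\<^sub>V Y"
  "X \<in> car FS \<Longrightarrow> Y \<in> car FS \<Longrightarrow> ract FT (X \<otimes>\<^sub>V Y) a = X \<otimes>\<^sub>V ract VF Y a"
  using VV.lact_htp[of X Y a] VV.ract_htp[of X Y a] by simp_all

lemma pair_act:
  assumes G: "G \<in> car FT" and t: "t \<in> car W2"
  shows "pair (lact FT a G) t = a * pair G t"
    and "pair (ract FT G a) t = pair G (lact W2 a t)"
    and "pair G (ract W2 t a) = pair G t * a"
proof -
  have *: "pair_field (\<lambda>w. a * X w) Y t = a * pair_field X Y t \<and>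
     pair_field X (ract VF Y a) t = pair_field X Y (lact W2 a t) \<and>
     pair_field X Y (ract W2 t a) = pair_field X Y t * a"
    if XY: "X \<in> car FS" "Y \<in> car FS" for X Y
    using t XY
  proof (induction t rule: W2_induct)
    case (htp x y)
    then show ?case using FS_D(2)[OF htp(3), of "\<iota> (Y x) * y" a] by (simp add: mult.assoc)
  qed (simp_all add: algebra_simps)
  have "pair (lact FT a G) t = a * pair G t \<and> pair (ract FT G a) t = pair G (lact W2 a t) \<and>
    pair G (ract W2 t a) = pair G t * a"
    using G
  proof (induction G rule: FT_induct)
    case (htp X Y)
    then show ?case using * t by (simp add: pair_htp)
  qed (simp_all add: algebra_simps)
  then show "pair (lact FT a G) t = a * pair G t" "pair (ract FT G a) t = pair G (lact W2 a t)"
    "pair G (ract W2 t a) = pair G t * a" by auto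
qed

subsection \<open>Uniqueness of coactions given by their values\<close>

lemma ktens_maps_unique:
  fixes L :: "('k, 'w \<Rightarrow> 'v::ab_group_add) vect" and W :: "('k, 'v, 'x) vect_scheme"
  assumes W: "subvs W" and L: "subvs L" and scL: "\<And>c f x. sc L c f x = sc W c (f x)"
    and ev: "\<And>E m. E \<in> car L \<Longrightarrow> m \<in> \<Omega> \<Longrightarrow> E m \<in> car W"
    and ext: "\<And>E. E \<in> car L \<Longrightarrow> (\<And>m. m \<in> \<Omega> \<Longrightarrow> E m = 0) \<Longrightarrow> E = 0"
    and t: "t \<in> car (ktens H L)" and u: "u \<in> car (ktens H L)"
    and eq: "\<And>m. m \<in> \<Omega> \<Longrightarrow> swe t (\<lambda>(h, E). ktp H W h (E m)) = swe u (\<lambda>(h, E). ktp H W h (E m))"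
  shows "t = u"
proof -
  interpret K: ktensor H L by unfold_locales (rule subvs_H L)+
  interpret KW: ktensor H W by unfold_locales (rule subvs_H W)+
  interpret vW: vector_space "sc W" by (rule subvsD(1)[OF W])
  note KL = subvsD[OF K.ktens_subvs, unfolded sc_ktens]
  have evlin: "lin_on (car L) (sc L) (sc W) (\<lambda>E. E m)" for m
    by (simp add: lin_on_def scL)
  have d: "t - u \<in> car (ktens H L)" using KL(4)[OF t u] .
  have "t - u = 0"
  proof (rule ktens_separation[OF subvs_H L d])
    fix \<phi> :: "'h \<Rightarrow> 'k" assume \<phi>: "lin_on UNIV sH (*) \<phi>"
    let ?E = "lext (sc L) (t - u) (\<lambda>(h, E). sc L (\<phi> h) E)"
    have keys: "E \<in> car L" if "(h, E) \<in> Poly_Mapping.keys (t - u)" for h E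
      using K.ktens_keys[OF d that] by blast
    have "?E m = 0" if m: "m \<in> \<Omega>" for m
    proof -
      have \<phi>1: "lin_on UNIV sH (sc W) (\<lambda>h. sc W (\<phi> h) y)" for y
        using \<phi> by (simp add: lin_on_def vW.scale_left_distrib)
      have \<phi>2: "lin_on (car W) (sc W) (sc W) (\<lambda>y. sc W (\<phi> h) y)" for h
        by (intro lin_on_scale_fun[OF subvsD(1)[OF W]] lin_on_id)
      have "?E m = lext (sc W) (t - u) (\<lambda>(h, E). sc W (\<phi> h) (E m))"
        by (subst lin_on_lext_apply2[OF subvsD(1)[OF L] subvsD(1)[OF W] subvsD(2)[OF L] evlin])
          (auto simp: keys subvsD(5)[OF L] scL)
      also have "\<dots> = lext (sc W) (swe (t - u) (\<lambda>(h, E). ktp H W h (E m))) (\<lambda>(h, y). sc W (\<phi> h) y)"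
        unfolding lext_lext2[OF subvsD(1)[OF W]]
        by (intro lext_cong2 KW.lext_ktp[symmetric, OF subvsD(1)[OF W]])
          (auto intro!: bilin_onI \<phi>2 lin_on_subset[OF \<phi>1] ev keys m)
      also have "swe (t - u) (\<lambda>(h, E). ktp H W h (E m)) = 0"
        by (simp add: lext_diff[OF vs_fsc] eq m)
      finally show ?thesis by (simp add: lext_0[OF subvsD(1)[OF W]])
    qed
    moreover have "?E \<in> car L"
      by (rule lext_in_subspace[OF subvsD(1,2)[OF L]]) (auto simp: keys subvsD(5)[OF L])
    ultimately show "?E = 0" by (intro ext)
  qed
  then show ?thesis by simp
qed

end

section \<open>Metrics\<close>

locale hopf_metric = hopf_calculus_diag H C
  for H :: "('k::field, 'h::ring_1) hopf" and C :: "('k, 'w::ring_1, 'h) calc" +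
  fixes g :: "('w \<Rightarrow> 'h) \<times> ('w \<Rightarrow> 'h) \<Rightarrow>\<^sub>0 'k"
  assumes metric: "is_metric H C g" and central: "sigma_central H C g"
    and nonzero: "\<exists>t\<in>eigenspace H C 1. t \<noteq> 0"
begin

interpretation vH: vector_space "sc H" by (rule vector_space)
interpretation vC: vector_space "sc C" by (rule calc.vector_space)

interpretation vFS: vector_space "sc (field_space H C)" by (rule subvsD(1)[OF subvs_FS])

abbreviation "\<gamma> \<equiv> pair g"
abbreviation "shp \<equiv> sharp H C g"

lemma g_in [simp]: "g \<in> car FT" and braid_g: "braid H VF VF g = g"
  using metric by (simp_all add: is_metric_def field_vee_def)

lemma g_keys: "(X, Y) \<in> Poly_Mapping.keys g \<Longrightarrow> X \<in> car FS \<and> Y \<in> car FS"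
  using VV.tens_keys[OF g_in] by simp

lemma shp_bij: "bij_betw shp \<Omega> (car FS)"
  and shp_add: "v \<in> \<Omega> \<Longrightarrow> w \<in> \<Omega> \<Longrightarrow> shp (v + w) = shp v + shp w"
  and shp_ract: "w \<in> \<Omega> \<Longrightarrow> shp (w * \<iota> a) = ract VF (shp w) a"
  using metric by (simp_all add: is_metric_def)

lemma shp_inj: "shp v = shp w \<Longrightarrow> v \<in> \<Omega> \<Longrightarrow> w \<in> \<Omega> \<Longrightarrow> v = w"
  using inj_onD[OF bij_betw_imp_inj_on[OF shp_bij]] .

lemma shp_FS: "w \<in> \<Omega> \<Longrightarrow> shp w \<in> car FS"
  using shp_bij by (rule bij_betwE[THEN bspec])

lemma shp_eval:
  assumes "z \<in> \<Omega>" "w \<in> \<Omega>"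
  shows "shp z w = \<gamma> (z \<otimes> w)"
proof -
  have "shp z w = lext sH g (\<lambda>(X, Y). ract VF X (Y z) w)"
    unfolding sharp_def
    by (rule lin_on_lext_apply2[OF subvsD(1)[OF subvs_FS] vs_H vFS.subspace_UNIV lin_FS_eval[OF lin_on_id]]) simp
  also have "\<dots> = \<gamma> (z \<otimes> w)"
    using assms by (subst pair_eq) (auto intro!: lext_cong2 dest!: g_keys)
  finally show ?thesis .
qed

definition eb :: "('w \<Rightarrow> 'h) \<times> ('w \<Rightarrow> 'h) \<Rightarrow> 'w" where
  "eb p = inv_into \<Omega> shp (sc FS (Poly_Mapping.lookup g p) (fst p))"

definition zb :: "('w \<Rightarrow> 'h) \<times> ('w \<Rightarrow> 'h) \<Rightarrow> 'w" where
  "zb p = inv_into \<Omega> shp (snd p)"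

abbreviation "K \<equiv> Poly_Mapping.keys g"

lemma inv_shp: "X \<in> car FS \<Longrightarrow> inv_into \<Omega> shp X \<in> \<Omega> \<and> shp (inv_into \<Omega> shp X) = X"
  using f_inv_into_f[of X shp \<Omega>] inv_into_into[of X shp \<Omega>] bij_betw_imp_surj_on[OF shp_bij] by simp

lemma eb_in [simp]: "p \<in> K \<Longrightarrow> eb p \<in> \<Omega>" and shp_eb: "p \<in> K \<Longrightarrow> shp (eb p) = sc FS (Poly_Mapping.lookup g p) (fst p)"
  and zb_in [simp]: "p \<in> K \<Longrightarrow> zb p \<in> \<Omega>" and shp_zb: "p \<in> K \<Longrightarrow> shp (zb p) = snd p"
  unfolding eb_def zb_def using inv_shp g_keys[of "fst p" "snd p"] subvsD(5)[OF subvs_FS] by auto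

lemma snd_FS: "p \<in> K \<Longrightarrow> snd p \<in> car FS"
  using g_keys[of "fst p" "snd p"] by simp

lemma \<Omega>_sum: "(\<And>i. i \<in> I \<Longrightarrow> f i \<in> \<Omega>) \<Longrightarrow> (\<Sum>i\<in>I. f i) \<in> \<Omega>"
  using vC.subspace_sum[OF \<Omega>_subspace] by blast

lemma dual_basis: "w \<in> \<Omega> \<Longrightarrow> w = (\<Sum>p\<in>K. eb p * \<iota> (snd p w))"
proof -
  assume w: "w \<in> \<Omega>"
  let ?w = "\<Sum>p\<in>K. eb p * \<iota> (snd p w)"
  have "shp 0 + shp 0 = shp 0" using shp_add[of 0 0] by simp
  then have s0: "shp 0 = 0" by (metis add_cancel_right_right)
  have "shp (\<Sum>p\<in>I. eb p * \<iota> (snd p w)) = (\<Sum>p\<in>I. shp (eb p * \<iota> (snd p w)))" if "finite I" "I \<subseteq> K" for I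
    using that
  proof induction
    case (insert p I)
    then have pI: "p \<in> K" "I \<subseteq> K" by auto
    then have "(\<Sum>p\<in>I. eb p * \<iota> (snd p w)) \<in> \<Omega>" by (intro \<Omega>_sum) auto
    then show ?case using insert pI by (simp add: shp_add)
  qed (simp add: s0)
  then have "shp ?w = (\<Sum>p\<in>K. shp (eb p * \<iota> (snd p w)))" by simp
  also have "\<dots> = (\<Sum>p\<in>K. sc FS (Poly_Mapping.lookup g p) (ract VF (fst p) (snd p w)))"
    by (intro sum.cong) (auto simp: shp_ract shp_eb fun_eq_iff ract_VF)
  also have "\<dots> = shp w" by (simp add: sharp_def lext_def case_prod_unfold)
  finally have "shp ?w = shp w" .
  moreover have "?w \<in> \<Omega>" by (rule \<Omega>_sum) simp
  ultimately show "w = ?w" using shp_inj[of ?w w] w by simp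
qed

lemma \<gamma>_zb: "p \<in> K \<Longrightarrow> w \<in> \<Omega> \<Longrightarrow> \<gamma> (zb p \<otimes> w) = snd p w"
  by (simp add: shp_zb flip: shp_eval)

lemma \<gamma>_nondegenerate: "z \<in> \<Omega> \<Longrightarrow> (\<And>w. w \<in> \<Omega> \<Longrightarrow> \<gamma> (z \<otimes> w) = 0) \<Longrightarrow> z = 0"
proof -
  assume z: "z \<in> \<Omega>" "\<And>w. w \<in> \<Omega> \<Longrightarrow> \<gamma> (z \<otimes> w) = 0"
  have FS: "shp z \<in> car FS" using shp_FS[OF z(1)] .
  have "shp z w = shp (z + z) w" for w
    using z FS shp_eval[OF z(1), of w] by (cases "w \<in> \<Omega>") (simp_all add: shp_add)
  then have "z = z + z" using z(1) by (intro shp_inj ext) simp_all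
  then show "z = 0" by simp
qed

lemma ktens_maps_exist:
  fixes L :: "('k, 'w \<Rightarrow> 'v::ab_group_add) vect" and W :: "('k, 'v, 'x) vect_scheme"
  assumes W: "subvs W" and L: "subvs L" and scL: "\<And>c f x. sc L c f x = sc W c (f x)"
    and ev: "\<And>E m. E \<in> car L \<Longrightarrow> m \<in> \<Omega> \<Longrightarrow> E m \<in> car W"
    and E: "\<And>s Y. s \<in> car W \<Longrightarrow> Y \<in> car FS \<Longrightarrow> (\<lambda>m. if m \<in> \<Omega> then r s (Y m) else 0) \<in> car L"
    and Q: "\<And>w. w \<in> \<Omega> \<Longrightarrow> Q w \<in> car (ktens H W)" "lin_on \<Omega> sC fsc Q"
      "\<And>w b. w \<in> \<Omega> \<Longrightarrow> Q (w * \<iota> b) = swe (Q w) (\<lambda>(h, s). ktp H W h (r s b))"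
  shows "\<exists>t\<in>car (ktens H L). \<forall>m\<in>\<Omega>. swe t (\<lambda>(h, E). ktp H W h (E m)) = Q m"
proof -
  interpret K: ktensor H L by unfold_locales (rule subvs_H L)+
  interpret KW: ktensor H W by unfold_locales (rule subvs_H W)+
  let ?E = "\<lambda>p s m. if m \<in> \<Omega> then r s (snd p m) else 0"
  define t where "t = (\<Sum>p\<in>K. swe (Q (eb p)) (\<lambda>(h, s). ktp H L h (?E p s)))"
  have sub: "fsc.subspace (car (ktens H L))" using subvsD(2)[OF K.ktens_subvs] by simp
  have "t \<in> car (ktens H L)"
    unfolding t_def by (auto intro!: fsc.subspace_sum[OF sub] lext_in_subspace[OF vs_fsc sub] K.ktp_in)
  moreover have "swe t (\<lambda>(h, E). ktp H W h (E m)) = Q m" if m: "m \<in> \<Omega>" for m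
  proof -
    have evlin: "lin_on (car L) (sc L) (sc W) (\<lambda>E. E m)" by (simp add: lin_on_def scL)
    have bil: "bilin H L fsc (\<lambda>h E. ktp H W h (E m))"
      using ev m by (auto intro!: bilin_onI KW.ktp_lin1 lin_on_comp[OF KW.ktp_lin2 evlin])
    have "swe t (\<lambda>(h, E). ktp H W h (E m)) =
        (\<Sum>p\<in>K. swe (Q (eb p)) (\<lambda>(h, s). swe (ktp H L h (?E p s)) (\<lambda>(h, E). ktp H W h (E m))))"
      by (simp add: t_def lext_sum[OF vs_fsc] lext_lext2[OF vs_fsc])
    also have "\<dots> = (\<Sum>p\<in>K. swe (Q (eb p)) (\<lambda>(h, s). ktp H W h (?E p s m)))"
    proof (intro sum.cong refl lext_cong2)
      fix p h s assume p: "p \<in> K" and hs: "(h, s) \<in> Poly_Mapping.keys (Q (eb p))"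
      then have "s \<in> car W" using KW.ktens_keys[OF Q(1)[OF eb_in[OF p]]] by blast
      then show "swe (ktp H L h (?E p s)) (\<lambda>(h, E). ktp H W h (E m)) = ktp H W h (?E p s m)"
        by (intro K.lext_ktp[OF vs_fsc _ _ bil]) (simp_all add: E snd_FS p)
    qed
    also have "\<dots> = (\<Sum>p\<in>K. Q (eb p * \<iota> (snd p m)))"
      using m by (intro sum.cong) (simp_all add: Q(3))
    also have "\<dots> = Q (\<Sum>p\<in>K. eb p * \<iota> (snd p m))"
      by (rule lin_on_sum[symmetric, OF vs_C vs_fsc \<Omega>_subspace Q(2)]) simp
    finally show ?thesis using dual_basis[OF m] by simp
  qed
  ultimately show ?thesis by blast
qed

subsection \<open>Coactions of vector fields\<close>

definition cvl :: "('w \<Rightarrow> 'h) \<Rightarrow> 'w \<Rightarrow> ('h \<times> 'h \<Rightarrow>\<^sub>0 'k)" where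
  "cvl X w = swe (cl w) (\<lambda>(k, w0). swe (\<Delta> (X w0)) (\<lambda>(x1, x0). ktp H H (x1 * T k) x0))"

definition cvr :: "('w \<Rightarrow> 'h) \<Rightarrow> 'w \<Rightarrow> ('h \<times> 'h \<Rightarrow>\<^sub>0 'k)" where
  "cvr X w = swe (cr w) (\<lambda>(w0, k). swe (\<Delta> (X w0)) (\<lambda>(x0, x1). ktp H H x0 (x1 * S k)))"

lemma lin_HH [lin]: "lin_on A s sH f \<Longrightarrow> lin_on A s fsc (\<lambda>x. ktp H H (f x) y)"
  "lin_on A s sH f \<Longrightarrow> lin_on A s fsc (\<lambda>x. ktp H H y (f x))"
  using lin_compU[of sH fsc _ A s f] HH.ktp_lin1[of y] HH.ktp_lin2[of y] by (auto simp: car_UNIV)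

lemma cvl_lin: "X \<in> car FS \<Longrightarrow> lin_on \<Omega> sC fsc (cvl X)" and cvr_lin: "X \<in> car FS \<Longrightarrow> lin_on \<Omega> sC fsc (cvr X)"
  unfolding cvl_def cvr_def by (auto intro!: lin)

lemma swe_HH_in: "(\<And>a b. f a b \<in> car (ktens H H)) \<Longrightarrow> swe p (case_prod f) \<in> car (ktens H H)"
  by (rule lext_in_subspace[OF vs_fsc]) (use subvsD(2)[OF HH.ktens_subvs] in auto)

lemma cvl_in: "cvl X w \<in> car (ktens H H)" and cvr_in: "cvr X w \<in> car (ktens H H)"
  unfolding cvl_def cvr_def by (auto intro!: swe_HH_in HH.ktp_in)

lemma cvl_lco:
  assumes X: "X \<in> car FS" and m: "m \<in> lco"
  shows "cvl X (m * \<iota> c) = swe (\<Delta> (X m)) (\<lambda>(x, y). ktp H H x (y * c))"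
proof -
  have "cvl X (m * \<iota> c) = swe (\<Delta> c) (\<lambda>(c1, c2). swe (\<Delta> (X m * c2)) (\<lambda>(x1, x0). ktp H H (x1 * T c1) x0))"
    unfolding cvl_def cl_lco_right[OF m] lext_lext2[OF vs_fsc]
    using X m by (intro lext_cong2, subst lext_HO[OF vs_fsc]) (auto intro!: bilin_onI lin)
  also have "\<dots> = swe (\<Delta> c) (\<lambda>(c1, c2). swe (\<Delta> (X m)) (\<lambda>(x, y). swe (\<Delta> c2) (\<lambda>(u, v). ktp H H (x * (u * T c1)) (y * v))))"
    by (intro lext_cong2, subst lext_\<Delta>_mult[OF vs_fsc]) (auto intro!: bilin_onI lin simp: mult.assoc)
  also have "\<dots> = swe (\<Delta> (X m)) (\<lambda>(x, y). swe (\<Delta> c) (\<lambda>(c1, c2). swe (\<Delta> c2) (\<lambda>(u, v). ktp H H (x * (u * T c1)) (y * v))))"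
    by (rule lext_swap2[OF vs_fsc])
  also have "\<dots> = swe (\<Delta> (X m)) (\<lambda>(x, y). swe (\<Delta> c) (\<lambda>(c', v). swe (\<Delta> c') (\<lambda>(c1, u). ktp H H (x * (u * T c1)) (y * v))))"
    by (intro lext_cong2 coassoc[symmetric]) (intro lin)+
  also have "\<dots> = swe (\<Delta> (X m)) (\<lambda>(x, y). ktp H H (x * 1) (y * c))"
    by (intro lext_cong2 cancel_left[OF cancels_T(2) vs_fsc]) (intro lin)+
  finally show ?thesis by simp
qed

lemma cvr_rco:
  assumes X: "X \<in> car FS" and n: "n \<in> rco"
  shows "cvr X (n * \<iota> c) = swe (\<Delta> (X n)) (\<lambda>(x, y). ktp H H (x * c) y)"
proof -
  have "cvr X (n * \<iota> c) = swe (\<Delta> c) (\<lambda>(c1, c2). swe (\<Delta> (X n * c1)) (\<lambda>(x0, x1). ktp H H x0 (x1 * S c2)))"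
    unfolding cvr_def cr_rco_right[OF n] lext_lext2[OF vs_fsc]
    using X n by (intro lext_cong2, subst lext_OH[OF vs_fsc]) (auto intro!: bilin_onI lin)
  also have "\<dots> = swe (\<Delta> c) (\<lambda>(c1, c2). swe (\<Delta> (X n)) (\<lambda>(x, y). swe (\<Delta> c1) (\<lambda>(u, v). ktp H H (x * u) (y * (v * S c2)))))"
    by (intro lext_cong2, subst lext_\<Delta>_mult[OF vs_fsc]) (auto intro!: bilin_onI lin simp: mult.assoc)
  also have "\<dots> = swe (\<Delta> (X n)) (\<lambda>(x, y). swe (\<Delta> c) (\<lambda>(c1, c2). swe (\<Delta> c1) (\<lambda>(u, v). ktp H H (x * u) (y * (v * S c2)))))"
    by (rule lext_swap2[OF vs_fsc])
  also have "\<dots> = swe (\<Delta> (X n)) (\<lambda>(x, y). swe (\<Delta> c) (\<lambda>(u, c'). swe (\<Delta> c') (\<lambda>(v, c2). ktp H H (x * u) (y * (v * S c2)))))"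
    by (intro lext_cong2 coassoc) (intro lin)+
  also have "\<dots> = swe (\<Delta> (X n)) (\<lambda>(x, y). ktp H H (x * c) (y * 1))"
    by (intro lext_cong2 cancel_right[OF cancels_S_right vs_fsc]) (intro lin)+
  finally show ?thesis by simp
qed

lemma lext_ktp_swe:
  "vector_space s \<Longrightarrow> hbilin s F \<Longrightarrow>
    lext s (swe p (\<lambda>(x, y). ktp H H (f x y) (f' x y))) (case_prod F) = lext s p (\<lambda>(x, y). F (f x y) (f' x y))"
  by (simp add: lext_lext2 lext_ktp_H)

lemma cvl_ract:
  assumes X: "X \<in> car FS" and w: "w \<in> \<Omega>"
  shows "cvl X (w * \<iota> b) = swe (cvl X w) (\<lambda>(h, s). ktp H H h (s * b))"
  using w
proof (induction w rule: \<Omega>_induct_LH)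
  case (add x y)
  then show ?case
    using lin_on_add[OF cvl_lin[OF X]] by (simp add: distrib_right lext_add[OF vs_fsc])
next
  case (gen c m)
  have "cvl X (m * \<iota> (c * b)) = swe (cvl X (m * \<iota> c)) (\<lambda>(h, s). ktp H H h (s * b))"
    unfolding cvl_lco[OF X gen]
    by (subst lext_ktp_swe) (auto intro!: bilin_onI lin simp: mult.assoc)
  then show ?case by (simp add: calc.embed_hom mult.assoc)
qed

lemma cvr_ract:
  assumes X: "X \<in> car FS" and w: "w \<in> \<Omega>"
  shows "cvr X (w * \<iota> b) = swe (cvr X w) (\<lambda>(s, h). ktp H H (s * b) h)"
  using w
proof (induction w rule: \<Omega>_induct_RH)
  case (add x y)
  then show ?case
    using lin_on_add[OF cvr_lin[OF X]] by (simp add: distrib_right lext_add[OF vs_fsc])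
next
  case (gen c n)
  have "cvr X (n * \<iota> (c * b)) = swe (cvr X (n * \<iota> c)) (\<lambda>(s, h). ktp H H (s * b) h)"
    unfolding cvr_rco[OF X gen]
    by (subst lext_ktp_swe) (auto intro!: bilin_onI lin simp: mult.assoc)
  then show ?case by (simp add: calc.embed_hom mult.assoc)
qed

lemma FS_E: "Y \<in> car FS \<Longrightarrow> (\<lambda>m. if m \<in> \<Omega> then s * Y m else 0) \<in> car FS"
proof -
  assume Y: "Y \<in> car FS"
  have "(\<lambda>m. if m \<in> \<Omega> then s * Y m else 0) = (\<lambda>m. s * Y m)" using Y by auto
  then show ?thesis using FS_act(1)[OF Y] by simp
qed

lemma FS_ext: "E \<in> car FS \<Longrightarrow> (\<And>m. m \<in> \<Omega> \<Longrightarrow> E m = 0) \<Longrightarrow> E = 0"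
proof (rule ext)
  fix m assume "E \<in> car FS" "\<And>m. m \<in> \<Omega> \<Longrightarrow> E m = 0"
  then show "E m = 0 m" by (cases "m \<in> \<Omega>") (simp_all add: zero_fun_def)
qed

lemmas FS_maps_unique = ktens_maps_unique[OF subvs_H subvs_FS FS_simps(6) car_H FS_ext]

lemma the_rule: "\<exists>t. P t \<Longrightarrow> (\<And>t u. P t \<Longrightarrow> P u \<Longrightarrow> t = u) \<Longrightarrow> P (THE t. P t)"
  by (blast intro: theI)

lemma lcoact_VF:
  assumes X: "X \<in> car FS"
  shows "lcoact VF X \<in> car (ktens H FS)"
    and "w \<in> \<Omega> \<Longrightarrow> swe (lcoact VF X) (\<lambda>(h, Y). ktp H H h (Y w)) = cvl X w"
proof -
  let ?P = "\<lambda>t. t \<in> car (ktens H FS) \<and> (\<forall>w\<in>\<Omega>. swe t (\<lambda>(h, Y). ktp H H h (Y w)) = cvl X w)"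
  have "\<exists>t. ?P t"
    using ktens_maps_exist[OF subvs_H subvs_FS FS_simps(6) car_H FS_E cvl_in cvl_lin[OF X] cvl_ract[OF X]] by blast
  moreover have "t = u" if "?P t" "?P u" for t u
    using that by (intro FS_maps_unique) auto
  ultimately have "?P (THE t. ?P t)" by (rule the_rule)
  moreover have "lcoact VF X = (THE t. ?P t)" by (simp add: vector_fields_def cvl_def)
  ultimately have "?P (lcoact VF X)" by simp
  then show "lcoact VF X \<in> car (ktens H FS)"
    "w \<in> \<Omega> \<Longrightarrow> swe (lcoact VF X) (\<lambda>(h, Y). ktp H H h (Y w)) = cvl X w" by auto
qed

lemma flip_HH: "t \<in> car (ktens H H) \<Longrightarrow> swe (swe t (\<lambda>(x, y). ktp H H y x)) (\<lambda>(x, y). ktp H H y x) = t"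
  using ktens_flip(1)[OF subvs_H subvs_H] by blast

lemma rcoact_VF:
  assumes X: "X \<in> car FS"
  shows "rcoact VF X \<in> car (ktens FS H)"
    and "w \<in> \<Omega> \<Longrightarrow> swe (rcoact VF X) (\<lambda>(Y, h). ktp H H (Y w) h) = cvr X w"
proof -
  let ?P = "\<lambda>t. t \<in> car (ktens FS H) \<and> (\<forall>w\<in>\<Omega>. swe t (\<lambda>(Y, h). ktp H H (Y w) h) = cvr X w)"
  let ?Q = "\<lambda>w. swe (cvr X w) (\<lambda>(x, y). ktp H H y x)"
  have flip: "swe (swe p (\<lambda>(x, y). ktp H H (f x y) (f' x y))) (\<lambda>(x, y). ktp H H y x) = swe p (\<lambda>(x, y). ktp H H (f' x y) (f x y))"
    for p and f f' :: "'a \<Rightarrow> 'b \<Rightarrow> 'h"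
    by (rule lext_ktp_swe[OF vs_fsc]) (auto intro!: bilin_onI lin)
  have bil: "bilin FS H fsc (\<lambda>Y h. ktp H H (Y w) h)" "bilin H FS fsc (\<lambda>h Y. ktp H H (Y w) h)" "bilin FS H fsc (\<lambda>Y h. ktp H H h (Y w))" for w
    by (auto intro!: bilin_onI lin lin_FS_eval[OF lin_on_id] simp: car_UNIV)
  have Q3: "?Q (w * \<iota> b) = swe (?Q w) (\<lambda>(h, s). ktp H H h (s * b))" if "w \<in> \<Omega>" for w b
    unfolding cvr_ract[OF X that] flip
    by (subst lext_ktp_swe[OF vs_fsc]) (auto intro!: bilin_onI lin)
  have "\<exists>t\<in>car (ktens H FS). \<forall>m\<in>\<Omega>. swe t (\<lambda>(h, E). ktp H H h (E m)) = ?Q m"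
    by (rule ktens_maps_exist[OF subvs_H subvs_FS FS_simps(6) car_H FS_E _ _ Q3])
      (auto intro!: swe_HH_in HH.ktp_in lin_on_lext_arg[OF vs_fsc cvr_lin[OF X]])
  then obtain t where t: "t \<in> car (ktens H FS)" "\<And>m. m \<in> \<Omega> \<Longrightarrow> swe t (\<lambda>(h, E). ktp H H h (E m)) = ?Q m" by blast
  let ?t = "swe t (\<lambda>(x, y). ktp FS H y x)"
  have "swe ?t (\<lambda>(Y, h). ktp H H (Y w) h) = cvr X w" if w: "w \<in> \<Omega>" for w
  proof -
    have "swe ?t (\<lambda>(Y, h). ktp H H (Y w) h) = swe t (\<lambda>(h, Y). ktp H H (Y w) h)"
      by (rule lext_ktens_flip[OF subvs_H subvs_FS t(1) vs_fsc bil(1)])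
    also have "\<dots> = swe (swe t (\<lambda>(h, Y). ktp H H h (Y w))) (\<lambda>(x, y). ktp H H y x)" by (simp add: flip)
    also have "\<dots> = cvr X w" by (simp add: t(2)[OF w] flip_HH cvr_in)
    finally show ?thesis .
  qed
  then have "?P ?t" using ktens_flip(2)[OF subvs_H subvs_FS t(1)] by blast
  then have "\<exists>t. ?P t" by (rule exI[of ?P])
  moreover have "t = u" if t: "?P t" and u: "?P u" for t u
  proof -
    have *: "swe (swe t (\<lambda>(x, y). ktp H FS y x)) (\<lambda>(h, Y). ktp H H h (Y w)) = ?Q w"
      if t: "?P t" and w: "w \<in> \<Omega>" for t w
    proof -
      have "swe (swe t (\<lambda>(x, y). ktp H FS y x)) (\<lambda>(h, Y). ktp H H h (Y w)) = swe t (\<lambda>(Y, h). ktp H H h (Y w))"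
        by (rule lext_ktens_flip[OF subvs_FS subvs_H _ vs_fsc])
          (use t in \<open>auto intro!: bilin_onI lin lin_FS_eval[OF lin_on_id] simp: car_UNIV\<close>)
      also have "\<dots> = swe (swe t (\<lambda>(Y, h). ktp H H (Y w) h)) (\<lambda>(x, y). ktp H H y x)" by (simp add: flip)
      finally show ?thesis using t w by simp
    qed
    have "swe t (\<lambda>(x, y). ktp H FS y x) = swe u (\<lambda>(x, y). ktp H FS y x)"
      using ktens_flip(2)[OF subvs_FS subvs_H] t u
      by (intro FS_maps_unique) (auto simp only: *[OF t] *[OF u])
    then have "swe (swe t (\<lambda>(x, y). ktp H FS y x)) (\<lambda>(y, x). ktp FS H x y) =
        swe (swe u (\<lambda>(x, y). ktp H FS y x)) (\<lambda>(y, x). ktp FS H x y)" by (rule arg_cong)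
    then show "t = u"
      unfolding ktens_flip(1)[OF subvs_FS subvs_H conjunct1[OF t]]
        ktens_flip(1)[OF subvs_FS subvs_H conjunct1[OF u]] .
  qed
  ultimately have "?P (THE t. ?P t)" by (rule the_rule)
  moreover have "rcoact VF X = (THE t. ?P t)" by (simp add: vector_fields_def cvr_def)
  ultimately have "?P (rcoact VF X)" by simp
  then show "rcoact VF X \<in> car (ktens FS H)"
    "w \<in> \<Omega> \<Longrightarrow> swe (rcoact VF X) (\<lambda>(Y, h). ktp H H (Y w) h) = cvr X w" by auto
qed

lemma lcoact_VF_keys [dest!]: "(h, Y) \<in> Poly_Mapping.keys (lcoact VF X) \<Longrightarrow> X \<in> car FS \<Longrightarrow> Y \<in> car FS"
  by (rule conjunct2[OF HF.ktens_keys[OF lcoact_VF(1)]])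

lemma rcoact_VF_keys [dest!]: "(Y, h) \<in> Poly_Mapping.keys (rcoact VF X) \<Longrightarrow> X \<in> car FS \<Longrightarrow> Y \<in> car FS"
  by (rule conjunct1[OF FH.ktens_keys[OF rcoact_VF(1)]])

lemma lcoact_VF_eval:
  assumes s: "vector_space s" and F: "hbilin s F" and X: "X \<in> car FS" and m: "m \<in> lco"
  shows "lext s (lcoact VF X) (\<lambda>(h, Y). F h (Y m)) = lext s (\<Delta> (X m)) (case_prod F)"
proof -
  have "lext s (lcoact VF X) (\<lambda>(h, Y). F h (Y m)) = lext s (swe (lcoact VF X) (\<lambda>(h, Y). ktp H H h (Y m))) (case_prod F)"
    by (simp add: lext_ktp_swe s F)
  also have "swe (lcoact VF X) (\<lambda>(h, Y). ktp H H h (Y m)) = swe (\<Delta> (X m)) (\<lambda>(x, y). ktp H H x y)"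
    using lcoact_VF(2)[OF X, of m] cvl_lco[OF X m, of 1] m by (simp add: calc.embed_hom)
  finally show ?thesis by (simp add: lext_ktp_swe s F)
qed

lemma rcoact_VF_eval:
  assumes s: "vector_space s" and F: "hbilin s F" and X: "X \<in> car FS" and n: "n \<in> rco"
  shows "lext s (rcoact VF X) (\<lambda>(Y, h). F (Y n) h) = lext s (\<Delta> (X n)) (case_prod F)"
proof -
  have "lext s (rcoact VF X) (\<lambda>(Y, h). F (Y n) h) = lext s (swe (rcoact VF X) (\<lambda>(Y, h). ktp H H (Y n) h)) (case_prod F)"
    by (simp add: lext_ktp_swe s F)
  also have "swe (rcoact VF X) (\<lambda>(Y, h). ktp H H (Y n) h) = swe (\<Delta> (X n)) (\<lambda>(x, y). ktp H H x y)"
    using rcoact_VF(2)[OF X, of n] cvr_rco[OF X n, of 1] n by (simp add: calc.embed_hom)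
  finally show ?thesis by (simp add: lext_ktp_swe s F)
qed

end

section \<open>Consequences of centrality\<close>

lemma lext_swap3:
  assumes s: "vector_space s"
  shows "lext s p (\<lambda>(x, y). lext s (f x y) (\<lambda>(a, b). lext s q (\<lambda>(z, w). F x y a b z w))) =
    lext s q (\<lambda>(z, w). lext s p (\<lambda>(x, y). lext s (f x y) (\<lambda>(a, b). F x y a b z w)))"
proof -
  have "lext s p (\<lambda>(x, y). lext s (f x y) (\<lambda>(a, b). lext s q (\<lambda>(z, w). F x y a b z w))) =
    lext s p (\<lambda>(x, y). lext s q (\<lambda>(z, w). lext s (f x y) (\<lambda>(a, b). F x y a b z w)))"
    by (intro lext_cong2 lext_swap2[OF s])
  also have "\<dots> = lext s q (\<lambda>(z, w). lext s p (\<lambda>(x, y). lext s (f x y) (\<lambda>(a, b). F x y a b z w)))"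
    by (rule lext_swap2[OF s])
  finally show ?thesis .
qed

lemma lext_swap4:
  assumes s: "vector_space s"
  shows "lext s p (\<lambda>(x, y). lext s (f x y) (\<lambda>(a, b). lext s q (\<lambda>(z, w). lext s (g z w) (\<lambda>(c, d). F x y a b z w c d)))) =
    lext s q (\<lambda>(z, w). lext s (g z w) (\<lambda>(c, d). lext s p (\<lambda>(x, y). lext s (f x y) (\<lambda>(a, b). F x y a b z w c d))))"
  unfolding lext_swap3[OF s, of p f q] by (intro lext_cong2 lext_swap3[OF s])

context hopf_metric
begin

interpretation vH: vector_space "sc H" by (rule vector_space)
interpretation vC: vector_space "sc C" by (rule calc.vector_space)

definition ad :: "'w \<Rightarrow> 'h \<Rightarrow> 'w" where
  "ad m a = lext sC (\<Delta> a) (\<lambda>(a1, a2). \<iota> a2 * m * \<iota> (T a1))"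

definition adr :: "'w \<Rightarrow> 'h \<Rightarrow> 'w" where
  "adr n a = lext sC (\<Delta> a) (\<lambda>(a1, a2). \<iota> a1 * n * \<iota> (S a2))"

lemma ad_lco [simp]: "m \<in> lco \<Longrightarrow> ad m a \<in> lco" and adr_rco [simp]: "n \<in> rco \<Longrightarrow> adr n a \<in> rco"
  unfolding ad_def adr_def by (rule lco_ad rco_ad, assumption)+

lemma lin_ad [lin]: "lin_on A s sH f \<Longrightarrow> lin_on A s sC (\<lambda>x. ad m (f x))"
  and lin_adr [lin]: "lin_on A s sH f \<Longrightarrow> lin_on A s sC (\<lambda>x. adr m (f x))"
  unfolding ad_def adr_def by (intro lin, assumption)+

lemma ad_decomp: "\<iota> a * m = lext sC (\<Delta> a) (\<lambda>(a1, a'). ad m a' * \<iota> a1)"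
  and adr_decomp: "\<iota> a * n = lext sC (\<Delta> a) (\<lambda>(a', a3). adr n a' * \<iota> a3)"
  unfolding ad_def adr_def by (rule one_form_decomp)+

lemma FS_lext:
  assumes "X \<in> car FS" "\<And>x y. (x, y) \<in> Poly_Mapping.keys p \<Longrightarrow> f x y \<in> \<Omega>"
  shows "X (lext sC p (case_prod f)) = lext sH p (\<lambda>(x, y). X (f x y))"
  by (rule lin_on_lext_apply2[OF vs_C vs_H \<Omega>_subspace FS_lin]) (use assms in auto)

lemma FS_ad: "X \<in> car FS \<Longrightarrow> m \<in> lco \<Longrightarrow> X (\<iota> a * m) = lext sH (\<Delta> a) (\<lambda>(a1, a'). X (ad m a') * a1)"
  by (subst ad_decomp, subst FS_lext) auto

lemma FS_adr: "X \<in> car FS \<Longrightarrow> n \<in> rco \<Longrightarrow> X (\<iota> a * n) = lext sH (\<Delta> a) (\<lambda>(a', a3). X (adr n a') * a3)"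
  by (subst adr_decomp, subst FS_lext) auto

lemma hlin_lext: "vector_space s \<Longrightarrow> hlin s L \<Longrightarrow> L (lext sH p (case_prod f)) = lext s p (\<lambda>(x, y). L (f x y))"
  by (rule lin_on_lext_apply2[OF vs_H _ vH.subspace_UNIV]) auto

lemma rcoact_VF2_eval:
  assumes s [lin]: "vector_space s" and R: "hbilin s R" and X: "X \<in> car FS" and Y: "Y \<in> car FS"
    and p: "p \<in> rco" and q: "q \<in> rco"
  shows "lext s (rcoact VF X) (\<lambda>(X0, h). lext s (rcoact VF Y) (\<lambda>(Y0, k). R (X0 (\<iota> (Y0 p) * q)) (h * k))) =
    lext s (\<Delta> (X (\<iota> (Y p) * q))) (case_prod R)"
proof -
  note [lin] = bilin_onD(1)[OF R UNIV_I, THEN lin_compU] bilin_onD(2)[OF R UNIV_I, THEN lin_compU]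
  note [simp] = X Y p q
  have "lext s (rcoact VF X) (\<lambda>(X0, h). lext s (rcoact VF Y) (\<lambda>(Y0, k). R (X0 (\<iota> (Y0 p) * q)) (h * k))) =
    lext s (rcoact VF X) (\<lambda>(X0, h). lext s (\<Delta> (Y p)) (\<lambda>(y1, y2). R (X0 (\<iota> y1 * q)) (h * y2)))"
    by (intro lext_cong2 rcoact_VF_eval[where F = "\<lambda>y k. R (_ (\<iota> y * q)) (_ * k)"]) (auto intro!: bilin_onI lin)
  also have "\<dots> = lext s (rcoact VF X) (\<lambda>(X0, h). lext s (\<Delta> (Y p)) (\<lambda>(y1, y2). lext s (\<Delta> y1) (\<lambda>(u, v). R (X0 (adr q u) * v) (h * y2))))"
  proof (intro lext_cong2)
    fix X0 h y1 y2 assume "(X0, h) \<in> Poly_Mapping.keys (rcoact VF X)"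
    then have "X0 \<in> car FS" by auto
    then show "R (X0 (\<iota> y1 * q)) (h * y2) = lext s (\<Delta> y1) (\<lambda>(u, v). R (X0 (adr q u) * v) (h * y2))"
      by (simp add: FS_adr) (rule hlin_lext[OF s, of "\<lambda>z. R z (h * y2)"], intro lin)
  qed
  also have "\<dots> = lext s (\<Delta> (Y p)) (\<lambda>(y1, y2). lext s (\<Delta> y1) (\<lambda>(u, v). lext s (rcoact VF X) (\<lambda>(X0, h). R (X0 (adr q u) * v) (h * y2))))"
    by (rule lext_swap3[OF s, symmetric])
  also have "\<dots> = lext s (\<Delta> (Y p)) (\<lambda>(y1, y2). lext s (\<Delta> y1) (\<lambda>(u, v). lext s (\<Delta> (X (adr q u))) (\<lambda>(x1, x2). R (x1 * v) (x2 * y2))))"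
    by (intro lext_cong2 rcoact_VF_eval[where F = "\<lambda>x h. R (x * _) (h * _)"]) (auto intro!: bilin_onI lin)
  also have "\<dots> = lext s (\<Delta> (Y p)) (\<lambda>(u, y'). lext s (\<Delta> y') (\<lambda>(v, y2). lext s (\<Delta> (X (adr q u))) (\<lambda>(x1, x2). R (x1 * v) (x2 * y2))))"
    by (rule coassoc[OF s]) (auto intro!: lin)
  also have "\<dots> = lext s (\<Delta> (Y p)) (\<lambda>(u, y'). lext s (\<Delta> (X (adr q u))) (\<lambda>(x1, x2). lext s (\<Delta> y') (\<lambda>(v, y2). R (x1 * v) (x2 * y2))))"
    by (intro lext_cong2 lext_swap2[OF s])
  also have "\<dots> = lext s (\<Delta> (Y p)) (\<lambda>(u, y'). lext s (\<Delta> (X (adr q u) * y')) (case_prod R))"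
    by (intro lext_cong2 lext_\<Delta>_mult[OF s R, symmetric])
  also have "\<dots> = lext s (\<Delta> (X (\<iota> (Y p) * q))) (case_prod R)"
    by (simp add: FS_adr) (rule hlin_lext[OF s, of "\<lambda>z. lext s (\<Delta> z) (case_prod R)", symmetric], intro lin)
  finally show ?thesis .
qed

lemma lcoact_VF2_eval:
  assumes s [lin]: "vector_space s" and R: "hbilin s R" and X: "X \<in> car FS" and Y: "Y \<in> car FS"
    and p: "p \<in> lco" and q: "q \<in> lco"
  shows "lext s (lcoact VF X) (\<lambda>(h, X0). lext s (lcoact VF Y) (\<lambda>(k, Y0). R (h * k) (X0 (\<iota> (Y0 p) * q)))) =
    lext s (\<Delta> (X (\<iota> (Y p) * q))) (case_prod R)"
proof -
  note [lin] = bilin_onD(1)[OF R UNIV_I, THEN lin_compU] bilin_onD(2)[OF R UNIV_I, THEN lin_compU]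
  note [simp] = X Y p q
  have "lext s (lcoact VF X) (\<lambda>(h, X0). lext s (lcoact VF Y) (\<lambda>(k, Y0). R (h * k) (X0 (\<iota> (Y0 p) * q)))) =
    lext s (lcoact VF X) (\<lambda>(h, X0). lext s (\<Delta> (Y p)) (\<lambda>(y1, y2). R (h * y1) (X0 (\<iota> y2 * q))))"
    by (intro lext_cong2 lcoact_VF_eval[where F = "\<lambda>k y. R (_ * k) (_ (\<iota> y * q))"]) (auto intro!: bilin_onI lin)
  also have "\<dots> = lext s (lcoact VF X) (\<lambda>(h, X0). lext s (\<Delta> (Y p)) (\<lambda>(y1, y2). lext s (\<Delta> y2) (\<lambda>(v, u). R (h * y1) (X0 (ad q u) * v))))"
  proof (intro lext_cong2)
    fix X0 h y1 y2 assume "(h, X0) \<in> Poly_Mapping.keys (lcoact VF X)"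
    then have "X0 \<in> car FS" by auto
    then show "R (h * y1) (X0 (\<iota> y2 * q)) = lext s (\<Delta> y2) (\<lambda>(v, u). R (h * y1) (X0 (ad q u) * v))"
      by (simp add: FS_ad) (rule hlin_lext[OF s, of "\<lambda>z. R (h * y1) z"], intro lin)
  qed
  also have "\<dots> = lext s (\<Delta> (Y p)) (\<lambda>(y1, y2). lext s (\<Delta> y2) (\<lambda>(v, u). lext s (lcoact VF X) (\<lambda>(h, X0). R (h * y1) (X0 (ad q u) * v))))"
    by (rule lext_swap3[OF s, symmetric])
  also have "\<dots> = lext s (\<Delta> (Y p)) (\<lambda>(y1, y2). lext s (\<Delta> y2) (\<lambda>(v, u). lext s (\<Delta> (X (ad q u))) (\<lambda>(x1, x2). R (x1 * y1) (x2 * v))))"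
    by (intro lext_cong2 lcoact_VF_eval[where F = "\<lambda>h x. R (h * _) (x * _)"]) (auto intro!: bilin_onI lin)
  also have "\<dots> = lext s (\<Delta> (Y p)) (\<lambda>(y', u). lext s (\<Delta> y') (\<lambda>(y1, v). lext s (\<Delta> (X (ad q u))) (\<lambda>(x1, x2). R (x1 * y1) (x2 * v))))"
    by (rule coassoc[OF s, symmetric]) (auto intro!: lin)
  also have "\<dots> = lext s (\<Delta> (Y p)) (\<lambda>(y', u). lext s (\<Delta> (X (ad q u))) (\<lambda>(x1, x2). lext s (\<Delta> y') (\<lambda>(y1, v). R (x1 * y1) (x2 * v))))"
    by (intro lext_cong2 lext_swap2[OF s])
  also have "\<dots> = lext s (\<Delta> (Y p)) (\<lambda>(y', u). lext s (\<Delta> (X (ad q u) * y')) (case_prod R))"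
    by (intro lext_cong2 lext_\<Delta>_mult[OF s R, symmetric])
  also have "\<dots> = lext s (\<Delta> (X (\<iota> (Y p) * q))) (case_prod R)"
    by (simp add: FS_ad) (rule hlin_lext[OF s, of "\<lambda>z. lext s (\<Delta> z) (case_prod R)", symmetric], intro lin)
  finally show ?thesis .
qed

lemma coact_FT_eq:
  "lcoact FT G = swe G (\<lambda>(X, Y). swe (lcoact VF X) (\<lambda>(h, X0). swe (lcoact VF Y) (\<lambda>(k, Y0). ktp H FT (h * k) (X0 \<otimes>\<^sub>V Y0))))"
  "rcoact FT G = swe G (\<lambda>(X, Y). swe (rcoact VF X) (\<lambda>(X0, h). swe (rcoact VF Y) (\<lambda>(Y0, k). ktp FT H (X0 \<otimes>\<^sub>V Y0) (h * k))))"
proof -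
  have c: "car (hspace VF VF) = car FT" "sc (hspace VF VF) = sc FT"
    by (simp_all add: VV.car_tens hspace_def) (simp add: qspace_def)
  have 1: "ktp H FT = ktp H (hspace VF VF)" and 2: "ktp FT H = ktp (hspace VF VF) H"
    by (rule ktp_cong; simp add: c)+
  show "lcoact FT G = swe G (\<lambda>(X, Y). swe (lcoact VF X) (\<lambda>(h, X0). swe (lcoact VF Y) (\<lambda>(k, Y0). ktp H FT (h * k) (X0 \<otimes>\<^sub>V Y0))))"
    unfolding 1 by (simp add: tens_def)
  show "rcoact FT G = swe G (\<lambda>(X, Y). swe (rcoact VF X) (\<lambda>(X0, h). swe (rcoact VF Y) (\<lambda>(Y0, k). ktp FT H (X0 \<otimes>\<^sub>V Y0) (h * k))))"
    unfolding 2 by (simp add: tens_def)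
qed

lemma coact_FT_lin [lin]:
  "lin_on A s fsc f \<Longrightarrow> lin_on A s fsc (\<lambda>x. lcoact FT (f x))"
  "lin_on A s fsc f \<Longrightarrow> lin_on A s fsc (\<lambda>x. rcoact FT (f x))"
  unfolding coact_FT_eq by (intro lin, assumption)+

lemma lcoact_FT_keys [dest!]: "(h, G') \<in> Poly_Mapping.keys (lcoact FT G) \<Longrightarrow> G' \<in> car FT"
proof -
  have "fsc.subspace (car (ktens H FT))" using subvsD(2)[OF HFT.ktens_subvs] by simp
  then have "lcoact FT G \<in> car (ktens H FT)"
    unfolding coact_FT_eq by (auto intro!: lext_in_subspace[OF vs_fsc] HFT.ktp_in)
  then show "(h, G') \<in> Poly_Mapping.keys (lcoact FT G) \<Longrightarrow> G' \<in> car FT"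
    by (rule conjunct2[OF HFT.ktens_keys])
qed

lemma rcoact_FT_keys [dest!]: "(G', h) \<in> Poly_Mapping.keys (rcoact FT G) \<Longrightarrow> G' \<in> car FT"
proof -
  have "fsc.subspace (car (ktens FT H))" using subvsD(2)[OF FTH.ktens_subvs] by simp
  then have "rcoact FT G \<in> car (ktens FT H)"
    unfolding coact_FT_eq by (auto intro!: lext_in_subspace[OF vs_fsc] FTH.ktp_in)
  then show "(G', h) \<in> Poly_Mapping.keys (rcoact FT G) \<Longrightarrow> G' \<in> car FT"
    by (rule conjunct1[OF FTH.ktens_keys])
qed

lemma FT_keys: "(X, Y) \<in> Poly_Mapping.keys G \<Longrightarrow> G \<in> car FT \<Longrightarrow> X \<in> car FS \<and> Y \<in> car FS"
  using VV.tens_keys[of G H X Y] by simp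

lemma pair_FT_lext: "G \<in> car FT \<Longrightarrow> x \<in> \<Omega> \<Longrightarrow> y \<in> \<Omega> \<Longrightarrow> pair G (x \<otimes> y) = lext sH G (\<lambda>(X, Y). X (\<iota> (Y x) * y))"
  by (subst pair_eq) (auto intro!: lext_cong2 dest!: FT_keys)

lemma rcoact_FT_eval:
  assumes s [lin]: "vector_space s" and R: "hbilin s R" and G: "G \<in> car FT" and p: "p \<in> rco" and q: "q \<in> rco"
  shows "lext s (rcoact FT G) (\<lambda>(G', l). R (pair G' (p \<otimes> q)) l) = lext s (\<Delta> (pair G (p \<otimes> q))) (case_prod R)"
proof -
  note [lin] = bilin_onD(1)[OF R UNIV_I, THEN lin_compU] bilin_onD(2)[OF R UNIV_I, THEN lin_compU]
  have L: "lext s (ktp FT H (X \<otimes>\<^sub>V Y) l) (\<lambda>(G', l). R (pair G' (p \<otimes> q)) l) = R (X (\<iota> (Y p) * q)) l"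
    if "X \<in> car FS" "Y \<in> car FS" for X Y l
    using p q that
    by (subst FTH.lext_ktp[OF s]) (auto intro!: bilin_onI lin simp: pair_htp)
  have "lext s (rcoact FT G) (\<lambda>(G', l). R (pair G' (p \<otimes> q)) l) = lext s G (\<lambda>(X, Y).
    lext s (rcoact VF X) (\<lambda>(X0, h). lext s (rcoact VF Y) (\<lambda>(Y0, k). R (X0 (\<iota> (Y0 p) * q)) (h * k))))"
    unfolding coact_FT_eq lext_lext2[OF s]
    by (intro lext_cong2 L) (use G in \<open>auto dest!: FT_keys\<close>)
  also have "\<dots> = lext s G (\<lambda>(X, Y). lext s (\<Delta> (X (\<iota> (Y p) * q))) (case_prod R))"
    by (intro lext_cong2 rcoact_VF2_eval[OF s R _ _ p q]) (use G in \<open>auto dest!: FT_keys\<close>)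
  also have "\<dots> = lext s (\<Delta> (lext sH G (\<lambda>(X, Y). X (\<iota> (Y p) * q)))) (case_prod R)"
    by (rule hlin_lext[OF s, of "\<lambda>z. lext s (\<Delta> z) (case_prod R)", symmetric]) (intro lin)
  finally show ?thesis using G p q by (simp add: pair_FT_lext)
qed

lemma lcoact_FT_eval:
  assumes s [lin]: "vector_space s" and R: "hbilin s R" and G: "G \<in> car FT" and p: "p \<in> lco" and q: "q \<in> lco"
  shows "lext s (lcoact FT G) (\<lambda>(l, G'). R l (pair G' (p \<otimes> q))) = lext s (\<Delta> (pair G (p \<otimes> q))) (case_prod R)"
proof -
  note [lin] = bilin_onD(1)[OF R UNIV_I, THEN lin_compU] bilin_onD(2)[OF R UNIV_I, THEN lin_compU]
  have L: "lext s (ktp H FT l (X \<otimes>\<^sub>V Y)) (\<lambda>(l, G'). R l (pair G' (p \<otimes> q))) = R l (X (\<iota> (Y p) * q))"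
    if "X \<in> car FS" "Y \<in> car FS" for X Y l
    using p q that
    by (subst HFT.lext_ktp[OF s]) (auto intro!: bilin_onI lin simp: pair_htp)
  have "lext s (lcoact FT G) (\<lambda>(l, G'). R l (pair G' (p \<otimes> q))) = lext s G (\<lambda>(X, Y).
    lext s (lcoact VF X) (\<lambda>(h, X0). lext s (lcoact VF Y) (\<lambda>(k, Y0). R (h * k) (X0 (\<iota> (Y0 p) * q)))))"
    unfolding coact_FT_eq lext_lext2[OF s]
    by (intro lext_cong2 L) (use G in \<open>auto dest!: FT_keys\<close>)
  also have "\<dots> = lext s G (\<lambda>(X, Y). lext s (\<Delta> (X (\<iota> (Y p) * q))) (case_prod R))"
    by (intro lext_cong2 lcoact_VF2_eval[OF s R _ _ p q]) (use G in \<open>auto dest!: FT_keys\<close>)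
  also have "\<dots> = lext s (\<Delta> (lext sH G (\<lambda>(X, Y). X (\<iota> (Y p) * q)))) (case_prod R)"
    by (rule hlin_lext[OF s, of "\<lambda>z. lext s (\<Delta> z) (case_prod R)", symmetric]) (intro lin)
  finally show ?thesis using G p q by (simp add: pair_FT_lext)
qed

subsection \<open>Moving the metric to the right\<close>

text \<open>
  Evaluates the first factor of \<open>G \<otimes> x\<close> at \<open>t\<close>, which turns the second centrality equation into a
  commutation rule for the values of \<open>\<gamma>\<close>; \<open>phi\<close> below does the same for the first equation.
\<close>

definition psi :: "('w \<times> 'w \<Rightarrow>\<^sub>0 'k) \<Rightarrow> (('w \<Rightarrow> 'h) \<times> ('w \<Rightarrow> 'h) \<Rightarrow>\<^sub>0 'k) \<Rightarrow> 'w \<Rightarrow> 'w" where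
  "psi t G x = lext sC (cl x) (\<lambda>(h, x0). lext sC (\<Delta> h) (\<lambda>(h1, h2). \<iota> (pair G (lact W2 h1 t)) * (\<iota> (S h2) * x0)))"

lemma psi_eq:
  assumes t: "t \<in> car W2" and m: "m \<in> lco"
  shows "psi t G (\<iota> a * m) = \<iota> (pair G (lact W2 a t)) * m"
    and "psi t G (m * \<iota> c) = lext sC (\<Delta> c) (\<lambda>(c1, c2). lext sC (\<Delta> c1) (\<lambda>(p, q). \<iota> (pair G (lact W2 p t)) * (\<iota> (S q) * (m * \<iota> c2))))"
  unfolding psi_def
  by (rule cl_comult_left[OF vs_C _ m, where F = "\<lambda>h x. \<iota> (pair G (lact W2 h t)) * x"],
      use t in \<open>auto intro!: bilin_onI lin\<close>)+

lemma psi_lin [lin]: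
  "lin_on A s fsc f \<Longrightarrow> lin_on A s sC (\<lambda>z. psi t (f z) x)"
  "lin_on A s sC f' \<Longrightarrow> (\<And>x. x \<in> A \<Longrightarrow> f' x \<in> \<Omega>) \<Longrightarrow> lin_on A s sC (\<lambda>z. psi t G (f' z))"
  unfolding psi_def by (auto intro!: lin)

lemma psi_bal:
  assumes t: "t \<in> car W2" and G: "G \<in> car FT" and x: "x \<in> \<Omega>"
  shows "psi t (ract FT G c) x = psi t G (\<iota> c * x)"
  using x
proof (induction x rule: \<Omega>_induct_HL)
  case (gen a m)
  have "psi t G (\<iota> (c * a) * m) = \<iota> (pair G (lact W2 c (lact W2 a t))) * m"
    by (simp add: psi_eq t gen W2.lact_mult)
  then show ?case
    using t gen G by (simp add: psi_eq pair_act calc.embed_hom mult.assoc)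
next
  case (add x y)
  then show ?case
    using lin_on_add[OF psi_lin(2)[OF lin_on_id], of \<Omega>] by (simp add: distrib_left)
qed

lemma psi_htp:
  assumes t: "t \<in> car W2" and G: "G \<in> car FT" and x: "x \<in> \<Omega>"
  shows "lext sC (htp FT Om G x) (\<lambda>(G, x). psi t G x) = psi t G x"
  by (rule FO.lext_htp[OF vs_C G]) (use x in \<open>auto intro!: bilin_onI lin psi_bal[OF t]\<close>)

lemma braid_right_eval:
  assumes p: "p \<in> rco" and q: "q \<in> rco" and G: "G \<in> car FT" and w: "w \<in> \<Omega>"
  shows "lext sC (swe (cl w) (\<lambda>(h, w0). swe (\<Delta> h) (\<lambda>(m2, m1). swe (rcoact FT G) (\<lambda>(G0, k). swe (\<Delta> k) (\<lambda>(n1, n2).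
      htp FT Om (lact FT m2 (ract FT G0 (S n1))) (\<iota> (S m1) * (w0 * \<iota> n2))))))) (\<lambda>(G, x). psi (p \<otimes> q) G x) = w * \<iota> (pair G (p \<otimes> q))"
    (is "lext sC (?B w) _ = _")
proof -
  let ?t = "p \<otimes> q"
  note [simp] = p q G
  define F where "F = (\<lambda>h x. lext sC (rcoact FT G) (\<lambda>(G0, k). lext sC (\<Delta> k) (\<lambda>(n1, n2).
     psi ?t (lact FT h (ract FT G0 (S n1))) (x * \<iota> n2))))"
  have 1: "lext sC (?B w) (\<lambda>(G, x). psi ?t G x) = lext sC (cl w) (\<lambda>(h, w0). lext sC (\<Delta> h) (\<lambda>(m2, m1). F m2 (\<iota> (S m1) * w0)))"
    if w: "w \<in> \<Omega>" for w
    unfolding lext_lext2[OF vs_C] F_def using w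
    by (intro lext_cong2) (auto simp: mult.assoc intro!: psi_htp)
  have Fbil: "bilin_on UNIV sH \<Omega> sC sC F"
    unfolding F_def
    by (intro bilin_onI lin) (auto intro!: lin_compU[OF FT.lact_lin1[unfolded sc_W]] lin)
  have core: "F b m = \<iota> b * m * \<iota> (pair G ?t)" if m: "m \<in> lco" for b m
  proof -
    let ?f = "\<lambda>G0 x q c. \<iota> (b * pair G0 (lact W2 x ?t)) * (\<iota> (S q) * (m * \<iota> c))"
    have "F b m = lext sC (rcoact FT G) (\<lambda>(G0, k). lext sC (\<Delta> k) (\<lambda>(n1, n2). lext sC (\<Delta> n2) (\<lambda>(c1, c2). lext sC (\<Delta> c1) (\<lambda>(p', q').
        ?f G0 (S n1 * p') q' c2))))"
      unfolding F_def using m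
      by (intro lext_cong2) (auto simp: psi_eq pair_act W2.lact_mult calc.embed_hom mult.assoc)
    also have "\<dots> = lext sC (rcoact FT G) (\<lambda>(G0, k). lext sC (\<Delta> k) (\<lambda>(n1, n2). lext sC (\<Delta> n2) (\<lambda>(p', c'). lext sC (\<Delta> c') (\<lambda>(q', c2).
        ?f G0 (S n1 * p') q' c2))))"
      by (intro lext_cong2 coassoc) (auto intro!: lin)
    also have "\<dots> = lext sC (rcoact FT G) (\<lambda>(G0, k). lext sC (\<Delta> k) (\<lambda>(k1, c'). lext sC (\<Delta> k1) (\<lambda>(n1, p'). lext sC (\<Delta> c') (\<lambda>(q', c2).
        ?f G0 (S n1 * p') q' c2))))"
      by (intro lext_cong2 coassoc[symmetric]) (auto intro!: lin)
    also have "\<dots> = lext sC (rcoact FT G) (\<lambda>(G0, k). lext sC (\<Delta> k) (\<lambda>(q', c2). ?f G0 1 q' c2))"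
      by (intro lext_cong2 cancel_left[OF cancels_S_left vs_C]) (auto intro!: lin)
    also have "\<dots> = lext sC (rcoact FT G) (\<lambda>(G0, k). lext sC (\<Delta> k) (\<lambda>(q', c2). \<iota> (b * pair G0 ?t) * (\<iota> (S q') * (m * \<iota> c2))))"
      by (simp add: calc.embed_hom)
    also have "\<dots> = lext sC (\<Delta> (pair G ?t)) (\<lambda>(x1, k). lext sC (\<Delta> k) (\<lambda>(q', c2). \<iota> (b * x1) * (\<iota> (S q') * (m * \<iota> c2))))"
      by (rule rcoact_FT_eval[OF vs_C, where R = "\<lambda>x k. lext sC (\<Delta> k) (\<lambda>(q', c2). \<iota> (b * x) * (\<iota> (S q') * (m * \<iota> c2)))"])
        (auto intro!: bilin_onI lin)
    also have "\<dots> = lext sC (\<Delta> (pair G ?t)) (\<lambda>(x', c2). lext sC (\<Delta> x') (\<lambda>(x1, q'). \<iota> (b * x1) * (\<iota> (S q') * (m * \<iota> c2))))"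
      by (rule coassoc[symmetric]) (auto intro!: lin)
    also have "\<dots> = lext sC (\<Delta> (pair G ?t)) (\<lambda>(x', c2). lext sC (\<Delta> x') (\<lambda>(x1, q'). \<iota> (b * (x1 * S q')) * (m * \<iota> c2)))"
      by (simp add: calc.embed_hom mult.assoc)
    also have "\<dots> = \<iota> (b * 1) * (m * \<iota> (pair G ?t))"
      by (rule cancel_left[OF cancels_S_right vs_C]) (auto intro!: lin)
    finally show ?thesis by (simp add: mult.assoc)
  qed
  have "lext sC (cl w) (\<lambda>(h, w0). lext sC (\<Delta> h) (\<lambda>(m2, m1). F m2 (\<iota> (S m1) * w0))) = w * \<iota> (pair G ?t)"
    using w
  proof (induction w rule: \<Omega>_induct_HL)
    case (gen b m)
    show ?case unfolding cl_comult_left(1)[OF vs_C Fbil gen] core[OF gen] ..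
  next
    case (add x y)
    then show ?case
      using lin_on_add[OF cl_lin, of x y] by (simp add: lext_add[OF vs_C] distrib_right)
  qed
  then show ?thesis using 1[OF w] by simp
qed

lemma \<gamma>_right:
  assumes p: "p \<in> rco" and q: "q \<in> rco" and m: "m \<in> lco"
  shows "\<iota> a * m * \<iota> (\<gamma> (p \<otimes> q)) = \<iota> (\<gamma> (lact W2 a (p \<otimes> q))) * m"
proof -
  let ?w = "\<iota> a * m" and ?t = "p \<otimes> q"
  have w: "?w \<in> \<Omega>" using m by simp
  have "lext sC (braid H Om FT (htp Om FT ?w g)) (\<lambda>(G, x). psi ?t G x) =
    lext sC (htp Om FT ?w g) (\<lambda>(w, G). w * \<iota> (pair G ?t))"
    unfolding braid_def Om_simps
    by (subst lext_lext2[OF vs_C], intro lext_cong2 braid_right_eval p q)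
      (use OF.tens_keys[OF OF.htp_in[where H=H]] in \<open>auto\<close>)
  also have "\<dots> = ?w * \<iota> (\<gamma> ?t)"
  proof (rule OF.lext_htp[OF vs_C])
    show "bilin Om FT sC (\<lambda>w G. w * \<iota> (pair G ?t))" by (auto intro!: bilin_onI lin)
    show "ract Om x c * \<iota> (pair G ?t) = x * \<iota> (pair (lact FT c G) ?t)" if "x \<in> car Om" "G \<in> car FT" for x c G
      using that p q by (simp add: pair_act calc.embed_hom mult.assoc)
  qed (use w in simp_all)
  finally have "?w * \<iota> (\<gamma> ?t) = lext sC (braid H Om FT (htp Om FT ?w g)) (\<lambda>(G, x). psi ?t G x)" ..
  also have "braid H Om FT (htp Om FT ?w g) = htp FT Om g ?w"
    using central w by (simp add: sigma_central_def)
  also have "lext sC (htp FT Om g ?w) (\<lambda>(G, x). psi ?t G x) = \<iota> (\<gamma> (lact W2 a ?t)) * m"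
    using psi_htp[of ?t g ?w] psi_eq(1)[of ?t m g a] p q m w by simp
  finally show ?thesis .
qed

subsection \<open>Left linearity\<close>

lemma lco_nonzero: "\<exists>m\<in>lco. m \<noteq> 0"
proof (rule ccontr)
  assume "\<not> (\<exists>m\<in>lco. m \<noteq> 0)"
  then have z: "m = 0" if "m \<in> lco" for m using that by blast
  have 0: "x = 0" if "x \<in> \<Omega>" for x
    using that by (induction x rule: \<Omega>_induct_HL) (auto dest!: z)
  have 00: "0 \<otimes> y = 0" if "y \<in> \<Omega>" for y
    using lin_on_zero[OF vs_C vs_fsc \<Omega>_subspace, of "\<lambda>x. x \<otimes> y"] OO.htp_lin1[of y] that by simp
  have "t = 0" if "t \<in> car W2" for t
    using that
  proof (induction t rule: W2_induct)
    case (htp x y)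
    then show ?case using 0[of x] 00[of y] by simp
  qed simp
  then show False using nonzero by (auto simp: eigenspace_def)
qed

lemma left_cancel:
  assumes m: "m \<in> lco" "m \<noteq> 0" and h: "\<iota> h * m = 0"
  shows "h = 0"
proof -
  have ind: "vC.independent {m}" using m by simp
  define \<phi> where "\<phi> = (\<lambda>x. vC.representation (vC.extend_basis {m}) x m)"
  have ext: "{m} \<subseteq> vC.extend_basis {m}" "vC.independent (vC.extend_basis {m})" "vC.span (vC.extend_basis {m}) = UNIV"
    using vC.extend_basis_superset[OF ind] vC.independent_extend_basis[OF ind] vC.span_extend_basis[OF ind] by auto
  have \<phi>: "\<phi> (x + y) = \<phi> x + \<phi> y" "\<phi> (sC c x) = c * \<phi> x" for x y c
    unfolding \<phi>_def by (simp_all add: vC.representation_add[OF ext(2)] vC.representation_scale[OF ext(2)] ext(3))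
  have \<phi>m: "\<phi> m = 1"
    unfolding \<phi>_def using vC.representation_basis[OF ext(2), of m] ext(1) by simp
  have "ktp H Om h m = lext fsc (cl (\<iota> h * m)) (\<lambda>(h, x). lext fsc (\<Delta> h) (\<lambda>(h1, h2). ktp H Om h1 (\<iota> (S h2) * x)))"
    by (rule cl_comult_left(1)[OF vs_fsc _ m(1), symmetric]) (auto intro!: bilin_onI lin)
  also have "cl (\<iota> h * m) = 0"
    unfolding h using lin_on_zero[OF vs_C vs_fsc \<Omega>_subspace cl_lin] .
  finally have 0: "ktp H Om h m = 0" by (simp add: lext_0[OF vs_fsc])
  have "lext sH (ktp H Om h m) (\<lambda>(a, x). sH (\<phi> x) a) = sH (\<phi> m) h"
    by (rule lext_HO[OF vs_H])
      (use m in \<open>auto intro!: bilin_onI lin_onI simp: \<phi> vH.scale_right_distrib vH.scale_left_distrib mult.commute\<close>)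
  then show "h = 0" by (simp add: 0 \<phi>m lext_0[OF vs_H])
qed

lemma \<gamma>_commute_left:
  assumes "p \<in> rco" "q \<in> rco" "m \<in> lco"
  shows "\<iota> (\<gamma> (p \<otimes> q)) * m = m * \<iota> (\<gamma> (p \<otimes> q))"
  using \<gamma>_right[OF assms, of 1] assms by (simp add: calc.embed_hom)

lemma \<gamma>_lact: "t \<in> car W2 \<Longrightarrow> \<gamma> (lact W2 a t) = a * \<gamma> t"
proof (induction t rule: W2_induct_RRH)
  case (add t u)
  then show ?case by (simp add: distrib_left)
next
  case (gen b p q)
  obtain m where m: "m \<in> lco" "m \<noteq> 0" using lco_nonzero by blast
  let ?t = "p \<otimes> q"
  have "\<iota> (\<gamma> (lact W2 a ?t)) * m = \<iota> a * (m * \<iota> (\<gamma> ?t))"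
    using \<gamma>_right[OF gen m(1), of a] by (simp add: mult.assoc)
  also have "\<dots> = \<iota> (a * \<gamma> ?t) * m"
    by (simp add: calc.embed_hom mult.assoc \<gamma>_commute_left[OF gen m(1)])
  finally have "\<iota> (\<gamma> (lact W2 a ?t)) * m + \<iota> (- (a * \<gamma> ?t)) * m = 0"
    by (metis add.right_inverse calc.embed_hom(1) distrib_right mult_zero_left add_cancel_left_right)
  then have "\<iota> (\<gamma> (lact W2 a ?t) + - (a * \<gamma> ?t)) * m = 0"
    by (simp only: calc.embed_hom distrib_right)
  from left_cancel[OF m this] have e: "\<gamma> (lact W2 a ?t) = a * \<gamma> ?t" by simp
  have "\<gamma> (lact W2 a (ract W2 ?t b)) = \<gamma> (ract W2 (lact W2 a ?t) b)" using gen by simp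
  also have "\<dots> = a * \<gamma> ?t * b" using gen by (subst pair_act) (simp_all flip: e)
  also have "\<dots> = a * \<gamma> (ract W2 ?t b)" using gen by (subst pair_act) (simp_all add: mult.assoc)
  finally show ?case using gen by simp
qed

lemma \<gamma>_ract: "t \<in> car W2 \<Longrightarrow> \<gamma> (ract W2 t a) = \<gamma> t * a"
  by (rule pair_act) simp_all

subsection \<open>Symmetry\<close>

lemma antipode_twist:
  assumes s [lin]: "vector_space s" and F: "hbilin s F"
  shows "lext s (\<Delta> x) (\<lambda>(x1, x2). lext s (\<Delta> x1) (\<lambda>(h1, h2). F h1 (S h2 * x2))) = F x 1"
proof -
  note [lin] = bilin_onD(1)[OF F UNIV_I, THEN lin_compU] bilin_onD(2)[OF F UNIV_I, THEN lin_compU]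
  have "lext s (\<Delta> x) (\<lambda>(x1, x2). lext s (\<Delta> x1) (\<lambda>(h1, h2). F h1 (S h2 * x2))) =
    lext s (\<Delta> x) (\<lambda>(h1, x'). lext s (\<Delta> x') (\<lambda>(h2, x2). F h1 (S h2 * x2)))"
    by (rule coassoc) (intro lin)+
  also have "\<dots> = F x 1"
    by (rule cancel_right[OF cancels_S_left s]) (intro lin)+
  finally show ?thesis .
qed

lemma lcoact_VF_twist:
  assumes s [lin]: "vector_space s" and F: "hbilin s F" and X: "X \<in> car FS" and m: "m \<in> lco"
  shows "lext s (lcoact VF X) (\<lambda>(h, X0). lext s (\<Delta> h) (\<lambda>(h1, h2). F h1 (S h2 * X0 m))) = F (X m) 1"
proof -
  note [lin] = bilin_onD(1)[OF F UNIV_I, THEN lin_compU] bilin_onD(2)[OF F UNIV_I, THEN lin_compU]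
  have "lext s (lcoact VF X) (\<lambda>(h, X0). lext s (\<Delta> h) (\<lambda>(h1, h2). F h1 (S h2 * X0 m))) =
    lext s (\<Delta> (X m)) (\<lambda>(h, x). lext s (\<Delta> h) (\<lambda>(h1, h2). F h1 (S h2 * x)))"
    by (rule lcoact_VF_eval[OF s _ X m]) (auto intro!: bilin_onI lin)
  then show ?thesis by (simp add: antipode_twist[OF s F])
qed

definition vbrd :: "('w \<Rightarrow> 'h) \<Rightarrow> ('w \<Rightarrow> 'h) \<Rightarrow> (('w \<Rightarrow> 'h) \<times> ('w \<Rightarrow> 'h) \<Rightarrow>\<^sub>0 'k)" where
  "vbrd X Y = swe (lcoact VF X) (\<lambda>(h, X0). swe (\<Delta> h) (\<lambda>(h1, h2). swe (rcoact VF Y) (\<lambda>(Y0, k). swe (\<Delta> k) (\<lambda>(k1, k2).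
     lact VF h1 (ract VF Y0 (S k1)) \<otimes>\<^sub>V lact VF (S h2) (ract VF X0 k2)))))"

lemma pair_lext: "pair (swe p (case_prod f)) t = lext sH p (\<lambda>(x, y). pair (f x y) t)"
  unfolding pair2_def by (rule lext_lext2[OF vs_H])

lemma pair_vbrd:
  assumes X: "X \<in> car FS" and Y: "Y \<in> car FS" and m: "m \<in> lco" and n: "n \<in> rco"
  shows "pair (vbrd X Y) (m \<otimes> n) = X (\<iota> (Y n) * m)"
proof -
  note [simp] = X Y m n
  have "pair (vbrd X Y) (m \<otimes> n) = lext sH (lcoact VF X) (\<lambda>(h, X0). lext sH (\<Delta> h) (\<lambda>(h1, h2). lext sH (rcoact VF Y) (\<lambda>(Y0, k). lext sH (\<Delta> k) (\<lambda>(k1, k2).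
     h1 * Y0 (\<iota> (S k1) * (\<iota> (S h2 * X0 (\<iota> k2 * m)) * n))))))"
    unfolding vbrd_def pair_lext
  proof (intro lext_cong2)
    fix h X0 h1 h2 Y0 k k1 k2
    assume "(h, X0) \<in> Poly_Mapping.keys (lcoact VF X)" "(Y0, k) \<in> Poly_Mapping.keys (rcoact VF Y)"
    then have "X0 \<in> car FS" "Y0 \<in> car FS" by auto
    then show "pair (lact VF h1 (ract VF Y0 (S k1)) \<otimes>\<^sub>V lact VF (S h2) (ract VF X0 k2)) (m \<otimes> n) =
        h1 * Y0 (\<iota> (S k1) * (\<iota> (S h2 * X0 (\<iota> k2 * m)) * n))"
      by (simp add: pair_htp)
  qed
  also have "\<dots> = lext sH (rcoact VF Y) (\<lambda>(Y0, k). lext sH (\<Delta> k) (\<lambda>(k1, k2). lext sH (lcoact VF X) (\<lambda>(h, X0). lext sH (\<Delta> h) (\<lambda>(h1, h2).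
     h1 * Y0 (\<iota> (S k1) * (\<iota> (S h2 * X0 (\<iota> k2 * m)) * n))))))"
    by (rule lext_swap4[OF vs_H])
  also have "\<dots> = lext sH (rcoact VF Y) (\<lambda>(Y0, k). lext sH (\<Delta> k) (\<lambda>(k1, k2). lext sH (\<Delta> k2) (\<lambda>(a1, a').
      X (ad m a') * Y0 (\<iota> (S k1) * (\<iota> a1 * n)))))"
  proof (intro lext_cong2)
    fix Y0 k k1 k2
    assume "(Y0, k) \<in> Poly_Mapping.keys (rcoact VF Y)"
    then have [simp]: "Y0 \<in> car FS" by auto
    have "lext sH (lcoact VF X) (\<lambda>(h, X0). lext sH (\<Delta> h) (\<lambda>(h1, h2). h1 * Y0 (\<iota> (S k1) * (\<iota> (S h2 * X0 (\<iota> k2 * m)) * n)))) =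
      lext sH (lcoact VF X) (\<lambda>(h, X0). lext sH (\<Delta> h) (\<lambda>(h1, h2). lext sH (\<Delta> k2) (\<lambda>(a1, a').
        h1 * Y0 (\<iota> (S k1) * (\<iota> (S h2 * X0 (ad m a') * a1) * n)))))"
    proof (intro lext_cong2)
      fix h X0 h1 h2 assume "(h, X0) \<in> Poly_Mapping.keys (lcoact VF X)"
      then have "X0 \<in> car FS" by auto
      then show "h1 * Y0 (\<iota> (S k1) * (\<iota> (S h2 * X0 (\<iota> k2 * m)) * n)) =
         lext sH (\<Delta> k2) (\<lambda>(a1, a'). h1 * Y0 (\<iota> (S k1) * (\<iota> (S h2 * X0 (ad m a') * a1) * n)))"
        by (simp add: FS_ad mult.assoc) (rule hlin_lext[OF vs_H, of "\<lambda>z. h1 * Y0 (\<iota> (S k1) * (\<iota> (S h2 * z) * n))"], auto intro!: lin)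
    qed
    also have "\<dots> = lext sH (\<Delta> k2) (\<lambda>(a1, a'). lext sH (lcoact VF X) (\<lambda>(h, X0). lext sH (\<Delta> h) (\<lambda>(h1, h2).
        h1 * Y0 (\<iota> (S k1) * (\<iota> (S h2 * X0 (ad m a') * a1) * n)))))"
      by (rule lext_swap3[OF vs_H])
    also have "\<dots> = lext sH (\<Delta> k2) (\<lambda>(a1, a'). X (ad m a') * Y0 (\<iota> (S k1) * (\<iota> (1 * a1) * n)))"
      by (intro lext_cong2 lcoact_VF_twist[OF vs_H, where F = "\<lambda>h x. h * Y0 (\<iota> (S k1) * (\<iota> (x * _) * n))"])
        (auto intro!: bilin_onI lin)
    finally show "lext sH (lcoact VF X) (\<lambda>(h, X0). lext sH (\<Delta> h) (\<lambda>(h1, h2). h1 * Y0 (\<iota> (S k1) * (\<iota> (S h2 * X0 (\<iota> k2 * m)) * n)))) =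
      lext sH (\<Delta> k2) (\<lambda>(a1, a'). X (ad m a') * Y0 (\<iota> (S k1) * (\<iota> a1 * n)))" by simp
  qed
  also have "\<dots> = lext sH (rcoact VF Y) (\<lambda>(Y0, k). lext sH (\<Delta> k) (\<lambda>(c, a'). lext sH (\<Delta> c) (\<lambda>(k1, a1).
      X (ad m a') * Y0 (\<iota> (S k1) * (\<iota> a1 * n)))))"
    by (intro lext_cong2 coassoc[symmetric]) (auto intro!: lin)
  also have "\<dots> = lext sH (rcoact VF Y) (\<lambda>(Y0, k). lext sH (\<Delta> k) (\<lambda>(c, a'). lext sH (\<Delta> c) (\<lambda>(k1, a1).
      X (ad m a') * Y0 (\<iota> (S k1 * a1) * n))))"
    by (simp add: calc.embed_hom mult.assoc)
  also have "\<dots> = lext sH (rcoact VF Y) (\<lambda>(Y0, k). X (ad m k) * Y0 (\<iota> 1 * n))"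
    by (intro lext_cong2 cancel_left[OF cancels_S_left vs_H]) (auto intro!: lin)
  also have "\<dots> = lext sH (\<Delta> (Y n)) (\<lambda>(y, k). X (ad m k) * y)"
    by (simp add: calc.embed_hom) (rule rcoact_VF_eval[OF vs_H, where F = "\<lambda>y k. X (ad m k) * y"], auto intro!: bilin_onI lin)
  also have "\<dots> = X (\<iota> (Y n) * m)" by (simp add: FS_ad)
  finally show ?thesis .
qed

lemma \<gamma>_flip:
  assumes m: "m \<in> lco" and n: "n \<in> rco"
  shows "\<gamma> (m \<otimes> n) = \<gamma> (n \<otimes> m)"
proof -
  have "braid H VF VF g = swe g (\<lambda>(X, Y). vbrd X Y)"
    by (simp add: braid_def vbrd_def)
  then have "\<gamma> (m \<otimes> n) = pair (swe g (\<lambda>(X, Y). vbrd X Y)) (m \<otimes> n)" using braid_g by simp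
  also have "\<dots> = lext sH g (\<lambda>(X, Y). X (\<iota> (Y n) * m))"
    unfolding pair_lext by (intro lext_cong2 pair_vbrd m n) (auto dest!: g_keys)
  also have "\<dots> = \<gamma> (n \<otimes> m)" using m n by (simp add: pair_FT_lext)
  finally show ?thesis .
qed

lemma \<gamma>_\<sigma>: "t \<in> car W2 \<Longrightarrow> \<gamma> (\<sigma> t) = \<gamma> t"
proof (induction t rule: W2_induct_HLRH)
  case (gen a b m n)
  have "(\<iota> a * m) \<otimes> (n * \<iota> b) = lact W2 a (ract W2 (m \<otimes> n) b)" using gen by simp
  then show ?case
    using gen by (simp add: \<sigma>_lact \<sigma>_ract \<gamma>_lact \<gamma>_ract \<sigma>_flip \<gamma>_flip[OF gen] del: htp_act \<sigma>_htp)
qed simp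

subsection \<open>Moving the metric to the left\<close>

definition sym_lco :: "('w \<times> 'w \<Rightarrow>\<^sub>0 'k) set" where
  "sym_lco = fsc.span {p \<otimes> q | p q. p \<in> lco \<and> q \<in> lco}"

lemma sym_lco_W2: "t \<in> sym_lco \<Longrightarrow> t \<in> car W2"
  unfolding sym_lco_def
  by (rule subsetD[OF fsc.span_minimal[OF _ W2.subspace[unfolded sc_W]]]) auto

lemma lcoact_FT_twist:
  assumes s [lin]: "vector_space s" and F: "hbilin s F" and G: "G \<in> car FT" and t: "t \<in> sym_lco"
  shows "lext s (lcoact FT G) (\<lambda>(h, G0). lext s (\<Delta> h) (\<lambda>(h1, h2). F h1 (S h2 * pair G0 t))) = F (pair G t) 1"
proof -
  note F12 [lin] = bilin_onD(1)[OF F UNIV_I, THEN lin_compU] bilin_onD(2)[OF F UNIV_I, THEN lin_compU]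
  interpret vs: vector_space s by (rule s)
  let ?L = "\<lambda>t. lext s (lcoact FT G) (\<lambda>(h, G0). lext s (\<Delta> h) (\<lambda>(h1, h2). F h1 (S h2 * pair G0 t)))"
  have 1: "lin_on UNIV fsc s ?L" and 2: "lin_on UNIV fsc s (\<lambda>t. F (pair G t) 1)"
    by (intro lin)+
  have base: "?L (p \<otimes> q) = F (pair G (p \<otimes> q)) 1" if "p \<in> lco" "q \<in> lco" for p q
  proof -
    have "?L (p \<otimes> q) = lext s (\<Delta> (pair G (p \<otimes> q))) (\<lambda>(h, x). lext s (\<Delta> h) (\<lambda>(h1, h2). F h1 (S h2 * x)))"
      by (rule lcoact_FT_eval[OF s _ G that, where R = "\<lambda>h x. lext s (\<Delta> h) (\<lambda>(h1, h2). F h1 (S h2 * x))"])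
        (auto intro!: bilin_onI lin)
    then show ?thesis by (simp add: antipode_twist[OF s F])
  qed
  show ?thesis
    using t unfolding sym_lco_def
  proof (induction t rule: fsc.span_induct_alt)
    case base
    then show ?case
      using lin_on_zero[OF vs_fsc s fsc.subspace_UNIV 1] lin_on_zero[OF vs_fsc s fsc.subspace_UNIV 2] by simp
  next
    case (step c x y)
    then show ?case
      using lin_on_add[OF 1, of "fsc c x" y] lin_on_add[OF 2, of "fsc c x" y]
        lin_on_scale[OF 1, of x c] lin_on_scale[OF 2, of x c] base by auto
  qed
qed

definition ad2 :: "'w \<Rightarrow> 'w \<Rightarrow> 'h \<Rightarrow> ('w \<times> 'w \<Rightarrow>\<^sub>0 'k)" where
  "ad2 p q a = swe (\<Delta> a) (\<lambda>(c, v). ad p v \<otimes> ad q c)"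

lemma ad2_in: "p \<in> lco \<Longrightarrow> q \<in> lco \<Longrightarrow> ad2 p q a \<in> sym_lco"
proof -
  have b: "x \<otimes> y \<in> sym_lco" if "x \<in> lco" "y \<in> lco" for x y
    unfolding sym_lco_def by (rule fsc.span_base) (use that in blast)
  assume "p \<in> lco" "q \<in> lco"
  then show ?thesis
    unfolding ad2_def
    by (intro lext_in_subspace[OF vs_fsc fsc.subspace_span[of "{p \<otimes> q | p q. p \<in> lco \<and> q \<in> lco}", folded sym_lco_def]])
      (auto intro!: b)
qed

lemma lin_ad2 [lin]: "lin_on A s sH f \<Longrightarrow> lin_on A s fsc (\<lambda>x. ad2 p q (f x))"
  unfolding ad2_def by (intro lin)

lemma ad2_decomp:
  assumes p: "p \<in> lco" and q: "q \<in> lco"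
  shows "lact W2 a (p \<otimes> q) = swe (\<Delta> a) (\<lambda>(a1, a'). ract W2 (ad2 p q a') a1)"
proof -
  note [simp] = p q
  have "lact W2 a (p \<otimes> q) = lext sC (\<Delta> a) (\<lambda>(b, v). ad p v * \<iota> b) \<otimes> q"
    by (simp flip: ad_decomp)
  also have "\<dots> = swe (\<Delta> a) (\<lambda>(b, v). (ad p v * \<iota> b) \<otimes> q)"
    by (rule lin_on_lext_apply2[OF vs_C vs_fsc \<Omega>_subspace, of "\<lambda>x. x \<otimes> q"]) (auto intro!: lin)
  also have "\<dots> = swe (\<Delta> a) (\<lambda>(b, v). ad p v \<otimes> lext sC (\<Delta> b) (\<lambda>(a1, c). ad q c * \<iota> a1))"
    by (simp add: htp_bal flip: ad_decomp)
  also have "\<dots> = swe (\<Delta> a) (\<lambda>(b, v). swe (\<Delta> b) (\<lambda>(a1, c). ad p v \<otimes> (ad q c * \<iota> a1)))"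
    by (intro lext_cong2 lin_on_lext_apply2[OF vs_C vs_fsc \<Omega>_subspace, of "\<lambda>x. ad p _ \<otimes> x"]) (auto intro!: lin)
  also have "\<dots> = swe (\<Delta> a) (\<lambda>(a1, a'). swe (\<Delta> a') (\<lambda>(c, v). ad p v \<otimes> (ad q c * \<iota> a1)))"
    by (rule coassoc) (auto intro!: lin)
  also have "\<dots> = swe (\<Delta> a) (\<lambda>(a1, a'). ract W2 (ad2 p q a') a1)"
  proof (intro lext_cong2)
    fix a1 a'
    have "ract W2 (ad2 p q a') a1 = swe (\<Delta> a') (\<lambda>(c, v). ract W2 (ad p v \<otimes> ad q c) a1)"
      unfolding ad2_def by (rule lin_on_lext_apply2[OF vs_fsc vs_fsc fsc.subspace_UNIV, of "\<lambda>t. ract W2 t a1"]) (auto intro!: lin)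
    then show "swe (\<Delta> a') (\<lambda>(c, v). ad p v \<otimes> (ad q c * \<iota> a1)) = ract W2 (ad2 p q a') a1" by simp
  qed
  finally show ?thesis .
qed

lemma pair_ad2:
  assumes "p \<in> lco" "q \<in> lco" "G \<in> car FT"
  shows "pair G (lact W2 a (p \<otimes> q)) = lext sH (\<Delta> a) (\<lambda>(a1, a'). pair G (ad2 p q a') * a1)"
proof -
  have "pair G (lact W2 a (p \<otimes> q)) = lext sH (\<Delta> a) (\<lambda>(a1, a'). pair G (ract W2 (ad2 p q a') a1))"
    unfolding ad2_decomp[OF assms(1,2)]
    by (rule lin_on_lext_apply2[OF vs_fsc vs_H fsc.subspace_UNIV pair_lin[OF lin_on_id]]) simp
  then show ?thesis using assms by (simp add: pair_act sym_lco_W2[OF ad2_in])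
qed

definition phi :: "('w \<times> 'w \<Rightarrow>\<^sub>0 'k) \<Rightarrow> (('w \<Rightarrow> 'h) \<times> ('w \<Rightarrow> 'h) \<Rightarrow>\<^sub>0 'k) \<Rightarrow> 'w \<Rightarrow> 'w" where
  "phi t G w = lext sC (lcoact FT G) (\<lambda>(h, G0). lext sC (\<Delta> h) (\<lambda>(m2, m1). lext sC (cr w) (\<lambda>(n0, k). lext sC (\<Delta> k) (\<lambda>(n1, n2).
     \<iota> m2 * (n0 * \<iota> (S n1)) * \<iota> (S m1 * pair G0 (lact W2 n2 t))))))"

lemma phi_eq:
  assumes p: "p \<in> lco" and q: "q \<in> lco" and G: "G \<in> car FT" and n: "n \<in> rco"
  shows "phi (p \<otimes> q) G (\<iota> a * n) = \<iota> (pair G (lact W2 a (p \<otimes> q))) * n"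
proof -
  let ?t = "p \<otimes> q"
  note [simp] = p q G n
  have "phi ?t G (\<iota> a * n) = lext sC (lcoact FT G) (\<lambda>(h, G0). lext sC (\<Delta> h) (\<lambda>(m2, m1). lext sC (\<Delta> a) (\<lambda>(a1, a'). lext sC (\<Delta> a') (\<lambda>(a2, a3).
     \<iota> m2 * (\<iota> a1 * n * \<iota> (S a2)) * \<iota> (S m1 * pair G0 (lact W2 a3 ?t))))))"
    unfolding phi_def
    by (intro lext_cong2 cr_comult_right(2)[OF vs_C _ n, where F = "\<lambda>x k. \<iota> _ * x * \<iota> (S _ * pair _ (lact W2 k ?t))"])
      (auto intro!: bilin_onI lin simp del: htp_act)
  also have "\<dots> = lext sC (\<Delta> a) (\<lambda>(a1, a'). lext sC (\<Delta> a') (\<lambda>(a2, a3). lext sC (lcoact FT G) (\<lambda>(h, G0). lext sC (\<Delta> h) (\<lambda>(m2, m1).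
     \<iota> m2 * (\<iota> a1 * n * \<iota> (S a2)) * \<iota> (S m1 * pair G0 (lact W2 a3 ?t))))))"
    by (rule lext_swap4[OF vs_C])
  also have "\<dots> = lext sC (\<Delta> a) (\<lambda>(a1, a'). lext sC (\<Delta> a') (\<lambda>(a2, a3). lext sC (\<Delta> a3) (\<lambda>(b1, b').
     \<iota> (pair G (ad2 p q b')) * (\<iota> a1 * n * \<iota> (S a2)) * \<iota> b1)))"
  proof (intro lext_cong2)
    fix a1 a' a2 a3
    have "lext sC (lcoact FT G) (\<lambda>(h, G0). lext sC (\<Delta> h) (\<lambda>(m2, m1). \<iota> m2 * (\<iota> a1 * n * \<iota> (S a2)) * \<iota> (S m1 * pair G0 (lact W2 a3 ?t)))) =
      lext sC (lcoact FT G) (\<lambda>(h, G0). lext sC (\<Delta> h) (\<lambda>(m2, m1). lext sC (\<Delta> a3) (\<lambda>(b1, b').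
        \<iota> m2 * (\<iota> a1 * n * \<iota> (S a2)) * \<iota> (S m1 * pair G0 (ad2 p q b') * b1))))"
    proof (intro lext_cong2)
      fix h G0 m2 m1 assume "(h, G0) \<in> Poly_Mapping.keys (lcoact FT G)"
      then have "G0 \<in> car FT" by auto
      then show "\<iota> m2 * (\<iota> a1 * n * \<iota> (S a2)) * \<iota> (S m1 * pair G0 (lact W2 a3 ?t)) =
        lext sC (\<Delta> a3) (\<lambda>(b1, b'). \<iota> m2 * (\<iota> a1 * n * \<iota> (S a2)) * \<iota> (S m1 * pair G0 (ad2 p q b') * b1))"
        unfolding pair_ad2[OF p q \<open>G0 \<in> car FT\<close>] mult.assoc[of "S m1"]
        by (intro hlin_lext[OF vs_C, of "\<lambda>z. \<iota> m2 * (\<iota> a1 * n * \<iota> (S a2)) * \<iota> (S m1 * z)"] lin)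
    qed
    also have "\<dots> = lext sC (\<Delta> a3) (\<lambda>(b1, b'). lext sC (lcoact FT G) (\<lambda>(h, G0). lext sC (\<Delta> h) (\<lambda>(m2, m1).
        \<iota> m2 * (\<iota> a1 * n * \<iota> (S a2)) * \<iota> (S m1 * pair G0 (ad2 p q b') * b1))))"
      by (rule lext_swap3[OF vs_C])
    also have "\<dots> = lext sC (\<Delta> a3) (\<lambda>(b1, b'). \<iota> (pair G (ad2 p q b')) * (\<iota> a1 * n * \<iota> (S a2)) * \<iota> (1 * b1))"
      by (intro lext_cong2 lcoact_FT_twist[OF vs_C _ G ad2_in[OF p q], where F = "\<lambda>x y. \<iota> x * (\<iota> a1 * n * \<iota> (S a2)) * \<iota> (y * _)"])
        (auto intro!: bilin_onI lin)
    finally show "lext sC (lcoact FT G) (\<lambda>(h, G0). lext sC (\<Delta> h) (\<lambda>(m2, m1). \<iota> m2 * (\<iota> a1 * n * \<iota> (S a2)) * \<iota> (S m1 * pair G0 (lact W2 a3 ?t)))) =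
      lext sC (\<Delta> a3) (\<lambda>(b1, b'). \<iota> (pair G (ad2 p q b')) * (\<iota> a1 * n * \<iota> (S a2)) * \<iota> b1)" by simp
  qed
  also have "\<dots> = lext sC (\<Delta> a) (\<lambda>(a1, a'). lext sC (\<Delta> a') (\<lambda>(c, b'). lext sC (\<Delta> c) (\<lambda>(a2, b1).
     \<iota> (pair G (ad2 p q b')) * (\<iota> a1 * n * \<iota> (S a2)) * \<iota> b1)))"
    by (intro lext_cong2 coassoc[symmetric]) (auto intro!: lin)
  also have "\<dots> = lext sC (\<Delta> a) (\<lambda>(a1, a'). lext sC (\<Delta> a') (\<lambda>(c, b'). lext sC (\<Delta> c) (\<lambda>(a2, b1).
     \<iota> (pair G (ad2 p q b')) * (\<iota> a1 * n) * \<iota> (S a2 * b1))))"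
    by (simp add: calc.embed_hom mult.assoc)
  also have "\<dots> = lext sC (\<Delta> a) (\<lambda>(a1, a'). \<iota> (pair G (ad2 p q a')) * (\<iota> a1 * n) * \<iota> 1)"
    by (intro lext_cong2 cancel_left[OF cancels_S_left vs_C]) (auto intro!: lin)
  also have "\<dots> = lext sC (\<Delta> a) (\<lambda>(a1, a'). \<iota> (pair G (ad2 p q a') * a1) * n)"
    by (simp add: calc.embed_hom mult.assoc)
  also have "\<dots> = \<iota> (lext sH (\<Delta> a) (\<lambda>(a1, a'). pair G (ad2 p q a') * a1)) * n"
    by (rule hlin_lext[OF vs_C, of "\<lambda>z. \<iota> z * n", symmetric]) (intro lin)
  finally show ?thesis using pair_ad2[OF p q G, of a] by (simp del: htp_act)
qed

lemma phi_lin [lin]: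
  "lin_on A s fsc f \<Longrightarrow> lin_on A s sC (\<lambda>z. phi t (f z) x)"
  "lin_on A s sC f' \<Longrightarrow> (\<And>x. x \<in> A \<Longrightarrow> f' x \<in> \<Omega>) \<Longrightarrow> lin_on A s sC (\<lambda>z. phi t G (f' z))"
  unfolding phi_def by (auto intro!: lin)

lemma phi_bal:
  assumes p: "p \<in> lco" and q: "q \<in> lco" and G: "G \<in> car FT" and x: "x \<in> \<Omega>"
  shows "phi (p \<otimes> q) (ract FT G c) x = phi (p \<otimes> q) G (\<iota> c * x)"
  using x
proof (induction x rule: \<Omega>_induct_HR)
  case (gen a n)
  have "phi (p \<otimes> q) G (\<iota> (c * a) * n) = \<iota> (pair G (lact W2 c (lact W2 a (p \<otimes> q)))) * n"
    using p q G gen by (simp add: phi_eq W2.lact_mult del: htp_act)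
  then show ?case
    using p q G gen by (simp add: phi_eq pair_act calc.embed_hom mult.assoc del: htp_act)
next
  case (add x y)
  then show ?case
    using lin_on_add[OF phi_lin(2)[OF lin_on_id], of \<Omega>] by (simp add: distrib_left)
qed

lemma eval_htp:
  assumes w: "w \<in> \<Omega>" and G: "G \<in> car FT" and t: "t \<in> car W2"
  shows "lext sC (htp Om FT w G) (\<lambda>(w, G). w * \<iota> (pair G t)) = w * \<iota> (pair G t)"
proof (rule OF.lext_htp[OF vs_C])
  show "bilin Om FT sC (\<lambda>w G. w * \<iota> (pair G t))" by (auto intro!: bilin_onI lin)
  show "ract Om x c * \<iota> (pair G t) = x * \<iota> (pair (lact FT c G) t)" if "x \<in> car Om" "G \<in> car FT" for x c G
    using that t by (simp add: pair_act calc.embed_hom mult.assoc)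
qed (use w G in simp_all)

lemma \<gamma>_commute_right:
  assumes p: "p \<in> lco" and q: "q \<in> lco" and n: "n \<in> rco"
  shows "\<iota> (\<gamma> (p \<otimes> q)) * n = n * \<iota> (\<gamma> (p \<otimes> q))"
proof -
  let ?t = "p \<otimes> q"
  have 1: "lext sC (swe (lcoact FT G) (\<lambda>(h, G0). swe (\<Delta> h) (\<lambda>(m2, m1). swe (cr w) (\<lambda>(n0, k). swe (\<Delta> k) (\<lambda>(n1, n2).
     htp Om FT (\<iota> m2 * (n0 * \<iota> (S n1))) (lact FT (S m1) (ract FT G0 n2))))))) (\<lambda>(w, G). w * \<iota> (pair G ?t)) = phi ?t G w"
    if "G \<in> car FT" "w \<in> \<Omega>" for G w
    unfolding lext_lext2[OF vs_C] phi_def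
  proof (intro lext_cong2)
    fix h G0 m2 m1 n0 k n1 n2
    assume "(h, G0) \<in> Poly_Mapping.keys (lcoact FT G)" "(n0, k) \<in> Poly_Mapping.keys (cr w)"
    then have "G0 \<in> car FT" "n0 \<in> \<Omega>" using that by auto
    then show "lext sC (htp Om FT (\<iota> m2 * (n0 * \<iota> (S n1))) (lact FT (S m1) (ract FT G0 n2))) (\<lambda>(w, G). w * \<iota> (pair G ?t)) =
      \<iota> m2 * (n0 * \<iota> (S n1)) * \<iota> (S m1 * pair G0 (lact W2 n2 ?t))"
      using p q by (subst eval_htp) (simp_all add: pair_act del: htp_act)
  qed
  have "lext sC (braid H FT Om (htp FT Om g n)) (\<lambda>(w, G). w * \<iota> (pair G ?t)) = lext sC (htp FT Om g n) (\<lambda>(G, w). phi ?t G w)"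
    unfolding braid_def Om_simps
    by (subst lext_lext2[OF vs_C], intro lext_cong2 1)
      (use FO.tens_keys[OF FO.htp_in[where H=H]] in \<open>auto\<close>)
  also have "\<dots> = phi ?t g n"
    by (rule FO.lext_htp[OF vs_C]) (use p q n in \<open>auto intro!: bilin_onI lin phi_bal\<close>)
  also have "\<dots> = \<iota> (\<gamma> ?t) * n"
    using phi_eq[OF p q g_in n, of 1] p q n by (simp add: calc.embed_hom)
  finally have "lext sC (braid H FT Om (htp FT Om g n)) (\<lambda>(w, G). w * \<iota> (pair G ?t)) = \<iota> (\<gamma> ?t) * n" .
  moreover have "braid H FT Om (htp FT Om g n) = htp Om FT n g"
    using central n by (simp add: sigma_central_def)
  ultimately show ?thesis using eval_htp[of n g ?t] p q n by simp
qed

subsection \<open>Contractions of three-fold tensors\<close>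

abbreviation "g12 \<equiv> pair3 H C g"

definition g23 :: "(('w \<times> 'w \<Rightarrow>\<^sub>0 'k) \<times> 'w \<Rightarrow>\<^sub>0 'k) \<Rightarrow> 'w" where
  "g23 t = lext sC t (\<lambda>(s, z). lext sC s (\<lambda>(x, y). x * \<iota> (\<gamma> (y \<otimes> z))))"

lemma g_lin [lin]:
  "lin_on A s fsc f \<Longrightarrow> lin_on A s sC (\<lambda>x. g12 (f x))"
  "lin_on A s fsc f \<Longrightarrow> lin_on A s sC (\<lambda>x. g23 (f x))"
  unfolding pair3_def g23_def by (intro lin, assumption)+

lemma g_add [simp]: "g12 (t + u) = g12 t + g12 u" "g23 (t + u) = g23 t + g23 u"
  by (simp_all add: pair3_def g23_def lext_add[OF vs_C])

lemma \<gamma>_bal: "x \<in> \<Omega> \<Longrightarrow> y \<in> \<Omega> \<Longrightarrow> \<gamma> ((\<iota> a * x) \<otimes> y) = a * \<gamma> (x \<otimes> y)"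
  "x \<in> \<Omega> \<Longrightarrow> y \<in> \<Omega> \<Longrightarrow> \<gamma> (x \<otimes> (y * \<iota> a)) = \<gamma> (x \<otimes> y) * a"
  using \<gamma>_lact[of "x \<otimes> y" a] \<gamma>_ract[of "x \<otimes> y" a] by auto

lemma g12_htp [simp]: "t \<in> car W2 \<Longrightarrow> z \<in> \<Omega> \<Longrightarrow> g12 (t \<odot> z) = \<iota> (\<gamma> t) * z"
  unfolding pair3_def Om_simps
  by (rule lext_WO[OF vs_C]) (auto intro!: bilin_onI lin simp: \<gamma>_ract calc.embed_hom mult.assoc)

lemma g23_htp [simp]:
  assumes "x \<in> \<Omega>" "y \<in> \<Omega>" "z \<in> \<Omega>"
  shows "g23 (x \<otimes> y \<odot> z) = x * \<iota> (\<gamma> (y \<otimes> z))"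
proof -
  have f: "lext sC (x \<otimes> y) (\<lambda>(x, y). x * \<iota> (\<gamma> (y \<otimes> z))) = x * \<iota> (\<gamma> (y \<otimes> z))"
    if "x \<in> \<Omega>" "y \<in> \<Omega>" "z \<in> \<Omega>" for x y z
    by (rule lext_OO[OF vs_C that(1,2)])
      (use that in \<open>auto intro!: bilin_onI lin simp: \<gamma>_bal calc.embed_hom mult.assoc\<close>)
  have b: "lext sC (ract W2 t a) (\<lambda>(x, y). x * \<iota> (\<gamma> (y \<otimes> z))) = lext sC t (\<lambda>(x, y). x * \<iota> (\<gamma> (y \<otimes> (\<iota> a * z))))"
    if "t \<in> car W2" "z \<in> \<Omega>" for t a z
    using that by (induction t rule: W2_induct) (simp_all add: f lext_add[OF vs_C] htp_bal)
  have "g23 (x \<otimes> y \<odot> z) = lext sC (x \<otimes> y) (\<lambda>(x, y). x * \<iota> (\<gamma> (y \<otimes> z)))"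
    unfolding g23_def by (rule lext_WO[OF vs_C]) (use assms in \<open>auto intro!: bilin_onI lin simp: b\<close>)
  then show ?thesis using f assms by simp
qed

lemma g_act:
  assumes "t \<in> car W3"
  shows "g12 (lact W3 a t) = \<iota> a * g12 t" "g12 (ract W3 t a) = g12 t * \<iota> a"
    "g23 (lact W3 a t) = \<iota> a * g23 t" "g23 (ract W3 t a) = g23 t * \<iota> a"
proof -
  have "g12 (lact W3 a t) = \<iota> a * g12 t \<and> g12 (ract W3 t a) = g12 t * \<iota> a \<and>
    g23 (lact W3 a t) = \<iota> a * g23 t \<and> g23 (ract W3 t a) = g23 t * \<iota> a"
    using assms
    by (induction t rule: W3_induct) (simp_all add: \<gamma>_bal calc.embed_hom mult.assoc distrib_left distrib_right)
  then show "g12 (lact W3 a t) = \<iota> a * g12 t" "g12 (ract W3 t a) = g12 t * \<iota> a"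
    "g23 (lact W3 a t) = \<iota> a * g23 t" "g23 (ract W3 t a) = g23 t * \<iota> a" by auto
qed

lemma g23_\<sigma>12_\<sigma>23: "t \<in> car W3 \<Longrightarrow> g23 (\<sigma>12 (\<sigma>23 t)) = g12 t"
proof (induction t rule: W3_induct_LLR)
  case (gen a b p q n)
  then have "p \<otimes> q \<odot> n \<in> car W3" by simp
  then have "g23 (\<sigma>12 (\<sigma>23 (lact W3 a (ract W3 (p \<otimes> q \<odot> n) b)))) = \<iota> a * (g23 (n \<otimes> p \<odot> q) * \<iota> b)"
    by (simp add: g_act on_act[OF bimap_\<sigma>] \<sigma>12_\<sigma>23_flip[OF gen] W3.lact_closed W3.ract_closed
        del: htp_act WO.htp_in \<sigma>_ops(5,6)) (simp add: \<sigma>12_\<sigma>23_flip[OF gen] g_act del: htp_act)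
  also have "\<dots> = g12 (lact W3 a (ract W3 (p \<otimes> q \<odot> n) b))"
  proof -
    have "n * (\<iota> (\<gamma> (p \<otimes> q)) * \<iota> b) = \<iota> (\<gamma> (p \<otimes> q)) * (n * \<iota> b)"
      using \<gamma>_commute_right[OF gen] by (metis mult.assoc)
    then show ?thesis using gen by (simp add: \<gamma>_bal calc.embed_hom mult.assoc)
  qed
  finally show ?case .
qed simp

lemma g12_\<sigma>23_\<sigma>12: "t \<in> car W3 \<Longrightarrow> g12 (\<sigma>23 (\<sigma>12 t)) = g23 t"
proof (induction t rule: W3_induct_LRR)
  case (gen a b p q r)
  then have "p \<otimes> q \<odot> r \<in> car W3" by simp
  then have "g12 (\<sigma>23 (\<sigma>12 (lact W3 a (ract W3 (p \<otimes> q \<odot> r) b)))) = \<iota> a * (g12 (q \<otimes> r \<odot> p) * \<iota> b)"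
    by (simp add: g_act on_act[OF bimap_\<sigma>] \<sigma>23_\<sigma>12_flip[OF gen] W3.lact_closed W3.ract_closed
        del: htp_act WO.htp_in \<sigma>_ops(5,6)) (simp add: \<sigma>23_\<sigma>12_flip[OF gen] g_act del: htp_act)
  also have "\<dots> = g23 (lact W3 a (ract W3 (p \<otimes> q \<odot> r) b))"
  proof -
    have "p * (\<iota> (\<gamma> (q \<otimes> r)) * \<iota> b) = \<iota> (\<gamma> (q \<otimes> r)) * (p * \<iota> b)"
      using \<gamma>_commute_left[OF gen(2,3,1)] by (metis mult.assoc)
    then show ?thesis using gen by (simp add: \<gamma>_bal calc.embed_hom mult.assoc)
  qed
  finally show ?case .
qed simp

end

section \<open>Right linear maps into symmetric tensors\<close>

context hopf_metric
begin

interpretation vH: vector_space "sc H" by (rule vector_space)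
interpretation vC: vector_space "sc C" by (rule calc.vector_space)

lemma g_in_\<Omega> [simp]: "t \<in> car W3 \<Longrightarrow> g12 t \<in> \<Omega>" "t \<in> car W3 \<Longrightarrow> g23 t \<in> \<Omega>"
proof -
  show "t \<in> car W3 \<Longrightarrow> g12 t \<in> \<Omega>" by (induction t rule: W3_induct) simp_all
  show "t \<in> car W3 \<Longrightarrow> g23 t \<in> \<Omega>" by (induction t rule: W3_induct) simp_all
qed

lemma basis_right: "w \<in> \<Omega> \<Longrightarrow> (\<Sum>p\<in>K. eb p * \<iota> (\<gamma> (zb p \<otimes> w))) = w"
  by (simp add: \<gamma>_zb flip: dual_basis)

lemma htp_sum:
  assumes "\<And>i. i \<in> I \<Longrightarrow> f i \<in> \<Omega>" "y \<in> \<Omega>"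
  shows "(\<Sum>i\<in>I. f i) \<otimes> y = (\<Sum>i\<in>I. f i \<otimes> y)" "y \<otimes> (\<Sum>i\<in>I. f i) = (\<Sum>i\<in>I. y \<otimes> f i)"
proof -
  show "(\<Sum>i\<in>I. f i) \<otimes> y = (\<Sum>i\<in>I. f i \<otimes> y)"
    by (rule lin_on_sum[OF vs_C vs_fsc \<Omega>_subspace, of "\<lambda>x. x \<otimes> y"]) (use assms in \<open>auto intro!: lin\<close>)
  show "y \<otimes> (\<Sum>i\<in>I. f i) = (\<Sum>i\<in>I. y \<otimes> f i)"
    by (rule lin_on_sum[OF vs_C vs_fsc \<Omega>_subspace, of "\<lambda>x. y \<otimes> x"]) (use assms in \<open>auto intro!: lin\<close>)
qed

lemma \<gamma>_sum: "\<gamma> (\<Sum>i\<in>I. t i) = (\<Sum>i\<in>I. \<gamma> (t i))"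
  by (rule lin_on_sum[OF vs_fsc vs_H fsc.subspace_UNIV pair_lin[OF lin_on_id]]) simp

lemma basis_left: "z \<in> \<Omega> \<Longrightarrow> (\<Sum>p\<in>K. \<iota> (\<gamma> (z \<otimes> eb p)) * zb p) = z"
proof -
  assume z: "z \<in> \<Omega>"
  let ?z = "\<Sum>p\<in>K. \<iota> (\<gamma> (z \<otimes> eb p)) * zb p"
  have z': "?z \<in> \<Omega>" by (rule \<Omega>_sum) simp
  have "\<gamma> ((?z - z) \<otimes> w) = 0" if w: "w \<in> \<Omega>" for w
  proof -
    have "\<gamma> (?z \<otimes> w) = (\<Sum>p\<in>K. \<gamma> (z \<otimes> eb p) * \<gamma> (zb p \<otimes> w))"
      using w by (simp add: htp_sum \<gamma>_sum \<gamma>_bal)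
    also have "\<dots> = \<gamma> (z \<otimes> (\<Sum>p\<in>K. eb p * \<iota> (\<gamma> (zb p \<otimes> w))))"
      using w z by (simp add: htp_sum \<gamma>_sum \<gamma>_bal)
    also have "\<dots> = \<gamma> (z \<otimes> w)" by (simp add: basis_right w)
    finally have "\<gamma> (?z \<otimes> w) = \<gamma> (z \<otimes> w)" .
    moreover have "(?z - z) \<otimes> w = ?z \<otimes> w - z \<otimes> w"
      by (rule lin_on_diff[OF vs_C vs_fsc \<Omega>_subspace, of "\<lambda>x. x \<otimes> w"]) (use z z' w in \<open>auto intro!: lin\<close>)
    ultimately show ?thesis by simp
  qed
  then have "?z - z = 0" using z z' by (intro \<gamma>_nondegenerate) simp_all
  then show "?z = z" by simp
qed

definition gg :: "('w \<times> 'w \<Rightarrow>\<^sub>0 'k) \<Rightarrow> ('w \<times> 'w \<Rightarrow>\<^sub>0 'k) \<Rightarrow> 'h" where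
  "gg u s = lext sH u (\<lambda>(y, z). \<gamma> (y \<otimes> g12 (attch z s)))"

lemma gg_htp [simp]: "y \<in> \<Omega> \<Longrightarrow> z \<in> \<Omega> \<Longrightarrow> s \<in> car W2 \<Longrightarrow> gg (y \<otimes> z) s = \<gamma> (y \<otimes> g12 (attch z s))"
  unfolding gg_def
  by (rule lext_OO[OF vs_H]) (auto intro!: bilin_onI lin simp: attch_act g_act htp_bal)

lemma gg_add [simp]: "gg (t + u) s = gg t s + gg u s"
  by (simp add: gg_def lext_add[OF vs_H])

lemma gg_add2 [simp]: "u \<in> car W2 \<Longrightarrow> s \<in> car W2 \<Longrightarrow> t \<in> car W2 \<Longrightarrow> gg u (s + t) = gg u s + gg u t"
  by (induction u rule: W2_induct) (simp_all add: algebra_simps)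

lemma gg_lin1: "lin_on A s' fsc f \<Longrightarrow> lin_on A s' sH (\<lambda>x. gg (f x) s)"
  unfolding gg_def by (intro lin)

lemma gg_lin2: "u \<in> car W2 \<Longrightarrow> lin_on (car W2) fsc sH (gg u)"
  unfolding gg_def by (auto intro!: lin)

lemma gg_lact: "u \<in> car W2 \<Longrightarrow> s \<in> car W2 \<Longrightarrow> gg (lact W2 a u) s = a * gg u s"
  by (induction u rule: W2_induct) (simp_all add: \<gamma>_bal distrib_left)

lemma gg_htp_lact: "y \<in> \<Omega> \<Longrightarrow> z \<in> \<Omega> \<Longrightarrow> s \<in> car W2 \<Longrightarrow> gg ((\<iota> a * y) \<otimes> z) s = a * gg (y \<otimes> z) s"
  using gg_lact[of "y \<otimes> z" s a] by simp

lemma gg_g23: "u \<in> car W2 \<Longrightarrow> m \<in> \<Omega> \<Longrightarrow> n \<in> \<Omega> \<Longrightarrow> gg u (m \<otimes> n) = \<gamma> (g23 (u \<odot> m) \<otimes> n)"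
  by (induction u rule: W2_induct) (simp_all add: htp_bal)

lemma gg_\<sigma>:
  assumes u: "u \<in> car W2" and s: "s \<in> car W2"
  shows "gg (\<sigma> u) s = gg u (\<sigma> s)"
proof -
  have *: "\<gamma> (g12 (attch y v) \<otimes> n) = \<gamma> (y \<otimes> g23 (v \<odot> n))" if "v \<in> car W2" "y \<in> \<Omega>" "n \<in> \<Omega>" for v y n
    using that by (induction v rule: W2_induct) (simp_all add: \<gamma>_bal)
  have htp: "gg (\<sigma> (y \<otimes> z)) (m \<otimes> n) = gg (y \<otimes> z) (\<sigma> (m \<otimes> n))" if yzmn: "y \<in> \<Omega>" "z \<in> \<Omega>" "m \<in> \<Omega>" "n \<in> \<Omega>" for y z m n
  proof -
    obtain v where v: "v \<in> car W2" "\<sigma> v = z \<otimes> m" using \<sigma>_surj[of "z \<otimes> m"] yzmn by auto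
    have "gg (\<sigma> (y \<otimes> z)) (m \<otimes> n) = \<gamma> (g23 (\<sigma>12 (attch y (\<sigma> v))) \<otimes> n)"
      using yzmn v(2) by (simp add: gg_g23)
    also have "\<dots> = \<gamma> (g12 (attch y v) \<otimes> n)"
      using g23_\<sigma>12_\<sigma>23[of "attch y v"] v(1) yzmn by (simp add: on_23_attch[OF bimap_\<sigma>])
    also have "\<dots> = \<gamma> (y \<otimes> g23 (v \<odot> n))" using * v(1) yzmn by simp
    also have "\<dots> = \<gamma> (y \<otimes> g12 (\<sigma>23 (\<sigma> v \<odot> n)))"
      using g12_\<sigma>23_\<sigma>12[of "v \<odot> n"] v(1) yzmn by simp
    also have "\<dots> = gg (y \<otimes> z) (\<sigma> (m \<otimes> n))" using yzmn v(2) by simp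
    finally show ?thesis .
  qed
  have "gg (\<sigma> u) (m \<otimes> n) = gg u (\<sigma> (m \<otimes> n))" if "m \<in> \<Omega>" "n \<in> \<Omega>" for m n
    using u by (induction u rule: W2_induct) (use htp that in \<open>simp_all del: \<sigma>_htp gg_htp\<close>)
  with s u show ?thesis by (induction s rule: W2_induct) (simp_all del: \<sigma>_htp)
qed

lemma gg_\<pi>: "s \<in> V \<Longrightarrow> u \<in> car W2 \<Longrightarrow> gg (\<pi> u) s = gg u s"
  "u \<in> V \<Longrightarrow> s \<in> car W2 \<Longrightarrow> gg u (\<pi> s) = gg u s"
proof -
  show "gg (\<pi> u) s = gg u s" if "s \<in> V" "u \<in> car W2"
    by (rule \<sigma>_invariant_\<pi>[OF vs_H gg_lin1[OF lin_on_id]]) (use that in \<open>simp_all add: gg_\<sigma> \<sigma>_V\<close>)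
  show "gg u (\<pi> s) = gg u s" if "u \<in> V" "s \<in> car W2"
    by (rule \<sigma>_invariant_\<pi>[OF vs_H gg_lin2]) (use that in \<open>simp_all add: \<sigma>_V flip: gg_\<sigma>\<close>)
qed

definition ev :: "('w \<times> 'w \<Rightarrow>\<^sub>0 'k) \<Rightarrow> (('w \<times> 'w \<Rightarrow>\<^sub>0 'k) \<times> 'w \<Rightarrow>\<^sub>0 'k) \<Rightarrow> 'w" where
  "ev s t = lext sC t (\<lambda>(u, z). lext sC u (\<lambda>(x, y). x * \<iota> (gg (y \<otimes> z) s)))"

lemma ev_htp [simp]:
  assumes "x \<in> \<Omega>" "y \<in> \<Omega>" "z \<in> \<Omega>" and s: "s \<in> car W2"
  shows "ev s (x \<otimes> y \<odot> z) = x * \<iota> (gg (y \<otimes> z) s)"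
proof -
  note [lin] = gg_lin1
  have f: "lext sC (x \<otimes> y) (\<lambda>(x, y). x * \<iota> (gg (y \<otimes> z) s)) = x * \<iota> (gg (y \<otimes> z) s)"
    if "x \<in> \<Omega>" "y \<in> \<Omega>" "z \<in> \<Omega>" for x y z
    by (rule lext_OO[OF vs_C that(1,2)])
      (use that s in \<open>auto intro!: bilin_onI lin simp: gg_htp_lact calc.embed_hom mult.assoc simp del: gg_htp\<close>)
  have b: "lext sC (ract W2 t a) (\<lambda>(x, y). x * \<iota> (gg (y \<otimes> z) s)) = lext sC t (\<lambda>(x, y). x * \<iota> (gg (y \<otimes> (\<iota> a * z)) s))"
    if "t \<in> car W2" "z \<in> \<Omega>" for t a z
    using that by (induction t rule: W2_induct) (simp_all add: f lext_add[OF vs_C] htp_bal del: gg_htp)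
  have "ev s (x \<otimes> y \<odot> z) = lext sC (x \<otimes> y) (\<lambda>(x, y). x * \<iota> (gg (y \<otimes> z) s))"
    unfolding ev_def by (rule lext_WO[OF vs_C]) (use assms in \<open>auto intro!: bilin_onI lin simp: b simp del: gg_htp\<close>)
  then show ?thesis using f assms by simp
qed

lemma ev_add [simp]: "ev s (t + u) = ev s t + ev s u" and ev_scale: "ev s (fsc c t) = sC c (ev s t)" and ev_0 [simp]: "ev s 0 = 0"
  by (simp_all add: ev_def lext_add[OF vs_C] lext_scale[OF vs_C] lext_0[OF vs_C])

lemma ev_attch: "u \<in> car W2 \<Longrightarrow> x \<in> \<Omega> \<Longrightarrow> s \<in> car W2 \<Longrightarrow> ev s (attch x u) = x * \<iota> (gg u s)"
  by (induction u rule: W2_induct) (simp_all add: calc.embed_hom distrib_left del: gg_htp)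

lemma ev_in: "t \<in> car W3 \<Longrightarrow> s \<in> car W2 \<Longrightarrow> ev s t \<in> \<Omega>"
  by (induction t rule: W3_induct) simp_all

lemma ev_sum: "ev s (\<Sum>i\<in>I. t i) = (\<Sum>i\<in>I. ev s (t i))"
  by (induction I rule: infinite_finite_induct) simp_all

lemma ev_on_23_\<pi>: "t \<in> car W3 \<Longrightarrow> s \<in> V \<Longrightarrow> ev s (on_23 H C \<pi> t) = ev s t"
  by (induction t rule: W3_induct) (simp_all add: on_23_htp[OF bimap_\<pi>] ev_attch gg_\<pi> bimapD[OF bimap_\<pi>] del: gg_htp)

lemma vee_12_induct [consumes 1, case_names zero add]:
  assumes t: "t \<in> vee_12 H C" and "P 0"
    and "\<And>c s z t. s \<in> V \<Longrightarrow> z \<in> \<Omega> \<Longrightarrow> t \<in> car W3 \<Longrightarrow> P t \<Longrightarrow> P (fsc c (s \<odot> z) + t)"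
  shows "P t"
proof -
  have "t \<in> car W3 \<and> P t"
    using t unfolding vee_12_def
    by (induction rule: fsc.span_induct_alt) (use assms(2,3) in auto)
  then show ?thesis ..
qed

lemma vee_23_induct [consumes 1, case_names zero add]:
  assumes t: "t \<in> vee_23 H C" and "P 0"
    and "\<And>c s x t. s \<in> V \<Longrightarrow> x \<in> \<Omega> \<Longrightarrow> t \<in> car W3 \<Longrightarrow> P t \<Longrightarrow> P (fsc c (attch x s) + t)"
  shows "P t"
proof -
  have "t \<in> car W3 \<and> P t"
    using t unfolding vee_23_def
    by (induction rule: fsc.span_induct_alt) (use assms(2,3) in auto)
  then show ?thesis ..
qed

lemma vee_W3 [simp]: "t \<in> vee_12 H C \<Longrightarrow> t \<in> car W3" "u \<in> vee_23 H C \<Longrightarrow> u \<in> car W3"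
  by (induction rule: vee_12_induct; simp) (induction rule: vee_23_induct; simp)

lemma vee_intros: "s \<in> V \<Longrightarrow> z \<in> \<Omega> \<Longrightarrow> s \<odot> z \<in> vee_12 H C" "s \<in> V \<Longrightarrow> z \<in> \<Omega> \<Longrightarrow> attch z s \<in> vee_23 H C"
  unfolding vee_12_def vee_23_def by (rule fsc.span_base, auto)+

lemma ev_vee_23: "t \<in> vee_23 H C \<Longrightarrow> s \<in> car W2 \<Longrightarrow> ev (\<pi> s) t = ev s t"
  by (induction rule: vee_23_induct) (simp_all add: ev_scale ev_attch gg_\<pi> \<pi>_props)

lemma on_23_vee: "t \<in> car W3 \<Longrightarrow> on_23 H C \<pi> t \<in> vee_23 H C"
proof (induction t rule: W3_induct)
  case (htp x y z)
  then show ?case by (simp add: on_23_htp[OF bimap_\<pi>] vee_intros \<pi>_props)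
next
  case (add t u)
  then show ?case unfolding vee_23_def by (simp add: fsc.span_add)
qed

lemma W2_basis_left:
  assumes "u \<in> car W2"
  shows "(\<Sum>p\<in>K. \<Sum>q\<in>K. lact W2 (gg u (eb p \<otimes> eb q)) (zb q \<otimes> zb p)) = u"
  using assms
proof (induction u rule: W2_induct)
  case (htp y z)
  have "(\<Sum>q\<in>K. lact W2 (gg (y \<otimes> z) (eb p \<otimes> eb q)) (zb q \<otimes> zb p)) = y \<otimes> (\<iota> (\<gamma> (z \<otimes> eb p)) * zb p)"
    if p: "p \<in> K" for p
  proof -
    let ?y = "y * \<iota> (\<gamma> (z \<otimes> eb p))"
    have "(\<Sum>q\<in>K. lact W2 (gg (y \<otimes> z) (eb p \<otimes> eb q)) (zb q \<otimes> zb p)) = (\<Sum>q\<in>K. \<iota> (\<gamma> (?y \<otimes> eb q)) * zb q) \<otimes> zb p"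
      using htp p by (simp add: htp_sum htp_bal)
    also have "\<dots> = ?y \<otimes> zb p" using htp p by (subst basis_left) simp_all
    finally show ?thesis using htp p by (simp add: htp_bal)
  qed
  then have "(\<Sum>p\<in>K. \<Sum>q\<in>K. lact W2 (gg (y \<otimes> z) (eb p \<otimes> eb q)) (zb q \<otimes> zb p)) = y \<otimes> (\<Sum>p\<in>K. \<iota> (\<gamma> (z \<otimes> eb p)) * zb p)"
    using htp by (simp add: htp_sum)
  then show ?case using htp by (simp add: basis_left)
next
  case (add t u)
  have "lact W2 (a + b) v = lact W2 a v + lact W2 b v" if "v \<in> car W2" for a b v
    using lin_on_add[OF W2.lact_lin1[OF that]] by simp
  then show ?case using add by (simp add: sum.distrib del: htp_act gg_htp)
qed

lemma W2_basis_right: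
  assumes "s \<in> car W2"
  shows "(\<Sum>p\<in>K. \<Sum>q\<in>K. ract W2 (eb p \<otimes> eb q) (gg (zb q \<otimes> zb p) s)) = s"
  using assms
proof (induction s rule: W2_induct)
  case (htp m n)
  have "(\<Sum>q\<in>K. ract W2 (eb p \<otimes> eb q) (gg (zb q \<otimes> zb p) (m \<otimes> n))) = (eb p * \<iota> (\<gamma> (zb p \<otimes> m))) \<otimes> n"
    if p: "p \<in> K" for p
  proof -
    let ?n = "\<iota> (\<gamma> (zb p \<otimes> m)) * n"
    have "(\<Sum>q\<in>K. ract W2 (eb p \<otimes> eb q) (gg (zb q \<otimes> zb p) (m \<otimes> n))) = eb p \<otimes> (\<Sum>q\<in>K. eb q * \<iota> (\<gamma> (zb q \<otimes> ?n)))"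
      using htp p by (simp add: htp_sum)
    also have "\<dots> = eb p \<otimes> ?n" using htp p by (subst basis_right) simp_all
    finally show ?thesis using htp p by (simp add: htp_bal)
  qed
  then have "(\<Sum>p\<in>K. \<Sum>q\<in>K. ract W2 (eb p \<otimes> eb q) (gg (zb q \<otimes> zb p) (m \<otimes> n))) = (\<Sum>p\<in>K. eb p * \<iota> (\<gamma> (zb p \<otimes> m))) \<otimes> n"
    using htp by (simp add: htp_sum)
  then show ?case using htp by (simp add: basis_right)
next
  case (add t u)
  have "ract W2 v (a + b) = ract W2 v a + ract W2 v b" if "v \<in> car W2" for a b v
    using lin_on_add[OF W2.ract_lin2[OF that]] by simp
  then show ?case using add by (simp add: sum.distrib del: gg_htp htp_act)
qed

lemma attch_sum: "attch x (\<Sum>i\<in>I. t i) = (\<Sum>i\<in>I. attch x (t i))"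
  by (rule lin_on_sum[OF vs_fsc vs_fsc fsc.subspace_UNIV attch_lin[OF lin_on_id]]) simp

lemma W3_recover:
  assumes "t \<in> car W3"
  shows "(\<Sum>p\<in>K. \<Sum>q\<in>K. attch (ev (eb p \<otimes> eb q) t) (zb q \<otimes> zb p)) = t"
  using assms
proof (induction t rule: W3_induct)
  case (htp x y z)
  have "(\<Sum>p\<in>K. \<Sum>q\<in>K. attch (ev (eb p \<otimes> eb q) (x \<otimes> y \<odot> z)) (zb q \<otimes> zb p)) =
    attch x (\<Sum>p\<in>K. \<Sum>q\<in>K. lact W2 (gg (y \<otimes> z) (eb p \<otimes> eb q)) (zb q \<otimes> zb p))"
    using htp by (simp add: attch_sum attch_act(1) del: gg_htp htp_act attch_htp)
  then show ?case using htp by (simp add: W2_basis_left del: gg_htp htp_act)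
next
  case (add t u)
  then show ?case by (simp add: sum.distrib ev_in del: attch_htp)
qed

subsection \<open>Contraction of a right linear map with the metric\<close>

definition rmap :: "('w \<Rightarrow> ('w \<times> 'w \<Rightarrow>\<^sub>0 'k)) \<Rightarrow> bool" where
  "rmap \<Phi> \<longleftrightarrow> (\<forall>m\<in>\<Omega>. \<Phi> m \<in> car W2) \<and> lin_on \<Omega> sC fsc \<Phi> \<and> (\<forall>m\<in>\<Omega>. \<forall>a. \<Phi> (m * \<iota> a) = ract W2 (\<Phi> m) a)"

lemma rmapD:
  assumes "rmap \<Phi>"
  shows "m \<in> \<Omega> \<Longrightarrow> \<Phi> m \<in> car W2" "lin_on \<Omega> sC fsc \<Phi>" "m \<in> \<Omega> \<Longrightarrow> \<Phi> (m * \<iota> a) = ract W2 (\<Phi> m) a"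
    "lin_on A s sC f \<Longrightarrow> (\<And>x. x \<in> A \<Longrightarrow> f x \<in> \<Omega>) \<Longrightarrow> lin_on A s fsc (\<lambda>x. \<Phi> (f x))"
  using assms lin_on_comp[of \<Omega> sC fsc \<Phi> A s f] unfolding rmap_def by blast+

definition hat :: "('w \<Rightarrow> ('w \<times> 'w \<Rightarrow>\<^sub>0 'k)) \<Rightarrow> ('w \<times> 'w \<Rightarrow>\<^sub>0 'k) \<Rightarrow> (('w \<times> 'w \<Rightarrow>\<^sub>0 'k) \<times> 'w \<Rightarrow>\<^sub>0 'k)" where
  "hat \<Phi> s = swe s (\<lambda>(x, y). \<Phi> x \<odot> y)"

lemma hat_htp [simp]: "rmap \<Phi> \<Longrightarrow> x \<in> \<Omega> \<Longrightarrow> y \<in> \<Omega> \<Longrightarrow> hat \<Phi> (x \<otimes> y) = \<Phi> x \<odot> y"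
  unfolding hat_def
  by (rule lext_OO[OF vs_fsc]) (auto intro!: bilin_onI lin rmapD(4) simp: rmapD htp_bal)

lemma hat_add [simp]: "hat \<Phi> (t + u) = hat \<Phi> t + hat \<Phi> u"
  by (simp add: hat_def lext_add[OF vs_fsc])

lemma hat_in: "rmap \<Phi> \<Longrightarrow> s \<in> car W2 \<Longrightarrow> hat \<Phi> s \<in> car W3"
  by (rotate_tac, induction s rule: W2_induct) (simp_all add: rmapD)

lemma hat_cong: "(\<And>x. x \<in> \<Omega> \<Longrightarrow> \<Phi> x = \<Psi> x) \<Longrightarrow> s \<in> car W2 \<Longrightarrow> hat \<Phi> s = hat \<Psi> s"
  unfolding hat_def by (intro lext_cong2) auto

text \<open>By the dual basis, every right linear \<open>\<Phi>\<close> is \<open>c34 t\<close> for \<open>t = \<Sum>\<^sub>p \<Phi> (eb p) \<odot> zb p\<close>.\<close>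

definition c34 :: "(('w \<times> 'w \<Rightarrow>\<^sub>0 'k) \<times> 'w \<Rightarrow>\<^sub>0 'k) \<Rightarrow> 'w \<Rightarrow> ('w \<times> 'w \<Rightarrow>\<^sub>0 'k)" where
  "c34 t m = swe t (\<lambda>(s, z). ract W2 s (\<gamma> (z \<otimes> m)))"

lemma c34_htp [simp]: "s \<in> car W2 \<Longrightarrow> z \<in> \<Omega> \<Longrightarrow> m \<in> \<Omega> \<Longrightarrow> c34 (s \<odot> z) m = ract W2 s (\<gamma> (z \<otimes> m))"
  unfolding c34_def
  by (rule lext_WO[OF vs_fsc]) (auto intro!: bilin_onI lin simp: \<gamma>_bal W2.ract_mult)

lemma c34_add [simp]: "c34 (t + u) m = c34 t m + c34 u m" and c34_scale: "c34 (fsc c t) m = fsc c (c34 t m)"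
  and c34_0 [simp]: "c34 0 m = 0"
  by (simp_all add: c34_def lext_add[OF vs_fsc] lext_scale[OF vs_fsc] lext_0[OF vs_fsc])

lemma c34_sum: "c34 (\<Sum>i\<in>I. t i) m = (\<Sum>i\<in>I. c34 (t i) m)"
  by (induction I rule: infinite_finite_induct) simp_all

lemma c34_ract: "t \<in> car W3 \<Longrightarrow> m \<in> \<Omega> \<Longrightarrow> c34 t m \<in> car W2 \<and> c34 t (m * \<iota> a) = ract W2 (c34 t m) a"
proof (induction t rule: WO.tens_induct)
  case (htp s z)
  then show ?case using \<gamma>_bal(2)[of z m a] by (simp add: W2.ract_mult)
qed simp

lemma rmap_c34: "t \<in> car W3 \<Longrightarrow> rmap (c34 t)"
proof -
  assume t: "t \<in> car W3"
  have "lin_on \<Omega> sC fsc (\<lambda>m. c34 t m)"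
    unfolding c34_def[abs_def] using t by (auto intro!: lin)
  then show ?thesis unfolding rmap_def using c34_ract[OF t] by simp
qed

lemma c34_V: "t \<in> vee_12 H C \<Longrightarrow> m \<in> \<Omega> \<Longrightarrow> c34 t m \<in> V"
  by (induction rule: vee_12_induct) (simp_all add: c34_scale)

lemma g23_hat_c34: "t \<in> car W3 \<Longrightarrow> s \<in> car W2 \<Longrightarrow> g23 (hat (c34 t) s) = ev s t"
proof -
  assume t: "t \<in> car W3" and s: "s \<in> car W2"
  have *: "g23 (c34 t m \<odot> n) = ev (m \<otimes> n) t" if "m \<in> \<Omega>" "n \<in> \<Omega>" for m n
    using t
  proof (induction t rule: W3_induct)
    case (htp x y z)
    then show ?case using that by (simp add: htp_bal)
  next
    case (add t u)
    then show ?case using that c34_ract by simp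
  qed
  have "g23 (hat (c34 t) s) = ev s t \<and> s \<in> car W2"
    using s
  proof (induction s rule: W2_induct)
    case (htp x y)
    then show ?case using t * by (simp add: rmap_c34)
  next
    case (add u v)
    have "ev (u + v) t = ev u t + ev v t"
      using t by (induction t rule: W3_induct) (use add in \<open>simp_all add: calc.embed_hom distrib_left\<close>)
    then show ?case using add by simp
  qed
  then show ?thesis ..
qed

context
  assumes invertible: "bij_betw (on_23 H C \<pi>) (vee_12 H C) (vee_23 H C)"
begin

lemma rmap_unique:
  assumes \<Phi>: "rmap \<Phi>" "\<And>m. m \<in> \<Omega> \<Longrightarrow> \<Phi> m \<in> V" and 0: "\<And>s. s \<in> V \<Longrightarrow> g23 (hat \<Phi> s) = 0"
    and m: "m \<in> \<Omega>"
  shows "\<Phi> m = 0"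
proof -
  define t where "t = (\<Sum>p\<in>K. \<Phi> (eb p) \<odot> zb p)"
  have t: "t \<in> vee_12 H C"
    unfolding t_def using \<Phi>(2) vee_intros(1) unfolding vee_12_def by (intro fsc.span_sum) auto
  have c: "c34 t m = \<Phi> m" if m: "m \<in> \<Omega>" for m
  proof -
    have "c34 t m = (\<Sum>p\<in>K. \<Phi> (eb p * \<iota> (\<gamma> (zb p \<otimes> m))))"
      using m unfolding t_def c34_sum by (simp add: rmapD[OF \<Phi>(1)])
    also have "\<dots> = \<Phi> (\<Sum>p\<in>K. eb p * \<iota> (\<gamma> (zb p \<otimes> m)))"
      by (rule lin_on_sum[symmetric, OF vs_C vs_fsc \<Omega>_subspace rmapD(2)[OF \<Phi>(1)]]) simp
    finally show ?thesis by (simp add: basis_right m)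
  qed
  define r where "r = on_23 H C \<pi> t"
  have r: "r \<in> vee_23 H C" unfolding r_def using t by (simp add: on_23_vee)
  have "ev s r = 0" if s: "s \<in> V" for s
  proof -
    have "ev s r = g23 (hat (c34 t) s)" unfolding r_def using s t by (simp add: ev_on_23_\<pi> g23_hat_c34)
    also have "\<dots> = 0" using hat_cong[of "c34 t" \<Phi> s] c s 0 by simp
    finally show ?thesis .
  qed
  then have ev0: "ev s r = 0" if "s \<in> car W2" for s
    using ev_vee_23[OF r that] \<pi>_props(1)[OF that] by simp
  have "attch 0 v = 0" if "v \<in> car W2" for v
    using lin_on_zero[OF vs_C vs_fsc \<Omega>_subspace, of "\<lambda>x. attch x v"] that by (simp add: lin)
  then have r0: "r = 0"
    using W3_recover[of r] r ev0 by (simp del: attch_htp)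
  have z: "0 \<in> vee_12 H C" unfolding vee_12_def by (rule fsc.span_zero)
  have "on_23 H C \<pi> 0 = 0" by (simp add: on_23_def lext_0[OF vs_fsc])
  then have "t = 0"
    using inj_onD[OF bij_betw_imp_inj_on[OF invertible] _ t z] r0 by (simp add: r_def)
  then show ?thesis using c[OF m] by simp
qed

lemma rmap_exists:
  assumes R: "\<And>s. s \<in> V \<Longrightarrow> R s \<in> \<Omega>" "lin_on V fsc sC R" "\<And>s a. s \<in> V \<Longrightarrow> R (ract W2 s a) = R s * \<iota> a"
  shows "\<exists>\<Phi>. rmap \<Phi> \<and> (\<forall>m\<in>\<Omega>. \<Phi> m \<in> V) \<and> (\<forall>s\<in>V. g23 (hat \<Phi> s) = R s)"
proof -
  define r where "r = (\<Sum>p\<in>K. \<Sum>q\<in>K. attch (R (\<pi> (eb p \<otimes> eb q))) (zb q \<otimes> zb p))"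
  have W3s: "(\<Sum>i\<in>I. f i) \<in> car W3" if "\<And>i. i \<in> I \<Longrightarrow> f i \<in> car W3" for I and f :: "_ \<Rightarrow> _"
    using that fsc.subspace_sum[OF W3.subspace[unfolded sc_W]] by blast
  have r: "r \<in> car W3" unfolding r_def by (intro W3s attch_in) (simp_all add: R \<pi>_props)
  have "ev s r = R s" if s: "s \<in> V" for s
  proof -
    have \<pi>': "\<pi> (ract W2 (eb p \<otimes> eb q) a) = ract W2 (\<pi> (eb p \<otimes> eb q)) a" if "p \<in> K" "q \<in> K" for p q a
      using that by (intro bimapD(4)[OF bimap_\<pi>]) simp
    have "ev s r = (\<Sum>p\<in>K. \<Sum>q\<in>K. R (\<pi> (eb p \<otimes> eb q)) * \<iota> (gg (zb q \<otimes> zb p) s))"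
      unfolding r_def ev_sum using s by (intro sum.cong refl ev_attch) (simp_all add: R \<pi>_props)
    also have "\<dots> = (\<Sum>p\<in>K. \<Sum>q\<in>K. R (\<pi> (ract W2 (eb p \<otimes> eb q) (gg (zb q \<otimes> zb p) s))))"
      by (intro sum.cong refl) (simp add: \<pi>' R(3) \<pi>_props del: htp_act gg_htp)
    also have "\<dots> = (\<Sum>x\<in>K \<times> K. R (\<pi> (case x of (p, q) \<Rightarrow> ract W2 (eb p \<otimes> eb q) (gg (zb q \<otimes> zb p) s))))"
      by (simp add: sum.cartesian_product case_prod_unfold del: htp_act gg_htp)
    also have "\<dots> = R (\<pi> (\<Sum>(p, q)\<in>K \<times> K. ract W2 (eb p \<otimes> eb q) (gg (zb q \<otimes> zb p) s)))"
    proof -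
      have "lin_on (car W2) fsc sC (\<lambda>t. R (\<pi> t))"
        by (rule lin_on_comp[OF R(2) bimapD(2)[OF bimap_\<pi>] \<pi>_props(1)])
      then show ?thesis
        by (rule lin_on_sum[symmetric, OF vs_fsc vs_C W2.subspace[unfolded sc_W]]) auto
    qed
    also have "\<dots> = R (\<pi> s)"
      using W2_basis_right[OF V_W2[OF s]] by (simp add: sum.cartesian_product del: htp_act gg_htp)
    finally show ?thesis using s by simp
  qed
  note evr = this
  have "on_23 H C \<pi> r \<in> on_23 H C \<pi> ` vee_12 H C"
    using on_23_vee[OF r] bij_betw_imp_surj_on[OF invertible] by simp
  then obtain t where t: "t \<in> vee_12 H C" "on_23 H C \<pi> t = on_23 H C \<pi> r" by (auto simp: image_iff)
  have "g23 (hat (c34 t) s) = R s" if s: "s \<in> V" for s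
    using g23_hat_c34[of t s] ev_on_23_\<pi>[of t s] ev_on_23_\<pi>[OF r s] t s evr by simp
  then show ?thesis using t(1) by (intro exI[of _ "c34 t"]) (simp add: rmap_c34 c34_V)
qed

end

end

section \<open>Connections\<close>

context hopf_metric
begin

interpretation vH: vector_space "sc H" by (rule vector_space)
interpretation vC: vector_space "sc C" by (rule calc.vector_space)

subsection \<open>The left coaction on two-fold tensors\<close>

sublocale HW: ktensor H W2 by unfold_locales (rule subvs_H W2.subvs)+

lemma lin_HW [lin]:
  "lin_on A s sH f \<Longrightarrow> y \<in> car W2 \<Longrightarrow> lin_on A s fsc (\<lambda>x. ktp H W2 (f x) y)"
  "lin_on A s fsc f' \<Longrightarrow> (\<And>x. x \<in> A \<Longrightarrow> f' x \<in> car W2) \<Longrightarrow> lin_on A s fsc (\<lambda>x. ktp H W2 a (f' x))"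
  using lin_on_comp[OF HW.ktp_lin1[of y], of A s f] lin_on_comp[OF HW.ktp_lin2[of a], of A s f'] by auto

lemma lext_HW:
  "vector_space s \<Longrightarrow> y \<in> car W2 \<Longrightarrow> bilin_on UNIV sH (car W2) fsc s F \<Longrightarrow> lext s (ktp H W2 x y) (case_prod F) = F x y"
  using HW.lext_ktp[of s x y F] by (simp add: car_UNIV)

abbreviation "lW \<equiv> lcoact W2"

lemma lW_eq: "lW t = swe t (\<lambda>(x, y). swe (cl x) (\<lambda>(h, x0). swe (cl y) (\<lambda>(k, y0). ktp H W2 (h * k) (x0 \<otimes> y0))))"
proof -
  have c: "car (hspace Om Om) = car W2" "sc (hspace Om Om) = sc W2"
    by (simp_all add: OO.car_tens hspace_def) (simp add: qspace_def)
  have 1: "ktp H W2 = ktp H (hspace Om Om)" by (rule ktp_cong; simp add: c)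
  show ?thesis unfolding 1 by (simp add: tens_def)
qed

lemma lW_lin [lin]: "lin_on A s fsc f \<Longrightarrow> lin_on A s fsc (\<lambda>x. lW (f x))"
  unfolding lW_eq by (intro lin)

lemma lW_add [simp]: "lW (t + u) = lW t + lW u"
  by (simp add: lW_eq lext_add[OF vs_fsc])

lemma lW_htp:
  assumes x: "x \<in> \<Omega>" and y: "y \<in> \<Omega>"
  shows "lW (x \<otimes> y) = swe (cl x) (\<lambda>(h, x0). swe (cl y) (\<lambda>(k, y0). ktp H W2 (h * k) (x0 \<otimes> y0)))"
  unfolding lW_eq
proof (rule lext_OO[OF vs_fsc x y])
  let ?f = "\<lambda>x y. swe (cl x) (\<lambda>(h, x0). swe (cl y) (\<lambda>(k, y0). ktp H W2 (h * k) (x0 \<otimes> y0)))"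
  show "bilin_on \<Omega> sC \<Omega> sC fsc ?f" by (auto intro!: bilin_onI lin)
  fix x c y assume x: "x \<in> \<Omega>" and y: "y \<in> \<Omega>"
  have "?f (x * \<iota> c) y = swe (cl x) (\<lambda>(k, w). swe (\<Delta> c) (\<lambda>(c1, c2). swe (cl y) (\<lambda>(k', y0). ktp H W2 (k * c1 * k') ((w * \<iota> c2) \<otimes> y0))))"
    unfolding cl_right[OF x] lext_lext2[OF vs_fsc]
    using x y by (intro lext_cong2 lext_HO[OF vs_fsc, where F = "\<lambda>h x0. swe (cl y) (\<lambda>(k, y0). ktp H W2 (h * k) (x0 \<otimes> y0))"])
      (auto intro!: bilin_onI lin)
  also have "\<dots> = swe (cl x) (\<lambda>(k, w). swe (\<Delta> c) (\<lambda>(c1, c2). swe (cl y) (\<lambda>(k', y0). ktp H W2 (k * (c1 * k')) (w \<otimes> (\<iota> c2 * y0)))))"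
    using x y by (intro lext_cong2) (auto simp: htp_bal mult.assoc)
  also have "\<dots> = ?f x (\<iota> c * y)"
    unfolding cl_left[OF y] lext_lext2[OF vs_fsc]
    using x y by (intro lext_cong2 lext_HO[OF vs_fsc, symmetric, where F = "\<lambda>k y0. ktp H W2 (_ * k) (_ \<otimes> y0)"])
      (auto intro!: bilin_onI lin)
  finally show "?f (x * \<iota> c) y = ?f x (\<iota> c * y)" .
qed

lemma lW_in [simp]: "t \<in> car W2 \<Longrightarrow> lW t \<in> car (ktens H W2)"
  unfolding lW_eq using subvsD(2)[OF HW.ktens_subvs]
  by (auto intro!: lext_in_subspace[OF vs_fsc] HW.ktp_in)

lemma lW_keys [dest!]: "(h, u) \<in> Poly_Mapping.keys (lW t) \<Longrightarrow> t \<in> car W2 \<Longrightarrow> u \<in> car W2"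
  using HW.ktens_keys[OF lW_in] by blast

lemma lW_ract: "t \<in> car W2 \<Longrightarrow> lW (ract W2 t c) = swe (lW t) (\<lambda>(k, s). swe (\<Delta> c) (\<lambda>(c1, c2). ktp H W2 (k * c1) (ract W2 s c2)))"
proof (induction t rule: W2_induct)
  case (htp x y)
  have "lW (x \<otimes> (y * \<iota> c)) = swe (cl x) (\<lambda>(h, x0). swe (cl y) (\<lambda>(k, y0). swe (\<Delta> c) (\<lambda>(c1, c2). ktp H W2 (h * (k * c1)) (x0 \<otimes> (y0 * \<iota> c2)))))"
    using htp by (subst lW_htp, simp, simp, unfold cl_right[OF htp(2)] lext_lext2[OF vs_fsc])
      (intro lext_cong2 lext_HO[OF vs_fsc, where F = "\<lambda>k y0. ktp H W2 (_ * k) (_ \<otimes> y0)"], auto intro!: bilin_onI lin)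
  also have "\<dots> = swe (lW (x \<otimes> y)) (\<lambda>(k, s). swe (\<Delta> c) (\<lambda>(c1, c2). ktp H W2 (k * c1) (ract W2 s c2)))"
    unfolding lW_htp[OF htp] lext_lext2[OF vs_fsc]
  proof (intro lext_cong2)
    fix h x0 k y0 assume "(h, x0) \<in> Poly_Mapping.keys (cl x)" "(k, y0) \<in> Poly_Mapping.keys (cl y)"
    then have "x0 \<in> \<Omega>" "y0 \<in> \<Omega>" using htp by auto
    then show "swe (\<Delta> c) (\<lambda>(c1, c2). ktp H W2 (h * (k * c1)) (x0 \<otimes> (y0 * \<iota> c2))) =
       swe (ktp H W2 (h * k) (x0 \<otimes> y0)) (\<lambda>(k, s). swe (\<Delta> c) (\<lambda>(c1, c2). ktp H W2 (k * c1) (ract W2 s c2)))"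
      by (subst lext_HW[OF vs_fsc]) (auto intro!: bilin_onI lin simp: mult.assoc)
  qed
  finally show ?case using htp by simp
qed (simp add: lext_add[OF vs_fsc])

lemma lW_lco:
  assumes p: "p \<in> lco" and q: "q \<in> lco"
  shows "lW ((\<iota> a * p) \<otimes> q) = swe (\<Delta> a) (\<lambda>(a1, a2). ktp H W2 a1 ((\<iota> a2 * p) \<otimes> q))"
proof -
  have 1: "swe (cl q) (\<lambda>(k, y0). ktp H W2 (h * k) (x0 \<otimes> y0)) = ktp H W2 h (x0 \<otimes> q)" if "x0 \<in> \<Omega>" for h x0
    unfolding cl_lco[OF q]
    using that q lext_HO[OF vs_fsc, of q "\<lambda>k y0. ktp H W2 (h * k) (x0 \<otimes> y0)" 1] by (simp add: bilin_onI lin)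
  have "lW ((\<iota> a * p) \<otimes> q) = swe (cl (\<iota> a * p)) (\<lambda>(h, x0). ktp H W2 h (x0 \<otimes> q))"
    using p q by (subst lW_htp) (auto intro!: lext_cong2 1)
  also have "\<dots> = swe (\<Delta> a) (\<lambda>(a1, a2). ktp H W2 a1 ((\<iota> a2 * p) \<otimes> q))"
    unfolding cl_lco_left[OF p] lext_lext2[OF vs_fsc]
    using p q by (intro lext_cong2 lext_HO[OF vs_fsc, where F = "\<lambda>h x0. ktp H W2 h (x0 \<otimes> q)"]) (auto intro!: bilin_onI lin)
  finally show ?thesis .
qed

lemma lW_\<delta>:
  assumes m: "m \<in> lco"
  shows "lW (m \<otimes> \<delta> (\<iota> c)) = swe (\<Delta> c) (\<lambda>(c1, c2). ktp H W2 c1 (m \<otimes> \<delta> (\<iota> c2)))"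
proof -
  have "lW (m \<otimes> \<delta> (\<iota> c)) = swe (cl (\<delta> (\<iota> c))) (\<lambda>(k, y0). ktp H W2 (1 * k) (m \<otimes> y0))"
    using m by (subst lW_htp, simp, simp, unfold cl_lco[OF m])
      (rule lext_HO[OF vs_fsc, where F = "\<lambda>h x0. swe (cl (\<delta> (\<iota> c))) (\<lambda>(k, y0). ktp H W2 (h * k) (x0 \<otimes> y0))"], auto intro!: bilin_onI lin)
  also have "\<dots> = swe (\<Delta> c) (\<lambda>(c1, c2). ktp H W2 (1 * c1) (m \<otimes> \<delta> (\<iota> c2)))"
    unfolding cl_\<delta> lext_lext2[OF vs_fsc]
    using m by (intro lext_cong2 lext_HO[OF vs_fsc, where F = "\<lambda>k y0. ktp H W2 (1 * k) (m \<otimes> y0)"]) (auto intro!: bilin_onI lin)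
  finally show ?thesis by simp
qed

subsection \<open>The left coaction of a connection\<close>

abbreviation "LM \<equiv> lmaps Om W2"

lemma LM_iff: "E \<in> car LM \<longleftrightarrow> lin_on \<Omega> sC fsc E \<and> (\<forall>x\<in>\<Omega>. E x \<in> car W2) \<and> (\<forall>x. x \<notin> \<Omega> \<longrightarrow> E x = 0)"
  by (auto simp: lmaps_def linear_on_def lin_on_def)

lemma sc_LM [simp]: "sc LM c E x = fsc c (E x)"
  by (simp add: lmaps_def)

lemma LM_D [simp]: "E \<in> car LM \<Longrightarrow> x \<in> \<Omega> \<Longrightarrow> E x \<in> car W2" "E \<in> car LM \<Longrightarrow> x \<notin> \<Omega> \<Longrightarrow> E x = 0"
  by (simp_all add: LM_iff)

lemma lin_LM: "lin_on A s sC f \<Longrightarrow> E \<in> car LM \<Longrightarrow> (\<And>x. x \<in> A \<Longrightarrow> f x \<in> \<Omega>) \<Longrightarrow> lin_on A s fsc (\<lambda>x. E (f x))"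
  unfolding LM_iff by (rule lin_on_comp[of \<Omega> sC fsc E A s f]) blast+

lemma lin_LM_eval: "lin_on A (sc LM) fsc (\<lambda>E. E m)"
  by (simp add: lin_on_def)

lemma subvs_LM: "subvs LM"
proof -
  have v: "vector_space (sc LM)"
    by unfold_locales (simp_all add: fun_eq_iff fsc.scale_right_distrib fsc.scale_left_distrib)
  interpret L: vector_space "sc LM" by (rule v)
  have "L.subspace (car LM)"
    unfolding L.subspace_def
  proof (intro conjI allI ballI)
    show "0 \<in> car LM" unfolding LM_iff by (simp add: zero_fun_def lin_on_def)
    show "E + F \<in> car LM" if "E \<in> car LM" "F \<in> car LM" for E F
      using that unfolding LM_iff plus_fun_def by (auto intro: lin_on_add_fun[OF vs_fsc])
    show "sc LM c E \<in> car LM" if "E \<in> car LM" for c E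
    proof -
      have "sc LM c E = (\<lambda>x. fsc c (E x))" by (simp add: fun_eq_iff)
      then show ?thesis using that unfolding LM_iff by (auto intro: lin_on_scale_fun[OF vs_fsc])
    qed
  qed
  with v show ?thesis by (simp add: subvs_def)
qed

lemma LM_ext: "E \<in> car LM \<Longrightarrow> (\<And>m. m \<in> \<Omega> \<Longrightarrow> E m = 0) \<Longrightarrow> E = 0"
proof (rule ext)
  fix m assume "E \<in> car LM" "\<And>m. m \<in> \<Omega> \<Longrightarrow> E m = 0"
  then show "E m = 0 m" by (cases "m \<in> \<Omega>") (simp_all add: zero_fun_def)
qed

lemma LM_E: "s \<in> car W2 \<Longrightarrow> Y \<in> car FS \<Longrightarrow> (\<lambda>m. if m \<in> \<Omega> then ract W2 s (Y m) else 0) \<in> car LM"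
proof -
  assume s: "s \<in> car W2" and Y: "Y \<in> car FS"
  have "lin_on \<Omega> sC fsc (\<lambda>m. ract W2 s (Y m))" using s Y by (auto intro!: lin)
  then have "lin_on \<Omega> sC fsc (\<lambda>m. if m \<in> \<Omega> then ract W2 s (Y m) else 0)" by (simp add: lin_on_def)
  then show ?thesis unfolding LM_iff using s by simp
qed

sublocale HL: ktensor H LM by unfold_locales (rule subvs_H subvs_LM)+

abbreviation "rconn \<equiv> right_connection H C"

lemma rconnD:
  assumes "rconn D"
  shows "D \<in> car LM" "m \<in> \<Omega> \<Longrightarrow> D (m * \<iota> a) = ract W2 (D m) a + m \<otimes> \<delta> (\<iota> a)"
  using assms by (simp_all add: right_connection_def)

definition ccv :: "('w \<Rightarrow> ('w \<times> 'w \<Rightarrow>\<^sub>0 'k)) \<Rightarrow> 'w \<Rightarrow> ('h \<times> ('w \<times> 'w \<Rightarrow>\<^sub>0 'k) \<Rightarrow>\<^sub>0 'k)" where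
  "ccv D m = swe (cl m) (\<lambda>(h, m0). swe (lW (D m0)) (\<lambda>(k, s). ktp H W2 (k * T h) s))"

lemma ccv_lco:
  assumes D: "rconn D" and m: "m \<in> lco"
  shows "ccv D (m * \<iota> c) = swe (lW (D m)) (\<lambda>(k, s). ktp H W2 k (ract W2 s c)) + ktp H W2 1 (m \<otimes> \<delta> (\<iota> c))"
proof -
  note [lin] = lin_LM[OF _ rconnD(1)[OF D]] note [simp] = rconnD(1)[OF D] m
  have Dm: "D m \<in> car W2" by simp
  have "ccv D (m * \<iota> c) = swe (\<Delta> c) (\<lambda>(c1, c2). swe (lW (D (m * \<iota> c2))) (\<lambda>(k, s). ktp H W2 (k * T c1) s))"
    unfolding ccv_def cl_lco_right[OF m] lext_lext2[OF vs_fsc]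
    by (intro lext_cong2 lext_HO[OF vs_fsc, where F = "\<lambda>h m0. swe (lW (D m0)) (\<lambda>(k, s). ktp H W2 (k * T h) s)"])
      (auto intro!: bilin_onI lin)
  also have "\<dots> = swe (\<Delta> c) (\<lambda>(c1, c2). swe (lW (D m)) (\<lambda>(k, s). swe (\<Delta> c2) (\<lambda>(u, v). ktp H W2 (k * (u * T c1)) (ract W2 s v))) +
      swe (\<Delta> c2) (\<lambda>(u, v). ktp H W2 (u * T c1) (m \<otimes> \<delta> (\<iota> v))))"
  proof (intro lext_cong2)
    fix c1 c2
    have 1: "swe (swe (\<Delta> c2) (\<lambda>(u, v). ktp H W2 u (m \<otimes> \<delta> (\<iota> v)))) (\<lambda>(k, s). ktp H W2 (k * T c1) s) =
      swe (\<Delta> c2) (\<lambda>(u, v). ktp H W2 (u * T c1) (m \<otimes> \<delta> (\<iota> v)))"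
      unfolding lext_lext2[OF vs_fsc]
      by (intro lext_cong2 lext_HW[OF vs_fsc, where F = "\<lambda>k s. ktp H W2 (k * T c1) s"]) (auto intro!: bilin_onI lin)
    have 2: "swe (swe (lW (D m)) (\<lambda>(k, s). swe (\<Delta> c2) (\<lambda>(u, v). ktp H W2 (k * u) (ract W2 s v)))) (\<lambda>(k, s). ktp H W2 (k * T c1) s) =
      swe (lW (D m)) (\<lambda>(k, s). swe (\<Delta> c2) (\<lambda>(u, v). ktp H W2 (k * (u * T c1)) (ract W2 s v)))"
      unfolding lext_lext2[OF vs_fsc]
      by (intro lext_cong2, subst lext_HW[OF vs_fsc, where F = "\<lambda>k s. ktp H W2 (k * T c1) s"])
        (auto intro!: bilin_onI lin simp: mult.assoc)
    show "swe (lW (D (m * \<iota> c2))) (\<lambda>(k, s). ktp H W2 (k * T c1) s) =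
      swe (lW (D m)) (\<lambda>(k, s). swe (\<Delta> c2) (\<lambda>(u, v). ktp H W2 (k * (u * T c1)) (ract W2 s v))) +
      swe (\<Delta> c2) (\<lambda>(u, v). ktp H W2 (u * T c1) (m \<otimes> \<delta> (\<iota> v)))"
      by (simp add: rconnD(2)[OF D] lW_ract lW_\<delta> lext_add[OF vs_fsc] 1 2)
  qed
  also have "\<dots> = swe (\<Delta> c) (\<lambda>(c1, c2). swe (lW (D m)) (\<lambda>(k, s). swe (\<Delta> c2) (\<lambda>(u, v). ktp H W2 (k * (u * T c1)) (ract W2 s v)))) +
      swe (\<Delta> c) (\<lambda>(c1, c2). swe (\<Delta> c2) (\<lambda>(u, v). ktp H W2 (u * T c1) (m \<otimes> \<delta> (\<iota> v))))"
    by (rule lext_add_fun2[OF vs_fsc])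
  also have "swe (\<Delta> c) (\<lambda>(c1, c2). swe (lW (D m)) (\<lambda>(k, s). swe (\<Delta> c2) (\<lambda>(u, v). ktp H W2 (k * (u * T c1)) (ract W2 s v)))) =
      swe (lW (D m)) (\<lambda>(k, s). swe (\<Delta> c) (\<lambda>(c1, c2). swe (\<Delta> c2) (\<lambda>(u, v). ktp H W2 (k * (u * T c1)) (ract W2 s v))))"
    by (rule lext_swap2[OF vs_fsc])
  also have "\<dots> = swe (lW (D m)) (\<lambda>(k, s). swe (\<Delta> c) (\<lambda>(c', v). swe (\<Delta> c') (\<lambda>(c1, u). ktp H W2 (k * (u * T c1)) (ract W2 s v))))"
    by (intro lext_cong2 coassoc[symmetric]) (auto intro!: lin)
  also have "\<dots> = swe (lW (D m)) (\<lambda>(k, s). ktp H W2 (k * 1) (ract W2 s c))"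
    by (intro lext_cong2 cancel_left[OF cancels_T(2) vs_fsc]) (auto intro!: lin)
  also have "swe (\<Delta> c) (\<lambda>(c1, c2). swe (\<Delta> c2) (\<lambda>(u, v). ktp H W2 (u * T c1) (m \<otimes> \<delta> (\<iota> v)))) =
      swe (\<Delta> c) (\<lambda>(c', v). swe (\<Delta> c') (\<lambda>(c1, u). ktp H W2 (u * T c1) (m \<otimes> \<delta> (\<iota> v))))"
    by (rule coassoc[symmetric]) (auto intro!: lin)
  also have "\<dots> = ktp H W2 1 (m \<otimes> \<delta> (\<iota> c))"
    by (rule cancel_left[OF cancels_T(2) vs_fsc]) (auto intro!: lin)
  finally show ?thesis by simp
qed

lemma ktens_HW_closed: "t \<in> car (ktens H W2) \<Longrightarrow> u \<in> car (ktens H W2) \<Longrightarrow> t - u \<in> car (ktens H W2)"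
  using subvsD(4)[OF HW.ktens_subvs] .

lemma conn_coact_spec:
  assumes D: "rconn D"
  shows "conn_coact H C D \<in> car (ktens H LM)"
    and "m \<in> \<Omega> \<Longrightarrow> swe (conn_coact H C D) (\<lambda>(h, E). ktp H W2 h (E m)) = ccv D m"
proof -
  note [lin] = lin_LM[OF _ rconnD(1)[OF D]] note [simp] = rconnD(1)[OF D]
  let ?P = "\<lambda>t. t \<in> car (ktens H LM) \<and> (\<forall>m\<in>\<Omega>. swe t (\<lambda>(h, E). ktp H W2 h (E m)) = ccv D m)"
  define Q where "Q = (\<lambda>w. ccv D w - ktp H W2 1 (D w))"
  have Q1: "Q w \<in> car (ktens H W2)" if "w \<in> \<Omega>" for w
    unfolding Q_def ccv_def using that subvsD(2)[OF HW.ktens_subvs]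
    by (auto intro!: ktens_HW_closed lext_in_subspace[OF vs_fsc] HW.ktp_in)
  have clin: "lin_on \<Omega> sC fsc (ccv D)"
    unfolding ccv_def[abs_def] by (auto intro!: lin)
  have klin: "lin_on \<Omega> sC fsc (\<lambda>w. ktp H W2 1 (D w))" by (auto intro!: lin)
  have Q2: "lin_on \<Omega> sC fsc Q"
    using clin klin unfolding Q_def lin_on_def by (simp add: fsc.scale_right_diff_distrib)
  have Q3: "Q (w * \<iota> b) = swe (Q w) (\<lambda>(h, s). ktp H W2 h (ract W2 s b))" if "w \<in> \<Omega>" for w b
    using that
  proof (induction w rule: \<Omega>_induct_LH)
    case (add x y)
    then show ?case using lin_on_add[OF Q2] by (simp add: distrib_right lext_add[OF vs_fsc])
  next
    case (gen c m)
    have bil: "bilin_on UNIV sH (car W2) fsc fsc (\<lambda>h s. ktp H W2 h (ract W2 s b))"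
      by (auto intro!: bilin_onI lin)
    have Qm: "Q (m * \<iota> c) = swe (lW (D m)) (\<lambda>(k, s). ktp H W2 k (ract W2 s c)) - ktp H W2 1 (ract W2 (D m) c)" for c
    proof -
      have "ktp H W2 1 (D (m * \<iota> c)) = ktp H W2 1 (ract W2 (D m) c) + ktp H W2 1 (m \<otimes> \<delta> (\<iota> c))"
        using gen lin_on_add[OF lin_HW(2)[OF lin_on_id, of "car W2" 1], of "ract W2 (D m) c" "m \<otimes> \<delta> (\<iota> c)"]
        by (simp add: rconnD(2)[OF D])
      then show ?thesis by (simp add: Q_def ccv_lco[OF D gen])
    qed
    have "swe (Q (m * \<iota> c)) (\<lambda>(h, s). ktp H W2 h (ract W2 s b)) =
      swe (lW (D m)) (\<lambda>(k, s). ktp H W2 k (ract W2 (ract W2 s c) b)) - ktp H W2 1 (ract W2 (ract W2 (D m) c) b)"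
      unfolding Qm lext_diff[OF vs_fsc] lext_lext2[OF vs_fsc]
      using gen by (subst lext_HW[OF vs_fsc _ bil], simp) (intro arg_cong2[where f = "(-)"] lext_cong2 refl lext_HW[OF vs_fsc _ bil], auto)
    also have "\<dots> = Q (m * \<iota> (c * b))"
      unfolding Qm using gen by (intro arg_cong2[where f = "(-)"] lext_cong2) (auto simp: W2.ract_mult)
    finally show ?case by (simp add: calc.embed_hom mult.assoc)
  qed
  have sc': "sc LM c E x = sc W2 c (E x)" for c E x by simp
  obtain t where t: "t \<in> car (ktens H LM)" "\<And>m. m \<in> \<Omega> \<Longrightarrow> swe t (\<lambda>(h, E). ktp H W2 h (E m)) = Q m"
  proof -
    have "\<exists>t\<in>car (ktens H LM). \<forall>m\<in>\<Omega>. swe t (\<lambda>(h, E). ktp H W2 h (E m)) = Q m"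
      by (rule ktens_maps_exist[where W = W2 and L = LM and r = "ract W2" and Q = Q])
        (rule W2.subvs subvs_LM sc' LM_D(1) LM_E Q1 Q2 Q3; assumption)+
    then show ?thesis using that by blast
  qed
  have "?P (t + ktp H LM 1 D)"
  proof (intro conjI ballI)
    show "t + ktp H LM 1 D \<in> car (ktens H LM)"
      using subvsD(3)[OF HL.ktens_subvs t(1) HL.ktp_in] .
    fix m assume m: "m \<in> \<Omega>"
    have "swe (ktp H LM 1 D) (\<lambda>(h, E). ktp H W2 h (E m)) = ktp H W2 1 (D m)"
      by (rule HL.lext_ktp[OF vs_fsc])
        (use m in \<open>auto intro!: bilin_onI lin lin_LM_eval simp: car_UNIV\<close>)
    then show "swe (t + ktp H LM 1 D) (\<lambda>(h, E). ktp H W2 h (E m)) = ccv D m"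
      using t(2)[OF m] by (simp add: lext_add[OF vs_fsc] Q_def)
  qed
  then have "\<exists>t. ?P t" by (rule exI[of ?P])
  moreover have "t = u" if "?P t" "?P u" for t u
  proof (rule ktens_maps_unique[where W = W2 and L = LM])
    show "E = 0" if "E \<in> car LM" "\<And>m. m \<in> \<Omega> \<Longrightarrow> E m = 0" for E using that by (rule LM_ext)
  qed (use that in \<open>simp_all add: W2.subvs subvs_LM\<close>)
  ultimately have "?P (THE t. ?P t)" by (rule the_rule)
  moreover have "conn_coact H C D = (THE t. ?P t)" by (simp add: conn_coact_def ccv_def)
  ultimately have "?P (conn_coact H C D)" by simp
  then show "conn_coact H C D \<in> car (ktens H LM)"
    "m \<in> \<Omega> \<Longrightarrow> swe (conn_coact H C D) (\<lambda>(h, E). ktp H W2 h (E m)) = ccv D m" by auto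
qed

lemma conn_coact_keys: "rconn D \<Longrightarrow> (h, E) \<in> Poly_Mapping.keys (conn_coact H C D) \<Longrightarrow> E \<in> car LM"
  by (rule conjunct2[OF HL.ktens_keys[OF conn_coact_spec(1)]])

lemma conn_coact_eval:
  assumes D: "rconn D" and n: "n \<in> lco" and s: "vector_space s" and F: "bilin_on UNIV sH (car W2) fsc s F"
  shows "lext s (conn_coact H C D) (\<lambda>(k, E). F k (E (n * \<iota> b))) =
    lext s (lW (D n)) (\<lambda>(k, u). F k (ract W2 u b)) + F 1 (n \<otimes> \<delta> (\<iota> b))"
proof -
  note [lin] = lin_LM[OF _ rconnD(1)[OF D]] note [simp] = rconnD(1)[OF D]
  have "lext s (conn_coact H C D) (\<lambda>(k, E). F k (E (n * \<iota> b))) =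
    lext s (swe (conn_coact H C D) (\<lambda>(k, E). ktp H W2 k (E (n * \<iota> b)))) (case_prod F)"
    unfolding lext_lext2[OF s] using n
    by (intro lext_cong2 lext_HW[OF s _ F, symmetric]) (auto dest!: conn_coact_keys[OF D])
  also have "\<dots> = lext s (ccv D (n * \<iota> b)) (case_prod F)"
    using n by (simp add: conn_coact_spec(2)[OF D])
  also have "\<dots> = lext s (lW (D n)) (\<lambda>(k, u). F k (ract W2 u b)) + F 1 (n \<otimes> \<delta> (\<iota> b))"
    unfolding ccv_lco[OF D n] lext_add[OF s] lext_lext2[OF s] using n
    by (intro arg_cong2[where f = "(+)"] lext_cong2 lext_HW[OF s _ F]) auto
  finally show ?thesis .
qed

subsection \<open>The sum of a connection with itself\<close>

text \<open>The summand of \<open>conn_sum\<close> with \<open>m\<^sub>0 S(m\<^sub>1)\<close> and \<open>m\<^sub>2\<close> replaced by free variables\<close>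

definition csum :: "('w \<Rightarrow> ('w \<times> 'w \<Rightarrow>\<^sub>0 'k)) \<Rightarrow> 'w \<Rightarrow> 'w \<Rightarrow> 'h \<Rightarrow> (('w \<times> 'w \<Rightarrow>\<^sub>0 'k) \<times> 'w \<Rightarrow>\<^sub>0 'k)" where
  "csum D n x c = \<sigma>23 (D x \<odot> (\<iota> c * n)) +
     swe (conn_coact H C D) (\<lambda>(k, E). swe (\<Delta> k) (\<lambda>(k2, k1). attch (\<iota> k2 * (x * \<iota> (S k1))) (E (\<iota> c * n))))"

lemma lin_conn_coact:
  assumes "rconn D" "(k, E) \<in> Poly_Mapping.keys (conn_coact H C D)"
  shows "n \<in> \<Omega> \<Longrightarrow> lin_on UNIV sH fsc (\<lambda>c. E (\<iota> c * n))" "lin_on \<Omega> sC fsc (\<lambda>n. E (\<iota> c * n))"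
  by (rule lin_LM[OF _ conn_coact_keys[OF assms]]; auto intro!: lin)+

lemma csum_bilin: "rconn D \<Longrightarrow> n \<in> \<Omega> \<Longrightarrow> bilin_on \<Omega> sC UNIV sH fsc (csum D n)"
proof (rule bilin_onI)
  assume D: "rconn D" and n: "n \<in> \<Omega>"
  note [lin] = lin_LM[OF _ rconnD(1)[OF D]] note [simp] = rconnD(1)[OF D] n conn_coact_keys[OF D]
  show "lin_on \<Omega> sC fsc (\<lambda>x. csum D n x c)" for c
    unfolding csum_def by (auto intro!: lin_on_add_fun[OF vs_fsc] lin)
  show "lin_on UNIV sH fsc (csum D n x)" if "x \<in> \<Omega>" for x
    unfolding csum_def using that by (auto intro!: lin_on_add_fun[OF vs_fsc] lin) (rule lin_conn_coact[OF D]; simp)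
qed

lemma csum_lin: "rconn D \<Longrightarrow> x \<in> \<Omega> \<Longrightarrow> lin_on \<Omega> sC fsc (\<lambda>n. csum D n x c)"
proof -
  assume D: "rconn D" and x: "x \<in> \<Omega>"
  note [simp] = rconnD(1)[OF D] x conn_coact_keys[OF D]
  show ?thesis
    unfolding csum_def by (auto intro!: lin_on_add_fun[OF vs_fsc] lin) (rule lin_conn_coact[OF D]; simp)
qed

definition csm :: "('w \<Rightarrow> ('w \<times> 'w \<Rightarrow>\<^sub>0 'k)) \<Rightarrow> 'w \<Rightarrow> 'w \<Rightarrow> (('w \<times> 'w \<Rightarrow>\<^sub>0 'k) \<times> 'w \<Rightarrow>\<^sub>0 'k)" where
  "csm D m n = swe (cr m) (\<lambda>(m0, h). swe (\<Delta> h) (\<lambda>(m1, m2). csum D n (m0 * \<iota> (S m1)) m2))"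

lemma conn_sum_eq: "conn_sum H C D t = swe t (\<lambda>(m, n). csm D m n)"
  by (simp add: conn_sum_def Let_def csm_def csum_def S_mult calc.embed_hom mult.assoc)

lemma csm_rco: "rconn D \<Longrightarrow> m \<in> rco \<Longrightarrow> n \<in> \<Omega> \<Longrightarrow> csm D (m * \<iota> b) n = csum D n m b"
  unfolding csm_def by (rule cr_comult_right(1)[OF vs_fsc csum_bilin])

lemma csum_bal: "csum D (\<iota> c * n) m b = csum D n m (b * c)"
  by (simp add: csum_def calc.embed_hom mult.assoc)

lemma csm_bilin: "rconn D \<Longrightarrow> bilin_on \<Omega> sC \<Omega> sC fsc (csm D)"
  unfolding csm_def[abs_def]
  by (intro bilin_onI lin_on_lext_arg[OF vs_fsc cr_lin] lin_on_lext2[OF vs_fsc] csum_lin) auto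

lemma csm_bal:
  assumes D: "rconn D" and x: "x \<in> \<Omega>" and y: "y \<in> \<Omega>"
  shows "csm D (x * \<iota> c) y = csm D x (\<iota> c * y)"
  using x
proof (induction x rule: \<Omega>_induct_RH)
  case (gen b m)
  have "csm D (m * \<iota> (b * c)) y = csm D (m * \<iota> b) (\<iota> c * y)"
    using gen y by (simp add: csm_rco[OF D] csum_bal)
  then show ?case by (simp add: calc.embed_hom mult.assoc)
next
  case (add u v)
  then show ?case
    using lin_on_add[OF bilin_onD(1)[OF csm_bilin[OF D]]] y by (simp add: distrib_right)
qed

lemma conn_sum_htp: "rconn D \<Longrightarrow> x \<in> \<Omega> \<Longrightarrow> y \<in> \<Omega> \<Longrightarrow> conn_sum H C D (x \<otimes> y) = csm D x y"
  unfolding conn_sum_eq by (rule lext_OO[OF vs_fsc _ _ csm_bilin csm_bal])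

lemma conn_sum_add [simp]: "conn_sum H C D (t + u) = conn_sum H C D t + conn_sum H C D u"
  and conn_sum_lin: "lin_on A s fsc f \<Longrightarrow> lin_on A s fsc (\<lambda>x. conn_sum H C D (f x))"
  unfolding conn_sum_eq by (simp_all add: lext_add[OF vs_fsc] lin_on_lext_arg[OF vs_fsc])

lemma lW_contract:
  assumes u: "u \<in> car W2" and m: "m \<in> rco"
  shows "swe (lW u) (\<lambda>(k, v). swe (\<Delta> k) (\<lambda>(k2, k1). attch (\<iota> k2 * (m * \<iota> (S k1))) (ract W2 v b))) =
    ract W3 (\<sigma>12 (\<sigma>23 (u \<odot> m))) b"
  using u
proof (induction u rule: W2_induct_HLL)
  case (add t u)
  then show ?case using m by (simp add: lext_add[OF vs_fsc])
next
  case (gen a p q)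
  note [simp] = gen m
  let ?F = "\<lambda>k v. swe (\<Delta> k) (\<lambda>(k2, k1). attch (\<iota> k2 * (m * \<iota> (S k1))) (ract W2 v b))"
  have bil: "bilin_on UNIV sH (car W2) fsc fsc ?F" by (auto intro!: bilin_onI lin)
  let ?t = "p \<otimes> (q * \<iota> b)"
  have "swe (lW ((\<iota> a * p) \<otimes> q)) (\<lambda>(k, v). ?F k v) = swe (\<Delta> a) (\<lambda>(a1, a2). ?F a1 ((\<iota> a2 * p) \<otimes> q))"
    unfolding lW_lco[OF gen] lext_lext2[OF vs_fsc]
    by (intro lext_cong2 lext_HW[OF vs_fsc _ bil]) simp
  also have "\<dots> = swe (\<Delta> a) (\<lambda>(a1, a2). swe (\<Delta> a1) (\<lambda>(k2, k1). attch (\<iota> k2 * m * \<iota> (S k1 * a2)) ?t))"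
  proof (intro lext_cong2)
    fix a1 a2 k2 k1
    have "attch (\<iota> k2 * (m * \<iota> (S k1)) * \<iota> a2) ?t = attch (\<iota> k2 * (m * \<iota> (S k1))) (lact W2 a2 ?t)"
      by (rule attch_act) simp_all
    then show "attch (\<iota> k2 * (m * \<iota> (S k1))) (ract W2 ((\<iota> a2 * p) \<otimes> q) b) = attch (\<iota> k2 * m * \<iota> (S k1 * a2)) ?t"
      by (simp add: calc.embed_hom mult.assoc)
  qed
  also have "\<dots> = swe (\<Delta> a) (\<lambda>(k2, a'). swe (\<Delta> a') (\<lambda>(k1, a2). attch (\<iota> k2 * m * \<iota> (S k1 * a2)) ?t))"
    by (rule coassoc) (auto intro!: lin)
  also have "\<dots> = attch (\<iota> a * m * \<iota> 1) ?t"
    by (rule cancel_right[OF cancels_S_left vs_fsc]) (auto intro!: lin)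
  also have "\<dots> = ract W3 (lact W3 a (m \<otimes> p \<odot> q)) b"
    by (simp add: calc.embed_hom)
  also have "m \<otimes> p \<odot> q = \<sigma>12 (\<sigma>23 (p \<otimes> q \<odot> m))"
    by (rule \<sigma>12_\<sigma>23_flip[symmetric]) simp_all
  also have "lact W3 a \<dots> = \<sigma>12 (\<sigma>23 (lact W3 a (p \<otimes> q \<odot> m)))"
    by (simp only: on_act[OF bimap_\<sigma>] on_in[OF bimap_\<sigma>] WO.htp_in)
  also have "lact W3 a (p \<otimes> q \<odot> m) = (\<iota> a * p) \<otimes> q \<odot> m" by simp
  finally show ?case .
qed

lemma conn_sum_co:
  assumes D: "rconn D" and m: "m \<in> rco" and n: "n \<in> lco"
  shows "conn_sum H C D (m \<otimes> (n * \<iota> b)) =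
    \<sigma>23 (D m \<odot> (n * \<iota> b)) + (ract W3 (\<sigma>12 (\<sigma>23 (D n \<odot> m))) b + m \<otimes> n \<odot> \<delta> (\<iota> b))"
proof -
  note [lin] = lin_LM[OF _ rconnD(1)[OF D]] note [simp] = rconnD(1)[OF D] m n
  let ?F = "\<lambda>k v. swe (\<Delta> k) (\<lambda>(k2, k1). attch (\<iota> k2 * (m * \<iota> (S k1))) v)"
  have bil: "bilin_on UNIV sH (car W2) fsc fsc ?F" by (auto intro!: bilin_onI lin)
  have "swe (\<Delta> 1) (\<lambda>(k2, k1). attch (\<iota> k2 * (m * \<iota> (S k1))) (n \<otimes> \<delta> (\<iota> b))) = attch (\<iota> 1 * (m * \<iota> (S 1))) (n \<otimes> \<delta> (\<iota> b))"
    by (rule lext_\<Delta>_one[OF vs_fsc]) (auto intro!: bilin_onI lin simp del: attch_htp)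
  then have F1: "?F 1 (n \<otimes> \<delta> (\<iota> b)) = m \<otimes> n \<odot> \<delta> (\<iota> b)" by (simp add: calc.embed_hom)
  have "conn_sum H C D (m \<otimes> (n * \<iota> b)) = csum D (n * \<iota> b) m 1"
    using csm_rco[OF D m, of "n * \<iota> b" 1] by (simp add: conn_sum_htp[OF D] calc.embed_hom)
  also have "\<dots> = \<sigma>23 (D m \<odot> (n * \<iota> b)) + swe (conn_coact H C D) (\<lambda>(k, E). ?F k (E (n * \<iota> b)))"
    by (simp add: csum_def calc.embed_hom)
  also have "swe (conn_coact H C D) (\<lambda>(k, E). ?F k (E (n * \<iota> b))) =
      swe (lW (D n)) (\<lambda>(k, u). ?F k (ract W2 u b)) + ?F 1 (n \<otimes> \<delta> (\<iota> b))"
    by (rule conn_coact_eval[OF D n vs_fsc bil])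
  also have "swe (lW (D n)) (\<lambda>(k, u). ?F k (ract W2 u b)) = ract W3 (\<sigma>12 (\<sigma>23 (D n \<odot> m))) b"
    by (rule lW_contract) simp_all
  finally show ?thesis using F1 by simp
qed

lemma conn_sum_in: "rconn D \<Longrightarrow> t \<in> car W2 \<Longrightarrow> conn_sum H C D t \<in> car W3"
proof (rotate_tac, induction t rule: W2_induct_RLH)
  case (gen b m n)
  then show ?case by (subst conn_sum_co) (simp_all add: rconnD(1))
qed simp

lemma \<delta>_mult: "\<delta> (\<iota> (a * b)) = \<delta> (\<iota> a) * \<iota> b + \<iota> a * \<delta> (\<iota> b)"
  using calc.diff_mult[OF \<iota>_grade, of a "\<iota> b"] by (simp add: calc.embed_hom)

lemma conn_sum_ract:
  assumes D: "rconn D" and t: "t \<in> car W2"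
  shows "conn_sum H C D (ract W2 t a) = ract W3 (conn_sum H C D t) a + t \<odot> \<delta> (\<iota> a)"
  using t
proof (induction t rule: W2_induct_RLH)
  case (add t u)
  then show ?case by (simp add: algebra_simps)
next
  case (gen b m n)
  note [lin] = lin_LM[OF _ rconnD(1)[OF D]] note [simp] = rconnD(1)[OF D] gen
  have 1: "conn_sum H C D (m \<otimes> (n * \<iota> (b * a))) =
    \<sigma>23 (D m \<odot> (n * \<iota> (b * a))) + (ract W3 (\<sigma>12 (\<sigma>23 (D n \<odot> m))) (b * a) + m \<otimes> n \<odot> \<delta> (\<iota> (b * a)))"
    by (rule conn_sum_co[OF D]) simp_all
  have 2: "\<sigma>23 (D m \<odot> (n * \<iota> (b * a))) = ract W3 (\<sigma>23 (D m \<odot> (n * \<iota> b))) a"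
    using on_act(4)[OF bimap_\<sigma>, of "D m \<odot> (n * \<iota> b)" a] by (simp add: calc.embed_hom mult.assoc)
  have 3: "m \<otimes> n \<odot> \<delta> (\<iota> (b * a)) = ract W3 (m \<otimes> n \<odot> \<delta> (\<iota> b)) a + m \<otimes> (n * \<iota> b) \<odot> \<delta> (\<iota> a)"
    using htp_bal(2)[of "m \<otimes> n" "\<delta> (\<iota> a)" b] by (simp add: \<delta>_mult)
  have "ract W2 (m \<otimes> (n * \<iota> b)) a = m \<otimes> (n * \<iota> (b * a))"
    by (simp add: calc.embed_hom mult.assoc)
  then show ?case
    by (simp only: 1 2 3 conn_sum_co[OF D gen] act_add)
      (simp add: W3.ract_mult on_in[OF bimap_\<sigma>] algebra_simps)
qed

lemma conn_sum_diff:
  assumes D: "rconn D" and D': "rconn D'" and \<Phi>: "rmap \<Phi>" and eq: "\<And>x. x \<in> \<Omega> \<Longrightarrow> D' x = D x + \<Phi> x" and t: "t \<in> car W2"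
  shows "conn_sum H C D' t = conn_sum H C D t + (\<sigma>23 (hat \<Phi> t) + \<sigma>12 (\<sigma>23 (hat \<Phi> (\<tau> t))))"
  using t
proof (induction t rule: W2_induct_RLH)
  case (add t u)
  then show ?case by (simp add: bimapD(6)[OF bimap_\<tau>] algebra_simps)
next
  case (gen b m n)
  note [lin] = lin_LM[OF _ rconnD(1)[OF D]] note [simp] = rconnD(1)[OF D] gen rmapD(1)[OF \<Phi>]
  have "\<sigma> (ract W2 (n \<otimes> m) b) = m \<otimes> (n * \<iota> b)"
    by (subst \<sigma>_ract) (simp_all add: \<sigma>_flip del: \<sigma>_htp)
  then have "\<tau> (m \<otimes> (n * \<iota> b)) = ract W2 (n \<otimes> m) b"
    using \<tau>_\<sigma>[of "ract W2 (n \<otimes> m) b"] by simp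
  then have "hat \<Phi> (\<tau> (m \<otimes> (n * \<iota> b))) = ract W3 (\<Phi> n \<odot> m) b"
    using \<Phi> by simp
  moreover have "\<sigma>12 (\<sigma>23 (ract W3 (\<Phi> n \<odot> m) b)) = ract W3 (\<sigma>12 (\<sigma>23 (\<Phi> n \<odot> m))) b"
    by (subst on_act(4)[OF bimap_\<sigma>], simp, subst on_act(2)[OF bimap_\<sigma>]) (simp_all add: on_in[OF bimap_\<sigma>])
  ultimately show ?case
    using \<Phi> by (simp add: conn_sum_co[OF D gen] conn_sum_co[OF D' gen] eq algebra_simps
        del: htp_act \<sigma>_ops)
qed

subsection \<open>Metric compatibility\<close>

abbreviation "kd D s \<equiv> g12 (conn_sum H C D s)"

lemma g12_on_12:
  assumes "t \<in> car W3"
  shows "g12 (\<sigma>12 t) = g12 t" "g12 (on_12 H C \<pi> t) = g12 t"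
proof -
  have \<pi>: "\<gamma> (\<pi> t) = \<gamma> t" if "t \<in> car W2" for t
    by (rule \<sigma>_invariant_\<pi>[OF vs_H pair_lin[OF lin_on_id] \<gamma>_\<sigma> that])
  have "g12 (\<sigma>12 t) = g12 t \<and> g12 (on_12 H C \<pi> t) = g12 t"
    using assms
  proof (induction t rule: WO.tens_induct)
    case (htp s z)
    then show ?case by (simp add: \<gamma>_\<sigma> \<pi> on_12_htp[OF bimap_\<pi>] bimapD(1)[OF bimap_\<pi>])
  qed simp
  then show "g12 (\<sigma>12 t) = g12 t" "g12 (on_12 H C \<pi> t) = g12 t" by auto
qed

lemma \<sigma>12_hat:
  assumes \<Phi>: "rmap \<Phi>" "\<And>m. m \<in> \<Omega> \<Longrightarrow> \<Phi> m \<in> V" and s: "s \<in> car W2"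
  shows "\<sigma>12 (hat \<Phi> s) = hat \<Phi> s"
  using s by (induction s rule: W2_induct) (simp_all add: \<Phi> \<sigma>_V)

lemma kd_diff:
  assumes D: "rconn D" and D': "rconn D'" and \<Phi>: "rmap \<Phi>" "\<And>m. m \<in> \<Omega> \<Longrightarrow> \<Phi> m \<in> V"
    and eq: "\<And>x. x \<in> \<Omega> \<Longrightarrow> D' x = D x + \<Phi> x" and s: "s \<in> V"
  shows "kd D' s = kd D s + (g23 (hat \<Phi> s) + g23 (hat \<Phi> s))"
proof -
  have "\<tau> s = s" using \<tau>_\<sigma>[of s] \<sigma>_V[OF s] s by simp
  moreover have h: "hat \<Phi> s \<in> car W3" using hat_in[OF \<Phi>(1)] s by simp
  moreover have "g12 (\<sigma>23 (hat \<Phi> s)) = g23 (hat \<Phi> s)"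
    using g12_\<sigma>23_\<sigma>12[OF h] \<sigma>12_hat[OF \<Phi>, of s] s by simp
  ultimately show ?thesis
    using conn_sum_diff[OF D D' \<Phi>(1) eq, of s] s by (simp add: g12_on_12(1) on_in[OF bimap_\<sigma>])
qed

lemma kd_ract: "rconn D \<Longrightarrow> s \<in> car W2 \<Longrightarrow> kd D (ract W2 s a) = kd D s * \<iota> a + \<iota> (\<gamma> s) * \<delta> (\<iota> a)"
  by (simp add: conn_sum_ract g_act conn_sum_in)

lemma metric_compatible_iff:
  assumes D: "rconn D"
  shows "metric_compatible H C (lact FT f g) D \<longleftrightarrow> (\<forall>s\<in>V. \<iota> f * kd D s = \<delta> (\<iota> (f * \<gamma> s)))"
proof -
  have p3: "pair3 H C (lact FT f g) t = \<iota> f * g12 t" if "t \<in> car W3" for t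
  proof -
    have "pair3 H C (lact FT f g) t = lext sC t (\<lambda>(s, z). \<iota> f * (\<iota> (\<gamma> s) * z))"
      unfolding pair3_def using that
      by (intro lext_cong2) (auto simp: pair_act(1) calc.embed_hom mult.assoc)
    also have "\<dots> = \<iota> f * g12 t"
      unfolding pair3_def Om_simps
      by (rule lin_on_lext_apply2[OF vs_C vs_C vC.subspace_UNIV, of "\<lambda>x. \<iota> f * x", symmetric]) (auto intro!: lin)
    finally show ?thesis .
  qed
  have "pair3 H C (lact FT f g) (conn_vee H C D s) = \<iota> f * kd D s" "pair2 H C (lact FT f g) s = f * \<gamma> s" if "s \<in> V" for s
    using that D by (simp_all add: conn_vee_def p3 g12_on_12 conn_sum_in on_in[OF bimap_\<pi>] pair_act(1))
  then show ?thesis by (simp add: metric_compatible_def)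
qed

subsection \<open>Torsion-free connections\<close>

lemma torsion_free_iff: "torsion_free C D \<longleftrightarrow> (\<forall>m\<in>\<Omega>. wedge (D m) + \<delta> m = 0)"
  by (simp add: torsion_free_def wedge_def)

lemma rconnI:
  assumes "lin_on \<Omega> sC fsc D" "\<And>x. x \<in> \<Omega> \<Longrightarrow> D x \<in> car W2"
    and "\<And>m a. m \<in> \<Omega> \<Longrightarrow> D (m * \<iota> a) = ract W2 (D m) a + m \<otimes> \<delta> (\<iota> a)"
  shows "rconn (\<lambda>x. if x \<in> \<Omega> then D x else 0)"
proof -
  have "lin_on \<Omega> sC fsc (\<lambda>x. if x \<in> \<Omega> then D x else 0)"
    using assms(1) by (simp add: lin_on_def)
  then show ?thesis using assms(2,3) unfolding right_connection_def LM_iff by simp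
qed

lemma ract_diff: "ract W2 (t - u) a = ract W2 t a - ract W2 u a"
  by (rule lin_on_diff[OF vs_fsc vs_fsc fsc.subspace_UNIV lin_act(2)[OF lin_on_id]]) simp_all

lemma torsion_free_exists: "\<exists>D. rconn D \<and> torsion_free C D"
proof -
  define G where "G = (\<lambda>w. \<Sum>p\<in>K. eb p \<otimes> \<delta> (\<iota> (\<gamma> (zb p \<otimes> w))))"
  have G1: "lin_on \<Omega> sC fsc G" unfolding G_def by (auto intro!: lin_on_sum_fun[OF vs_fsc] lin)
  have G2: "G w \<in> car W2" for w
    unfolding G_def by (rule fsc.subspace_sum[OF W2.subspace[unfolded sc_W]]) simp
  have G3: "G (w * \<iota> a) = ract W2 (G w) a + w \<otimes> \<delta> (\<iota> a)" if w: "w \<in> \<Omega>" for w a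
  proof -
    have "G (w * \<iota> a) = (\<Sum>p\<in>K. ract W2 (eb p \<otimes> \<delta> (\<iota> (\<gamma> (zb p \<otimes> w)))) a + (eb p * \<iota> (\<gamma> (zb p \<otimes> w))) \<otimes> \<delta> (\<iota> a))"
      unfolding G_def using w by (intro sum.cong refl) (simp add: \<gamma>_bal \<delta>_mult htp_bal)
    also have "\<dots> = (\<Sum>p\<in>K. ract W2 (eb p \<otimes> \<delta> (\<iota> (\<gamma> (zb p \<otimes> w)))) a) + (\<Sum>p\<in>K. eb p * \<iota> (\<gamma> (zb p \<otimes> w))) \<otimes> \<delta> (\<iota> a)"
      using w by (simp add: sum.distrib htp_sum)
    also have "(\<Sum>p\<in>K. ract W2 (eb p \<otimes> \<delta> (\<iota> (\<gamma> (zb p \<otimes> w)))) a) = ract W2 (G w) a"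
      unfolding G_def
      by (rule lin_on_sum[symmetric, OF vs_fsc vs_fsc fsc.subspace_UNIV lin_act(2)[OF lin_on_id]]) simp
    finally show ?thesis by (simp add: basis_right w)
  qed
  define tor where "tor = (\<lambda>w. wedge (G w) + \<delta> w)"
  have wlin: "lin_on A s fsc f \<Longrightarrow> lin_on A s sC (\<lambda>x. wedge (f x))" for A f and s :: "'k \<Rightarrow> 'w \<Rightarrow> 'w"
    unfolding wedge_def by (intro lin)
  have tor_lin: "lin_on \<Omega> sC sC tor"
    unfolding tor_def by (intro lin_on_add_fun[OF vs_C] wlin G1 lin)
  have wedge_grade: "wedge t \<in> grade C 2" if "t \<in> car W2" for t
  proof -
    have "x * y \<in> grade C 2" if "x \<in> \<Omega>" "y \<in> \<Omega>" for x y
      using calc.grade_mult[OF that] by (simp add: one_add_one)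
    then show ?thesis unfolding wedge_def
      by (intro lext_in_subspace[OF vs_C calc.grade_subspace]) (use that in auto)
  qed
  have tor_grade: "tor w \<in> grade C 2" if "w \<in> \<Omega>" for w
    unfolding tor_def
    by (rule vC.subspace_add[OF calc.grade_subspace wedge_grade[OF G2] calc.diff_grade[OF that, unfolded Suc_1]])
  have tor_ract: "tor (w * \<iota> a) = tor w * \<iota> a" if w: "w \<in> \<Omega>" for w a
    using calc.diff_mult[OF w, of "\<iota> a"] w
    by (simp add: tor_def G3 wedge_ract G2 distrib_right)
  define lft where "lft = (\<lambda>u. SOME t. t \<in> car W2 \<and> wedge t = u)"
  have lft: "lft u \<in> car W2" "wedge (lft u) = u" if "u \<in> grade C 2" for u
    using someI_ex[of "\<lambda>t. t \<in> car W2 \<and> wedge t = u"] wedge_surj[OF that] unfolding lft_def by auto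
  define pr where "pr = (\<lambda>t. t - \<pi> t)"
  have pr_eq: "pr t = pr u" if "t \<in> car W2" "u \<in> car W2" "wedge t = wedge u" for t u
  proof -
    have "t - u \<in> V" using that wedge_eq_0_iff[of "t - u"] by simp
    then have "\<pi> (t - u) = t - u" by simp
    moreover have "\<pi> (t - u) = \<pi> t - \<pi> u"
      by (rule lin_on_diff[OF vs_fsc vs_fsc W2.subspace[unfolded sc_W] bimapD(2)[OF bimap_\<pi>]]) (use that in simp_all)
    ultimately show ?thesis by (simp add: pr_def algebra_simps)
  qed
  have wedge_pr: "wedge (pr t) = wedge t" if "t \<in> car W2" for t
  proof -
    have "wedge (\<pi> t) = 0" using wedge_eq_0_iff[of "\<pi> t"] \<pi>_props(1)[OF that] by simp
    then show ?thesis by (simp add: pr_def)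
  qed
  have pr_in: "t \<in> car W2 \<Longrightarrow> pr t \<in> car W2" for t by (simp add: pr_def bimapD(1)[OF bimap_\<pi>])
  have pr_add: "t \<in> car W2 \<Longrightarrow> u \<in> car W2 \<Longrightarrow> pr (t + u) = pr t + pr u" for t u
    by (simp add: pr_def bimapD(6)[OF bimap_\<pi>])
  have pr_scale: "t \<in> car W2 \<Longrightarrow> pr (fsc c t) = fsc c (pr t)" for t c
    by (simp add: pr_def lin_on_scale[OF bimapD(2)[OF bimap_\<pi>]] fsc.scale_right_diff_distrib)
  have pr_ract: "t \<in> car W2 \<Longrightarrow> pr (ract W2 t a) = ract W2 (pr t) a" for t a
    using ract_diff[of t "\<pi> t"]
    by (simp add: pr_def bimapD(4)[OF bimap_\<pi>])
  define B where "B = (\<lambda>w. pr (lft (tor w)))"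
  have B_eq: "B w = pr t" if "w \<in> \<Omega>" "t \<in> car W2" "wedge t = tor w" for w t
    unfolding B_def using lft[OF tor_grade[OF that(1)]] that by (intro pr_eq) simp_all
  have l: "lft (tor w) \<in> car W2" "wedge (lft (tor w)) = tor w" if "w \<in> \<Omega>" for w
    using lft[OF tor_grade[OF that]] .
  have B_lin: "lin_on \<Omega> sC fsc B"
  proof (rule lin_onI)
    fix x y assume *: "x \<in> \<Omega>" "y \<in> \<Omega>"
    have "B (x + y) = pr (lft (tor x) + lft (tor y))"
      using * l lin_on_add[OF tor_lin *] by (intro B_eq) simp_all
    then show "B (x + y) = B x + B y" using l * by (simp add: B_def pr_add)
  next
    fix c x assume *: "x \<in> \<Omega>"
    have "B (sC c x) = pr (fsc c (lft (tor x)))"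
      using * l lin_on_scale[OF tor_lin *] by (intro B_eq) simp_all
    then show "B (sC c x) = fsc c (B x)" using l * by (simp add: B_def pr_scale)
  qed
  have B_ract: "B (w * \<iota> a) = ract W2 (B w) a" if w: "w \<in> \<Omega>" for w a
  proof -
    have "B (w * \<iota> a) = pr (ract W2 (lft (tor w)) a)"
      using w l[OF w] by (intro B_eq) (simp_all add: wedge_ract tor_ract)
    then show ?thesis using l[OF w] by (simp add: B_def pr_ract)
  qed
  have B_in: "w \<in> \<Omega> \<Longrightarrow> B w \<in> car W2" for w using l by (simp add: B_def pr_in)
  let ?D = "\<lambda>x. if x \<in> \<Omega> then G x - B x else 0"
  have "rconn ?D"
  proof (rule rconnI)
    show "lin_on \<Omega> sC fsc (\<lambda>x. G x - B x)"
      using G1 B_lin unfolding lin_on_def by (simp add: fsc.scale_right_diff_distrib)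
    show "G (m * \<iota> a) - B (m * \<iota> a) = ract W2 (G m - B m) a + m \<otimes> \<delta> (\<iota> a)" if "m \<in> \<Omega>" for m a
      using that
      by (simp add: ract_diff G3 B_ract)
  qed (simp add: G2 B_in)
  moreover have "torsion_free C ?D"
    unfolding torsion_free_iff using l by (simp add: B_def wedge_pr) (simp add: tor_def)
  ultimately show ?thesis by blast
qed

lemma levi_civita_unique_exists:
  assumes invertible: "bij_betw (on_23 H C \<pi>) (vee_12 H C) (vee_23 H C)"
    and char_not_2: "(2 :: 'k) \<noteq> 0" and f: "f * f' = 1" "f' * f = 1"
  shows "\<exists>!D. levi_civita H C (lact FT f g) D"
proof -
  have ff: "\<iota> f * \<iota> f' = 1" "\<iota> f' * \<iota> f = 1"
    using f by (simp_all flip: calc.embed_hom)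
  obtain D0 where D0: "rconn D0" "torsion_free C D0" using torsion_free_exists by blast
  define R where "R = (\<lambda>s. sC (1 / 2) (\<iota> f' * \<delta> (\<iota> (f * \<gamma> s)) - kd D0 s))"
  have \<gamma>12_in: "kd D0 s \<in> \<Omega>" if "s \<in> V" for s using that conn_sum_in[OF D0(1)] by simp
  have R1: "R s \<in> \<Omega>" if "s \<in> V" for s using that \<gamma>12_in by (simp add: R_def)
  have R2: "lin_on V fsc sC R"
  proof -
    have 1: "lin_on V fsc sC (\<lambda>s. \<iota> f' * \<delta> (\<iota> (f * \<gamma> s)))" by (intro lin)
    have 2: "lin_on V fsc sC (\<lambda>s. kd D0 s)" by (intro lin conn_sum_lin)
    show ?thesis
      unfolding R_def using 1 2
      by (intro lin_on_scale_fun[OF vs_C]) (simp add: lin_on_def vC.scale_right_diff_distrib)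
  qed
  have R3: "R (ract W2 s a) = R s * \<iota> a" if s: "s \<in> V" for s a
  proof -
    have "\<iota> f' * \<delta> (\<iota> (f * \<gamma> (ract W2 s a))) = \<iota> f' * \<delta> (\<iota> (f * \<gamma> s * a))"
      using s by (simp add: \<gamma>_ract mult.assoc)
    also have "\<dots> = \<iota> f' * \<delta> (\<iota> (f * \<gamma> s)) * \<iota> a + (\<iota> f' * \<iota> f) * (\<iota> (\<gamma> s) * \<delta> (\<iota> a))"
    proof -
      have e: "\<iota> (f * \<gamma> s) = \<iota> f * \<iota> (\<gamma> s)" by (simp add: calc.embed_hom)
      show ?thesis by (subst \<delta>_mult) (simp only: e distrib_left mult.assoc)
    qed
    finally show ?thesis
      using s kd_ract[OF D0(1), of s a] by (simp add: R_def ff calc.scale_mult left_diff_distrib)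
  qed
  obtain \<Phi> where \<Phi>: "rmap \<Phi>" "\<And>m. m \<in> \<Omega> \<Longrightarrow> \<Phi> m \<in> V" "\<And>s. s \<in> V \<Longrightarrow> g23 (hat \<Phi> s) = R s"
    using rmap_exists[OF invertible R1 R2 R3] by blast
  let ?D = "\<lambda>x. if x \<in> \<Omega> then D0 x + \<Phi> x else 0"
  have D0L: "lin_on \<Omega> sC fsc D0" "x \<in> \<Omega> \<Longrightarrow> D0 x \<in> car W2" for x
    using rconnD(1)[OF D0(1)] unfolding LM_iff by blast+
  have D: "rconn ?D"
  proof (rule rconnI)
    show "lin_on \<Omega> sC fsc (\<lambda>x. D0 x + \<Phi> x)"
      by (intro lin_on_add_fun[OF vs_fsc] D0L rmapD(2)[OF \<Phi>(1)])
    show "D0 x + \<Phi> x \<in> car W2" if "x \<in> \<Omega>" for x using that \<Phi>(2) D0L by simp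
    show "D0 (m * \<iota> a) + \<Phi> (m * \<iota> a) = ract W2 (D0 m + \<Phi> m) a + m \<otimes> \<delta> (\<iota> a)" if "m \<in> \<Omega>" for m a
      using that rconnD(2)[OF D0(1)] rmapD(3)[OF \<Phi>(1)] by (simp add: algebra_simps)
  qed
  have "wedge (\<Phi> m) = 0" if "m \<in> \<Omega>" for m
    using \<Phi>(2)[OF that] wedge_eq_0_iff[of "\<Phi> m"] by simp
  then have "torsion_free C ?D"
    using D0(2) by (simp add: torsion_free_iff)
  moreover have "metric_compatible H C (lact FT f g) ?D"
    unfolding metric_compatible_iff[OF D]
  proof
    fix s assume s: "s \<in> V"
    have "R s + R s = sC (1 / 2 + 1 / 2) (\<iota> f' * \<delta> (\<iota> (f * \<gamma> s)) - kd D0 s)"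
      unfolding R_def by (rule vC.scale_left_distrib[symmetric])
    also have "(1 / 2 + 1 / 2 :: 'k) = 1" using char_not_2 by (simp add: add_divide_distrib[symmetric])
    finally have "R s + R s = \<iota> f' * \<delta> (\<iota> (f * \<gamma> s)) - kd D0 s" by simp
    then have "kd ?D s = \<iota> f' * \<delta> (\<iota> (f * \<gamma> s))"
      using kd_diff[OF D0(1) D \<Phi>(1,2) _ s] \<Phi>(3)[OF s] by simp
    then show "\<iota> f * kd ?D s = \<delta> (\<iota> (f * \<gamma> s))" by (simp add: ff flip: mult.assoc)
  qed
  ultimately have lc: "levi_civita H C (lact FT f g) ?D" using D by (simp add: levi_civita_def)
  show ?thesis
  proof (rule ex1I[of "levi_civita H C (lact FT f g)", OF lc])
    fix D' assume "levi_civita H C (lact FT f g) D'"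
    then have D': "rconn D'" "torsion_free C D'" "metric_compatible H C (lact FT f g) D'"
      by (simp_all add: levi_civita_def)
    have D'L: "lin_on \<Omega> sC fsc D'" "x \<in> \<Omega> \<Longrightarrow> D' x \<in> car W2" "x \<notin> \<Omega> \<Longrightarrow> D' x = 0" for x
      using rconnD(1)[OF D'(1)] unfolding LM_iff by blast+
    have DL: "lin_on \<Omega> sC fsc ?D" "x \<in> \<Omega> \<Longrightarrow> ?D x \<in> car W2" for x
      by (rule conjunct1[OF iffD1[OF LM_iff rconnD(1)[OF D]]])
        (rule bspec[OF conjunct1[OF conjunct2[OF iffD1[OF LM_iff rconnD(1)[OF D]]]]])
    let ?\<Psi> = "\<lambda>x. D' x - ?D x"
    have \<Psi>: "rmap ?\<Psi>"
      unfolding rmap_def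
    proof (intro conjI ballI allI)
      show "?\<Psi> m \<in> car W2" if "m \<in> \<Omega>" for m using D'L(2)[OF that] DL(2)[OF that] W2.diff_closed by blast
      show "lin_on \<Omega> sC fsc ?\<Psi>" using D'L(1) DL(1) unfolding lin_on_def by (simp add: fsc.scale_right_diff_distrib)
      show "?\<Psi> (m * \<iota> a) = ract W2 (?\<Psi> m) a" if "m \<in> \<Omega>" for m a
      proof -
        have "ract W2 (?\<Psi> m) a = ract W2 (D' m) a - ract W2 (?D m) a"
          by (rule ract_diff)
        then show ?thesis using rconnD(2)[OF D'(1) that, of a] rconnD(2)[OF D that, of a] by simp
      qed
    qed
    have \<Psi>V: "?\<Psi> m \<in> V" if m: "m \<in> \<Omega>" for m
    proof -
      have "wedge (D' m) + \<delta> m = 0" "wedge (?D m) + \<delta> m = 0"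
        using D'(2) \<open>torsion_free C ?D\<close> m unfolding torsion_free_iff by blast+
      then have "wedge (?\<Psi> m) = 0" unfolding wedge_diff by (simp only: add_eq_0_iff2 eq_iff_diff_eq_0[symmetric])
      then show ?thesis using wedge_eq_0_iff[of "?\<Psi> m"] rmapD(1)[OF \<Psi> m] by blast
    qed
    have "g23 (hat ?\<Psi> s) = 0" if s: "s \<in> V" for s
    proof -
      have "\<iota> f * kd D' s = \<iota> f * kd ?D s"
        using D'(3) \<open>metric_compatible H C (lact FT f g) ?D\<close> s
        unfolding metric_compatible_iff[OF D] metric_compatible_iff[OF D'(1)] by simp
      then have "\<iota> f' * \<iota> f * kd D' s = \<iota> f' * \<iota> f * kd ?D s" by (simp only: mult.assoc)
      then have "kd D' s = kd ?D s" by (simp add: ff)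
      moreover have "kd D' s = kd ?D s + (g23 (hat ?\<Psi> s) + g23 (hat ?\<Psi> s))"
        by (rule kd_diff[OF D D'(1) \<Psi> \<Psi>V _ s]) simp_all
      ultimately have "sC 1 (g23 (hat ?\<Psi> s)) + sC 1 (g23 (hat ?\<Psi> s)) = 0" by simp
      then have "sC (1 + 1) (g23 (hat ?\<Psi> s)) = 0" by (simp only: vC.scale_left_distrib)
      then show ?thesis using char_not_2 by (simp add: one_add_one del: vC.scale_left_distrib)
    qed
    then have "?\<Psi> m = 0" if "m \<in> \<Omega>" for m
      using rmap_unique[OF invertible \<Psi> \<Psi>V _ that] by blast
    then have "D' x = ?D x" for x using D'L(3)[of x] by (cases "x \<in> \<Omega>") auto
    then show "D' = ?D" by (rule ext)
  qed
qed

end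

theorem theorem5p13:
  fixes H :: "('k::field, 'h::ring_1) hopf"
    and C :: "('k, 'w::ring_1, 'h) calc"
    and g :: "('w \<Rightarrow> 'h) \<times> ('w \<Rightarrow> 'h) \<Rightarrow>\<^sub>0 'k"
    and f :: 'h
  assumes char_not_2: "(2::'k) \<noteq> 0"
    and hopf: "hopf_algebra H"
    and antipode: "bij (antipode H)"
    and calculus: "woronowicz_calculus H C"
    and fin_gen: "\<exists>B. finite B \<and> B \<subseteq> car (one_forms C) \<and>
      (\<forall>w\<in>car (one_forms C). \<exists>a. w = (\<Sum>b\<in>B. ract (one_forms C) b (a b)))"
    and diag: "diagonalisable H C"
    and eigenvalue_1: "\<exists>t\<in>eigenspace H C 1. t \<noteq> 0"
    and invertible: "bij_betw (on_23 H C (pi_vee H C)) (vee_12 H C) (vee_23 H C)"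
    and metric: "is_metric H C g"
    and central: "sigma_central H C g"
    and unit: "\<exists>f'. f * f' = 1 \<and> f' * f = 1"
  shows "\<exists>!D. levi_civita H C (lact (field_tensors H C) f g) D"
proof -
  have "hopf_metric H C g"
    by (intro hopf_metric.intro hopf_calculus_diag.intro hopf_calculus.intro hopf_bij.intro
        hopf_bij_axioms.intro hopf_calculus_diag_axioms.intro hopf_metric_axioms.intro
        hopf antipode calculus diag metric central eigenvalue_1)
  moreover from unit obtain f' where "f * f' = 1" "f' * f = 1" by blast
  ultimately show ?thesis
    by (rule hopf_metric.levi_civita_unique_exists[OF _ invertible char_not_2])
qed

end
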